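(* Let $G<SL_2(\mathbb{R})$ be a Fuchsian group such that the quotient $G\backslash\mathbb{H}^2$ is a non-compact, finite area hyperbolic orbifold, and let $x_0\in\mathbb{H}^2$ be a basepoint. Given a geodesic ray $\gamma$ starting at $x_0$, parameterized by arc length, let $$\rho(\gamma):=\lim_{t\to\infty}\frac{d_G(1,h_t)}{d_{rel}(1,h_t)},$$ where $h_t\in G$ is such that $h_tx_0$ is a closest element of the $G$-orbit of $x_0$ to $\gamma_t$. Let $\mathrm{Leb}$ be Lebesgue measure on the circle at infinity $S^1=\partial\mathbb{H}^2$, and let $\nu$ be the harmonic measure on $S^1$ determined by a random walk generated by a probability measure $\mu$ on $G$ with finite first moment in the word metric, whose support generates $G$ as a semigroup. Then there is a constant $c>0$ such that the limit $\rho(\gamma)$ satisfies $$\rho(\gamma)=\begin{cases}\infty & \text{for }\mathrm{Leb}\text{-almost all geodesics }\gamma,\\ c & \text{for }\nu\text{-almost all geodesics }\gamma\end{cases}$$ (in particular $\rho(\gamma)$ exists, in $(0,\infty]$, in both almost-everywhere senses).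
   Context: A Fuchsian group is a discrete subgroup of $SL_2(\mathbb{R})$, acting on the hyperbolic plane $\mathbb{H}^2$. Geodesic rays from $x_0$ are identified with their endpoints in $S^1=\partial\mathbb{H}^2$, so measures on $S^1$ are measures on the set of such rays. Metrics on $G$: $d_G$ is the word metric for a fixed finite generating set $\mathcal{A}$. The quotient $X=G\backslash\mathbb{H}^2$ has finitely many cusps; choose disjoint cusp neighbourhoods $c_1,\dots,c_p$ and for each a lift $\tilde c_i\subset\mathbb{H}^2$ (a horoball), and let $G_i$ be the (maximal parabolic) stabilizer of $\tilde c_i$ in $G$. The relative metric $d_{rel}$ is the word metric for the infinite generating set $\mathcal{A}\cup G_1\cup\dots\cup G_p$. Finite first moment in the word metric means $\int_G d_G(1,g)\,d\mu(g)<\infty$. The random walk is $w_n=g_1g_2\cdots g_n$ with $g_i$ independent of law $\mu$; almost surely $w_nx_0$ converges to a point of $S^1$ (Furstenberg), and the harmonic measure is the hitting measure $\nu(A)=\mathrm{Prob}(\lim_n w_nx_0\in A)$. *)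

theory Defs
  imports "HOL-Algebra.Generated_Groups" "HOL-Probability.Probability"
begin

section \<open>Word metrics\<close>

text \<open>The product of a list of group elements, read from left to right.\<close>

definition list_prod :: "('a, 'b) monoid_scheme \<Rightarrow> 'a list \<Rightarrow> 'a" where
  "list_prod M w = foldr (\<lambda>x y. x \<otimes>\<^bsub>M\<^esub> y) w \<one>\<^bsub>M\<^esub>"

text \<open>Letters are generators and their inverses, so \<open>S\<close> need not be symmetric. For \<open>g\<close>, \<open>h\<close> in the
  subgroup generated by \<open>S\<close> the set of word lengths is nonempty and the minimum is attained.\<close>

definition word_dist :: "('a, 'b) monoid_scheme \<Rightarrow> 'a set \<Rightarrow> 'a \<Rightarrow> 'a \<Rightarrow> nat" where
  "word_dist M S g h =
    (LEAST n. \<exists>w. length w = n \<and> set w \<subseteq> S \<union> m_inv M ` S \<and> h = g \<otimes>\<^bsub>M\<^esub> list_prod M w)"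

definition semigroup_generated :: "('a, 'b) monoid_scheme \<Rightarrow> 'a set \<Rightarrow> 'a set" where
  "semigroup_generated M S = {list_prod M w | w. w \<noteq> [] \<and> set w \<subseteq> S}"


section \<open>The hyperbolic plane and its isometries\<close>

text \<open>The hyperbolic plane is the upper half-plane, with curvature \<open>-1\<close>. Only points of
  \<open>upper_half_plane\<close> are meaningful arguments of \<open>hyp_dist\<close>.\<close>

definition upper_half_plane :: "complex set" where
  "upper_half_plane = {z. 0 < Im z}"

definition hyp_dist :: "complex \<Rightarrow> complex \<Rightarrow> real" where
  "hyp_dist z w = arcosh (1 + (cmod (z - w))\<^sup>2 / (2 * Im z * Im w))"

definition hyp_area :: "complex measure" where
  "hyp_area = density lborel (\<lambda>z. indicator upper_half_plane z * ennreal (1 / (Im z)\<^sup>2))"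

definition SL2R :: "(real^2^2) monoid" where
  "SL2R = \<lparr>carrier = {A. det A = 1}, monoid.mult = (**), one = mat 1\<rparr>"

lemma SL2R_simps [simp]:
  "carrier SL2R = {A. det A = 1}" "monoid.mult SL2R = (**)" "\<one>\<^bsub>SL2R\<^esub> = mat 1"
  by (simp_all add: SL2R_def)

lemma group_SL2R: "group SL2R"
proof (rule groupI)
  fix A assume A: "A \<in> carrier SL2R"
  then have "invertible A"
    by (simp add: invertible_det_nz)
  then obtain B where B: "A ** B = mat 1" "B ** A = mat 1"
    by (auto simp: invertible_def)
  from B(2) have "det B * det A = 1"
    by (metis det_I det_mul)
  with A B show "\<exists>B\<in>carrier SL2R. B \<otimes>\<^bsub>SL2R\<^esub> A = \<one>\<^bsub>SL2R\<^esub>"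
    by auto
qed (auto simp: det_mul matrix_mul_assoc)

definition act :: "real^2^2 \<Rightarrow> complex \<Rightarrow> complex" where
  "act A = moebius (of_real (A$1$1)) (of_real (A$1$2)) (of_real (A$2$1)) (of_real (A$2$2))"

definition parabolic :: "real^2^2 \<Rightarrow> bool" where
  "parabolic A \<longleftrightarrow> det A = 1 \<and> \<bar>trace A\<bar> = 2 \<and> A \<noteq> mat 1 \<and> A \<noteq> - mat 1"

text \<open>Open horoballs are the isometric images of one horoball based at infinity.\<close>

definition horoball :: "complex set \<Rightarrow> bool" where
  "horoball B \<longleftrightarrow> (\<exists>A\<in>carrier SL2R. B = act A ` {z. 1 < Im z})"


section \<open>Fuchsian groups and their quotients\<close>

definition fuchsian :: "(real^2^2) set \<Rightarrow> bool" where
  "fuchsian G \<longleftrightarrow> subgroup G SL2R \<and> topological_space_class.discrete G"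

definition orbit :: "(real^2^2) set \<Rightarrow> complex \<Rightarrow> complex set" where
  "orbit G z = (\<lambda>g. act g z) ` G"

definition quotient_topology :: "(real^2^2) set \<Rightarrow> complex set topology" where
  "quotient_topology G = topology (\<lambda>U. U \<subseteq> orbit G ` upper_half_plane \<and>
     openin (top_of_set upper_half_plane) {z \<in> upper_half_plane. orbit G z \<in> U})"

lemma openin_quotient_topology:
  "openin (quotient_topology G) U \<longleftrightarrow> U \<subseteq> orbit G ` upper_half_plane \<and>
     openin (top_of_set upper_half_plane) {z \<in> upper_half_plane. orbit G z \<in> U}"
proof -
  let ?P = "\<lambda>U. {z \<in> upper_half_plane. orbit G z \<in> U}"
  have Int: "?P (S \<inter> T) = ?P S \<inter> ?P T" for S T
    by auto
  have Un: "?P (\<Union>K) = (\<Union>S\<in>K. ?P S)" for K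
    by auto
  have "istopology (\<lambda>U. U \<subseteq> orbit G ` upper_half_plane \<and>
     openin (top_of_set upper_half_plane) (?P U))"
    unfolding istopology_def Int Un by (auto intro!: openin_Int openin_clauses(3))
  then show ?thesis
    by (simp add: quotient_topology_def topology_inverse')
qed

lemma quotient_map_orbit:
  "quotient_map (top_of_set upper_half_plane) (quotient_topology G) (orbit G)"
proof -
  let ?Q = "orbit G ` upper_half_plane"
  have "{z \<in> upper_half_plane. orbit G z \<in> ?Q} = upper_half_plane"
    by auto
  then have "openin (quotient_topology G) ?Q"
    by (simp add: openin_quotient_topology)
  then have "topspace (quotient_topology G) = ?Q"
    by (metis openin_quotient_topology openin_subset openin_topspace subset_antisym)
  then show ?thesis
    by (auto simp: quotient_map_def openin_quotient_topology)
qed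

text \<open>The area of the quotient is the area of any Borel set of orbit representatives; by invariance
  of \<open>hyp_area\<close> it does not depend on which one is used.\<close>

definition orbit_representatives :: "(real^2^2) set \<Rightarrow> complex set \<Rightarrow> bool" where
  "orbit_representatives G F \<longleftrightarrow> F \<in> sets borel \<and> F \<subseteq> upper_half_plane \<and>
     (\<forall>z\<in>upper_half_plane. \<exists>!w. w \<in> F \<and> w \<in> orbit G z)"

definition finite_area_quotient :: "(real^2^2) set \<Rightarrow> bool" where
  "finite_area_quotient G \<longleftrightarrow> (\<exists>F. orbit_representatives G F \<and> emeasure hyp_area F < \<infinity>)"


section \<open>Cusps and the relative metric\<close>

definition set_stabilizer :: "(real^2^2) set \<Rightarrow> complex set \<Rightarrow> (real^2^2) set" where
  "set_stabilizer G B = {g \<in> G. act g ` B = B}"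

text \<open>\<open>C\<close> consists of one horoball above each cusp of the quotient, the corresponding cusp
  neighbourhoods being pairwise disjoint. The disjointness clause says both that each
  \<open>B\<close> in \<open>C\<close> is precisely invariant under its stabilizer, so that \<open>B\<close> modulo its stabilizer embeds in
  the quotient, and that distinct members of \<open>C\<close> have disjoint images there. The last clause says
  that no cusp is missed: every parabolic element is conjugate in the group into one of the
  stabilizers.\<close>

definition cusp_horoballs :: "(real^2^2) set \<Rightarrow> complex set set \<Rightarrow> bool" where
  "cusp_horoballs G C \<longleftrightarrow> finite C \<and>
     (\<forall>B\<in>C. horoball B \<and> (\<exists>p\<in>set_stabilizer G B. parabolic p)) \<and>
     (\<forall>B\<in>C. \<forall>B'\<in>C. \<forall>g\<in>G. act g ` B \<inter> B' \<noteq> {} \<longrightarrow> B = B' \<and> g \<in> set_stabilizer G B) \<and>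
     (\<forall>p\<in>G. parabolic p \<longrightarrow>
        (\<exists>g\<in>G. \<exists>B\<in>C. g \<otimes>\<^bsub>SL2R\<^esub> p \<otimes>\<^bsub>SL2R\<^esub> inv\<^bsub>SL2R\<^esub> g \<in> set_stabilizer G B))"

definition rel_generators ::
    "(real^2^2) set \<Rightarrow> (real^2^2) set \<Rightarrow> complex set set \<Rightarrow> (real^2^2) set" where
  "rel_generators G A C = A \<union> (\<Union>B\<in>C. set_stabilizer G B)"


section \<open>Geodesic rays and the circle at infinity\<close>

text \<open>The circle at infinity is the unit circle of the complex plane, attached to the upper
  half-plane through the Cayley transform onto the unit disc.\<close>

definition cayley :: "complex \<Rightarrow> complex" where
  "cayley = moebius 1 (- \<i>) 1 \<i>"

definition geodesic_ray :: "complex \<Rightarrow> (real \<Rightarrow> complex) \<Rightarrow> bool" where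
  "geodesic_ray x0 \<gamma> \<longleftrightarrow> \<gamma> 0 = x0 \<and> (\<forall>t\<ge>0. \<gamma> t \<in> upper_half_plane) \<and>
     (\<forall>s\<ge>0. \<forall>t\<ge>0. hyp_dist (\<gamma> s) (\<gamma> t) = \<bar>s - t\<bar>)"

definition ray_endpoint :: "(real \<Rightarrow> complex) \<Rightarrow> complex \<Rightarrow> bool" where
  "ray_endpoint \<gamma> \<xi> \<longleftrightarrow> ((\<lambda>t. cayley (\<gamma> t)) \<longlongrightarrow> \<xi>) at_top"

text \<open>A measure on the circle at infinity is a Borel measure on the complex plane concentrated
  on the unit circle. A property of rays from \<open>x0\<close> holds almost surely for it if, for almost every
  point of the circle, it holds for the ray from \<open>x0\<close> to that point. A ray is a function
  on the whole real line with irrelevant values at negative times, which is why the definition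
  quantifies over all such functions.\<close>

definition almost_all_rays ::
    "complex \<Rightarrow> complex measure \<Rightarrow> ((real \<Rightarrow> complex) \<Rightarrow> bool) \<Rightarrow> bool" where
  "almost_all_rays x0 M P \<longleftrightarrow>
     (AE \<xi> in M. \<forall>\<gamma>. geodesic_ray x0 \<gamma> \<and> ray_endpoint \<gamma> \<xi> \<longrightarrow> P \<gamma>)"

definition circle_lebesgue :: "complex measure" where
  "circle_lebesgue = distr (restrict_space lborel {0..<2*pi}) borel cis"

definition closest_orbit_element ::
    "(real^2^2) set \<Rightarrow> complex \<Rightarrow> complex \<Rightarrow> real^2^2 \<Rightarrow> bool" where
  "closest_orbit_element G x0 p g \<longleftrightarrow>
     g \<in> G \<and> (\<forall>k\<in>G. hyp_dist (act g x0) p \<le> hyp_dist (act k x0) p)"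

text \<open>\<open>has_rho G A C x0 \<gamma> L\<close> says that the limit defining \<open>\<rho>(\<gamma>)\<close> exists and equals \<open>L\<close>.
  The closest orbit element is not unique in general; the limit is required for
  every choice.\<close>

definition has_rho :: "(real^2^2) set \<Rightarrow> (real^2^2) set \<Rightarrow> complex set set \<Rightarrow> complex \<Rightarrow>
    (real \<Rightarrow> complex) \<Rightarrow> ereal \<Rightarrow> bool" where
  "has_rho G A C x0 \<gamma> L \<longleftrightarrow>
     (\<forall>h. (\<forall>t\<ge>0. closest_orbit_element G x0 (\<gamma> t) (h t)) \<longrightarrow>
        ((\<lambda>t. ereal (real (word_dist SL2R A (mat 1) (h t)) /
                     real (word_dist SL2R (rel_generators G A C) (mat 1) (h t)))) \<longlongrightarrow> L) at_top)"


section \<open>Random walks and harmonic measure\<close>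

text \<open>A sample point is the sequence of increments \<open>g\<^sub>1, g\<^sub>2, \<dots>\<close>, indexed from \<open>0\<close>.\<close>

definition increments :: "(real^2^2) pmf \<Rightarrow> (nat \<Rightarrow> real^2^2) measure" where
  "increments \<mu> = PiM UNIV (\<lambda>_. measure_pmf \<mu>)"

definition walk :: "nat \<Rightarrow> (nat \<Rightarrow> real^2^2) \<Rightarrow> real^2^2" where
  "walk n \<omega> = list_prod SL2R (map \<omega> [0..<n])"

text \<open>The hitting measure on the circle at infinity. \<open>lim\<close> is unspecified where the walk does
  not converge.\<close>

definition harmonic_measure :: "(real^2^2) pmf \<Rightarrow> complex \<Rightarrow> complex measure" where
  "harmonic_measure \<mu> x0 =
     distr (increments \<mu>) borel (\<lambda>\<omega>. lim (\<lambda>n. cayley (act (walk n \<omega>) x0)))"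

end

(*
  Let D(z) be the distance from z to the orbit of x0.  A point with D(z) large lies deep in a cusp, at height
  about exp D(z), and crossing that depth costs about exp D(z) generators per unit of arc length, but only boundedly
  many relative generators for the whole excursion.  Hence d_G(1, h_t) is comparable to the integral of exp D along
  the ray, while d_rel(1, h_t) is at most linear in t.

  Lebesgue measure: along the vertical geodesics ending at x, the averages of exp D over the scales 2^-m tend to
  infinity for almost every x.  Below every dyadic point near the orbit there is a cusp of definite size, so a
  fraction c 2^-i of its descendants i levels below has exp D >= c 2^i, and every scale contributes a constant to a
  logarithmically divergent mean; a Laplace transform estimate over the dyadic tree turns this into almost sure
  divergence.

  Harmonic measure: Kingman's theorem gives d_G(1, w_n)/n -> a, d_rel(1, w_n)/n -> b and d(x0, w_n x0)/n -> l.  The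
  return probabilities of the walk decay exponentially (Kesten), and there are few elements of relative length m and
  word length n when m is small compared to n, so b > 0, and l > 0 because d_rel is at most linear in the hyperbolic
  distance.  The ray to the limit point tracks the walk sublinearly: a point at time t lies almost between
  w_n x0 and w_m x0 with n, m close to t/l, which bounds both lengths of w_n^-1 h_t by o(t).  So the ratio is a/b.
*)
theory Submission
  imports Defs "HOL-Real_Asymp.Real_Asymp"
begin

text \<open>The cusp data only say that every parabolic element is conjugate into one of the
  stabilizers. That the horoballs and a neighbourhood of the orbit cover the half-plane has to be
  extracted from finite area. A Zassenhaus argument does this, with the distance of a matrix from
  the scalars in place of the displacement of a point: where a nontrivial element is nearly scalar,
  some such element is conjugate to one of finitely many, and elliptic or hyperbolic ones do not
  lead away from the orbit. Both comparisons with word length go through one primitive of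
  \<open>exp D\<close> along a geodesic: short steps give the upper bound, and the lower bound rests
  on the contraction, by about \<open>exp (- r)\<close> at distance \<open>r\<close>, of the
  projection to the geodesic. Closest orbit elements are not unique and the limit is claimed for
  every choice, so the exceptional set is not visibly measurable; for the harmonic measure it is
  enclosed in a countable combination of closed sets of endpoints. Tracking of the walk is used in
  integrated form: the error at time \<open>t\<close> is bounded by the total length of the
  increments in a short window of times around \<open>t/l\<close>.\<close>

abbreviation "dH \<equiv> hyp_dist"

abbreviation hinv :: "real^2^2 => real^2^2" where "hinv \<equiv> m_inv SL2R"

section \<open>Matrices of determinant one and their inverses\<close>

definition mat2 :: "real => real => real => real => real^2^2" where
 "mat2 a b c d = vector [vector [a, b], vector [c, d]]"

lemma mat2_entries [simp]:
 "mat2 a b c d $ 1 $ 1 = a" "mat2 a b c d $ 1 $ 2 = b"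
 "mat2 a b c d $ 2 $ 1 = c" "mat2 a b c d $ 2 $ 2 = d" by (simp_all add: mat2_def)

lemma mat2_eqI:
 fixes A B :: "real^2^2" assumes "A$1$1 = B$1$1" "A$1$2 = B$1$2" "A$2$1 = B$2$1" "A$2$2 = B$2$2" shows "A = B"
 using assms by (simp add: vec_eq_iff forall_2)

lemma mat2_mult_entries:
 fixes A B :: "real^2^2" shows "(A ** B)$i$j = A$i$1 * B$1$j + A$i$2 * B$2$j" by (simp add: matrix_matrix_mult_def sum_2)

lemma mat2_one_entries [simp]:
 "(mat 1 :: real^2^2)$1$1 = 1" "(mat 1 :: real^2^2)$1$2 = 0"
 "(mat 1 :: real^2^2)$2$1 = 0" "(mat 1 :: real^2^2)$2$2 = 1" by (simp_all add: mat_def)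

definition SL2 :: "(real^2^2) set" where "SL2 = {A. det A = 1}"

lemma SL2_iff: "A : SL2 \<longleftrightarrow> A$1$1 * A$2$2 - A$1$2 * A$2$1 = 1" by (simp add: SL2_def det_2)

lemma mat2_in_SL2 [simp]: "mat2 a b c d : SL2 \<longleftrightarrow> a * d - b * c = 1" by (simp add: SL2_iff)

lemma SL2_mult [simp]: "A : SL2 ==> B : SL2 ==> A ** B : SL2" by (simp add: SL2_def det_mul)

lemma SL2_inv [simp]: "A : SL2 ==> hinv A : SL2" using group.inv_closed[OF group_SL2R, of A] by (simp add: SL2_def)

lemma hinv_left [simp]: "A : SL2 ==> hinv A ** A = mat 1" using group.l_inv[OF group_SL2R, of A] by (simp add: SL2_def)

lemma hinv_right [simp]: "A : SL2 ==> A ** hinv A = mat 1" using group.r_inv[OF group_SL2R, of A] by (simp add: SL2_def)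

lemma hinv_hinv [simp]: "A : SL2 ==> hinv (hinv A) = A" using group.inv_inv[OF group_SL2R, of A] by (simp add: SL2_def)

lemma hinv_mult: "A : SL2 ==> B : SL2 ==> hinv (A ** B) = hinv B ** hinv A" using group.inv_mult_group[OF group_SL2R, of A B] by (simp add: SL2_def)

lemma hinv_one [simp]: "hinv (mat 1) = mat 1" using group.is_monoid[OF group_SL2R] monoid.inv_one by fastforce

lemma hinv_cancel [simp]:
 "A : SL2 ==> hinv A ** (A ** B) = B" "A : SL2 ==> A ** (hinv A ** B) = B" by (simp_all add: matrix_mul_assoc)

lemma SL2_inv_unique: "A : SL2 ==> B : SL2 ==> B ** A = mat 1 ==> hinv A = B" using group.inv_equality[OF group_SL2R, of B A] by (simp add: SL2_def)

lemma hinv_eq: "A : SL2 ==> hinv A = mat2 (A$2$2) (- A$1$2) (- A$2$1) (A$1$1)"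
 by (rule SL2_inv_unique) (auto simp: SL2_iff mat2_mult_entries algebra_simps intro!: mat2_eqI)

lemma upper_half_plane_iff [simp]: "z : upper_half_plane \<longleftrightarrow> 0 < Im z" by (simp add: upper_half_plane_def)

subsection \<open>Moebius action\<close>

definition den :: "real^2^2 => complex => complex" where
 "den A z = of_real (A$2$1) * z + of_real (A$2$2)"

lemma act_eq: "act A z = (of_real (A$1$1) * z + of_real (A$1$2)) / den A z" by (simp add: act_def moebius_def den_def)

lemma den_nonzero: assumes "A : SL2" "0 < Im z" shows "den A z ~= 0"
proof
 assume "den A z = 0"
 then have "A$2$1 * Re z + A$2$2 = 0" "A$2$1 * Im z = 0" by (simp_all add: den_def complex_eq_iff)
 then show False using assms by (auto simp: SL2_iff)
qed

lemma act_diff: assumes "A : SL2" "0 < Im z" "0 < Im w" shows "act A z - act A w = (z - w) / (den A z * den A w)"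
proof -
 have D: "(of_real (A$1$1) * of_real (A$2$2) - of_real (A$1$2) * of_real (A$2$1) :: complex) = 1"
  using arg_cong[OF assms(1)[unfolded SL2_iff], of complex_of_real] by simp
 have "(of_real (A$1$1) * z + of_real (A$1$2)) * den A w - (of_real (A$1$1) * w + of_real (A$1$2)) * den A z
   = (of_real (A$1$1) * of_real (A$2$2) - of_real (A$1$2) * of_real (A$2$1)) * (z - w)" by (simp add: den_def algebra_simps)
 then show ?thesis using den_nonzero[OF assms(1,2)] den_nonzero[OF assms(1,3)] D by (simp add: act_eq diff_frac_eq)
qed

lemma Im_act: assumes "A : SL2" "0 < Im z" shows "Im (act A z) = Im z / (cmod (den A z))^2"
proof -
 have "act A z = ((of_real (A$1$1) * z + of_real (A$1$2)) * cnj (den A z)) / of_real ((cmod (den A z))^2)"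
  unfolding act_eq by (subst complex_div_cnj) simp
 then have "Im (act A z) = Im ((of_real (A$1$1) * z + of_real (A$1$2)) * cnj (den A z)) / (cmod (den A z))^2" by (metis Im_divide_of_real)
 also have "Im ((of_real (A$1$1) * z + of_real (A$1$2)) * cnj (den A z)) =
   (A$1$1 * A$2$2 - A$1$2 * A$2$1) * Im z" by (simp add: den_def algebra_simps)
 finally show ?thesis using assms(1) by (simp add: SL2_iff)
qed

lemma Im_act_pos [simp]: "A : SL2 ==> 0 < Im z ==> 0 < Im (act A z)" using Im_act den_nonzero by simp

lemma act_one [simp]: "act (mat 1) z = z" by (simp add: act_eq den_def)

lemma act_mult: assumes "A : SL2" "B : SL2" "0 < Im z" shows "act (A ** B) z = act A (act B z)"
proof -
 have n: "den B z ~= 0" "den A (act B z) ~= 0" "den (A ** B) z ~= 0"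
  using assms den_nonzero[of B z] den_nonzero[of A "act B z"] den_nonzero[of "A ** B" z] by simp_all
 have "den (A ** B) z = den A (act B z) * den B z" using n(1) by (simp add: den_def act_eq mat2_mult_entries field_simps)
 moreover have "of_real ((A ** B)$1$1) * z + of_real ((A ** B)$1$2) =
   (of_real (A$1$1) * act B z + of_real (A$1$2)) * den B z"
  using n(1) by (simp add: act_eq mat2_mult_entries field_simps) (simp add: den_def algebra_simps)
 ultimately show ?thesis using n by (simp add: act_eq[of A] act_eq[of "A ** B"])
qed

lemma act_inv [simp]:
 "A : SL2 ==> 0 < Im z ==> act (hinv A) (act A z) = z"
 "A : SL2 ==> 0 < Im z ==> act A (act (hinv A) z) = z" by (simp_all flip: act_mult)

subsection \<open>The hyperbolic distance\<close>

lemma cosh_hyp_dist: assumes "0 < Im z" "0 < Im w" shows "cosh (dH z w) = 1 + (cmod (z - w))^2 / (2 * Im z * Im w)"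
 using assms by (simp add: hyp_dist_def cosh_arcosh_real)

lemma dH_nonneg [simp]: "0 < Im z ==> 0 < Im w ==> 0 <= dH z w" by (simp add: hyp_dist_def)

lemma dH_le_iff: assumes "0 < Im z" "0 < Im w" "0 <= t" shows "dH z w <= t \<longleftrightarrow> 1 + (cmod (z - w))^2 / (2 * Im z * Im w) <= cosh t"
 using assms by (subst cosh_hyp_dist[symmetric]) (simp_all add: cosh_real_nonneg_le_iff)

lemma dH_eqI: assumes "0 < Im z" "0 < Im w" "0 <= t" "1 + (cmod (z - w))^2 / (2 * Im z * Im w) = cosh t" shows "dH z w = t"
 using assms by (simp add: hyp_dist_def arcosh_cosh_real)

lemma dH_same [simp]: "0 < Im z ==> dH z z = 0" by (simp add: hyp_dist_def)

lemma dH_commute: "dH z w = dH w z" by (simp add: hyp_dist_def norm_minus_commute mult.commute mult.left_commute)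

lemma dH_act [simp]: assumes "A : SL2" "0 < Im z" "0 < Im w" shows "dH (act A z) (act A w) = dH z w"
proof -
 have "(cmod (act A z - act A w))^2 / (2 * Im (act A z) * Im (act A w)) = (cmod (z - w))^2 / (2 * Im z * Im w)"
  using assms den_nonzero[OF assms(1,2)] den_nonzero[OF assms(1,3)]
  by (simp add: act_diff Im_act norm_divide norm_mult power_divide power_mult_distrib field_simps)
 then show ?thesis by (simp add: hyp_dist_def)
qed

lemma dH_act_left: assumes "A : SL2" "0 < Im z" "0 < Im w" shows "dH (act A z) w = dH z (act (hinv A) w)"
proof -
 have "dH (act (hinv A) (act A z)) (act (hinv A) w) = dH (act A z) w" using assms by (intro dH_act) simp_all
 then show ?thesis using assms by (simp only: act_inv)
qed

lemma cosh_ln: "0 < (x::real) ==> cosh (ln x) = (x + 1 / x) / 2" by (simp add: cosh_def exp_minus inverse_eq_divide)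

lemma cosh_dist_alt: assumes "0 < Im z" "0 < Im w" shows "cosh (dH z w) = ((cmod z)^2 + (cmod w)^2 - 2 * Re z * Re w) / (2 * Im z * Im w)"
proof -
 have "(cmod (z - w))^2 = (cmod z)^2 + (cmod w)^2 - 2 * Re z * Re w - 2 * Im z * Im w"
  by (simp only: cmod_power2) (simp add: power2_eq_square algebra_simps)
 then show ?thesis using assms by (simp add: cosh_hyp_dist field_simps)
qed

text \<open>The signed distance to the imaginary axis; together with \<open>ln (cmod z)\<close> it gives Fermi coordinates.\<close>

definition fr :: "complex => real" where "fr z = arsinh (Re z / Im z)"

lemma cosh_fr: assumes "0 < Im z" shows "cosh (fr z) = cmod z / Im z"
proof -
 have "(cosh (fr z))^2 = 1 + (Re z / Im z)^2" by (simp add: cosh_square_eq fr_def)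
 also have "... = (cmod z / Im z)^2" using assms by (simp add: power_divide cmod_power2 field_simps)
 finally show ?thesis using assms by (simp add: power2_eq_iff_nonneg)
qed

lemma sinh_fr: "sinh (fr z) = Re z / Im z" by (simp add: fr_def)

lemma cosh_fermi: assumes "0 < Im z" "0 < Im w" shows "cosh (dH z w) =
  cosh (fr z) * cosh (fr w) * cosh (ln (cmod z) - ln (cmod w)) - sinh (fr z) * sinh (fr w)"
proof -
 have nz: "0 < cmod z" "0 < cmod w" using assms by auto
 have "cosh (ln (cmod z) - ln (cmod w)) = ((cmod z)^2 + (cmod w)^2) / (2 * cmod z * cmod w)" proof -
  have "ln (cmod z) - ln (cmod w) = ln (cmod z / cmod w)" using nz by (simp add: ln_div)
  then show ?thesis using nz by (simp add: cosh_ln field_simps power2_eq_square)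
 qed
 then show ?thesis using nz assms by (simp add: cosh_dist_alt cosh_fr sinh_fr diff_divide_distrib)
qed

text \<open>Subtract \<open>cosh (fr z - fr w) >= 1\<close> from \<open>cosh_fermi\<close>. The
  factor \<open>cosh (fr z) * cosh (fr w)\<close> is the exponential contraction of the
  nearest-point projection to the imaginary axis, on which all later projection estimates
  rest.\<close>

lemma fermi_gap: assumes "0 < Im z" "0 < Im w" shows "cosh (fr z) * cosh (fr w) * (cosh (ln (cmod z) - ln (cmod w)) - 1) <= cosh (dH z w) - 1"
proof -
 have "1 <= cosh (fr z - fr w)" by (rule cosh_real_ge_1)
 then show ?thesis by (simp add: cosh_fermi[OF assms] cosh_diff algebra_simps)
qed

lemma ln_cmod_lipschitz: assumes "0 < Im z" "0 < Im w" shows "abs (ln (cmod z) - ln (cmod w)) <= dH z w"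
proof -
 have "1 * (cosh (ln (cmod z) - ln (cmod w)) - 1) <=
   cosh (fr z) * cosh (fr w) * (cosh (ln (cmod z) - ln (cmod w)) - 1)" using mult_mono[of 1 "cosh (fr z)" 1 "cosh (fr w)"]
  by (intro mult_right_mono) (simp_all add: cosh_real_ge_1)
 then have "cosh (abs (ln (cmod z) - ln (cmod w))) <= cosh (dH z w)" using fermi_gap[OF assms] by simp
 then show ?thesis using assms by (simp add: cosh_real_nonneg_le_iff del: cosh_real_abs)
qed

definition iax :: "real => complex" where "iax t = Complex 0 (exp t)"

lemma iax_simps [simp]: "Re (iax t) = 0" "Im (iax t) = exp t" "cmod (iax t) = exp t" "fr (iax t) = 0" by (simp_all add: iax_def cmod_def fr_def)

lemma iax_zero: "iax 0 = \<i>" by (simp add: iax_def complex_eq_iff)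

lemma dH_iax [simp]: "dH (iax s) (iax t) = abs (s - t)"
proof -
 have "cosh (dH (iax s) (iax t)) = cosh (abs (s - t))" by (simp add: cosh_fermi)
 then have "arcosh (cosh (dH (iax s) (iax t))) = arcosh (cosh (abs (s - t)))" by (simp only:)
 then show ?thesis by (subst (asm) (1 2) arcosh_cosh_real) simp_all
qed

subsection \<open>Transitivity\<close>

lemma to_i: assumes "0 < Im z" shows "\<exists>M\<in>SL2. act M z = \<i>"
proof
 let ?s = "sqrt (Im z)"
 let ?M = "mat2 (1 / ?s) (- Re z / ?s) 0 ?s"
 show "?M : SL2" using assms by simp
 have "act ?M z = (of_real (1 / ?s) * z + of_real (- Re z / ?s)) / of_real ?s" by (simp add: act_eq den_def)
 also have "... = (z - of_real (Re z)) / of_real (?s * ?s)" using assms by (simp add: field_simps flip: of_real_mult)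
 also have "... = \<i>" using assms by (simp add: complex_eq_iff)
 finally show "act ?M z = \<i>" .
qed

definition rot :: "real => real^2^2" where "rot t = mat2 (cos t) (sin t) (- sin t) (cos t)"

lemma rot_SL2 [simp]: "rot t : SL2" by (simp add: rot_def flip: power2_eq_square)

lemma rot_i [simp]: "act (rot t) \<i> = \<i>"
proof -
 have "den (rot t) \<i> ~= 0" by (rule den_nonzero) simp_all
 moreover have "of_real (cos t) * \<i> + of_real (sin t) = \<i> * den (rot t) \<i>" by (simp add: den_def rot_def algebra_simps complex_eq_iff)
 ultimately show ?thesis by (simp add: act_eq) (simp add: rot_def)
qed

lemma rot_iax_aux: assumes "0 < Im z" shows "\<exists>t. Re (act (rot t) z) = 0 \<and> 1 <= Im (act (rot t) z)"
proof -
 define q where "q = (z - \<i>) / (z + \<i>)"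
 have zi: "z + \<i> ~= 0" using assms by (auto simp: complex_eq_iff)
 have q1: "cmod q < 1" proof -
  have "cmod (z - \<i>) < cmod (z + \<i>)" proof (rule power2_less_imp_less)
   show "(cmod (z - \<i>))^2 < (cmod (z + \<i>))^2" unfolding cmod_power2 using assms by (simp add: power2_eq_square algebra_simps)
  qed simp
  then show ?thesis using zi by (simp add: q_def norm_divide)
 qed
 obtain t where t: "q = of_real (cmod q) * cis (2 * t)" proof -
  have "q = of_real (cmod q) * cis (2 * (Arg q / 2))" using rcis_cmod_Arg[of q] by (simp add: rcis_def)
  then show ?thesis using that by blast
 qed
 let ?w = "act (rot (-t)) z"
 have dn: "den (rot (-t)) z ~= 0" using assms by (intro den_nonzero) simp_all
 have wpos: "0 < Im ?w" using assms by simp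
 have wi: "?w + \<i> ~= 0" using wpos by (auto simp: complex_eq_iff)
 have wd: "?w * den (rot (-t)) z = of_real (rot (-t)$1$1) * z + of_real (rot (-t)$1$2)" unfolding act_eq using dn by simp
 have n1: "(?w - \<i>) * den (rot (-t)) z = cis (- t) * (z - \<i>)"
  by (simp only: left_diff_distrib wd) (simp add: den_def rot_def complex_eq_iff algebra_simps)
 have n2: "(?w + \<i>) * den (rot (-t)) z = cis t * (z + \<i>)"
  by (simp only: distrib_right wd) (simp add: den_def rot_def complex_eq_iff algebra_simps)
 have "(?w - \<i>) / (?w + \<i>) = (cis (- t) * (z - \<i>)) / (cis t * (z + \<i>))"
  unfolding n1[symmetric] n2[symmetric] using dn by (rule nonzero_mult_divide_mult_cancel_right[symmetric])
 also have "... = cis (- (2 * t)) * q" by (simp add: q_def cis_divide flip: times_divide_times_eq)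
 also have "... = of_real (cmod q)" by (subst t) (simp add: cis_mult)
 finally have e: "(?w - \<i>) / (?w + \<i>) = of_real (cmod q)" .
 then have e2: "?w - \<i> = of_real (cmod q) * (?w + \<i>)" using wi by (simp add: field_simps)
 then have "Re ?w = cmod q * Re ?w" "Im ?w - 1 = cmod q * (Im ?w + 1)" by (auto simp: complex_eq_iff)
 moreover have "Re ?w = 0" using calculation(1) q1 by simp
 moreover have "0 <= cmod q * (Im ?w + 1)" using wpos by simp
 ultimately show ?thesis by (intro exI[of _ "-t"]) simp
qed

text \<open>Two-point homogeneity: a pair of points is determined up to isometry by its distance.
  Statements about a segment are thereby reduced to the imaginary axis.\<close>

lemma to_iax: assumes "0 < Im z" "0 < Im w" shows "\<exists>M\<in>SL2. act M z = \<i> \<and> act M w = iax (dH z w)"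
proof -
 obtain M where M: "M : SL2" "act M z = \<i>" using to_i assms(1) by blast
 obtain t where t: "Re (act (rot t) (act M w)) = 0" "1 <= Im (act (rot t) (act M w))" using rot_iax_aux[of "act M w"] M assms by auto
 let ?N = "rot t ** M"
 let ?v = "act ?N w"
 have N: "?N : SL2" "act ?N z = \<i>" using M assms by (simp_all add: act_mult)
 have v: "?v = iax (ln (Im ?v))" "1 <= Im ?v" using t M assms by (simp_all add: act_mult complex_eq_iff)
 have "dH z w = dH (act ?N z) ?v" using N(1) assms by (simp only: dH_act)
 also have "... = dH (iax 0) (iax (ln (Im ?v)))" using N(2) v(1) by (simp add: iax_zero)
 also have "... = ln (Im ?v)" using v(2) by simp
 finally show ?thesis using N v(1) by (intro bexI[of _ ?N]) auto
qed

text \<open>Put the outer two points on the imaginary axis. There \<open>ln (cmod z)\<close>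
  measures distance exactly and it is 1-Lipschitz everywhere, so the triangle inequality of the real
  line suffices.\<close>

lemma dH_triangle: assumes "0 < Im x" "0 < Im y" "0 < Im z" shows "dH x z <= dH x y + dH y z"
proof -
 obtain M where M: "M : SL2" "act M x = \<i>" "act M z = iax (dH x z)" using to_iax[of x z] assms by blast
 let ?y = "act M y"
 have "abs (ln (cmod \<i>) - ln (cmod ?y)) <= dH \<i> ?y" using M assms by (intro ln_cmod_lipschitz) simp_all
 moreover have "abs (ln (cmod ?y) - ln (cmod (iax (dH x z)))) <= dH ?y (iax (dH x z))" using M assms by (intro ln_cmod_lipschitz) simp_all
 moreover have "dH \<i> ?y = dH x y" "dH ?y (iax (dH x z)) = dH y z" using M assms by (metis dH_act)+
 ultimately show ?thesis by simp
qed

lemma cosh_ge_exp_half: "exp (x::real) / 2 <= cosh x" by (simp add: cosh_def)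

lemma Im_le_exp: assumes "0 < Im z" "0 < Im w" shows "Im w <= Im z * exp (dH z w)"
proof -
 have "(Im z - Im w)^2 <= (cmod (z - w))^2" by (simp add: cmod_power2)
 then have "1 + (Im z - Im w)^2 / (2 * Im z * Im w) <= cosh (dH z w)" using assms by (simp add: cosh_hyp_dist divide_right_mono)
 moreover have "1 + (Im z - Im w)^2 / (2 * Im z * Im w) = cosh (ln (Im w / Im z))" using assms by (simp add: cosh_ln field_simps power2_eq_square)
 ultimately have "cosh (abs (ln (Im w / Im z))) <= cosh (dH z w)" by simp
 then have "ln (Im w / Im z) <= dH z w" using assms by (simp add: cosh_real_nonneg_le_iff del: cosh_real_abs)
 then have "Im w / Im z <= exp (dH z w)" using assms by (metis divide_pos_pos exp_le_cancel_iff exp_ln)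
 then show ?thesis using assms by (simp add: field_simps)
qed

lemma dH_vertical: assumes "0 < y" "0 < y'" shows "dH (Complex x y) (Complex x y') = abs (ln y - ln y')"
proof (rule dH_eqI)
 have "cosh (abs (ln y - ln y')) = (y / y' + y' / y) / 2" proof -
  have "ln y - ln y' = ln (y / y')" using assms by (simp add: ln_div)
  then show ?thesis using assms by (simp add: cosh_ln)
 qed
 moreover have "cmod (Complex x y - Complex x y') = abs (y - y')" by (simp add: cmod_def)
 ultimately show "1 + (cmod (Complex x y - Complex x y'))^2 / (2 * Im (Complex x y) * Im (Complex x y'))
   = cosh (abs (ln y - ln y'))" using assms by (simp add: field_simps power2_eq_square)
qed (use assms in auto)

text \<open>Each distance gives an equation that is linear in \<open>(cmod z)^2\<close> and
  \<open>Im z\<close>. The two equations determine both quantities, and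
  \<open>(cmod z)^2 = (Im z)^2\<close> leaves no room for a real part.\<close>

lemma iax_point_unique: assumes "0 < Im z" "0 <= t" "dH \<i> z = t" "dH (iax 1) z = abs (t - 1)" shows "z = iax t"
proof -
 have a: "(1 + (cmod z)^2) / (2 * Im z) = cosh t" using cosh_dist_alt[of \<i> z] assms by simp
 have b: "((exp 1)^2 + (cmod z)^2) / (2 * exp 1 * Im z) = cosh (t - 1)" using cosh_dist_alt[of "iax 1" z] assms by simp
 have a': "1 + (cmod z)^2 = (exp t + exp (-t)) * Im z" using a assms(1) by (simp add: cosh_def field_simps)
 have b': "(exp 1)^2 + (cmod z)^2 = (exp 1 * exp (t - 1) + exp 1 * exp (1 - t)) * Im z" using b assms(1) by (simp add: cosh_def field_simps)
 have e: "exp 1 * exp (t - 1) = exp t" "exp 1 * exp (1 - t) = (exp 1)^2 * exp (- t :: real)" by (simp_all add: power2_eq_square flip: exp_add)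
 have "((exp 1)^2 - 1) * 1 = ((exp 1)^2 - 1) * (exp (- t) * Im z)" using a' b' unfolding e by (simp add: algebra_simps)
 moreover have "(1::real) < (exp 1)^2" by (simp add: power2_eq_square one_less_exp_iff flip: exp_add)
 ultimately have "exp (- t) * Im z = 1" by simp
 then have y: "Im z = exp t" by (simp add: exp_minus field_simps)
 then have "(cmod z)^2 = (exp t)^2" using a' by (simp add: algebra_simps power2_eq_square flip: exp_add)
 then have "Re z = 0" using y by (simp add: cmod_power2)
 then show ?thesis using y by (simp add: complex_eq_iff)
qed

lemma geodesic_ray_iax: assumes "geodesic_ray x0 r" shows "\<exists>M\<in>SL2. \<forall>t\<ge>0. act M (r t) = iax t"
proof -
 have g: "0 < Im (r t)" if "0 <= t" for t using assms that by (simp add: geodesic_ray_def)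
 have d: "dH (r s) (r t) = abs (s - t)" if "0 <= s" "0 <= t" for s t using assms that by (simp add: geodesic_ray_def)
 obtain M where M: "M : SL2" "act M (r 0) = \<i>" "act M (r 1) = iax 1" using to_iax[of "r 0" "r 1"] g d by auto
 have "act M (r t) = iax t" if "0 <= t" for t proof (rule iax_point_unique)
  show "dH \<i> (act M (r t)) = t" using M g that d[of 0 t] by (metis abs_minus_commute abs_of_nonneg diff_0_right dH_act order_refl)
  show "dH (iax 1) (act M (r t)) = abs (t - 1)" using M g that d[of 1 t] by (metis abs_minus_commute dH_act zero_le_one)
 qed (use M g that in auto)
 then show ?thesis using M(1) by blast
qed

subsection \<open>Invariance of the hyperbolic area\<close>

definition v2c :: "real^2 => complex" where "v2c v = Complex (v$1) (v$2)"
definition c2v :: "complex => real^2" where "c2v z = vector [Re z, Im z]"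

lemma v2c_c2v [simp]: "v2c (c2v z) = z" "c2v (v2c v) = v" by (auto simp: v2c_def c2v_def vec_eq_iff forall_2)

lemma Re_v2c [simp]: "Re (v2c v) = v$1" "Im (v2c v) = v$2" "c2v z $ 1 = Re z" "c2v z $ 2 = Im z" by (auto simp: v2c_def c2v_def)

lemma linear_v2c: "linear v2c" by (rule linearI) (simp_all add: complex_eq_iff)

lemma linear_c2v: "linear c2v" by (rule linearI) (simp_all add: vec_eq_iff forall_2)

lemma v2c_measurable [measurable]: "v2c : borel_measurable borel" using linear_continuous_on[OF linear_conv_bounded_linear[THEN iffD1, OF linear_v2c]]
 by (rule borel_measurable_continuous_onI)

lemma Basis_real2: "(Basis :: (real^2) set) = {axis 1 1, axis 2 1}" by (auto simp: Basis_vec_def UNIV_2)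

lemma lborel_v2c: "distr lborel borel v2c = lborel"
proof (rule lborel_eqI[symmetric])
 fix l u :: complex
 assume le: "!!b. b : Basis ==> l \<bullet> b <= u \<bullet> b"
 have le': "Re l <= Re u" "Im l <= Im u" using le[of 1] le[of \<i>] by (auto simp: Basis_complex_def)
 have "v2c -` box l u = box (c2v l) (c2v u)" by (auto simp: box_def Basis_complex_def Basis_real2 inner_axis)
 then have "emeasure (distr lborel borel v2c) (box l u) = emeasure lborel (box (c2v l) (c2v u))" by (subst emeasure_distr) auto
 also have "... = (\<Prod>b\<in>Basis. (c2v u - c2v l) \<bullet> b)" using le' by (intro emeasure_lborel_box) (auto simp: Basis_real2 inner_axis)
 also have "(\<Prod>b\<in>Basis. (c2v u - c2v l) \<bullet> b) = (\<Prod>b\<in>Basis. (u - l) \<bullet> b)"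
  by (simp add: Basis_real2 Basis_complex_def inner_axis axis_eq_axis)
 finally show "emeasure (distr lborel borel v2c) (box l u) = (\<Prod>b\<in>Basis. (u - l) \<bullet> b)" .
qed simp

lemma emeasure_hyp_area_v2c: assumes S: "S : sets borel" "S \<subseteq> upper_half_plane"
 shows "emeasure hyp_area S = (\<integral>\<^sup>+v. ennreal (indicator (c2v ` S) v * (1 / (v$2)^2)) \<partial>lborel)"
proof -
 have [measurable]: "S : sets borel" by fact
 have uh: "upper_half_plane : sets borel" unfolding upper_half_plane_def by (simp add: borel_open open_halfspace_Im_gt)
 have mem: "v : c2v ` S \<longleftrightarrow> v2c v : S" for v by (auto simp: image_iff) (metis v2c_c2v(2))
 have "emeasure hyp_area S =
   (\<integral>\<^sup>+z. indicator upper_half_plane z * ennreal (1 / (Im z)^2) * indicator S z \<partial>lborel)"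
  unfolding hyp_area_def using uh by (subst emeasure_density) auto
 also have "... = (\<integral>\<^sup>+z. indicator S z * ennreal (1 / (Im z)^2) \<partial>lborel)"
  using S(2) by (intro nn_integral_cong) (auto simp: indicator_def)
 also have "... = (\<integral>\<^sup>+z. indicator S z * ennreal (1 / (Im z)^2) \<partial>distr lborel borel v2c)" by (simp only: lborel_v2c)
 also have "... = (\<integral>\<^sup>+v. indicator S (v2c v) * ennreal (1 / (Im (v2c v))^2) \<partial>lborel)" by (subst nn_integral_distr) auto
 also have "... = (\<integral>\<^sup>+v. ennreal (indicator (c2v ` S) v * (1 / (v$2)^2)) \<partial>lborel)"
  by (intro nn_integral_cong) (auto simp: indicator_def mem)
 finally show ?thesis .
qed

lemma c2v_image_borel: assumes "S : sets borel" shows "c2v ` S : sets borel"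
proof -
 have "c2v ` S = v2c -` S \<inter> space borel" by (auto simp: image_iff) (metis v2c_c2v(2))
 then show ?thesis using measurable_sets[OF v2c_measurable assms] by simp
qed

text \<open>Area is put into the shape of the change of variables theorem: vectors in
  \<open>real^2\<close>, values in \<open>real^1\<close>, and an equivalence for each finite value
  \<open>b\<close>, which handles integrability and value together.\<close>

lemma hyp_area_integral: assumes S: "S : sets borel" "S \<subseteq> upper_half_plane"
 shows "emeasure hyp_area S = ennreal b \<and> 0 <= b \<longleftrightarrow>
   ((%v. vec (1 / (v$2)^2) :: real^1) absolutely_integrable_on (c2v ` S) \<and>
   integral (c2v ` S) (%v. vec (1 / (v$2)^2) :: real^1) = vec b)" (is "?L \<longleftrightarrow> ?R")
proof -
 let ?f = "%v::real^2. 1 / (v$2)^2"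
 have [measurable]: "c2v ` S : sets borel" by (rule c2v_image_borel) fact
 have "?L \<longleftrightarrow> ((\<integral>\<^sup>+v. ennreal (indicator (c2v ` S) v * ?f v) \<partial>lborel) = ennreal b \<and> 0 <= b)"
  using S by (simp add: emeasure_hyp_area_v2c)
 also have "... \<longleftrightarrow> ((%v. indicator (c2v ` S) v * ?f v) has_integral b) UNIV" proof (intro iffI conjI)
  assume h: "(\<integral>\<^sup>+v. ennreal (indicator (c2v ` S) v * ?f v) \<partial>lborel) = ennreal b \<and> 0 <= b"
  show "((%v. indicator (c2v ` S) v * ?f v) has_integral b) UNIV" by (rule nn_integral_has_integral) (use h in auto)
 next
  assume h: "((%v. indicator (c2v ` S) v * ?f v) has_integral b) UNIV"
  show "0 <= b" using h by (rule has_integral_nonneg) auto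
  show "(\<integral>\<^sup>+v. ennreal (indicator (c2v ` S) v * ?f v) \<partial>lborel) = ennreal b"
   by (rule nn_integral_has_integral_lborel[OF _ _ h]) auto
 qed
 also have "... \<longleftrightarrow> (?f has_integral b) (c2v ` S)"
  by (subst has_integral_restrict_UNIV[symmetric], rule arg_cong[where f="%f. (f has_integral b) UNIV"])
    (auto simp: indicator_def)
 also have "... \<longleftrightarrow> ?f absolutely_integrable_on (c2v ` S) \<and> integral (c2v ` S) ?f = b"
  by (subst absolutely_integrable_on_iff_nonneg) (auto simp: has_integral_iff)
 also have "... \<longleftrightarrow> ?R" by (auto simp: absolutely_integrable_on_1_iff integral_on_1_eq)
 finally show ?thesis .
qed

lemma act_has_derivative: assumes "A : SL2" "0 < Im z" shows "(act A has_field_derivative 1 / (den A z)^2) (at z)"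
proof -
 have D: "of_real (A$1$1) * of_real (A$2$2) - of_real (A$1$2) * of_real (A$2$1) = (1::complex)"
  using arg_cong[OF assms(1)[unfolded SL2_iff], of complex_of_real] by simp
 have n: "of_real (A$2$1) * z + of_real (A$2$2) ~= 0" using den_nonzero[OF assms] by (simp add: den_def)
 have "act A = (%z. (of_real (A$1$1) * z + of_real (A$1$2)) / (of_real (A$2$1) * z + of_real (A$2$2)))" by (rule ext) (simp add: act_eq den_def)
 moreover have "of_real (A$1$1) * (of_real (A$2$1) * z + of_real (A$2$2)) -
   (of_real (A$1$1) * z + of_real (A$1$2)) * of_real (A$2$1) = (1::complex)" by (subst D[symmetric]) (simp add: algebra_simps)
 ultimately show ?thesis using n by (auto intro!: derivative_eq_intros simp: den_def power2_eq_square)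
qed

lemma act_image_borel: assumes A: "A : SL2" and S: "S : sets borel" "S \<subseteq> upper_half_plane" shows "act A ` S : sets borel"
proof -
 have cont: "continuous_on upper_half_plane (act (hinv A))" using act_has_derivative[of "hinv A"] A
  by (intro DERIV_continuous_on[of _ _ "%z. 1 / (den (hinv A) z)^2"]) (auto intro: has_field_derivative_at_within)
 have uh: "upper_half_plane : sets borel" unfolding upper_half_plane_def by (simp add: borel_open open_halfspace_Im_gt)
 have im: "act A ` S = act (hinv A) -` S \<inter> upper_half_plane" proof safe
  fix z assume "act (hinv A) z : S" "z : upper_half_plane"
  then show "z : act A ` S" using A by (intro image_eqI[of _ _ "act (hinv A) z"]) auto
 qed (use S(2) A in "auto simp: subset_iff")
 show ?thesis using measurable_sets[OF borel_measurable_continuous_on_restrict[OF cont] S(1)] uh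
  by (simp add: im space_restrict_space sets_restrict_space_iff)
qed

text \<open>The derivative of \<open>act A\<close> is \<open>1 / (den A z)^2\<close>, so the
  Jacobian determinant is \<open>1 / (cmod (den A z))^4\<close>; this cancels the change of
  \<open>1 / (Im z)^2\<close> given by \<open>Im_act\<close>.\<close>

lemma hyp_area_act: assumes A: "A : SL2" and S: "S : sets borel" "S \<subseteq> upper_half_plane"
 shows "emeasure hyp_area (act A ` S) = emeasure hyp_area S"
proof -
 have inj: "inj_on (act A) S" using S(2) A by (intro inj_on_inverseI[where g="act (hinv A)"]) (auto simp: subset_iff)
 have Ab: "act A ` S : sets borel" using A S by (rule act_image_borel)
 have Au: "act A ` S \<subseteq> upper_half_plane" using A S(2) by (auto simp: subset_iff)
 define g where "g = (%v. c2v (act A (v2c v)))"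
 define g' where "g' = (%v h. c2v (1 / (den A (v2c v))^2 * v2c h))"
 have g_im: "g ` (c2v ` S) = c2v ` (act A ` S)" by (auto simp: g_def image_image)
 have dg: "(g has_derivative g' v) (at v within c2v ` S)" if "v : c2v ` S" for v proof -
  have p: "0 < Im (v2c v)" using that S(2) by auto
  have bl: "bounded_linear v2c" "bounded_linear c2v" using linear_v2c linear_c2v by (simp_all add: linear_conv_bounded_linear)
  have "(act A has_derivative (%h. 1 / (den A (v2c v))^2 * h)) (at (v2c v))" using act_has_derivative[OF A p] unfolding has_field_derivative_def .
  from bounded_linear.has_derivative[OF bl(2) has_derivative_compose[OF bounded_linear_imp_has_derivative[OF bl(1)] this]]
  have "(g has_derivative g' v) (at v)" unfolding g_def g'_def .
  then show ?thesis by (rule has_derivative_at_withinI)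
 qed
 have injg: "inj_on g (c2v ` S)" using inj by (auto simp: g_def inj_on_def) (metis v2c_c2v(1))
 have jac: "abs (det (matrix (g' v))) *\<^sub>R (vec (1 / (g v $ 2)^2) :: real^1) = vec (1 / (v$2)^2)"
  if "v : c2v ` S" for v proof -
  have p: "0 < Im (v2c v)" using that S(2) by auto
  define q where "q = 1 / (den A (v2c v))^2"
  have n: "den A (v2c v) ~= 0" using den_nonzero[OF A p] .
  have m: "v2c (axis 1 1) = 1" "v2c (axis 2 1) = \<i>" by (simp_all add: complex_eq_iff axis_def)
  have "det (matrix (g' v)) = (Re q)^2 + (Im q)^2" unfolding det_2 matrix_def g'_def q_def[symmetric] by (simp add: m power2_eq_square axis_def)
  also have "... = (cmod q)^2" by (simp add: cmod_power2)
  also have "... = 1 / (cmod (den A (v2c v)))^4" by (simp add: q_def norm_divide norm_power power_divide)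
  finally have "det (matrix (g' v)) = 1 / (cmod (den A (v2c v)))^4" .
  moreover have "g v $ 2 = v $ 2 / (cmod (den A (v2c v)))^2" using Im_act[OF A p] by (simp add: g_def)
  ultimately show ?thesis using n p by (simp add: vec_eq_iff power_divide flip: power_mult)
 qed
 have cov: "(emeasure hyp_area S = ennreal b \<and> 0 <= b) \<longleftrightarrow> (emeasure hyp_area (act A ` S) = ennreal b \<and> 0 <= b)" for b
 proof -
  have "(%v. abs (det (matrix (g' v))) *\<^sub>R (vec (1 / (g v $ 2)^2) :: real^1)) absolutely_integrable_on (c2v ` S) \<longleftrightarrow>
    (%v. vec (1 / (v$2)^2) :: real^1) absolutely_integrable_on (c2v ` S)" by (rule set_integrable_cong[OF refl refl]) (rule jac)
  moreover have "integral (c2v ` S) (%v. abs (det (matrix (g' v))) *\<^sub>R (vec (1 / (g v $ 2)^2) :: real^1)) =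
    integral (c2v ` S) (%v. vec (1 / (v$2)^2) :: real^1)" by (rule integral_cong) (rule jac)
  ultimately show ?thesis using has_absolute_integral_change_of_variables[OF _ dg injg, of "%v. vec (1 / (v$2)^2) :: real^1" "vec b"]
    c2v_image_borel[OF S(1)] by (simp add: hyp_area_integral[OF S] hyp_area_integral[OF Ab Au] g_im)
 qed
 \<comment> \<open>\<open>cov\<close> matches finite values only. Infinite area follows because a
   finite area on either side forces the same one on the other.\<close>
 show ?thesis proof (cases "emeasure hyp_area S")
  case (real b)
  then show ?thesis using cov[of b] by simp
 next
  case top
  then show ?thesis proof (cases "emeasure hyp_area (act A ` S)")
   case (real b) then show ?thesis using cov[of b] by simp
  qed simp
 qed
qed

subsection \<open>Size and deviation from scalar matrices\<close>

definition frob :: "real^2^2 => real" where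
 "frob A = (A$1$1)^2 + (A$1$2)^2 + (A$2$1)^2 + (A$2$2)^2"

definition dev :: "real^2^2 => real" where
 "dev A = (A$1$1 - A$2$2)^2 / 2 + (A$1$2)^2 + (A$2$1)^2"

lemma frob_nonneg [simp]: "0 <= frob A" and dev_nonneg [simp]: "0 <= dev A" by (simp_all add: frob_def dev_def)

lemma cauchy2: "((a::real) * p + b * q)^2 <= (a^2 + b^2) * (p^2 + q^2)"
proof -
 have "0 <= (a * q - b * p)^2" by simp
 then show ?thesis by (simp add: power2_eq_square algebra_simps)
qed

lemma frob_mult: "frob (A ** B) <= frob A * frob B"
proof -
 have "frob (A ** B) <=
   ((A$1$1)^2 + (A$1$2)^2) * ((B$1$1)^2 + (B$2$1)^2) + ((A$1$1)^2 + (A$1$2)^2) * ((B$1$2)^2 + (B$2$2)^2) +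
   ((A$2$1)^2 + (A$2$2)^2) * ((B$1$1)^2 + (B$2$1)^2) + ((A$2$1)^2 + (A$2$2)^2) * ((B$1$2)^2 + (B$2$2)^2)"
  unfolding frob_def mat2_mult_entries by (intro add_mono cauchy2)
 also have "... = frob A * frob B" by (simp add: frob_def algebra_simps)
 finally show ?thesis .
qed

lemma frob_hinv [simp]: "A : SL2 ==> frob (hinv A) = frob A" by (simp add: hinv_eq frob_def)

lemma frob_dist: "A : SL2 ==> frob A = 2 * cosh (dH \<i> (act A \<i>))"
proof -
 assume A: "A : SL2"
 have n: "den A \<i> ~= 0" using den_nonzero[OF A] by simp
 have d: "(cmod (den A \<i>))^2 = (A$2$1)^2 + (A$2$2)^2" by (simp add: den_def cmod_power2)
 have e: "(cmod (act A \<i>))^2 = ((A$1$1)^2 + (A$1$2)^2) / (cmod (den A \<i>))^2"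
  by (simp add: act_eq norm_divide power_divide) (simp add: cmod_power2)
 have i: "Im (act A \<i>) = 1 / (cmod (den A \<i>))^2" using Im_act[OF A, of \<i>] by simp
 have "2 * cosh (dH \<i> (act A \<i>)) = (1 + (cmod (act A \<i>))^2) / Im (act A \<i>)"
  using cosh_dist_alt[of \<i> "act A \<i>"] A by (simp del: distrib_left_numeral)
 also have "... = (cmod (den A \<i>))^2 + ((A$1$1)^2 + (A$1$2)^2)" unfolding e i using n by (simp add: field_simps)
 finally show ?thesis by (simp add: d frob_def)
qed

lemma trace2: "trace (A::real^2^2) = A$1$1 + A$2$2" by (simp add: trace_def sum_2)

lemma frob_dev: "frob A = dev A + (trace A)^2 / 2" by (simp add: frob_def dev_def trace2 power2_eq_square field_simps)

lemma trace_dev: assumes "A : SL2" shows "abs ((trace A)^2 / 2 - 2) <= dev A"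
proof -
 have "(trace A)^2 / 2 - 2 = (A$1$1 - A$2$2)^2 / 2 + 2 * (A$1$2 * A$2$1)"
  using assms unfolding SL2_iff trace2 by (simp add: power2_eq_square field_simps)
 moreover have "abs (2 * (A$1$2 * A$2$1)) <= (A$1$2)^2 + (A$2$1)^2"
  using sum_squares_bound[of "A$1$2" "A$2$1"] sum_squares_bound[of "- A$1$2" "A$2$1"] by (simp add: abs_le_iff mult.assoc)
 moreover have "0 <= (A$1$1 - A$2$2)^2" by simp
 ultimately show ?thesis unfolding dev_def by linarith
qed

lemma frob_dev_le: "A : SL2 ==> frob A <= 2 + 2 * dev A" using trace_dev[of A] by (simp add: frob_dev)

text \<open>The commutator minus the identity is \<open>(A ** B - B ** A) ** W\<close>. The bracket
  ignores the scalar parts of \<open>A\<close> and \<open>B\<close>, so it is bilinear in their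
  trace-free parts, and its square is bounded by the product of the deviations.\<close>

lemma dev_commutator: assumes A: "A : SL2" "dev A <= 1" and B: "B : SL2" "dev B <= 1"
 shows "dev (A ** B ** (hinv A ** hinv B)) <= 160 * dev A * dev B"
proof -
 define W where "W = hinv A ** hinv B"
 define E where "E = A ** B - B ** A"
 have W: "W = hinv (B ** A)" using A B by (simp add: W_def hinv_mult)
 have "B ** A ** W = mat 1" using A B by (simp add: W)
 moreover have "A ** B ** W = B ** A ** W + E ** W" by (rule mat2_eqI) (simp_all add: E_def mat2_mult_entries algebra_simps)
 ultimately have c: "A ** B ** W = mat 1 + E ** W" by simp
 have "dev (mat 1 + E ** W) <= frob (E ** W)" proof -
  have "(((E ** W)$1$1) - (E ** W)$2$2)^2 / 2 <= ((E ** W)$1$1)^2 + ((E ** W)$2$2)^2"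
   using sum_squares_bound[of "(E ** W)$1$1" "- (E ** W)$2$2"] by (simp add: power2_eq_square field_simps)
  then show ?thesis by (simp add: dev_def frob_def)
 qed
 also have "... <= frob E * frob W" by (rule frob_mult)
 \<comment> \<open>The four entries of the bracket contribute 1, 1, 4 and 4 times
   \<open>dev A * dev B\<close>; each factor of \<open>W\<close> has \<open>frob\<close> at most 4,
   hence 16.\<close>
 also have "... <= (10 * dev A * dev B) * 16" proof (rule mult_mono)
  have "frob W = frob (B ** A)" using A B by (simp add: W)
  also have "... <= frob B * frob A" by (rule frob_mult)
  also have "... <= 4 * 4" using frob_dev_le[OF A(1)] frob_dev_le[OF B(1)] A B by (intro mult_mono) auto
  finally show "frob W <= 16" by simp
  define p where "p = A$1$1 - A$2$2"
  define p' where "p' = B$1$1 - B$2$2"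
  have e: "E$1$1 = A$1$2 * B$2$1 - A$2$1 * B$1$2" "E$2$2 = - (A$1$2 * B$2$1 - A$2$1 * B$1$2)"
   "E$1$2 = p * B$1$2 - A$1$2 * p'" "E$2$1 = A$2$1 * p' - p * B$2$1" by (simp_all add: E_def mat2_mult_entries p_def p'_def algebra_simps)
  have dA: "p^2 <= 2 * dev A" "(A$1$2)^2 + (A$2$1)^2 <= dev A" "p^2 + (A$1$2)^2 <= 2 * dev A" "p^2 + (A$2$1)^2 <= 2 * dev A"
   by (simp_all add: dev_def p_def)
  have dB: "p'^2 <= 2 * dev B" "(B$1$2)^2 + (B$2$1)^2 <= dev B" "p'^2 + (B$1$2)^2 <= 2 * dev B" "p'^2 + (B$2$1)^2 <= 2 * dev B"
   by (simp_all add: dev_def p'_def)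
  have "(E$1$1)^2 <= dev A * dev B" proof -
   have "(E$1$1)^2 <= ((A$1$2)^2 + (A$2$1)^2) * ((B$1$2)^2 + (B$2$1)^2)"
    using cauchy2[of "A$1$2" "B$2$1" "A$2$1" "- B$1$2"] by (simp add: e add.commute)
   also have "... <= dev A * dev B" using dA dB by (intro mult_mono) auto
   finally show ?thesis .
  qed
  moreover have "(E$2$2)^2 = (E$1$1)^2" by (simp add: e power2_commute)
  moreover have "(E$1$2)^2 <= 4 * (dev A * dev B)" proof -
   have "(E$1$2)^2 <= (p^2 + (A$1$2)^2) * (p'^2 + (B$1$2)^2)" using cauchy2[of p "B$1$2" "A$1$2" "- p'"] by (simp add: e add.commute)
   also have "... <= (2 * dev A) * (2 * dev B)" using dA dB by (intro mult_mono) auto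
   finally show ?thesis by simp
  qed
  moreover have "(E$2$1)^2 <= 4 * (dev A * dev B)" proof -
   have "(E$2$1)^2 <= (p^2 + (A$2$1)^2) * (p'^2 + (B$2$1)^2)" using cauchy2[of "p" "- B$2$1" "A$2$1" "p'"] by (simp add: e add.commute)
   also have "... <= (2 * dev A) * (2 * dev B)" using dA dB by (intro mult_mono) auto
   finally show ?thesis by simp
  qed
  ultimately show "frob E <= 10 * dev A * dev B" by (simp add: frob_def)
 qed auto
 finally show ?thesis using c W_def by simp
qed

text \<open>Conjugation by an element that moves \<open>z\<close> to \<open>\<i>\<close> turns \<open>displ z A\<close> into \<open>dev A\<close>, the squared distance of
 \<open>A\<close> from the scalar matrices.\<close>

definition displ :: "complex => real^2^2 => real" where
 "displ z A = 2 * cosh (dH z (act A z)) - (trace A)^2 / 2"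

lemma displ_i: "A : SL2 ==> displ \<i> A = dev A" using frob_dist[of A] by (simp add: displ_def frob_dev)

lemma trace_conj: "M : SL2 ==> trace (M ** A ** hinv M) = trace A" by (metis hinv_cancel(1) matrix_mul_assoc trace_mul_sym)

lemma displ_conj: assumes "M : SL2" "A : SL2" "0 < Im z" shows "displ (act M z) (M ** A ** hinv M) = displ z A"
 using assms by (simp add: displ_def trace_conj act_mult)

lemma displ_conj_i: assumes "M : SL2" "A : SL2" "0 < Im z" "act M z = \<i>" shows "displ z A = dev (M ** A ** hinv M)"
 using displ_conj[OF assms(1-3)] assms by (simp add: displ_i)

text \<open>Conjugation by the triangular matrix that moves \<open>Complex x y\<close> to
  \<open>\<i>\<close> turns the displacement into \<open>dev\<close>. The result is a quadratic form
  in the trace-free part of \<open>A\<close>, with coefficients that are explicit in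
  \<open>x\<close> and \<open>y\<close>.\<close>

lemma displ_formula: assumes A: "A : SL2" and y: "0 < y" shows "displ (Complex x y) A = (A$1$1 - A$2$2 - 2 * A$2$1 * x)^2 / 2 +
   ((A$1$2 + (A$1$1 - A$2$2) * x - A$2$1 * x^2) / y)^2 + (A$2$1 * y)^2"
proof -
 define s where "s = sqrt y"
 have s: "0 < s" "s * s = y" using y by (auto simp: s_def)
 define M where "M = mat2 (1 / s) (- x / s) 0 s"
 have M: "M : SL2" using s by (simp add: M_def)
 have iM: "hinv M = mat2 s (x / s) 0 (1 / s)" unfolding hinv_eq[OF M] by (simp add: M_def)
 have "act M (Complex x y) = \<i>" using s y by (simp add: act_eq den_def M_def complex_eq_iff Re_divide Im_divide power2_eq_square field_simps)
 then have "displ (Complex x y) A = dev (M ** A ** hinv M)" using displ_conj_i[OF M A] y by simp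
 also have "... = (A$1$1 - A$2$2 - 2 * A$2$1 * x)^2 / 2 +
   ((A$1$2 + (A$1$1 - A$2$2) * x - A$2$1 * x^2) / y)^2 + (A$2$1 * y)^2" proof -
  have e: "(M ** A ** hinv M)$1$1 = A$1$1 - A$2$1 * x" "(M ** A ** hinv M)$2$2 = A$2$2 + A$2$1 * x"
   "(M ** A ** hinv M)$1$2 = (A$1$2 + (A$1$1 - A$2$2) * x - A$2$1 * x^2) / y"
   "(M ** A ** hinv M)$2$1 = A$2$1 * y" unfolding iM unfolding M_def mat2_mult_entries using s(1)
   by (simp_all add: field_simps power2_eq_square flip: s(2))
  show ?thesis unfolding dev_def e by (simp add: algebra_simps)
 qed
 finally show ?thesis .
qed

lemma dev_zero: assumes "A : SL2" "dev A = 0" shows "A = mat 1 \<or> A = - mat 1"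
proof -
 have h: "A$1$1 = A$2$2" "A$1$2 = 0" "A$2$1 = 0" proof -
  have "(A$1$1 - A$2$2)^2 / 2 = 0 \<and> (A$1$2)^2 = 0 \<and> (A$2$1)^2 = 0" using assms(2) unfolding dev_def
   by (smt (verit) zero_le_power2 divide_nonneg_nonneg)
  then show "A$1$1 = A$2$2" "A$1$2 = 0" "A$2$1 = 0" by auto
 qed
 then have "A$1$1 * A$1$1 = 1" using assms(1) by (simp add: SL2_iff)
 then have "A$1$1 = 1 \<or> A$1$1 = -1" by (simp add: square_eq_1_iff)
 then show ?thesis using h by (auto intro!: mat2_eqI)
qed

lemma mat2_neg_mult:
 fixes A B :: "real^2^2" shows "(- A) ** B = - (A ** B)" "A ** (- B) = - (A ** B)" by (rule mat2_eqI; simp add: mat2_mult_entries)+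

lemma conj_scalar: assumes M: "M : SL2" "M ** A ** hinv M = mat 1 \<or> M ** A ** hinv M = - mat 1" shows "A = mat 1 \<or> A = - mat 1"
proof -
 have "A = hinv M ** (M ** A ** hinv M) ** M" using M(1) by (simp add: matrix_mul_assoc[symmetric])
 moreover have "hinv M ** (- mat 1) ** M = - mat 1" using M(1) by (simp add: mat2_neg_mult)
 ultimately show ?thesis using M by auto
qed

lemma displ_pos: assumes "A : SL2" "0 < Im z" "A ~= mat 1" "A ~= - mat 1" shows "0 < displ z A"
proof -
 obtain M where M: "M : SL2" "act M z = \<i>" using to_i assms by blast
 have "dev (M ** A ** hinv M) ~= 0" using dev_zero[of "M ** A ** hinv M"] conj_scalar[OF M(1)] assms M by (metis SL2_inv SL2_mult)
 then show ?thesis using displ_conj_i[OF M(1) assms(1,2) M(2)] dev_nonneg[of "M ** A ** hinv M"] by (simp add: order_less_le)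
qed

lemma displ_commutator: assumes "A : SL2" "displ z A <= 1" "B : SL2" "displ z B <= 1" "0 < Im z"
 shows "displ z (A ** B ** (hinv A ** hinv B)) <= 160 * displ z A * displ z B"
proof -
 obtain M where M: "M : SL2" "act M z = \<i>" using to_i assms by blast
 let ?c = "%A. M ** A ** hinv M"
 have "?c (A ** B ** (hinv A ** hinv B)) = ?c A ** ?c B ** (hinv (?c A) ** hinv (?c B))"
  using M(1) assms by (simp add: hinv_mult matrix_mul_assoc[symmetric])
 then show ?thesis using dev_commutator[of "?c A" "?c B"] assms M by (simp add: displ_conj_i[OF M(1) _ assms(5) M(2)])
qed

lemma displ_dist: "A : SL2 ==> 0 < Im z ==> cosh (dH z (act A z)) <= 1 + displ z A"
proof -
 assume A: "A : SL2" "0 < Im z"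
 obtain M where M: "M : SL2" "act M z = \<i>" using to_i A by blast
 have "trace (M ** A ** hinv M) = trace A" using M by (simp add: trace_conj)
 then show ?thesis using trace_dev[of "M ** A ** hinv M"] displ_conj_i[OF M(1) A(1,2) M(2)] A M by (simp add: displ_def)
qed

text \<open>Commuting matrices have proportional trace-free parts when one of them is not scalar,
  and \<open>displ_formula\<close> is quadratic in that part. The factor \<open>s\<close> is the
  same at all points \<open>w\<close>; this uniformity is what \<open>thin_to_thick\<close>
  needs.\<close>

lemma commute_parallel: assumes A: "A : SL2" "A ~= mat 1" "A ~= - mat 1" and B: "B : SL2" and c: "A ** B = B ** A"
 shows "\<exists>s\<ge>0. \<forall>w. 0 < Im w --> displ w B = s * displ w A"
proof -
 define p where "p = A$1$1 - A$2$2"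
 define p' where "p' = B$1$1 - B$2$2"
 have e: "A$1$2 * B$2$1 = A$2$1 * B$1$2" "p * B$1$2 = A$1$2 * p'" "A$2$1 * p' = p * B$2$1" proof -
  have "(A ** B)$1$1 = (B ** A)$1$1" "(A ** B)$1$2 = (B ** A)$1$2" "(A ** B)$2$1 = (B ** A)$2$1" by (simp_all only: c)
  then show "A$1$2 * B$2$1 = A$2$1 * B$1$2" "p * B$1$2 = A$1$2 * p'" "A$2$1 * p' = p * B$2$1"
   unfolding mat2_mult_entries p_def p'_def by (simp_all add: algebra_simps)
 qed
 have "dev A ~= 0" using dev_zero A by blast
 then have nz: "p ~= 0 \<or> A$1$2 ~= 0 \<or> A$2$1 ~= 0" by (auto simp: dev_def p_def)
 have "\<exists>t. p' = t * p \<and> B$1$2 = t * A$1$2 \<and> B$2$1 = t * A$2$1" using nz proof (elim disjE)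
  assume "p ~= 0" then show ?thesis using e by (intro exI[of _ "p' / p"]) (simp add: field_simps)
 next
  assume "A$1$2 ~= 0" then show ?thesis using e by (intro exI[of _ "B$1$2 / A$1$2"]) (simp add: field_simps)
 next
  assume "A$2$1 ~= 0" then show ?thesis using e by (intro exI[of _ "B$2$1 / A$2$1"]) (simp add: field_simps)
 qed
 then obtain t where t: "p' = t * p" "B$1$2 = t * A$1$2" "B$2$1 = t * A$2$1" by blast
 have "displ w B = t^2 * displ w A" if "0 < Im w" for w proof -
  have w: "w = Complex (Re w) (Im w)" by simp
  have f1: "p' - 2 * B$2$1 * Re w = t * (p - 2 * A$2$1 * Re w)"
   "B$1$2 + p' * Re w - B$2$1 * (Re w)^2 = t * (A$1$2 + p * Re w - A$2$1 * (Re w)^2)"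
   "B$2$1 * Im w = t * (A$2$1 * Im w)" by (simp_all add: t algebra_simps)
  show ?thesis
   apply (subst (1 2) w) unfolding displ_formula[OF A(1) that] displ_formula[OF B that] p_def[symmetric] p'_def[symmetric] f1
   by (simp only: power_mult_distrib power_divide distrib_left times_divide_eq_right)
 qed
 then show ?thesis by (intro exI[of _ "t^2"]) simp
qed

text \<open>If the lower left entry is nonzero, going up makes the term \<open>(A$2$1 * y)^2\<close>
  large. Otherwise going down above a real number not fixed by \<open>A\<close> makes the middle
  term of \<open>displ_formula\<close> large.\<close>

lemma displ_unbounded: assumes A: "A : SL2" "A ~= mat 1" "A ~= - mat 1" shows "\<exists>w. 0 < Im w \<and> E <= displ w A"
proof -
 \<comment> \<open>A target of at least 1 lies below its own square, so it is enough that the term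
   to be squared reaches it.\<close>
 let ?E = "abs E + 1"
 have sq: "?E <= r^2" if "?E <= r" for r :: real
  using mult_mono[of 1 ?E r r] that order_trans[of 1 ?E r] by (simp add: power2_eq_square) (smt (verit) mult_le_cancel_left1)
 define p where "p = A$1$1 - A$2$2"
 have "dev A ~= 0" using dev_zero A by blast
 then have nz: "p ~= 0 \<or> A$1$2 ~= 0 \<or> A$2$1 ~= 0" by (auto simp: dev_def p_def)
 show ?thesis proof (cases "A$2$1 = 0")
  case False
  define y where "y = ?E / abs (A$2$1)"
  have y: "0 < y" using False by (simp add: y_def add_nonneg_pos)
  have "?E <= (abs (A$2$1 * y))^2" using False by (intro sq) (simp add: y_def abs_mult)
  then have "E <= displ (Complex 0 y) A" using y unfolding displ_formula[OF A(1) y] power2_abs by (smt (verit) zero_le_power2 divide_nonneg_nonneg)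
  then show ?thesis using y by (intro exI[of _ "Complex 0 y"]) simp
 next
  case c: True
  obtain x where x: "A$1$2 + p * x ~= 0"
   using nz c by (metis add.right_neutral add_cancel_left_left mult_cancel_left1 mult_zero_right add_0 mult_1_right)
  define y where "y = abs (A$1$2 + p * x) / ?E"
  have y: "0 < y" using x by (simp add: y_def add_nonneg_pos)
  have "?E <= (abs ((A$1$2 + p * x) / y))^2" using x y by (intro sq) (simp add: y_def abs_mult)
  then have "E <= displ (Complex x y) A" using y unfolding displ_formula[OF A(1) y] power2_abs p_def c
   by (smt (verit) zero_le_power2 divide_nonneg_nonneg mult_zero_left)
  then show ?thesis using y by (intro exI[of _ "Complex x y"]) simp
 qed
qed

lemma displ_IVT: assumes A: "A : SL2" "A ~= mat 1" "A ~= - mat 1" and z: "0 < Im z" "displ z A <= E" shows "\<exists>w. 0 < Im w \<and> displ w A = E"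
proof -
 obtain v where v: "0 < Im v" "E <= displ v A" using displ_unbounded[OF A] by blast
 define x where "x = (%t. Re z + t * (Re v - Re z))"
 define y where "y = (%t. Im z + t * (Im v - Im z))"
 have pos: "0 < y t" if "0 <= t" "t <= 1" for t proof -
  have "y t = (1 - t) * Im z + t * Im v" by (simp add: y_def algebra_simps)
  then show ?thesis using that z v by (cases "t = 0") (auto intro!: add_nonneg_pos mult_nonneg_nonneg)
 qed
 have "continuous_on {0..1} (%t. (A$1$1 - A$2$2 - 2 * A$2$1 * x t)^2 / 2 +
   ((A$1$2 + (A$1$1 - A$2$2) * x t - A$2$1 * (x t)^2) / y t)^2 + (A$2$1 * y t)^2)"
  using pos unfolding x_def y_def by (intro continuous_intros) (auto simp: less_imp_neq[symmetric])
 then have "continuous_on {0..1} (%t. displ (Complex (x t) (y t)) A)" by (rule continuous_on_eq) (use pos displ_formula[OF A(1)] in auto)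
 moreover have "Complex (x 0) (y 0) = z" "Complex (x 1) (y 1) = v" by (simp_all add: x_def y_def)
 ultimately obtain t where "0 <= t" "t <= 1" "displ (Complex (x t) (y t)) A = E" using IVT'[of "%t. displ (Complex (x t) (y t)) A" 0 E 1] z v by auto
 then show ?thesis using pos[of t] by (intro exI[of _ "Complex (x t) (y t)"]) simp
qed

lemma norm_mat2_le:
 fixes A :: "real^2^2" shows "norm A <= abs (A$1$1) + abs (A$1$2) + abs (A$2$1) + abs (A$2$2)"
proof -
 have "norm A <= norm (A$1) + norm (A$2)" unfolding norm_vec_def[of A] using L2_set_le_sum[of UNIV "%i. norm (A$i)"] by (simp add: sum_2)
 moreover have "norm (A$1) <= abs (A$1$1) + abs (A$1$2)" "norm (A$2) <= abs (A$2$1) + abs (A$2$2)"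
  using norm_le_l1_cart[of "A$1"] norm_le_l1_cart[of "A$2"] by (simp_all add: sum_2)
 ultimately show ?thesis by simp
qed

lemma entry_le_norm: "abs ((A::real^2^2)$i$j) <= norm A"
 using component_le_norm_cart[of "A$i" j] Finite_Cartesian_Product.norm_nth_le[of A i] by linarith

lemma entry_le_frob: "abs (A$i$j) <= sqrt (frob A)"
proof -
 have "(A$i$j)^2 <= frob A" using exhaust_2[of i] exhaust_2[of j] by (auto simp: frob_def)
 then have "sqrt ((A$i$j)^2) <= sqrt (frob A)" by (rule real_sqrt_le_mono)
 then show ?thesis by simp
qed

lemma norm_le_frob: "norm (A::real^2^2) <= 4 * sqrt (frob A)"
 using norm_mat2_le[of A] entry_le_frob[of A 1 1] entry_le_frob[of A 1 2] entry_le_frob[of A 2 1]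
  entry_le_frob[of A 2 2] by linarith

lemma entry_hinv_mult_diff: assumes g: "g : SL2" "frob g <= m^2" "0 <= m" and d: "dist g h <= v"
 shows "abs ((hinv g ** h)$i$j - (mat 1 :: real^2^2)$i$j) <= 2 * m * v"
proof -
 have "(hinv g ** h)$i$j - (mat 1 :: real^2^2)$i$j = (hinv g ** h)$i$j - (hinv g ** g)$i$j" using g by simp
 also have "... = hinv g$i$1 * (h - g)$1$j + hinv g$i$2 * (h - g)$2$j" by (simp add: mat2_mult_entries algebra_simps)
 finally have e: "(hinv g ** h)$i$j - (mat 1 :: real^2^2)$i$j = hinv g$i$1 * (h - g)$1$j + hinv g$i$2 * (h - g)$2$j" .
 have sm: "sqrt (frob (hinv g)) <= m" using g by (simp add: real_le_lsqrt)
 have b: "abs (hinv g$i$k * (h - g)$k$j) <= m * v" for k unfolding abs_mult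
  using entry_le_frob[of "hinv g" i k] sm entry_le_norm[of "h - g" k j] d g(3) by (intro mult_mono) (auto simp: dist_norm norm_minus_commute)
 show ?thesis unfolding e using b[of 1] b[of 2] by linarith
qed

section \<open>Discreteness, the Zassenhaus argument and the thick part\<close>

definition triv :: "(real^2^2) set" where "triv = {mat 1, - mat 1}"

locale fuchsian_group =
 fixes G :: "(real^2^2) set" assumes fuchsian: "fuchsian G"
begin

lemma G_subgroup: "subgroup G SL2R" using fuchsian by (simp add: fuchsian_def)

lemma G_SL2 [simp]: "g : G ==> g : SL2" using subgroup.subset[OF G_subgroup] by (auto simp: SL2_def)

lemma G_mult [simp]: "g : G ==> h : G ==> g ** h : G" using subgroup.m_closed[OF G_subgroup, of g h] by simp

lemma G_inv [simp]: "g : G ==> hinv g : G" using subgroup.m_inv_closed[OF G_subgroup, of g] by simp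

lemma G_one [simp]: "mat 1 : G" using subgroup.one_closed[OF G_subgroup] by simp

lemma discrete_one: "\<exists>e>0. \<forall>g\<in>G. dist (mat 1) g < e --> g = mat 1"
 using fuchsian G_one unfolding fuchsian_def discrete_def by (metis isolated_in_dist_Ex_iff)

lemma finite_frob: "finite {g : G. frob g <= R}"
proof (rule ccontr)
 let ?S = "{g : G. frob g <= R}"
 assume inf: "infinite ?S"
 obtain e where e: "0 < e" "!!g. g : G ==> dist (mat 1) g < e ==> g = mat 1" using discrete_one by blast
 define m where "m = sqrt (abs R) + 1"
 have m: "0 < m" "abs R <= m^2" by (auto simp: m_def power2_sum intro: add_nonneg_pos)
 have "bounded ?S" proof (rule boundedI)
  fix g assume "g : ?S"
  then have "sqrt (frob g) <= sqrt (abs R)" by (intro real_sqrt_le_mono) auto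
  then show "norm g <= 4 * sqrt (abs R)" using norm_le_frob[of g] by linarith
 qed
 then obtain x where x: "x islimpt ?S" using bounded_infinite_imp_islimpt[OF subset_refl _ inf] by blast
 \<comment> \<open>Two elements in a ball of radius \<open>v\<close> are \<open>2 * v\<close> apart;
   each of the four entries of their quotient differs from the identity by at most
   \<open>4 * m * v\<close>, and \<open>16 * m * v < e\<close>.\<close>
 define v where "v = e / (20 * m)"
 have d: "0 < v" using e m by (simp add: v_def)
 have "infinite (?S \<inter> ball x v)" using x d by (simp add: islimpt_eq_infinite_ball)
 from infinite_imp_nonempty[OF this] obtain g where g: "g : ?S" "g : ball x v" by blast
 have "infinite (?S \<inter> ball x v - {g})" using \<open>infinite (?S \<inter> ball x v)\<close> by simp
 from infinite_imp_nonempty[OF this] obtain h where h: "h : ?S" "h : ball x v" "h ~= g" by blast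
 have "dist g h <= 2 * v" using g h dist_triangle_half_r[of x g "2 * v" h] by (simp add: dist_commute)
 then have b: "abs ((hinv g ** h)$i$j - (mat 1 :: real^2^2)$i$j) <= 2 * m * (2 * v)" for i j using g m by (intro entry_hinv_mult_diff) auto
 have "dist (mat 1) (hinv g ** h) <= 4 * (2 * m * (2 * v))" using norm_mat2_le[of "hinv g ** h - mat 1"] b[of 1 1] b[of 1 2] b[of 2 1] b[of 2 2]
  by (simp add: dist_norm norm_minus_commute)
 also have "... < e" using m e by (simp add: v_def)
 finally have "hinv g ** h = mat 1" using e g h by simp
 then have "g ** (hinv g ** h) = g" by simp
 then show False using h g by simp
qed

lemma countable_G: "countable G"
proof -
 have "G = (\<Union>n::nat. {g : G. frob g <= real n})" using real_arch_simple by blast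
 moreover have "countable (\<Union>n::nat. {g : G. frob g <= real n})" by (intro countable_UN countableI_type countable_finite finite_frob)
 ultimately show ?thesis by (simp only:)
qed

lemma finite_orbit: assumes z: "0 < Im z" "0 < Im w" shows "finite {g : G. dH z (act g w) <= R}"
proof (rule finite_subset)
 let ?R = "dH \<i> z + R + dH w \<i>"
 show "{g : G. dH z (act g w) <= R} \<subseteq> {g : G. frob g <= 2 * cosh ?R}" proof safe
  fix g assume g: "g : G" "dH z (act g w) <= R"
  have "dH \<i> (act g \<i>) <= dH \<i> z + dH z (act g w) + dH (act g w) (act g \<i>)"
   using dH_triangle[of \<i> z "act g \<i>"] dH_triangle[of z "act g w" "act g \<i>"] z g by simp
  also have "... <= ?R" using g z by simp
  finally have "cosh (dH \<i> (act g \<i>)) <= cosh ?R" using g by (subst cosh_real_nonneg_le_iff) (auto intro: order_trans[rotated])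
  then show "frob g <= 2 * cosh ?R" using g by (simp add: frob_dist)
 qed
qed (rule finite_frob)

text \<open>The thick part in the sense of Margulis, except that smallness is measured by
  \<open>displ\<close>. A half-turn does not move its fixed point but has trace 0, hence
  \<open>displ\<close> at least 2, so it does not make the point thin.\<close>

definition thick :: "real => complex => bool" where
 "thick e w \<longleftrightarrow> (\<forall>g\<in>G - triv. e <= displ w g)"

lemma displ_minimal: assumes z: "0 < Im z" and g: "g : G - triv" "displ z g < e"
 shows "\<exists>A\<in>G - triv. displ z A < e \<and> (\<forall>B\<in>G - triv. displ z A <= displ z B)"
proof -
 let ?S = "{g : G - triv. displ z g < e}"
 have "?S \<subseteq> {g : G. dH z (act g z) <= arcosh (1 + abs (e))}" proof safe
  fix h assume h: "h : G" "displ z h < e"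
  have "cosh (dH z (act h z)) <= 1 + abs (e)" using displ_dist[of h z] h z by auto
  then have "cosh (dH z (act h z)) <= cosh (arcosh (1 + abs (e)))" by (simp add: cosh_arcosh_real)
  then show "dH z (act h z) <= arcosh (1 + abs (e))" using h z by (subst (asm) cosh_real_nonneg_le_iff) auto
 qed
 then have fin: "finite ?S" using finite_orbit[OF z z] by (rule finite_subset)
 define A where "A = arg_min_on (displ z) ?S"
 have A: "A : ?S" using arg_min_if_finite(1)[OF fin] g by (auto simp: A_def)
 have "displ z A <= displ z B" if "B : G - triv" for B proof (cases "displ z B < e")
  case True
  then show ?thesis using that arg_min_least[OF fin, of B "displ z"] g by (auto simp: A_def)
 next
  case False then show ?thesis using A by auto
 qed
 then show ?thesis using A by blast
qed

text \<open>A form of the Zassenhaus lemma: the commutator of two elements of small deviation deviates even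
 less, so an element of minimal deviation commutes with all elements of small deviation.\<close>

lemma zassenhaus: assumes z: "0 < Im z" and A: "A : G - triv" "!!B. B : G - triv ==> displ z A <= displ z B"
  and B: "B : G" "displ z B < 1/160" and A1: "displ z A < 1/160" shows "A ** B = B ** A"
proof -
 have S: "A : SL2" "B : SL2" using A B by auto
 have pos: "0 < displ z A" using displ_pos[OF S(1) z] A by (auto simp: triv_def)
 let ?c = "A ** B ** (hinv A ** hinv B)"
 have "displ z ?c <= 160 * displ z A * displ z B" using A1 B z S by (intro displ_commutator) auto
 also have "... < displ z A" using pos B by simp
 finally have "?c : triv" using A(2)[of ?c] A(1) B(1) by (auto simp: not_less[symmetric])
 then have "?c = mat 1 \<or> ?c = - mat 1" by (auto simp: triv_def)
 moreover have e: "?c ** (B ** A) = A ** B" using S by (simp add: matrix_mul_assoc[symmetric])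
 \<comment> \<open>If \<open>A\<close> and \<open>B\<close> anticommute then \<open>A\<close> is
   conjugate to \<open>- A\<close>, so its trace is 0 and its \<open>displ\<close> is at least
   2.\<close>
 moreover have "?c ~= - mat 1" proof
  assume "?c = - mat 1"
  then have n: "A ** B = - (B ** A)" using e by (simp add: mat2_neg_mult)
  have "trace (A ** B ** hinv B) = trace (- (B ** A ** hinv B))" by (simp add: n mat2_neg_mult)
  then have "trace A = trace (- (B ** A ** hinv B))" using S by (simp add: matrix_mul_assoc[symmetric])
  also have "... = - trace (B ** A ** hinv B)" by (simp add: trace2)
  also have "... = - trace A" using S by (simp add: trace_conj)
  finally have "trace A = 0" by simp
  then have "displ z A \<ge> 2" using cosh_real_ge_1[of "dH z (act A z)"] by (simp add: displ_def)
  then show False using A1 by simp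
 qed
 ultimately show ?thesis by auto
qed

text \<open>Let \<open>A\<close> be minimal at \<open>z\<close> and move to a point \<open>w\<close>
  where \<open>A\<close> has displacement exactly \<open>e\<close>. If \<open>w\<close> were thin, a
  minimal element \<open>B\<close> there would commute with \<open>A\<close>; by proportionality
  \<open>B\<close> would then beat \<open>A\<close> at \<open>z\<close> as well.\<close>

lemma thin_to_thick: assumes z: "0 < Im z" and nt: "\<not> thick e z" and e: "e < 1/160"
 shows "\<exists>A\<in>G - triv. displ z A < e \<and> (\<exists>w. 0 < Im w \<and> displ w A = e \<and> thick e w)"
proof -
 obtain g where g: "g : G - triv" "displ z g < e" using nt by (auto simp: thick_def not_le)
 obtain A where A: "A : G - triv" "displ z A < e" "!!B. B : G - triv ==> displ z A <= displ z B" using displ_minimal[OF z g] by blast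
 have As: "A : SL2" "A ~= mat 1" "A ~= - mat 1" using A by (auto simp: triv_def)
 obtain w where w: "0 < Im w" "displ w A = e" using displ_IVT[OF As z, of e] A(2) by auto
 have "thick e w" proof (rule ccontr)
  assume "\<not> thick e w"
  then obtain h where "h : G - triv" "displ w h < e" by (auto simp: thick_def not_le)
  then obtain B where B: "B : G - triv" "displ w B < e" "!!C. C : G - triv ==> displ w B <= displ w C" using displ_minimal[OF w(1)] by blast
  have "B ** A = A ** B" using B A w e by (intro zassenhaus[OF w(1) B(1) B(3)]) simp_all
  then obtain s where s: "0 <= s" "!!v. 0 < Im v ==> displ v B = s * displ v A" using commute_parallel[OF As, of B] B by auto
  have "0 < displ z A" using displ_pos As z by blast
  have "0 < e" using \<open>0 < displ z A\<close> A by linarith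
  have "s * e < e" using s(2)[OF w(1)] w B by simp
  then have "s < 1" using \<open>0 < e\<close> by simp
  then have "displ z B < displ z A" using s(2)[OF z] \<open>0 < displ z A\<close> by simp
  then show False using A(3)[of B] B by simp
 qed
 then show ?thesis using A w by blast
qed

text \<open>After conjugation to \<open>\<i>\<close> all elements that move \<open>z\<close> by at
  most \<open>r\<close> lie in one compact set of matrices. Two of them in the same small ball would
  have a nearly scalar quotient, against thickness. The number of balls does not depend on
  \<open>z\<close>.\<close>

lemma thick_multiplicity: assumes "0 < e" shows "\<exists>K::nat. \<forall>z. 0 < Im z \<and> thick e z --> card {g : G. dH z (act g z) <= r} <= K"
proof -
 define m where "m = sqrt (2 * cosh r)"
 have m: "0 < m" "m^2 = 2 * cosh r" by (auto simp: m_def)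
 \<comment> \<open>The first bound makes \<open>2 * m * v\<close> at most 1, which excludes the
   quotient \<open>- mat 1\<close>. The second makes it at most \<open>sqrt e / 4\<close>, which
   gives the quotient a deviation of at most \<open>e / 4\<close>.\<close>
 define v where "v = min (1 / (2 * m)) (sqrt e / (8 * m))"
 have d: "0 < v" using m assms by (simp add: v_def)
 have "compact (cball 0 (4 * m) :: (real^2^2) set)" by simp
 then obtain k where k: "finite k" "cball 0 (4 * m) \<subseteq> (\<Union>x\<in>k. ball x (v / 2) :: (real^2^2) set)"
  using d unfolding compact_eq_totally_bounded by (meson half_gt_zero)
 show ?thesis proof (intro exI[of _ "card k"] allI impI)
  fix z assume z: "0 < Im z \<and> thick e z"
  let ?S = "{g : G. dH z (act g z) <= r}"
  obtain M where M: "M : SL2" "act M z = \<i>" using to_i z by blast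
  let ?c = "%g. M ** g ** hinv M"
  have fr: "frob (?c g) <= m^2" if "g : ?S" for g proof -
   have "dH \<i> (act (?c g) \<i>) = dH (act M z) (act M (act g z))" using M that z by (simp add: act_mult flip: M(2))
   also have "... = dH z (act g z)" using M that z by (intro dH_act) auto
   finally have "frob (?c g) = 2 * cosh (dH z (act g z))" using M that by (simp add: frob_dist)
   also have "... <= 2 * cosh r" using that z by (simp, subst cosh_real_nonneg_le_iff) (auto intro: order_trans[rotated])
   finally show ?thesis using m by simp
  qed
  have "\<exists>x\<in>k. ?c g : ball x (v / 2)" if "g : ?S" for g proof -
   have "sqrt (frob (?c g)) <= m" using fr[OF that] m by (simp add: real_le_lsqrt)
   then have "?c g : cball 0 (4 * m)" using norm_le_frob[of "?c g"] by simp
   then show ?thesis using k by blast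
  qed
  then have "\<forall>g\<in>?S. \<exists>x. x : k \<and> ?c g : ball x (v / 2)" by blast
  from bchoice[OF this] obtain f where f: "!!g. g : ?S ==> f g : k \<and> ?c g : ball (f g) (v / 2)" by blast
  have "inj_on f ?S" proof (rule inj_onI, rule ccontr)
   fix g h assume gh: "g : ?S" "h : ?S" "f g = f h" "g ~= h"
   have S: "g : SL2" "h : SL2" using gh by auto
   have "dist (?c g) (?c h) <= v" using f[OF gh(1)] f[OF gh(2)] gh(3) dist_triangle_half_r[of "f g" "?c g" v "?c h"] by (simp add: dist_commute)
   then have b: "abs ((hinv (?c g) ** ?c h)$i$j - (mat 1 :: real^2^2)$i$j) <= 2 * m * v" for i j
    using fr[OF gh(1)] M S m by (intro entry_hinv_mult_diff) auto
   let ?k = "hinv g ** h"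
   have kc: "hinv (?c g) ** ?c h = ?c ?k" using M S by (simp add: hinv_mult matrix_mul_assoc[symmetric])
   have md: "2 * m * v <= 1" "2 * m * v <= sqrt e / 4" using m by (simp_all add: v_def min_def field_simps)
   have "?k ~= mat 1" proof
    assume "?k = mat 1"
    then have "g ** (hinv g ** h) = g" by simp
    then show False using S gh by simp
   qed
   moreover have "?k ~= - mat 1" proof
    assume "?k = - mat 1"
    then have "?c ?k = - mat 1" using M by (simp add: mat2_neg_mult)
    then show False using b[of 1 1] md unfolding kc by simp
   qed
   ultimately have "e <= displ z ?k" using z gh by (auto simp: thick_def triv_def)
   also have "displ z ?k = dev (?c ?k)" using displ_conj_i[OF M(1) _ _ M(2)] S z by simp
   also have "... < e" proof -
    define c where "c = ?c ?k"
    have c: "abs (c$1$1 - 1) <= sqrt e / 4" "abs (c$2$2 - 1) <= sqrt e / 4" "abs (c$1$2) <= sqrt e / 4" "abs (c$2$1) <= sqrt e / 4"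
     using b[of 1 1] b[of 2 2] b[of 1 2] b[of 2 1] md unfolding kc c_def by simp_all
    have "abs (c$1$1 - c$2$2) <= sqrt e / 2" using c(1,2) by linarith
    then have "(c$1$1 - c$2$2)^2 <= (sqrt e / 2)^2" using abs_le_square_iff[of "c$1$1 - c$2$2" "sqrt e / 2"] assms by simp
    moreover have "(c$1$2)^2 <= (sqrt e / 4)^2" using abs_le_square_iff[of "c$1$2" "sqrt e / 4"] c assms by simp
    moreover have "(c$2$1)^2 <= (sqrt e / 4)^2" using abs_le_square_iff[of "c$2$1" "sqrt e / 4"] c assms by simp
    ultimately have "dev c <= e / 8 + e / 16 + e / 16" using assms by (simp add: dev_def power_divide)
    then show ?thesis using assms by (simp add: c_def)
   qed
   finally show False by simp
  qed
  then show "card ?S <= card k" using f k by (intro card_inj_on_le[of f]) auto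
 qed
qed

end

section \<open>Finite area keeps the thick part near the orbit\<close>

lemma sets_hyp_area [measurable_cong, simp]: "sets hyp_area = sets borel" by (simp add: hyp_area_def)

text \<open>The square has Euclidean area \<open>(Im z)^2 / 4\<close> and density at least
  \<open>16 / (25 * (Im z)^2)\<close>. By \<open>dH_box\<close> it lies in the unit ball about
  \<open>z\<close>, which it replaces because its area is immediate.\<close>

lemma hyp_area_box: assumes "0 < Im z"
 shows "ennreal (4/25) <= emeasure hyp_area (box (Complex (Re z - Im z / 4) (Im z * 3 / 4)) (Complex (Re z + Im z / 4) (Im z * 5 / 4)))"
  (is "_ <= emeasure _ ?U")
proof -
 have uh: "upper_half_plane : sets borel" unfolding upper_half_plane_def by (simp add: borel_open open_halfspace_Im_gt)
 have "emeasure lborel ?U = ennreal ((Im z / 2) * (Im z / 2))" using assms by (subst emeasure_lborel_box) (auto simp: Basis_complex_def)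
 then have "ennreal (4/25) = ennreal (16 / (25 * (Im z)^2)) * emeasure lborel ?U" using assms by (simp add: power2_eq_square flip: ennreal_mult)
 also have "... = (\<integral>\<^sup>+w. ennreal (16 / (25 * (Im z)^2)) * indicator ?U w \<partial>lborel)"
  by (subst nn_integral_cmult_indicator) auto
 also have "... <= (\<integral>\<^sup>+w. indicator upper_half_plane w * ennreal (1 / (Im w)^2) * indicator ?U w \<partial>lborel)"
 proof (rule nn_integral_mono)
  fix w
  show "ennreal (16 / (25 * (Im z)^2)) * indicator ?U w
    <= indicator upper_half_plane w * ennreal (1 / (Im w)^2) * indicator ?U w" proof (cases "w : ?U")
   case True
   then have w: "Im z * 3 / 4 < Im w" "Im w < Im z * 5 / 4" by (auto simp: box_def Basis_complex_def)
   have p: "0 < Im w" using w assms by linarith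
   have "(Im w)^2 <= (Im z * 5 / 4)^2" using w p by (intro power_mono) auto
   then have "16 / (25 * (Im z)^2) <= 1 / (Im w)^2" using assms p by (simp add: field_simps power2_eq_square)
   then show ?thesis using True p by (simp add: ennreal_leI)
  qed simp
 qed
 also have "... = emeasure hyp_area ?U" unfolding hyp_area_def using uh by (subst emeasure_density) auto
 finally show ?thesis .
qed

lemma cosh_1_ge: "(5/4::real) <= cosh 1"
proof -
 have "5/2 <= exp (1::real)" using exp_lower_Taylor_quadratic[of "1::real"] by simp
 moreover have "0 < exp (-1::real)" by simp
 ultimately have "5/2 <= exp 1 + exp (- 1 :: real)" by linarith
 then show ?thesis unfolding cosh_field_def by simp
qed

lemma dH_box: assumes "0 < Im z" and "w : box (Complex (Re z - Im z / 4) (Im z * 3 / 4)) (Complex (Re z + Im z / 4) (Im z * 5 / 4))"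
 shows "0 < Im w" "dH z w < 1"
proof -
 have w: "Im z * 3 / 4 < Im w" "Im w < Im z * 5 / 4" "Re z - Im z / 4 < Re w" "Re w < Re z + Im z / 4"
  using assms by (auto simp: box_def Basis_complex_def)
 then have w': "abs (Re z - Re w) <= Im z / 4" "abs (Im z - Im w) <= Im z / 4" by linarith+
 show p: "0 < Im w" using w assms by linarith
 have "(Re z - Re w)^2 <= (Im z / 4)^2" using w' assms abs_le_square_iff[of "Re z - Re w" "Im z / 4"] by simp
 moreover have "(Im z - Im w)^2 <= (Im z / 4)^2" using w' assms abs_le_square_iff[of "Im z - Im w" "Im z / 4"] by simp
 ultimately have n: "(cmod (z - w))^2 <= (Im z)^2 / 8" unfolding cmod_power2 by (simp add: power_divide)
 have "(Im z)^2 / 8 / (2 * Im z * Im w) <= 1 / 12" proof -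
  have "(Im z)^2 * 12 <= 8 * (2 * Im z * Im w)" using w(1) assms(1) mult_left_mono[of "Im z * 3" "Im w * 4" "Im z"] by (simp add: power2_eq_square)
  then show ?thesis using assms p by (simp add: field_simps)
 qed
 moreover have "(cmod (z - w))^2 / (2 * Im z * Im w) <= (Im z)^2 / 8 / (2 * Im z * Im w)" using n assms p by (intro divide_right_mono) auto
 ultimately have "cosh (dH z w) <= 1 + 1/12" unfolding cosh_hyp_dist[OF assms(1) p] by linarith
 also have "(1 + 1/12 :: real) < cosh 1" using cosh_1_ge by linarith
 finally show "dH z w < 1" using assms p by (metis cosh_real_nonneg_less_iff dH_nonneg zero_le_one)
qed

context fuchsian_group
begin

text \<open>Unfolding: the translates of \<open>F\<close> cover \<open>U\<close>. Moving each piece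
  back into \<open>F\<close> preserves its area, and a point of \<open>F\<close> is then hit at most
  \<open>K\<close> times.\<close>

lemma area_multiplicity: assumes F: "orbit_representatives G F" and U: "U : sets borel" "U \<subseteq> upper_half_plane"
  and K: "!!x. 0 < Im x ==> finite {h : G. act h x : U} \<and> card {h : G. act h x : U} <= K"
 shows "emeasure hyp_area U <= of_nat K * emeasure hyp_area F"
proof -
 have F': "F : sets borel" "F \<subseteq> upper_half_plane" using F by (auto simp: orbit_representatives_def)
 have [measurable]: "F : sets borel" "U : sets borel" by fact+
 have im [measurable]: "act h ` F : sets borel" if "h : G" for h using that F' by (intro act_image_borel) auto
 define V where "V = (%h. {x : F. act h x : U})"
 have Vim: "V h = act (hinv h) ` (U \<inter> act h ` F)" if "h : G" for h using that F' U by (force simp: V_def image_iff subset_iff)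
 have Vb [measurable]: "V h : sets borel" if "h : G" for h unfolding Vim[OF that] using that U im by (intro act_image_borel) auto
 have "emeasure hyp_area U = (\<integral>\<^sup>+z. indicator U z \<partial>hyp_area)" by simp
 also have "... <= (\<integral>\<^sup>+z. (\<integral>\<^sup>+h. indicator (U \<inter> act h ` F) z \<partial>count_space G) \<partial>hyp_area)"
 proof (rule nn_integral_mono)
  fix z
  show "indicator U z <= (\<integral>\<^sup>+h. indicator (U \<inter> act h ` F) z \<partial>count_space G)" proof (cases "z : U")
   case True
   then have z: "0 < Im z" using U by auto
   obtain w where w: "w : F" "w : orbit G z" using F z unfolding orbit_representatives_def by (metis upper_half_plane_iff)
   then obtain g where g: "g : G" "w = act g z" by (auto simp: orbit_def)
   then have "z : act (hinv g) ` F" using w z by (intro image_eqI[of _ _ w]) auto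
   then have "indicator U z <= (indicator (U \<inter> act (hinv g) ` F) z :: ennreal)" using True by simp
   also have "... <= (\<integral>\<^sup>+h. indicator (U \<inter> act h ` F) z \<partial>count_space G)"
    using g by (intro nn_integral_ge_point[where p="%h. indicator (U \<inter> act h ` F) z"]) auto
   finally show ?thesis .
  qed simp
 qed
 also have "... = (\<integral>\<^sup>+h. (\<integral>\<^sup>+z. indicator (U \<inter> act h ` F) z \<partial>hyp_area) \<partial>count_space G)"
  by (rule nn_integral_count_space_nn_integral[OF countable_G]) auto
 also have "... = (\<integral>\<^sup>+h. (\<integral>\<^sup>+z. indicator (V h) z \<partial>hyp_area) \<partial>count_space G)"
 proof (rule nn_integral_cong)
  fix h assume "h : space (count_space G)"
  then have h: "h : G" by simp
  have "emeasure hyp_area (V h) = emeasure hyp_area (U \<inter> act h ` F)" unfolding Vim[OF h] using h U im by (intro hyp_area_act) auto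
  then show "(\<integral>\<^sup>+z. indicator (U \<inter> act h ` F) z \<partial>hyp_area) = (\<integral>\<^sup>+z. indicator (V h) z \<partial>hyp_area)"
   using h by simp
 qed
 also have "... = (\<integral>\<^sup>+z. (\<integral>\<^sup>+h. indicator (V h) z \<partial>count_space G) \<partial>hyp_area)"
  by (rule nn_integral_count_space_nn_integral[OF countable_G, symmetric]) auto
 also have "... <= (\<integral>\<^sup>+z. of_nat K * indicator F z \<partial>hyp_area)" proof (rule nn_integral_mono)
  fix z
  show "(\<integral>\<^sup>+h. indicator (V h) z \<partial>count_space G) <= of_nat K * indicator F z" proof (cases "z : F")
   case True
   then have z: "0 < Im z" using F' by auto
   have "(\<integral>\<^sup>+h. indicator (V h) z \<partial>count_space G) = (\<integral>\<^sup>+h. indicator {h : G. act h z : U} h \<partial>count_space G)"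
    using True by (intro nn_integral_cong) (auto simp: V_def indicator_def)
   also have "... = of_nat (card {h : G. act h z : U})" using K[OF z] by (subst nn_integral_indicator) (auto simp: emeasure_count_space)
   also have "... <= of_nat K" using K[OF z] by simp
   finally show ?thesis using True by simp
  next
   case False
   then have "(\<integral>\<^sup>+h. indicator (V h) z \<partial>count_space G) = (\<integral>\<^sup>+h. 0 \<partial>count_space G)"
    by (intro nn_integral_cong) (auto simp: V_def)
   then show ?thesis by simp
  qed
 qed
 also have "... = of_nat K * emeasure hyp_area F" by (subst nn_integral_cmult_indicator) auto
 finally show ?thesis .
qed

text \<open>Otherwise there are arbitrarily many thick points whose orbits are mutually at distance
  at least 2. Their squares have disjoint images in the quotient, each covered at most
  \<open>K\<close> times, so the area of the quotient would exceed every bound.\<close>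

lemma thick_near_orbit: assumes fa: "finite_area_quotient G" and x0: "0 < Im x0" and e: "0 < e"
 shows "\<exists>R. \<forall>z. 0 < Im z \<and> thick e z --> (\<exists>g\<in>G. dH z (act g x0) <= R)"
proof (rule ccontr)
 assume "\<not> ?thesis"
 then have far: "\<exists>z. 0 < Im z \<and> thick e z \<and> (\<forall>g\<in>G. R < dH z (act g x0))" for R by (force simp: not_le)
 have seq: "\<exists>f::nat => complex. (\<forall>i<n. 0 < Im (f i) \<and> thick e (f i)) \<and>
   (\<forall>i<n. \<forall>j<i. \<forall>g\<in>G. 2 <= dH (f i) (act g (f j)))" for n proof (induction n)
  case (Suc n)
  then obtain f where f: "!!i. i < n ==> 0 < Im (f i) \<and> thick e (f i)"
   "!!i j g. i < n ==> j < i ==> g : G ==> 2 <= dH (f i) (act g (f j))" by blast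
  define R where "R = 2 + (\<Sum>j<n. dH x0 (f j))"
  obtain z where z: "0 < Im z" "thick e z" "!!g. g : G ==> R < dH z (act g x0)" using far[of R] by blast
  have new: "2 <= dH z (act g (f j))" if "j < n" "g : G" for j g proof -
   have "dH x0 (f j) <= (\<Sum>j<n. dH x0 (f j))" using that f x0 by (intro member_le_sum) auto
   moreover have "dH z (act g x0) <= dH z (act g (f j)) + dH (act g (f j)) (act g x0)" using that f x0 z by (intro dH_triangle) auto
   moreover have "dH (act g (f j)) (act g x0) = dH x0 (f j)" using that f x0 by (subst dH_act) (auto simp: dH_commute)
   ultimately show ?thesis using z(3)[OF that(2)] by (simp add: R_def)
  qed
  show ?case using f z new by (intro exI[of _ "f(n := z)"]) (auto simp: less_Suc_eq)
 qed simp
 obtain F where F: "orbit_representatives G F" "emeasure hyp_area F < \<infinity>" using fa by (auto simp: finite_area_quotient_def)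
 obtain K :: nat where K: "!!z. 0 < Im z ==> thick e z ==> card {g : G. dH z (act g z) <= 2} <= K" using thick_multiplicity[OF e, of 2] by blast
 have bound: "of_nat n * ennreal (4/25) <= of_nat K * emeasure hyp_area F" for n proof -
  obtain f where f: "!!i. i < n ==> 0 < Im (f i) \<and> thick e (f i)"
   "!!i j g. i < n ==> j < i ==> g : G ==> 2 <= dH (f i) (act g (f j))" using seq[of n] by blast
  define b where "b = (%z. box (Complex (Re z - Im z / 4) (Im z * 3 / 4)) (Complex (Re z + Im z / 4) (Im z * 5 / 4)))"
  have bd: "0 < Im w" "dH (f i) w < 1" if "i < n" "w : b (f i)" for i w using dH_box[of "f i" w] f that by (auto simp: b_def)
  have close: "dH (f i) (act (h ** hinv h') (f j)) < 2"
   if "i < n" "j < n" "h : G" "h' : G" "0 < Im x" "act h x : b (f i)" "act h' x : b (f j)" for i j h h' x proof -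
   let ?k = "h ** hinv h'"
   have "act ?k (act h' x) = act h x" using that by (simp add: act_mult)
   then have "dH (act h x) (act ?k (f j)) = dH (act h' x) (f j)" using that f by (metis G_SL2 G_inv G_mult Im_act_pos dH_act)
   then have "dH (act h x) (act ?k (f j)) < 1" using bd(2)[OF that(2,7)] by (simp add: dH_commute)
   moreover have "dH (f i) (act h x) < 1" using bd that by auto
   moreover have "dH (f i) (act ?k (f j)) <= dH (f i) (act h x) + dH (act h x) (act ?k (f j))" using that f by (intro dH_triangle) auto
   ultimately show ?thesis by linarith
  qed
  have same: "i = j"
   if "i < n" "j < n" "h : G" "h' : G" "0 < Im x" "act h x : b (f i)" "act h' x : b (f j)" for i j h h' x proof (rule ccontr)
   assume "i ~= j"
   then consider "j < i" | "i < j" by linarith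
   then show False proof cases
    case 1 then show False using f(2)[of i j "h ** hinv h'"] close[OF that] that by simp
   next
    case 2 then show False using f(2)[of j i "h' ** hinv h"] close[OF that(2,1,4,3,5,7,6)] that by simp
   qed
  qed
  define U where "U = (\<Union>i<n. b (f i))"
  have "(\<Sum>i<n. ennreal (4/25)) <= (\<Sum>i<n. emeasure hyp_area (b (f i)))" using f hyp_area_box by (intro sum_mono) (auto simp: b_def)
  also have "... = emeasure hyp_area U" unfolding U_def proof (rule sum_emeasure)
   show "disjoint_family_on (%i. b (f i)) {..<n}" unfolding disjoint_family_on_def using same[of _ _ "mat 1" "mat 1"] bd by fastforce
  qed (auto simp: b_def)
  also have "... <= of_nat K * emeasure hyp_area F" proof (rule area_multiplicity[OF F(1)])
   show "U : sets borel" by (simp add: U_def b_def)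
   show "U \<subseteq> upper_half_plane" using bd by (auto simp: U_def)
   fix x :: complex assume x: "0 < Im x"
   show "finite {h : G. act h x : U} \<and> card {h : G. act h x : U} <= K" proof (cases "{h : G. act h x : U} = {}")
    case True
    show ?thesis unfolding True by simp
   next
    case False
    then obtain h0 i where h0: "h0 : G" "i < n" "act h0 x : b (f i)" by (auto simp: U_def)
    let ?T = "{k : G. dH (f i) (act k (f i)) <= 2}"
    have sub: "(%h. h ** hinv h0) ` {h : G. act h x : U} \<subseteq> ?T" proof safe
     fix h assume h: "h : G" "act h x : U"
     then obtain j where j: "j < n" "act h x : b (f j)" by (auto simp: U_def)
     have "j = i" using same[OF j(1) h0(2) h(1) h0(1) x j(2) h0(3)] .
     then show "dH (f i) (act (h ** hinv h0) (f i)) <= 2" using close[OF h0(2) h0(2) h(1) h0(1) x _ h0(3)] j by simp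
     show "h ** hinv h0 : G" using h h0 by simp
    qed
    have inj: "inj_on (%h. h ** hinv h0) {h : G. act h x : U}" proof (rule inj_on_inverseI)
     fix h :: "real^2^2" show "h ** hinv h0 ** h0 = h" using h0 by (simp add: matrix_mul_assoc[symmetric])
    qed
    have fin: "finite ?T" using f h0 by (intro finite_orbit) auto
    show ?thesis using card_inj_on_le[OF inj sub fin] K[of "f i"] f h0 inj_on_finite[OF inj sub fin] by simp
   qed
  qed
  finally show ?thesis by (simp add: mult.commute)
 qed
 obtain a where a: "emeasure hyp_area F = ennreal a" "0 <= a" using F(2) by (cases "emeasure hyp_area F") auto
 obtain n :: nat where n: "real K * a < real n * (4/25)" using reals_Archimedean2[of "real K * a / (4/25)"] by (auto simp: field_simps)
 have "ennreal (real n * (4/25)) <= ennreal (real K * a)"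
  using bound[of n] a by (subst (1 2) ennreal_mult) (simp_all add: ennreal_of_nat_eq_real_of_nat)
 then show False using n a by (subst (asm) ennreal_le_iff) auto
qed

text \<open>The element found at a thin point is conjugated so that its thick companion
  \<open>w\<close> comes within \<open>R\<close> of \<open>x0\<close>. It moves \<open>w\<close> by
  at most 1, hence \<open>x0\<close> by at most \<open>2 * R + 1\<close>, and discreteness leaves
  finitely many such elements. The value 1/200 lies below the 1/160 of the Zassenhaus
  argument.\<close>

lemma thin_cases: assumes fa: "finite_area_quotient G" and x0: "0 < Im x0"
 shows "\<exists>R T. finite T \<and> T \<subseteq> G - triv \<and> (\<forall>z. 0 < Im z -->
   (\<exists>g\<in>G. dH z (act g x0) <= R) \<or> (\<exists>g\<in>G. \<exists>A\<in>T. displ (act g z) A < 1))"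
proof -
 obtain R where R: "!!z. 0 < Im z ==> thick (1/200) z ==> \<exists>g\<in>G. dH z (act g x0) <= R" using thick_near_orbit[OF fa x0, of "1/200"] by auto
 define T where "T = {A : G - triv. dH x0 (act A x0) <= 2 * R + 1}"
 have "finite T" by (rule finite_subset[OF _ finite_orbit[OF x0 x0, of "2 * R + 1"]]) (auto simp: T_def)
 moreover have "(\<exists>g\<in>G. dH z (act g x0) <= R) \<or> (\<exists>g\<in>G. \<exists>A\<in>T. displ (act g z) A < 1)" if z: "0 < Im z" for z
 proof (cases "thick (1/200) z")
  case True then show ?thesis using R z by blast
 next
  case False
  then obtain A w where A: "A : G - triv" "displ z A < 1/200" and w: "0 < Im w" "displ w A = 1/200" "thick (1/200) w"
   using thin_to_thick[OF z False] by auto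
  obtain g where g: "g : G" "dH w (act g x0) <= R" using R w by blast
  define k where "k = hinv g"
  define A' where "A' = k ** A ** hinv k"
  have k: "k : G" "A : G" using g A by (auto simp: k_def)
  have kw: "dH (act k w) x0 <= R" using g w x0 by (simp add: k_def dH_act_left)
  have d: "displ (act k z) A' = displ z A" "displ (act k w) A' = displ w A" unfolding A'_def using k z w by (auto intro!: displ_conj)
  have A'G: "A' : G" using k by (simp add: A'_def)
  have "A' \<notin> triv" using conj_scalar[of k A] k A by (auto simp: A'_def triv_def)
  have "cosh (dH (act k w) (act A' (act k w))) <= 1 + 1/200" using displ_dist[of A' "act k w"] d w k A'G by simp
  also have "(1 + 1/200 :: real) <= cosh 1" using cosh_1_ge by linarith
  finally have "dH (act k w) (act A' (act k w)) <= 1" using k w A'G by (subst (asm) cosh_real_nonneg_le_iff) auto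
  moreover have "dH x0 (act A' x0) <= dH x0 (act k w) + dH (act k w) (act A' x0)" using k w x0 A'G by (intro dH_triangle) auto
  moreover have "dH (act k w) (act A' x0) <= dH (act k w) (act A' (act k w)) + dH (act A' (act k w)) (act A' x0)"
   using k w x0 A'G by (intro dH_triangle) auto
  ultimately have "dH x0 (act A' x0) <= 2 * R + 1" using kw k w x0 A'G by (simp add: dH_commute)
  then have "A' : T" using A'G \<open>A' \<notin> triv\<close> by (simp add: T_def)
  then show ?thesis using k d A by (intro disjI2 bexI[of _ k] bexI[of _ A']) auto
 qed
 ultimately show ?thesis by (intro exI[of _ R] exI[of _ T]) (auto simp: T_def)
qed

end

section \<open>Regions of small displacement for elliptic and hyperbolic elements\<close>

lemma rect_dist: assumes y1: "0 < y1" and w: "0 < Im w" shows "\<exists>R. \<forall>z. abs (Re z) <= X --> y1 <= Im z --> Im z <= y2 --> dH z w <= R"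
proof -
 define D where "D = (abs X + abs (Re w) + (abs y2 + Im w))^2 / (2 * y1 * Im w)"
 have "dH z w <= arcosh (1 + D)" if z: "abs (Re z) <= X" "y1 <= Im z" "Im z <= y2" for z proof -
  have p: "0 < Im z" using z y1 by linarith
  have "cmod (z - w) <= abs (Re z - Re w) + abs (Im z - Im w)" using cmod_le[of "z - w"] by simp
  also have "... <= abs X + abs (Re w) + (abs y2 + Im w)" using z p w by linarith
  finally have "(cmod (z - w))^2 <= (abs X + abs (Re w) + (abs y2 + Im w))^2" by (intro power_mono) auto
  then have "(cmod (z - w))^2 / (2 * Im z * Im w) <= D" unfolding D_def using z y1 w by (intro frac_le) auto
  then have "cosh (dH z w) <= cosh (arcosh (1 + D))" using p w y1 by (simp add: cosh_hyp_dist cosh_arcosh_real D_def)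
  moreover have "0 <= arcosh (1 + D)" using y1 w by (simp add: D_def)
  ultimately show ?thesis using p w by (simp add: cosh_real_nonneg_le_iff)
 qed
 then show ?thesis by blast
qed

text \<open>For an elliptic element each of the three squares in \<open>displ_formula\<close>
  confines one coordinate: the first bounds \<open>x\<close>, the last bounds \<open>y\<close> from
  above, and the middle one, through the negative discriminant, bounds \<open>y\<close> from
  below.\<close>

lemma elliptic_near: assumes A: "A : SL2" "abs (trace A) < 2" and w: "0 < Im w"
 shows "\<exists>R. \<forall>z. 0 < Im z --> displ z A < 1 --> dH z w <= R"
proof -
 define p where "p = A$1$1 - A$2$2"
 define b where "b = A$1$2"
 define c where "c = A$2$1"
 define v where "v = - (p^2 + 4 * b * c) / 4"
 have "(trace A)^2 < 4" using A(2) abs_square_less_1[of "trace A / 2"] by (simp add: power_divide)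
 moreover have "(trace A)^2 - 4 = p^2 + 4 * b * c" using A(1) unfolding SL2_iff trace2 p_def b_def c_def by (simp add: power2_eq_square algebra_simps)
 ultimately have d: "0 < v" by (simp add: v_def)
 have c0: "c ~= 0" using d by (auto simp: v_def not_less)
 obtain R where R: "!!z. abs (Re z) <= (abs p + 2) / (2 * abs c) ==> v / abs c <= Im z ==> Im z <= 1 / abs c ==> dH z w <= R"
  using rect_dist[of "v / abs c" w "(abs p + 2) / (2 * abs c)" "1 / abs c"] d c0 w by auto
 have "dH z w <= R" if z: "0 < Im z" "displ z A < 1" for z proof -
  define x where "x = Re z"
  define y where "y = Im z"
  have zc: "z = Complex x y" by (simp add: x_def y_def)
  have y: "0 < y" using z by (simp add: y_def)
  have f: "(p - 2 * c * x)^2 / 2 + ((b + p * x - c * x^2) / y)^2 + (c * y)^2 < 1"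
   using z(2) displ_formula[OF A(1) y, of x] by (simp add: zc p_def b_def c_def)
  have f1: "(p - 2 * c * x)^2 < 4" and f2: "((b + p * x - c * x^2) / y)^2 < 1" and f3: "(c * y)^2 < 1"
   using f zero_le_power2[of "p - 2 * c * x"] zero_le_power2[of "(b + p * x - c * x^2) / y"] zero_le_power2[of "c * y"] by linarith+
  have "abs (p - 2 * c * x) < 2" using f1 abs_le_square_iff[of 2 "p - 2 * c * x"] by simp
  then have "abs (2 * c * x) <= abs p + 2" by linarith
  then have 1: "abs x <= (abs p + 2) / (2 * abs c)" using c0 by (simp add: abs_mult field_simps)
  have "abs (c * y) < 1" using f3 by (simp add: abs_square_less_1)
  then have 2: "y <= 1 / abs c" using c0 y by (simp add: abs_mult field_simps)
  have "abs ((b + p * x - c * x^2) / y) < 1" using f2 by (simp add: abs_square_less_1)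
  then have q: "abs (b + p * x - c * x^2) < y" using y by (simp add: field_simps)
  \<comment> \<open>Completing the square: the quadratic has no real zero, and \<open>v\<close>
    measures how far it stays from 0.\<close>
  have "c * (b + p * x - c * x^2) = - v - (c * x - p / 2)^2" by (simp add: v_def power2_eq_square field_simps)
  then have "v <= abs (c * (b + p * x - c * x^2))" using zero_le_power2[of "c * x - p / 2"] by linarith
  also have "... <= abs c * y" using q unfolding abs_mult by (intro mult_left_mono) auto
  finally have 3: "v / abs c <= y" using c0 by (simp add: field_simps)
  show ?thesis using R[of z] 1 2 3 by (simp add: x_def y_def)
 qed
 then show ?thesis by blast
qed

lemma hyperbolic_diag: assumes A: "A : SL2" "2 < abs (trace A)"
 shows "\<exists>N l m. N : SL2 \<and> N ** A ** hinv N = mat2 l 0 0 m \<and> l * m = 1 \<and> l ~= m"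
proof -
 have "\<exists>N l m. N : SL2 \<and> N ** A = mat2 l 0 0 m ** N" proof (cases "A$2$1 = 0")
  case True
  have "A$1$1 ~= A$2$2" proof
   assume "A$1$1 = A$2$2"
   then have "(trace A)^2 = 4" using A(1) True by (simp add: SL2_iff trace2 power2_eq_square)
   then have "abs (trace A) = 2" using real_sqrt_abs[of "trace A"] by simp
   then show False using A by simp
  qed
  then show ?thesis using True by (intro exI[of _ "mat2 1 (A$1$2 / (A$1$1 - A$2$2)) 0 1"] exI[of _ "A$1$1"] exI[of _ "A$2$2"])
    (auto intro!: mat2_eqI simp: mat2_mult_entries field_simps)
 next
  case c: False
  define s where "s = sqrt ((trace A)^2 - 4)"
  have "4 < (trace A)^2" using A(2) abs_le_square_iff[of "trace A" 2] by simp
  then have s: "0 < s" "s * s = (trace A)^2 - 4" by (auto simp: s_def)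
  \<comment> \<open>\<open>r1\<close> and \<open>r2\<close> are the two real fixed points of the
    Moebius action. The matrix \<open>?N\<close> below sends them to 0 and infinity; its rows are
    left eigenvectors.\<close>
  define r1 where "r1 = (A$1$1 - A$2$2 + s) / (2 * A$2$1)"
  define r2 where "r2 = (A$1$1 - A$2$2 - s) / (2 * A$2$1)"
  have tr: "(trace A)^2 - 4 = (A$1$1 - A$2$2)^2 + 4 * A$1$2 * A$2$1" using A(1) unfolding SL2_iff trace2 by (simp add: power2_eq_square algebra_simps)
  have e: "A$1$2 - r * A$2$2 = - r * (A$1$1 - r * A$2$1)" if "r = r1 \<or> r = r2" for r proof -
   have "(2 * A$2$1 * r - (A$1$1 - A$2$2))^2 = s * s" using that c by (auto simp: r1_def r2_def power2_eq_square)
   then have "4 * A$2$1 * (A$2$1 * r^2 - (A$1$1 - A$2$2) * r - A$1$2) = 0" unfolding s tr by (simp add: power2_eq_square algebra_simps)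
   then have "A$2$1 * r^2 - (A$1$1 - A$2$2) * r - A$1$2 = 0" using c by simp
   then show ?thesis by (simp add: power2_eq_square algebra_simps)
  qed
  define k where "k = r1 - r2"
  have k: "k ~= 0" using s c by (simp add: k_def r1_def r2_def field_simps)
  let ?N = "mat2 (1 / k) (- r1 / k) 1 (- r2)"
  have "(r1 - r2) / k = 1" using k by (simp add: k_def)
  then have "?N : SL2" by (simp add: diff_divide_distrib)
  moreover have "?N ** A = mat2 (A$1$1 - r1 * A$2$1) 0 0 (A$1$1 - r2 * A$2$1) ** ?N"
   using e[of r1] e[of r2] k arg_cong[OF e[OF disjI1[OF refl]], of "(*) k"] by (intro mat2_eqI) (auto simp: mat2_mult_entries field_simps)
  ultimately show ?thesis by blast
 qed
 then obtain N l m where N: "N : SL2" "N ** A = mat2 l 0 0 m ** N" by blast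
 have D: "N ** A ** hinv N = mat2 l 0 0 m" using N by (simp add: matrix_mul_assoc[symmetric])
 have "N ** A ** hinv N : SL2" using N(1) A by simp
 then have lm: "l * m = 1" by (simp add: D)
 have "l + m = trace A" using trace_conj[OF N(1), of A] by (simp add: D trace2)
 have "l ~= m" proof
  assume "l = m"
  then have "(trace A)^2 = 4" using lm \<open>l + m = trace A\<close>[symmetric] by (simp add: power2_eq_square)
  then have "abs (trace A) = 2" using real_sqrt_abs[of "trace A"] by simp
  then show False using A by simp
 qed
 then show ?thesis using N D lm by blast
qed

lemma int_shift: assumes "t ~= 0" shows "\<exists>k::int. abs (x + of_int k * t) <= abs (t::real)"
proof -
 define k where "k = \<lfloor>- x / t\<rfloor>"
 have "abs (- x / t - of_int k) <= 1" unfolding k_def by linarith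
 then have "abs (- x / t - of_int k) * abs t <= abs t" by (simp add: mult_left_le_one_le)
 also have "abs (- x / t - of_int k) * abs t = abs (x + of_int k * t)" using assms by (simp flip: abs_mult add: field_simps)
 finally show ?thesis by blast
qed

text \<open>In diagonal coordinates small displacement means a cone around the imaginary axis. Since
  \<open>A\<close> acts there as multiplication by \<open>L\<close>, a power of \<open>A\<close>
  brings the point into a fixed annulus, and the part of the cone in it is bounded.\<close>

lemma (in fuchsian_group) hyperbolic_near: assumes A: "A : G" "2 < abs (trace A)" and x0: "0 < Im x0"
 shows "\<exists>R. \<forall>z. 0 < Im z --> displ z A < 1 --> (\<exists>g\<in>G. dH z (act g x0) <= R)"
proof -
 obtain N l m where N: "N : SL2" "N ** A ** hinv N = mat2 l 0 0 m" and lm: "l * m = 1" "l ~= m" using hyperbolic_diag[of A] A by auto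
 define D where "D = mat2 l 0 0 m"
 define L where "L = l * l"
 have nz: "l ~= 0" "m ~= 0" using lm by auto
 have L: "0 < L" "L ~= 1" proof -
  show "0 < L" using nz by (auto simp: L_def zero_less_mult_iff neq_iff)
  show "L ~= 1" using lm nz by (metis L_def mult_left_cancel)
 qed
 define t where "t = ln L"
 have t: "t ~= 0" using L by (simp add: t_def)
 have NA: "act N (act A z) = of_real L * act N z" if "0 < Im z" for z proof -
  have "N ** A = D ** N" using N by (metis D_def hinv_cancel(1) hinv_left matrix_mul_assoc matrix_mul_rid)
  then have "act N (act A z) = act D (act N z)" using that N(1) A lm by (metis D_def G_SL2 act_mult diff_zero mat2_in_SL2 mult_zero_left)
  also have "... = of_real L * act N z" proof -
   have "l / m = L" using nz lm by (simp add: L_def field_simps)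
   then show ?thesis by (simp add: act_eq den_def D_def flip: \<open>l / m = L\<close>)
  qed
  finally show ?thesis .
 qed
 have NA': "act N (act (hinv A) z) = of_real (1 / L) * act N z" if "0 < Im z" for z using NA[of "act (hinv A) z"] that A L by simp
 have pw: "\<exists>g\<in>G. \<forall>z. 0 < Im z --> act N (act g z) = of_real (exp (of_int k * t)) * act N z" for k :: int
 proof (induction k rule: int_induct[of _ 0])
  case base then show ?case by (intro bexI[of _ "mat 1"]) auto
 next
  case (step1 i)
  then obtain g where g: "g : G" "!!z. 0 < Im z ==> act N (act g z) = of_real (exp (of_int i * t)) * act N z" by blast
  have "exp (of_int (i + 1) * t) = L * exp (of_int i * t)" using L by (simp add: t_def distrib_right exp_add)
  then show ?case using g A by (intro bexI[of _ "A ** g"]) (auto simp: act_mult NA)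
 next
  case (step2 i)
  then obtain g where g: "g : G" "!!z. 0 < Im z ==> act N (act g z) = of_real (exp (of_int i * t)) * act N z" by blast
  have "exp (of_int (i - 1) * t) = (1 / L) * exp (of_int i * t)" using L by (simp add: t_def left_diff_distrib exp_diff)
  then show ?case using g A by (intro bexI[of _ "hinv A ** g"]) (auto simp: act_mult NA')
 qed
 define b where "b = 1 / abs (l - m)"
 define Q where "Q = exp (abs t)"
 have k0: "0 < b" using lm by (simp add: b_def)
 have Q0: "0 < Q" by (simp add: Q_def)
 obtain R where R: "!!z. abs (Re z) <= Q ==> 1 / (Q * sqrt (b^2 + 1)) <= Im z ==> Im z <= Q ==> dH z (act N x0) <= R"
  using rect_dist[of "1 / (Q * sqrt (b^2 + 1))" "act N x0" Q Q] N x0 Q0 by (auto simp: add_nonneg_pos)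
 have "\<exists>g\<in>G. dH z (act g x0) <= R" if z: "0 < Im z" "displ z A < 1" for z proof -
  define w where "w = act N z"
  have w: "0 < Im w" using N z by (simp add: w_def)
  obtain k :: int where k: "abs (ln (cmod w) + of_int k * t) <= abs t" using int_shift[OF t] by blast
  obtain g where g: "g : G" "act N (act g z) = of_real (exp (of_int k * t)) * w" using pw[of k] z by (auto simp: w_def)
  define r where "r = exp (of_int k * t)"
  have r: "0 < r" by (simp add: r_def)
  have D1: "displ w D < 1" using displ_conj[OF N(1), of A z] A z N by (simp add: w_def D_def)
  have "displ (Complex (Re w) (Im w)) D = (l - m)^2 / 2 + ((l - m) * Re w / Im w)^2" using displ_formula[of D "Im w" "Re w"] w lm by (simp add: D_def)
  then have "((l - m) * Re w / Im w)^2 < 1" using D1 zero_le_power2[of "l - m"] unfolding complex_surj by linarith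
  then have "abs ((l - m) * Re w / Im w) < 1" by (simp add: abs_square_less_1)
  then have "abs (l - m) * abs (Re w) < Im w" using w unfolding abs_mult abs_divide by (simp add: pos_divide_less_eq)
  then have rw: "abs (Re w) <= b * Im w" using lm by (simp add: b_def field_simps)
  define v where "v = of_real r * w"
  have rv: "abs (Re v) <= b * Im v" "0 < Im v" using rw r w by (simp_all add: v_def abs_mult mult.left_commute)
  have cv: "ln (cmod v) = ln (cmod w) + of_int k * t" using r w by (subst v_def) (auto simp: norm_mult ln_mult r_def)
  have v0: "0 < cmod v" using rv by auto
  have v1: "cmod v <= Q" "1 / Q <= cmod v" proof -
   have "ln (cmod v) <= abs t" "- abs t <= ln (cmod v)" using k cv by auto
   then have "exp (ln (cmod v)) <= exp (abs t)" "exp (- abs t) <= exp (ln (cmod v))" by (simp_all only: exp_le_cancel_iff)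
   from this[unfolded exp_ln[OF v0]] show "cmod v <= Q" "1 / Q <= cmod v" by (simp_all add: Q_def exp_minus inverse_eq_divide)
  qed
  have "(cmod v)^2 <= (b^2 + 1) * (Im v)^2" proof -
   have "(Re v)^2 <= (b * Im v)^2" using rv k0 abs_le_square_iff[of "Re v" "b * Im v"] by simp
   then show ?thesis by (simp add: cmod_power2 algebra_simps power_mult_distrib)
  qed
  from real_sqrt_le_mono[OF this] have "cmod v <= sqrt (b^2 + 1) * Im v" using rv by (simp add: real_sqrt_mult)
  then have "1 / Q <= sqrt (b^2 + 1) * Im v" using v1 by linarith
  then have "1 <= Im v * (Q * sqrt (b^2 + 1))" using Q0 by (simp add: field_simps)
  moreover have "0 < Q * sqrt (b^2 + 1)" using Q0 by (simp add: add_nonneg_pos)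
  ultimately have "1 / (Q * sqrt (b^2 + 1)) <= Im v" by (simp only: pos_divide_le_eq)
  then have vd: "dH v (act N x0) <= R" using R[of v] v1 abs_Re_le_cmod[of v] abs_Im_le_cmod[of v] rv by linarith
  have "v = act N (act g z)" using g by (simp add: v_def r_def)
  then have "dH (act g z) x0 <= R" using vd dH_act[of N "act g z" x0] N(1) g(1) z x0 by simp
  then show ?thesis using g z x0 by (intro bexI[of _ "hinv g"]) (auto simp: dH_act_left)
 qed
 then show ?thesis by blast
qed

lemma act_image_mult:
 "A : SL2 ==> B : SL2 ==> S \<subseteq> upper_half_plane ==> act (A ** B) ` S = act A ` (act B ` S)"
 unfolding image_image by (intro image_cong) (auto simp: act_mult subset_iff)

lemma act_image_inv: "A : SL2 ==> S \<subseteq> upper_half_plane ==> act (hinv A) ` (act A ` S) = S" using act_image_mult[of "hinv A" A S] by simp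

subsection \<open>Cusps\<close>

text \<open>Such a matrix is a translation up to sign. Testing single points forces first the lower
  left entry to vanish and then, for the matrix and its inverse, the diagonal entries to have square
  at most 1.\<close>

lemma horoball_stab: assumes h: "h : SL2" "act h ` {z. 1 < Im z} = {z. 1 < Im z}" shows "h$2$1 = 0 \<and> h$1$1 * h$1$1 = 1 \<and> h$2$2 = h$1$1"
proof -
 have im: "1 < Im (act k z)" if "k : SL2" "act k ` {z. 1 < Im z} = {z. 1 < Im z}" "1 < Im z" for k z using that by blast
 have c: "h$2$1 = 0" proof (rule ccontr)
  assume c: "h$2$1 ~= 0"
  \<comment> \<open>At this real part the denominator has real part 2, so a point of height 2 would
    drop to height at most 1/2 and leave the half-plane \<open>1 < Im z\<close>.\<close>
  define x where "x = (2 - h$2$2) / h$2$1"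
  have "(cmod (den h (Complex x 2)))^2 \<ge> (h$2$1 * x + h$2$2)^2" by (simp add: den_def cmod_power2)
  then have "(cmod (den h (Complex x 2)))^2 \<ge> 4" using c by (simp add: x_def)
  then have "Im (act h (Complex x 2)) <= 2 / 4" using Im_act[OF h(1), of "Complex x 2"]
   frac_le[of 2 2 4 "(cmod (den h (Complex x 2)))^2"] by simp
  then show False using im[OF h, of "Complex x 2"] by simp
 qed
 have ad: "h$1$1 * h$2$2 = 1" using h(1) c by (simp add: SL2_iff)
 have le: "k$2$2 * k$2$2 <= 1" if k: "k : SL2" "act k ` {z. 1 < Im z} = {z. 1 < Im z}" "k$2$1 = 0" for k proof (rule ccontr)
  assume g: "\<not> k$2$2 * k$2$2 <= 1"
  have "k$2$2 ~= 0" using g by auto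
  then have "Im (act k (Complex 0 (k$2$2 * k$2$2))) = 1"
   using Im_act[OF k(1), of "Complex 0 (k$2$2 * k$2$2)"] g k(3) by (simp add: den_def power2_eq_square)
  then show False using im[OF k(1,2), of "Complex 0 (k$2$2 * k$2$2)"] g by simp
 qed
 have inv: "act (hinv h) ` {z. 1 < Im z} = {z. 1 < Im z}" proof -
  have "act (hinv h) ` (act h ` {z. 1 < Im z}) = {z. 1 < Im z}" using h(1) by (force simp: image_iff)
  then show ?thesis using h(2) by simp
 qed
 have "h$2$2 * h$2$2 <= 1" using le[OF h c] .
 moreover have "h$1$1 * h$1$1 <= 1" proof -
  have "hinv h$2$1 = 0" "hinv h$2$2 = h$1$1" using c by (simp_all add: hinv_eq[OF h(1)])
  then show ?thesis using le[OF _ inv] h(1) by simp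
 qed
 moreover have "(h$1$1 * h$1$1) * (h$2$2 * h$2$2) = 1" using arg_cong2[OF ad ad, of "(*)"] by (simp add: ac_simps)
 ultimately have a1: "h$1$1 * h$1$1 = 1" using mult_left_mono[of "h$2$2 * h$2$2" 1 "h$1$1 * h$1$1"] by simp
 have "h$2$2 = h$1$1 * h$1$1 * h$2$2" using a1 by simp
 also have "... = h$1$1" using ad by (simp add: mult.assoc)
 finally show ?thesis using c a1 by simp
qed

locale cusped = fuchsian_group +
 fixes A :: "(real^2^2) set" and C :: "complex set set" and x0 :: complex assumes noncompact: "\<not> compact_space (quotient_topology G)"
  and finite_area: "finite_area_quotient G" and x0_upper: "x0 : upper_half_plane"
  and finite_A: "finite A" and A_G: "A \<subseteq> G" and gen_A: "generate SL2R A = G" and cusps: "cusp_horoballs G C"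
begin

lemma x0 [simp]: "0 < Im x0" using x0_upper by simp

definition nb :: "complex set => real^2^2" where
 "nb B = (SOME N. N : SL2 \<and> B = act N ` {z. 1 < Im z})"

text \<open>The cusp coordinate: it turns the horoball \<open>B\<close> into the half-plane
  \<open>1 < Im z\<close>, so that \<open>ht B k z\<close> is the height of \<open>act k z\<close>
  above the cusp of \<open>B\<close>.\<close>

definition cd :: "complex set => complex => complex" where "cd B z = act (hinv (nb B)) z"
abbreviation "ht B k z \<equiv> Im (cd B (act k z))"

lemma nb: assumes "B : C" shows "nb B : SL2" "act (nb B) ` {z. 1 < Im z} = B"
proof -
 have "\<exists>N. N : SL2 \<and> B = act N ` {z. 1 < Im z}" using cusps assms by (auto simp: cusp_horoballs_def horoball_def SL2_def)
 from someI_ex[OF this] show "nb B : SL2" "act (nb B) ` {z. 1 < Im z} = B" by (auto simp: nb_def)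
qed

lemma horoball_upper: "B : C ==> B \<subseteq> upper_half_plane" using nb[of B] by force

lemma cd_upper [simp]: "B : C ==> 0 < Im z ==> 0 < Im (cd B z)" using nb by (simp add: cd_def)

lemma cd_dist [simp]: "B : C ==> 0 < Im z ==> 0 < Im w ==> dH (cd B z) (cd B w) = dH z w" using nb by (simp add: cd_def)

lemma mem_horoball: "B : C ==> 0 < Im z ==> z : B \<longleftrightarrow> 1 < Im (cd B z)"
proof -
 assume B: "B : C" "0 < Im z"
 have "z : act (nb B) ` {z. 1 < Im z} \<longleftrightarrow> 1 < Im (cd B z)" proof
  assume "z : act (nb B) ` {z. 1 < Im z}"
  then show "1 < Im (cd B z)" using nb(1)[OF B(1)] by (auto simp: cd_def)
 next
  assume "1 < Im (cd B z)"
  then show "z : act (nb B) ` {z. 1 < Im z}" using nb(1)[OF B(1)] B by (intro image_eqI[of _ _ "cd B z"]) (auto simp: cd_def)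
 qed
 then show ?thesis using nb(2)[OF B(1)] by simp
qed

lemma stab_matrix: assumes B: "B : C" and h: "h : set_stabilizer G B"
 defines "h' \<equiv> hinv (nb B) ** h ** nb B" shows "h' : SL2" "h'$2$1 = 0" "h'$1$1 * h'$1$1 = 1" "h'$2$2 = h'$1$1"
  "!!z. 0 < Im z ==> cd B (act h z) = act h' (cd B z)"
proof -
 note N = nb[OF B]
 have hG: "h : SL2" "act h ` B = B" using h by (auto simp: set_stabilizer_def)
 show S: "h' : SL2" using N hG by (simp add: h'_def)
 show eq: "cd B (act h z) = act h' (cd B z)" if "0 < Im z" for z using that N hG by (simp add: cd_def h'_def act_mult)
 let ?H = "{z. 1 < Im z}"
 have "act h' ` ?H = act (hinv (nb B)) ` (act h ` (act (nb B) ` ?H))" proof -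
  have "?H \<subseteq> upper_half_plane" "act (nb B) ` ?H \<subseteq> upper_half_plane" using N(2) horoball_upper[OF B] by auto
  then show ?thesis unfolding h'_def using N(1) hG(1) by (simp only: act_image_mult SL2_mult SL2_inv)
 qed
 also have "... = act (hinv (nb B)) ` B" using N(2) hG by simp
 also have "... = act (hinv (nb B)) ` (act (nb B) ` ?H)" using N(2) by simp
 also have "... = ?H" using N(1) by (intro act_image_inv) auto
 finally have "act h' ` ?H = ?H" .
 then show "h'$2$1 = 0" "h'$1$1 * h'$1$1 = 1" "h'$2$2 = h'$1$1" using horoball_stab[OF S] by auto
qed

lemma stab_translation: assumes B: "B : C" and h: "h : set_stabilizer G B"
 shows "\<exists>t. (\<forall>z. 0 < Im z --> cd B (act h z) = cd B z + of_real t) \<and>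
  (t = 0 --> h : triv) \<and> (\<forall>z. 0 < Im z --> displ z h = (t / Im (cd B z))^2)"
proof -
 define h' where "h' = hinv (nb B) ** h ** nb B"
 note s = stab_matrix[OF B h, folded h'_def]
 note N = nb[OF B]
 have hG: "h : SL2" using h by (auto simp: set_stabilizer_def)
 \<comment> \<open>The diagonal entry is 1 or -1, so this product equals the quotient of the two
   entries, and the sign of the matrix cancels.\<close>
 define t where "t = h'$1$1 * h'$1$2"
 have a: "h'$1$1 ~= 0" using s by auto
 have "t = h'$1$2 / h'$1$1" proof -
  have "h'$1$1 * t = h'$1$2" using s(3) by (simp add: t_def flip: mult.assoc)
  then show ?thesis using a by (simp add: field_simps)
 qed
 then have "act h' v = v + of_real t" for v using a by (simp add: act_eq den_def s(2) s(4) add_divide_distrib)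
 then have e: "cd B (act h z) = cd B z + of_real t" if "0 < Im z" for z by (simp only: s(5)[OF that])
 have d: "displ z h = (t / Im (cd B z))^2" if "0 < Im z" for z proof -
  have "displ z h = displ (cd B z) h'" using displ_conj[of "hinv (nb B)" h z] N hG that by (simp add: cd_def h'_def)
  also have "... = displ (Complex (Re (cd B z)) (Im (cd B z))) h'" by simp
  also have "... = (h'$1$2 / Im (cd B z))^2" by (subst displ_formula[OF s(1)]) (use B that s in auto)
  also have "... = (t / Im (cd B z))^2" using s(3) by (simp add: t_def power_divide power_mult_distrib power2_eq_square)
  finally show ?thesis .
 qed
 have "h : triv" if "t = 0" proof (rule ccontr)
  assume "h \<notin> triv"
  then have "0 < displ \<i> h" using displ_pos[OF hG, of \<i>] by (auto simp: triv_def)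
  then show False using d[of \<i>] that by simp
 qed
 then show ?thesis using e d by blast
qed

lemma stab_mult: "h : set_stabilizer G B ==> k : set_stabilizer G B ==> B : C ==> h ** k : set_stabilizer G B"
proof -
 assume a: "h : set_stabilizer G B" "k : set_stabilizer G B" "B : C"
 have "act (h ** k) ` B = act h ` (act k ` B)" using a horoball_upper[OF a(3)] by (intro act_image_mult) (auto simp: set_stabilizer_def)
 then show ?thesis using a by (simp add: set_stabilizer_def)
qed

lemma stab_inv: "h : set_stabilizer G B ==> B : C ==> hinv h : set_stabilizer G B"
proof -
 assume a: "h : set_stabilizer G B" "B : C"
 have "act (hinv h) ` (act h ` B) = B" using a horoball_upper[OF a(2)] by (intro act_image_inv) (auto simp: set_stabilizer_def)
 then show ?thesis using a by (simp add: set_stabilizer_def)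
qed

lemma stab_one: "mat 1 : set_stabilizer G B" by (simp add: set_stabilizer_def)

lemma stab_G: "h : set_stabilizer G B ==> h : G" by (simp add: set_stabilizer_def)

lemma parabolic_stab: assumes B: "B : C"
 shows "\<exists>p t. p : set_stabilizer G B \<and> t ~= 0 \<and> (\<forall>z. 0 < Im z --> cd B (act p z) = cd B z + of_real t)"
proof -
 obtain p where p: "p : set_stabilizer G B" "parabolic p" using cusps B by (auto simp: cusp_horoballs_def)
 then have "p \<notin> triv" by (auto simp: parabolic_def triv_def)
 then show ?thesis using stab_translation[OF B p(1)] p by metis
qed

definition par :: "complex set => (real^2^2) \<times> real" where
 "par B = (SOME (p, t). p : set_stabilizer G B \<and> t ~= 0 \<and> (\<forall>z. 0 < Im z --> cd B (act p z) = cd B z + of_real t))"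

definition pb :: "complex set => real^2^2" where "pb B = fst (par B)"
definition tb :: "complex set => real" where "tb B = snd (par B)"

lemma pb_tb: assumes B: "B : C" shows "pb B : set_stabilizer G B" "tb B ~= 0" "0 < Im z ==> cd B (act (pb B) z) = cd B z + of_real (tb B)"
proof -
 have "\<exists>x. case x of (p, t) => p : set_stabilizer G B \<and> t ~= 0 \<and> (\<forall>z. 0 < Im z --> cd B (act p z) = cd B z + of_real t)"
  using parabolic_stab[OF B] by auto
 from someI_ex[OF this, folded par_def] show "pb B : set_stabilizer G B" "tb B ~= 0"
  "0 < Im z ==> cd B (act (pb B) z) = cd B z + of_real (tb B)" by (auto simp: pb_def tb_def split: prod.splits)
qed

definition pw :: "complex set => int => real^2^2" where "pw B k = pb B [^]\<^bsub>SL2R\<^esub> k"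

lemma pb_SL2: "B : C ==> pb B : SL2" using stab_G[OF pb_tb(1)] by simp

lemma pw_add: "B : C ==> pw B (j + k) = pw B j ** pw B k"
 using group.int_pow_mult[OF group_SL2R, of "pb B" j k] pb_SL2[of B] by (simp add: pw_def SL2_def)

lemma pw_0 [simp]: "pw B 0 = mat 1" by (simp add: pw_def)

lemma pw_1: "B : C ==> pw B 1 = pb B" using group.int_pow_1[OF group_SL2R, of "pb B"] pb_SL2[of B] by (simp add: pw_def SL2_def)

lemma pw_minus: "B : C ==> pw B (- k) = hinv (pw B k)" using group.int_pow_neg[OF group_SL2R, of "pb B" k] pb_SL2[of B] by (simp add: pw_def SL2_def)

lemma pw_stab: "B : C ==> pw B k : set_stabilizer G B"
proof (induction k rule: int_induct[of _ 0])
 case (step2 i)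
 have "pw B (i - 1) = pw B i ** hinv (pb B)" using pw_add[of B i "- 1"] step2 by (simp add: pw_minus pw_1)
 then show ?case using step2 by (simp add: stab_mult stab_inv pb_tb)
qed (simp_all add: stab_one pw_add pw_1 stab_mult pb_tb)

lemma pw_G: "B : C ==> pw B k : G" using pw_stab stab_G by blast

lemma cd_pw: assumes B: "B : C" and z: "0 < Im z" shows "cd B (act (pw B k) z) = cd B z + of_real (of_int k * tb B)"
proof (induction k rule: int_induct[of _ 0])
 case (step1 i)
 have "pw B (i + 1) = pb B ** pw B i" using pw_add[OF B, of 1 i] by (simp add: pw_1[OF B] add.commute)
 then show ?case using step1 z pb_SL2[OF B] pw_G[OF B] by (simp add: act_mult pb_tb(3)[OF B] algebra_simps)
next
 case (step2 i)
 have i: "cd B (act (hinv (pb B)) w) = cd B w - of_real (tb B)" if "0 < Im w" for w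
  using pb_tb(3)[OF B, of "act (hinv (pb B)) w"] that pb_SL2[OF B] by simp
 have "pw B (i - 1) = hinv (pb B) ** pw B i" using pw_add[OF B, of "- 1" i] by (simp add: pw_1[OF B] pw_minus[OF B])
 then show ?case using step2 z pb_SL2[OF B] pw_G[OF B] by (simp add: act_mult i algebra_simps)
qed simp

lemma cusp_near: assumes B: "B : C" and y0: "0 < y0"
 shows "\<exists>R. \<forall>z. 0 < Im z --> y0 <= Im (cd B z) --> Im (cd B z) <= y1 --> (\<exists>g\<in>G. dH z (act g x0) <= R)"
proof -
 obtain R where R: "!!z. abs (Re z) <= abs (tb B) ==> y0 <= Im z ==> Im z <= y1 ==> dH z (cd B x0) <= R"
  using rect_dist[OF y0, of "cd B x0" "abs (tb B)" y1] B by auto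
 have "\<exists>g\<in>G. dH z (act g x0) <= R" if z: "0 < Im z" "y0 <= Im (cd B z)" "Im (cd B z) <= y1" for z proof -
  obtain k :: int where k: "abs (Re (cd B z) + of_int k * tb B) <= abs (tb B)" using int_shift[OF pb_tb(2)[OF B]] by blast
  let ?g = "pw B k"
  have g: "?g : G" using pw_stab[OF B] stab_G by blast
  have "dH (cd B (act ?g z)) (cd B x0) <= R" using k z by (intro R) (simp_all add: cd_pw[OF B])
  then have "dH (act ?g z) x0 <= R" using B z g by simp
  then show ?thesis using g z by (intro bexI[of _ "hinv ?g"]) (auto simp: dH_act_left)
 qed
 then show ?thesis by blast
qed

text \<open>By \<open>thin_cases\<close> only finitely many elements need to be examined, and the
  trace sorts them. Elliptic and hyperbolic ones are small only near the orbit; parabolic ones are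
  conjugate into a horoball stabilizer.\<close>

theorem cover:
 "\<exists>R. \<forall>z. 0 < Im z --> (\<exists>g\<in>G. dH z (act g x0) <= R) \<or> (\<exists>g\<in>G. \<exists>B\<in>C. act g z : B)"
proof -
 define P where "P = (%z R. (\<exists>g\<in>G. dH z (act g x0) <= R) \<or> (\<exists>g\<in>G. \<exists>B\<in>C. act g z : B))"
 have mono: "P z R ==> R <= R' ==> P z R'" for z R R' unfolding P_def by (meson order_trans)
 have shift: "P z R" if "P (act g z) R" "g : G" "0 < Im z" for z R g using that(1) unfolding P_def proof (elim disjE bexE)
  fix k assume "k : G" "dH (act g z) (act k x0) <= R"
  then show "(\<exists>g\<in>G. dH z (act g x0) <= R) \<or> (\<exists>g\<in>G. \<exists>B\<in>C. act g z : B)"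
   using that by (intro disjI1 bexI[of _ "hinv g ** k"]) (auto simp: act_mult dH_act_left)
 next
  fix k B assume "k : G" "B : C" "act k (act g z) : B"
  then show "(\<exists>g\<in>G. dH z (act g x0) <= R) \<or> (\<exists>g\<in>G. \<exists>B\<in>C. act g z : B)"
   using that by (intro disjI2 bexI[of _ "k ** g"] bexI[of _ B]) (auto simp: act_mult)
 qed
 obtain R0 T where T: "finite T" "T \<subseteq> G - triv" "!!z. 0 < Im z ==>
   (\<exists>g\<in>G. dH z (act g x0) <= R0) \<or> (\<exists>g\<in>G. \<exists>A\<in>T. displ (act g z) A < 1)"
  using thin_cases[OF finite_area x0] by blast
 have each: "\<exists>R. \<forall>z. 0 < Im z --> displ z h < 1 --> P z R" if h: "h : T" for h proof -
  have hG: "h : G" "h : SL2" "h ~= mat 1" "h ~= - mat 1" using h T by (auto simp: triv_def)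
  consider "abs (trace h) < 2" | "2 < abs (trace h)" | "abs (trace h) = 2" by linarith
  then show ?thesis proof cases
   case 1
   obtain R where "\<forall>z. 0 < Im z --> displ z h < 1 --> dH z x0 <= R" using elliptic_near[OF hG(2) 1 x0] by blast
   then show ?thesis unfolding P_def by (intro exI[of _ R]) (auto intro!: bexI[of _ "mat 1"])
  next
   case 2
   then show ?thesis using hyperbolic_near[OF hG(1) 2 x0] unfolding P_def by blast
  next
   case 3
   then have "parabolic h" using hG by (simp add: parabolic_def SL2_def)
   then obtain g B where g: "g : G" "B : C" "g \<otimes>\<^bsub>SL2R\<^esub> h \<otimes>\<^bsub>SL2R\<^esub> hinv g : set_stabilizer G B"
    using cusps hG unfolding cusp_horoballs_def by blast
   let ?h = "g ** h ** hinv g"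
   have hs: "?h : set_stabilizer G B" using g by simp
   obtain t where t: "t = 0 --> ?h : triv" "!!z. 0 < Im z ==> displ z ?h = (t / Im (cd B z))^2" using stab_translation[OF g(2) hs] by blast
   have "?h \<notin> triv" using conj_scalar[of g h] g hG by (auto simp: triv_def)
   then have t0: "t ~= 0" using t by auto
   obtain R where R: "!!z. 0 < Im z ==> abs t <= Im (cd B z) ==> Im (cd B z) <= 1 ==> \<exists>g\<in>G. dH z (act g x0) <= R"
    using cusp_near[OF g(2), of "abs t" 1] t0 by auto
   have "P z R" if z: "0 < Im z" "displ z h < 1" for z proof (rule shift[OF _ g(1) z(1)])
    have u: "0 < Im (act g z)" using g z by simp
    have "displ (act g z) ?h = displ z h" using g hG z by (intro displ_conj) auto
    \<comment> \<open>The displacement of a translation by \<open>t\<close> at height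
      \<open>y\<close> is \<open>(t / y)^2\<close>, so the height exceeds \<open>abs t\<close>: the
      point is inside the horoball or in the band up to height 1, which \<open>cusp_near\<close>
      controls.\<close>
    then have "(t / ht B g z)^2 < 1" using t(2)[OF u] z by simp
    then have "abs (t / ht B g z) < 1" by (simp add: abs_square_less_1)
    then have "abs t <= ht B g z" using cd_upper[OF g(2) u] by (simp add: abs_divide field_simps)
    then show "P (act g z) R" proof (cases "ht B g z <= 1")
     case False
     then have "act g z : B" using mem_horoball[OF g(2) u] by simp
     then show ?thesis unfolding P_def using g by (intro disjI2 bexI[of _ "mat 1"] bexI[of _ B]) auto
    qed (use R[OF u] in "auto simp: P_def")
   qed
   then show ?thesis by blast
  qed
 qed
 then obtain r where r: "!!h z. h : T ==> 0 < Im z ==> displ z h < 1 ==> P z (r h)" by metis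
 define R where "R = abs R0 + (\<Sum>h\<in>T. abs (r h))"
 have "P z R" if z: "0 < Im z" for z using T(3)[OF z] proof (elim disjE bexE)
  fix g assume "g : G" "dH z (act g x0) <= R0"
  then have "P z R0" by (auto simp: P_def)
  then show ?thesis by (rule mono) (simp add: R_def sum_nonneg add_increasing2)
 next
  fix g h assume g: "g : G" "h : T" "displ (act g z) h < 1"
  have "P (act g z) (r h)" using r[OF g(2)] g z by simp
  moreover have "r h <= R" using member_le_sum[of h T "%h. abs (r h)"] g(2) T(1) by (simp add: R_def)
  ultimately show ?thesis using shift[OF _ g(1) z] mono by blast
 qed
 then show ?thesis unfolding P_def by blast
qed

end

subsection \<open>Word lengths\<close>

abbreviation lp :: "(real^2^2) list => real^2^2" where "lp \<equiv> list_prod SL2R"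

lemma lp_simps [simp]: "lp [] = mat 1" "lp (s # w) = s ** lp w" by (simp_all add: list_prod_def)

lemma lp_append: "lp (u @ v) = lp u ** lp v" by (induction u) (simp_all add: matrix_mul_assoc)

locale generating = fuchsian_group +
 fixes S :: "(real^2^2) set" assumes S_G: "S \<subseteq> G" and gen_S: "generate SL2R S = G"
begin

definition len :: "real^2^2 => nat" where "len g = word_dist SL2R S (mat 1) g"

lemma letters_G: "set w \<subseteq> S \<union> hinv ` S ==> set w \<subseteq> G"
proof -
 assume "set w \<subseteq> S \<union> hinv ` S"
 moreover have "S \<union> hinv ` S \<subseteq> G" using S_G by auto
 ultimately show ?thesis by (rule order_trans)
qed

lemma lp_G: "set w \<subseteq> G ==> lp w : G" by (induction w) auto

lemma word_exists: "g : G ==> \<exists>w. set w \<subseteq> S \<union> hinv ` S \<and> g = lp w"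
proof -
 assume "g : G"
 then have "g : generate SL2R S" by (simp add: gen_S)
 then show ?thesis proof (induction rule: generate.induct)
  case one then show ?case by (intro exI[of _ "[]"]) simp
 next
  case (incl h) then show ?case by (intro exI[of _ "[h]"]) simp
 next
  case (inv h) then show ?case by (intro exI[of _ "[hinv h]"]) simp
 next
  case (eng h1 h2)
  then obtain u v where "set u \<subseteq> S \<union> hinv ` S" "h1 = lp u" "set v \<subseteq> S \<union> hinv ` S" "h2 = lp v" by blast
  then show ?case by (intro exI[of _ "u @ v"]) (simp add: lp_append)
 qed
qed

lemma len_word: assumes "g : G" shows "\<exists>w. length w = len g \<and> set w \<subseteq> S \<union> hinv ` S \<and> g = lp w"
proof -
 have "\<exists>n w. length w = n \<and> set w \<subseteq> S \<union> hinv ` S \<and> g = mat 1 ** lp w" using word_exists[OF assms] by auto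
 from LeastI_ex[OF this] show ?thesis by (simp add: len_def word_dist_def)
qed

lemma len_le: "set w \<subseteq> S \<union> hinv ` S ==> len (lp w) <= length w"
 unfolding len_def word_dist_def by (rule Least_le) (auto intro!: exI[of _ w])

lemma len_mult: "g : G ==> h : G ==> len (g ** h) <= len g + len h"
 using len_word[of g] len_word[of h] len_le[of "_ @ _"] by (fastforce simp: lp_append)

lemma len_one [simp]: "len (mat 1) = 0" using len_le[of "[]"] by simp

lemma len_letter: "s : S \<union> hinv ` S ==> len s <= 1" using len_le[of "[s]"] by simp

lemma hinv_lp: "set w \<subseteq> G ==> hinv (lp w) = lp (rev (map hinv w))" by (induction w) (auto simp: hinv_mult lp_append lp_G)

lemma len_inv [simp]: assumes "g : G" shows "len (hinv g) = len g"
proof -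
 have "len (hinv h) <= len h" if h: "h : G" for h proof -
  obtain w where w: "length w = len h" "set w \<subseteq> S \<union> hinv ` S" "h = lp w" using len_word[OF h] by blast
  have "set (rev (map hinv w)) \<subseteq> S \<union> hinv ` S" proof
   fix x assume "x : set (rev (map hinv w))"
   then obtain s where s: "s : set w" "x = hinv s" by auto
   then have "s : S \<or> (\<exists>r\<in>S. s = hinv r)" using w by auto
   then show "x : S \<union> hinv ` S" using s(2) S_G by auto
  qed
  then show ?thesis using len_le[of "rev (map hinv w)"] w letters_G[OF w(2)] by (simp add: hinv_lp)
 qed
 from this[OF assms] this[of "hinv g"] show ?thesis using assms by simp
qed

lemma len_zero: "g : G ==> len g = 0 ==> g = mat 1" using len_word[of g] by auto

lemma len_quot: "g : G ==> h : G ==> k : G ==> len (hinv g ** k) <= len (hinv g ** h) + len (hinv h ** k)"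
 using len_mult[of "hinv g ** h" "hinv h ** k"] by (simp add: matrix_mul_assoc[symmetric])

lemma len_quot_sym: "g : G ==> h : G ==> len (hinv g ** h) = len (hinv h ** g)" using len_inv[of "hinv g ** h"] by (simp add: hinv_mult)

end

sublocale cusped \<subseteq> A: generating G A by standard (rule A_G, rule gen_A)

context cusped
begin

lemma rel_G: "rel_generators G A C \<subseteq> G" using A_G by (auto simp: rel_generators_def set_stabilizer_def)

lemma gen_rel: "generate SL2R (rel_generators G A C) = G"
proof
 show "generate SL2R (rel_generators G A C) \<subseteq> G" using group.generate_subgroup_incl[OF group_SL2R rel_G G_subgroup] .
 show "G \<subseteq> generate SL2R (rel_generators G A C)"
  using group.mono_generate[OF group_SL2R, of A "rel_generators G A C"] gen_A by (auto simp: rel_generators_def)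
qed

end

sublocale cusped \<subseteq> R: generating G "rel_generators G A C" by standard (rule rel_G, rule gen_rel)

context cusped
begin

abbreviation lenG where "lenG \<equiv> A.len"
abbreviation lenR where "lenR \<equiv> R.len"
abbreviation "lG g \<equiv> real (lenG g)"
abbreviation "lR g \<equiv> real (lenR g)"

lemma lenR_le_lenG: assumes "g : G" shows "lenR g <= lenG g"
proof -
 obtain w where w: "length w = lenG g" "set w \<subseteq> A \<union> hinv ` A" "g = lp w" using A.len_word[OF assms] by blast
 have "set w \<subseteq> rel_generators G A C \<union> hinv ` rel_generators G A C" using w(2) by (auto simp: rel_generators_def)
 then show ?thesis using R.len_le[of w] w by simp
qed

lemma lenR_stab: "B : C ==> h : set_stabilizer G B ==> lenR h <= 1" by (rule R.len_letter) (auto simp: rel_generators_def)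

subsection \<open>Distance to the orbit\<close>

definition dorb :: "complex => real" where "dorb z = (INF g\<in>G. dH z (act g x0))"

definition closest :: "complex => real^2^2 => bool" where
 "closest z g \<longleftrightarrow> g : G \<and> dH z (act g x0) = dorb z"

lemma dorb_bdd: "0 < Im z ==> bdd_below ((%g. dH z (act g x0)) ` G)" by (intro bdd_belowI[of _ 0]) auto

lemma dorb_le: "0 < Im z ==> g : G ==> dorb z <= dH z (act g x0)" unfolding dorb_def by (intro cINF_lower dorb_bdd)

lemma closest_exists: assumes z: "0 < Im z" shows "\<exists>g. closest z g"
proof -
 let ?f = "%g. dH z (act g x0)"
 let ?S = "{g : G. ?f g <= ?f (mat 1)}"
 have fin: "finite ?S" using z by (intro finite_orbit) auto
 define g where "g = arg_min_on ?f ?S"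
 have ne: "?S ~= {}" by (auto intro!: exI[of _ "mat 1"])
 have g: "g : ?S" unfolding g_def by (rule arg_min_if_finite(1)[OF fin ne])
 have "?f g <= ?f h" if "h : G" for h proof (cases "h : ?S")
  case True then show ?thesis unfolding g_def by (rule arg_min_least[OF fin ne])
 next
  case False then show ?thesis using that g by auto
 qed
 then have "?f g <= dorb z" unfolding dorb_def using G_one by (intro cINF_greatest) blast+
 then show ?thesis using dorb_le[OF z, of g] g by (auto simp: closest_def)
qed

lemma closest_iff: "0 < Im z ==> closest z g \<longleftrightarrow> closest_orbit_element G x0 z g"
proof -
 assume z: "0 < Im z"
 obtain h where h: "closest z h" using closest_exists[OF z] by blast
 have "dorb z = dH z (act g x0)" if "closest_orbit_element G x0 z g" using that h dorb_le[OF z, of g]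
  unfolding closest_def closest_orbit_element_def by (metis dH_commute order_antisym)
 moreover have "closest_orbit_element G x0 z g" if "closest z g"
  using that dorb_le[OF z] unfolding closest_def closest_orbit_element_def by (metis dH_commute)
 ultimately show ?thesis by (auto simp: closest_def closest_orbit_element_def)
qed

lemma closestD: "closest z g ==> g : G" "closest z g ==> dH z (act g x0) = dorb z" by (auto simp: closest_def)

lemma dorb_nonneg: "0 < Im z ==> 0 <= dorb z" using closest_exists[of z] closestD[of z] by (metis Im_act_pos G_SL2 dH_nonneg x0)

lemma dorb_lipschitz: assumes "0 < Im z" "0 < Im w" shows "dorb z <= dorb w + dH z w"
proof -
 obtain g where g: "closest w g" using closest_exists assms by blast
 have "dorb z <= dH z (act g x0)" using assms closestD[OF g] by (intro dorb_le) auto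
 also have "... <= dH z w + dH w (act g x0)" using assms closestD[OF g] by (intro dH_triangle) auto
 finally show ?thesis using closestD[OF g] by simp
qed

lemma closest_act: assumes "0 < Im z" "k : G" "closest z g" shows "closest (act k z) (k ** g)" "dorb (act k z) = dorb z"
proof -
 have le: "dorb (act k z) <= dorb z" if h: "0 < Im z" "k : G" for z k proof -
  obtain g where g: "closest z g" using closest_exists[OF h(1)] by blast
  have "dorb (act k z) <= dH (act k z) (act (k ** g) x0)" using that closestD[OF g] by (intro dorb_le) auto
  also have "... = dH z (act g x0)" using that closestD[OF g] by (simp add: act_mult)
  finally show ?thesis using closestD[OF g] by simp
 qed
 show e: "dorb (act k z) = dorb z" using le[of z k] le[of "act k z" "hinv k"] assms by simp
 show "closest (act k z) (k ** g)" using assms e by (simp add: closest_def act_mult)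
qed

lemma dorb_act [simp]: "0 < Im z ==> k : G ==> dorb (act k z) = dorb z" using closest_exists[of z] closest_act(2) by blast

lemma dorb_x0 [simp]: "dorb x0 = 0" and closest_orbit: "g : G ==> closest (act g x0) g"
proof -
 show d: "dorb x0 = 0" using dorb_le[of x0 "mat 1"] dorb_nonneg[of x0] by simp
 show "g : G ==> closest (act g x0) g" by (simp add: closest_def d)
qed

subsection \<open>The cusps see the whole noncompact part\<close>

text \<open>Without horoballs, \<open>cover\<close> would put every orbit into the ball of radius
  \<open>R\<close> about \<open>x0\<close>, and the compact box \<open>K\<close> around that ball
  would map onto the quotient.\<close>

lemma C_nonempty: "C ~= {}"
proof
 assume C: "C = {}"
 obtain R where R: "!!z. 0 < Im z ==> \<exists>g\<in>G. dH z (act g x0) <= R" using cover C by auto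
 define K where "K = cbox (Complex (Re x0 - 2 * Im x0 * cosh R * exp R) (Im x0 * exp (- R)))
  (Complex (Re x0 + 2 * Im x0 * cosh R * exp R) (Im x0 * exp R))"
 have K: "0 < Im w" if "w : K" for w proof -
  have "Im x0 * exp (- R) <= Im w" using that by (simp add: K_def cbox_def Basis_complex_def)
  moreover have "0 < Im x0 * exp (- R)" by simp
  ultimately show ?thesis by linarith
 qed
 have x0': "0 <= Im x0" using x0 by linarith
 have inK: "w : K" if w: "0 < Im w" "dH x0 w <= R" for w proof -
  have R0: "0 <= R" using w dH_nonneg[OF x0 w(1)] by linarith
  have e: "exp (dH x0 w) <= exp R" using w by simp
  have 1: "Im w <= Im x0 * exp R" by (rule order_trans[OF Im_le_exp[OF x0 w(1)] mult_left_mono[OF e x0']])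
  have "Im x0 <= Im w * exp R" by (rule order_trans[OF Im_le_exp[OF w(1) x0, unfolded dH_commute[of w]] mult_left_mono[OF e less_imp_le[OF w(1)]]])
  then have 2: "Im x0 * exp (- R) <= Im w" by (simp add: exp_minus field_simps)
  have "1 + (cmod (x0 - w))^2 / (2 * Im x0 * Im w) <= cosh R" using cosh_hyp_dist[OF x0 w(1)] w R0 cosh_real_nonneg_le_iff[of "dH x0 w" R] by simp
  then have "(cmod (x0 - w))^2 / (2 * Im x0 * Im w) <= cosh R" by simp
  then have "(cmod (x0 - w))^2 <= cosh R * (2 * Im x0 * Im w)" using w(1) by (simp add: pos_divide_le_eq)
  also have "... <= cosh R * (2 * Im x0 * (Im x0 * exp R))" using 1 x0' by (intro mult_left_mono) auto
  also have "... <= (2 * Im x0 * cosh R * exp R)^2" proof -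
   have "1 <= cosh R * exp R" using R0 mult_mono[of 1 "cosh R" 1 "exp R"] by (simp add: cosh_real_ge_1)
   then have "1 * (2 * (Im x0)^2 * (cosh R * exp R)) <= (2 * (cosh R * exp R)) * (2 * (Im x0)^2 * (cosh R * exp R))" by (intro mult_right_mono) auto
   then show ?thesis by (simp add: power2_eq_square)
  qed
  finally have "cmod (x0 - w) <= 2 * Im x0 * cosh R * exp R" by (rule power2_le_imp_le) (simp add: less_imp_le)
  then have "abs (Re x0 - Re w) <= 2 * Im x0 * cosh R * exp R" using abs_Re_le_cmod[of "x0 - w"] by simp
  then show ?thesis using 1 2 by (auto simp: K_def cbox_def Basis_complex_def)
 qed
 have "compactin (top_of_set upper_half_plane) K" unfolding compactin_subtopology using K by (auto simp: K_def)
 then have "compactin (quotient_topology G) (orbit G ` K)" by (rule image_compactin) (rule quotient_imp_continuous_map[OF quotient_map_orbit])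
 moreover have "orbit G ` K = topspace (quotient_topology G)" proof -
  have "topspace (quotient_topology G) = orbit G ` upper_half_plane" using quotient_imp_surjective_map[OF quotient_map_orbit] by simp
  moreover have "orbit G ` upper_half_plane \<subseteq> orbit G ` K" proof
   fix q assume "q : orbit G ` upper_half_plane"
   then obtain z where z: "0 < Im z" "q = orbit G z" by auto
   obtain g where g: "g : G" "dH z (act g x0) <= R" using R[OF z(1)] by blast
   let ?w = "act (hinv g) z"
   have "dH ?w x0 = dH z (act g x0)" using dH_act_left[of "hinv g" z x0] g z by simp
   then have "dH x0 ?w <= R" using g by (simp add: dH_commute[of x0])
   then have w: "?w : K" using g z by (intro inK) auto
   have "orbit G ?w = orbit G z" proof
    show "orbit G ?w \<subseteq> orbit G z" using g z by (auto simp: orbit_def simp flip: act_mult)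
    show "orbit G z \<subseteq> orbit G ?w" proof
     fix y assume "y : orbit G z"
     then obtain k where k: "k : G" "y = act k z" by (auto simp: orbit_def)
     then have "y = act (k ** g) ?w" using g z by (simp add: act_mult)
     then show "y : orbit G ?w" using k g by (auto simp: orbit_def)
    qed
   qed
   then show "q : orbit G ` K" using w z by (intro image_eqI[of _ _ ?w]) auto
  qed
  ultimately show ?thesis using K by auto
 qed
 ultimately show False using noncompact by (simp add: compact_space_def)
qed

lemma horoball_unique: assumes "B : C" "B' : C" "g : G" "g' : G" "0 < Im z" "1 < ht B g z" "1 < ht B' g' z"
 shows "B' = B" "g' ** hinv g : set_stabilizer G B"
proof -
 have z: "act g z : B" "act g' z : B'" using assms by (simp_all add: mem_horoball)
 have "act g' z = act (g' ** hinv g) (act g z)" using assms by (simp add: act_mult)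
 then have "act (g' ** hinv g) ` B \<inter> B' ~= {}" using z by auto
 moreover have "g' ** hinv g : G" using assms by simp
 ultimately have "B = B' \<and> g' ** hinv g : set_stabilizer G B" using cusps assms(1,2) unfolding cusp_horoballs_def by blast
 then show "B' = B" "g' ** hinv g : set_stabilizer G B" by auto
qed

lemma horoball_height: assumes "B : C" "B' : C" "g : G" "g' : G" "0 < Im z" "1 < ht B g z" "1 < ht B' g' z" shows "ht B' g' z = ht B g z"
proof -
 note u = horoball_unique[OF assms]
 obtain t where t: "!!w. 0 < Im w ==> cd B (act (g' ** hinv g) w) = cd B w + of_real t" using stab_translation[OF assms(1) u(2)] by blast
 have "act g' z = act (g' ** hinv g) (act g z)" using assms by (simp add: act_mult)
 then show ?thesis using t[of "act g z"] assms u(1) by simp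
qed

text \<open>The orbit of \<open>x0\<close> realizes at most one height above 1: two translates
  inside horoballs are in the same one and differ by a stabilizer element, which preserves
  height.\<close>

lemma heights_bounded: "\<exists>H\<ge>1. \<forall>B\<in>C. \<forall>g\<in>G. ht B g x0 <= H"
proof (cases "\<exists>B\<in>C. \<exists>g\<in>G. 1 < ht B g x0")
 case True
 then obtain B g where b: "B : C" "g : G" "1 < ht B g x0" by blast
 have "ht B' g' x0 <= ht B g x0" if "B' : C" "g' : G" for B' g' using horoball_height[OF b(1) that(1) b(2) that(2) x0 b(3)] b(3) by linarith
 then show ?thesis using b(3) by (intro exI[of _ "ht B g x0"]) auto
next
 case False
 then show ?thesis by (intro exI[of _ 1]) (auto simp: not_less)
qed

definition H0 :: real where "H0 = (SOME H. 1 <= H \<and> (\<forall>B\<in>C. \<forall>g\<in>G. ht B g x0 <= H))"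

lemma H0: "1 <= H0" "B : C ==> g : G ==> ht B g x0 <= H0"
proof -
 have "\<exists>H. 1 <= H \<and> (\<forall>B\<in>C. \<forall>g\<in>G. ht B g x0 <= H)" using heights_bounded by blast
 from someI_ex[OF this, folded H0_def]
 show "1 <= H0" "B : C ==> g : G ==> ht B g x0 <= H0" by auto
qed

lemma dorb_ge_height: assumes "B : C" "k : G" "0 < Im z" shows "ht B k z <= H0 * exp (dorb z)"
proof -
 obtain g where g: "closest z g" using closest_exists assms by blast
 have "ht B k z <= ht B (k ** g) x0 * exp (dH (cd B (act (k ** g) x0)) (cd B (act k z)))" using assms closestD[OF g] by (intro Im_le_exp) auto
 also have "dH (cd B (act (k ** g) x0)) (cd B (act k z)) = dorb z" using assms closestD[OF g] by (simp add: act_mult dH_commute)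
 also have "ht B (k ** g) x0 * exp (dorb z) <= H0 * exp (dorb z)" using assms closestD[OF g] by (intro mult_right_mono H0) auto
 finally show ?thesis .
qed

text \<open>A point at height exactly 1 lies in no horoball, so \<open>cover\<close> puts it near
  the orbit. From a higher point one descends vertically to height 1, at the cost of the logarithm
  of the height.\<close>

lemma dorb_le_height:
 "\<exists>R\<ge>0. (\<forall>B\<in>C. \<forall>k\<in>G. \<forall>z. 0 < Im z --> 1 <= ht B k z --> dorb z <= ln (ht B k z) + R) \<and>
   (\<forall>z. 0 < Im z --> R < dorb z --> (\<exists>B\<in>C. \<exists>k\<in>G. 1 < ht B k z))"
proof -
 obtain R where R: "!!z. 0 < Im z ==> (\<exists>g\<in>G. dH z (act g x0) <= R) \<or> (\<exists>g\<in>G. \<exists>B\<in>C. act g z : B)"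
  using cover by blast
 have out: "dorb z <= R" if "0 < Im z" "!!B k. B : C ==> k : G ==> act k z \<notin> B" for z
  using R[OF that(1)] that dorb_le[OF that(1)] by (meson order_trans)
 have bd: "dorb z <= R" if B: "B : C" "k : G" "0 < Im z" "ht B k z = 1" for B k z proof (rule out[OF B(3)], rule notI)
  fix B' k' assume B': "B' : C" "k' : G" "act k' z : B'"
  define x where "x = Re (cd B (act k z))"
  define f where "f = (%e. act (hinv k) (act (nb B) (Complex x (1 + e))))"
  note N = nb(1)[OF B(1)]
  have z0: "cd B (act k z) = Complex x 1" using B by (simp add: x_def complex_eq_iff)
  then have "act (nb B) (Complex x 1) = act k z" using N B by (metis cd_def act_inv(2) Im_act_pos G_SL2)
  then have f0: "f 0 = z" using B by (simp add: f_def)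
  have fu: "0 < Im (f e)" if "0 <= e" for e using that N B by (simp add: f_def)
  have d: "dH (cd B' (act k' z)) (cd B' (act k' (f e))) = ln (1 + e)" if "0 <= e" for e proof -
   have "dH (cd B' (act k' z)) (cd B' (act k' (f e))) = dH (f 0) (f e)" using f0 fu[of 0] fu[OF that] B' by simp
   also have "... = dH (Complex x 1) (Complex x (1 + e))" using N B that by (simp add: f_def)
   also have "... = ln (1 + e)" using that by (subst dH_vertical) auto
   finally show ?thesis .
  qed
  have m: "1 < ht B' k' z" using B' B by (simp add: mem_horoball)
  \<comment> \<open>The point is raised by the factor \<open>1 + e\<close>, so that it enters
    \<open>B\<close>. Its height over \<open>B'\<close>, which was \<open>1 + 2 * e\<close>, drops
    by at most that factor and stays above 1. Then the horoballs coincide and the heights agree,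
    which contradicts height 1.\<close>
  define e where "e = (ht B' k' z - 1) / 2"
  have e: "0 < e" using m by (simp add: e_def)
  have "ht B' k' z <= ht B' k' (f e) * exp (dH (cd B' (act k' (f e))) (cd B' (act k' z)))" using e fu[of e] B' B by (intro Im_le_exp) auto
  also have "dH (cd B' (act k' (f e))) (cd B' (act k' z)) = ln (1 + e)" by (subst dH_commute) (use d[of e] e in simp)
  finally have le: "ht B' k' z <= ht B' k' (f e) * (1 + e)" using e by simp
  have "1 < ht B' k' (f e)" proof (rule ccontr)
   assume "\<not> ?thesis"
   then have "ht B' k' (f e) * (1 + e) <= 1 * (1 + e)" using e by (intro mult_right_mono) auto
   then show False using le m by (simp add: e_def field_simps)
  qed
  moreover have "cd B (act k (f e)) = Complex x (1 + e)" using e N B by (simp add: f_def cd_def)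
  ultimately have u: "B' = B" "k' ** hinv k : set_stabilizer G B" using horoball_unique[OF B(1) B'(1) B(2) B'(2) fu[of e]] e by auto
  obtain t where t: "!!w. 0 < Im w ==> cd B (act (k' ** hinv k) w) = cd B w + of_real t" using stab_translation[OF B(1) u(2)] by blast
  have "act k' z = act (k' ** hinv k) (act k z)" using B B' by (simp add: act_mult)
  then have "ht B' k' z = 1" using t[of "act k z"] B u(1) by simp
  then show False using m by simp
 qed
 have main: "dorb z <= ln (ht B k z) + R" if B: "B : C" "k : G" "0 < Im z" "1 <= ht B k z" for B k z proof -
  define x where "x = Re (cd B (act k z))"
  define y where "y = ht B k z"
  define w where "w = act (hinv k) (act (nb B) (Complex x 1))"
  note N = nb(1)[OF B(1)]
  have w: "0 < Im w" "cd B (act k w) = Complex x 1" using N B by (simp_all add: w_def cd_def)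
  have "dorb w <= R" using w B by (intro bd) auto
  moreover have "dH z w = ln y" proof -
   have "dH z w = dH (cd B (act k z)) (cd B (act k w))" using w(1) B by simp
   also have "... = dH (Complex x y) (Complex x 1)" using w(2) by (simp add: x_def y_def)
   also have "... = ln y" using B by (subst dH_vertical) (auto simp: y_def)
   finally show ?thesis .
  qed
  ultimately show ?thesis using dorb_lipschitz[OF B(3) w(1)] by (simp add: y_def)
 qed
 show ?thesis proof (intro exI[of _ "max R 0"] conjI ballI allI impI)
  fix B k z assume "B : C" "k : G" "0 < Im z" "1 <= ht B k z"
  then show "dorb z <= ln (ht B k z) + max R 0" using main[of B k z] by linarith
 next
  fix z assume z: "0 < Im z" "max R 0 < dorb z"
  then have "\<not> dorb z <= R" by simp
  then show "\<exists>B\<in>C. \<exists>k\<in>G. 1 < ht B k z" using out[OF z(1)] mem_horoball z(1) by (metis G_SL2 Im_act_pos)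
 qed simp
qed

definition R0 :: real where
 "R0 = (SOME R. 0 <= R \<and> (\<forall>B\<in>C. \<forall>k\<in>G. \<forall>z. 0 < Im z --> 1 <= ht B k z --> dorb z <= ln (ht B k z) + R) \<and>
   (\<forall>z. 0 < Im z --> R < dorb z --> (\<exists>B\<in>C. \<exists>k\<in>G. 1 < ht B k z)))"

lemma R0:
 "0 <= R0"
 "B : C ==> k : G ==> 0 < Im z ==> 1 <= ht B k z ==> dorb z <= ln (ht B k z) + R0"
 "0 < Im z ==> R0 < dorb z ==> \<exists>B\<in>C. \<exists>k\<in>G. 1 < ht B k z"
proof -
 have "\<exists>R. 0 <= R \<and> (\<forall>B\<in>C. \<forall>k\<in>G. \<forall>z. 0 < Im z --> 1 <= ht B k z --> dorb z <= ln (ht B k z) + R) \<and>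
   (\<forall>z. 0 < Im z --> R < dorb z --> (\<exists>B\<in>C. \<exists>k\<in>G. 1 < ht B k z))" using dorb_le_height by auto
 from someI_ex[OF this, folded R0_def]
 show "0 <= R0"
 "B : C ==> k : G ==> 0 < Im z ==> 1 <= ht B k z ==> dorb z <= ln (ht B k z) + R0"
 "0 < Im z ==> R0 < dorb z ==> \<exists>B\<in>C. \<exists>k\<in>G. 1 < ht B k z" by blast+
qed

end

section \<open>Word length and relative length near a cusp\<close>

lemma cosh_le_exp: "0 <= (x::real) ==> cosh x <= exp x" by (simp add: cosh_field_def)

lemma cmod_sq_le_dist: assumes "0 < Im z" "0 < Im w" shows "(cmod (z - w))^2 <= 2 * Im z * Im w * cosh (dH z w)"
proof -
 have p: "0 < 2 * Im z * Im w" using assms by simp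
 have "(cmod (z - w))^2 / (2 * Im z * Im w) <= cosh (dH z w)" using assms by (simp add: cosh_hyp_dist)
 then show ?thesis using p by (simp add: pos_divide_le_eq mult.commute)
qed

context cusped
begin

lemma finite_C: "finite C" using cusps by (simp add: cusp_horoballs_def)

definition vmin :: real where "vmin = 1 / (8 * exp R0)"
definition C1 :: real where "C1 = 2 * H0 * exp R0"

lemma vmin_pos: "0 < vmin" by (simp add: vmin_def)

lemma C1_ge: "1 <= C1"
proof -
 have "1 * 1 <= H0 * exp R0" using H0(1) R0(1) by (intro mult_mono) auto
 then show ?thesis by (simp add: C1_def)
qed

text \<open>The distance from \<open>z\<close> to its closest orbit point is at most the logarithm
  of the height plus \<open>R0\<close>, so the squared Euclidean distance in the cusp coordinate is
  at most the squared height times \<open>2 * Im q * exp R0\<close>. The vertical part of this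
  forces \<open>vmin\<close>, the horizontal part gives \<open>C1\<close>.\<close>

lemma near_cusp: assumes B: "B : C" and k: "k : G" and z: "0 < Im z" and h: "2 * H0 <= ht B k z" and g: "closest z g" shows "vmin <= ht B (k ** g) x0"
  "abs (Re (cd B (act (k ** g) x0)) - Re (cd B (act k z))) <= C1 * ht B k z"
proof -
 define p where "p = cd B (act k z)"
 define q where "q = cd B (act (k ** g) x0)"
 note gG = closestD[OF g]
 have p: "2 * H0 <= Im p" "0 < Im p" using h H0(1) by (auto simp: p_def)
 have q: "0 < Im q" "Im q <= H0" using B k gG H0(2)[OF B] by (auto simp: q_def)
 have "dH p q = dorb z" using B k z gG by (simp add: p_def q_def act_mult)
 also have "... <= ln (Im p) + R0" using R0(2)[OF B k z] h H0(1) by (simp add: p_def)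
 finally have d: "dH p q <= ln (Im p) + R0" .
 have "cosh (dH p q) <= exp (dH p q)" using p q by (intro cosh_le_exp) simp
 also have "... <= exp (ln (Im p) + R0)" using d by simp
 also have "... = Im p * exp R0" using p by (simp add: exp_add)
 finally have c: "cosh (dH p q) <= Im p * exp R0" .
 have "(cmod (p - q))^2 <= 2 * Im p * Im q * cosh (dH p q)" using p q by (intro cmod_sq_le_dist)
 also have "... <= 2 * Im p * Im q * (Im p * exp R0)" using c p q by (intro mult_left_mono) auto
 finally have m: "(Re p - Re q)^2 + (Im p - Im q)^2 <= (Im p)^2 * (2 * Im q * exp R0)" unfolding cmod_power2 by (simp add: power2_eq_square mult_ac)
 have "(Im p / 2)^2 <= (Im p - Im q)^2" using p q by (intro power_mono) auto
 then have "(Im p)^2 * (1 / 4) <= (Im p)^2 * (2 * Im q * exp R0)" proof -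
  have "(Im p)^2 * (1 / 4) = (Im p / 2)^2" by (simp add: power_divide)
  then show ?thesis using m zero_le_power2[of "Re p - Re q"] \<open>(Im p / 2)^2 <= (Im p - Im q)^2\<close> by linarith
 qed
 then have "1 / 4 <= 2 * Im q * exp R0" using p by (simp only: mult_le_cancel_left_pos zero_less_power)
 then show "vmin <= ht B (k ** g) x0" by (simp add: vmin_def q_def field_simps)
 have "(Im p)^2 * (2 * Im q * exp R0) <= (Im p)^2 * C1" unfolding C1_def using q by (intro mult_left_mono mult_right_mono) auto
 also have "... <= (Im p)^2 * (C1 * C1)" using C1_ge by (intro mult_left_mono) auto
 finally have "(Re q - Re p)^2 <= (C1 * Im p)^2" using m zero_le_power2[of "Im p - Im q"] by (simp add: power2_eq_square algebra_simps)
 then show "abs (Re (cd B (act (k ** g) x0)) - Re (cd B (act k z))) <= C1 * ht B k z"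
  using abs_le_square_iff[of "Re q - Re p" "C1 * Im p"] C1_ge p by (simp add: p_def q_def)
qed

text \<open>Representatives, modulo the powers of \<open>pb B\<close>, of the group elements that
  put \<open>x0\<close> at height at least \<open>vmin\<close>. The heights are also at most
  \<open>H0\<close>, which makes the set finite.\<close>

definition FB :: "complex set => (real^2^2) set" where
 "FB B = {g : G. vmin <= ht B g x0 \<and> abs (Re (cd B (act g x0))) <= abs (tb B)}"

lemma finite_FB: assumes B: "B : C" shows "finite (FB B)"
proof -
 obtain R where R: "!!z. abs (Re z) <= abs (tb B) ==> vmin <= Im z ==> Im z <= H0 ==> dH z \<i> <= R"
  using rect_dist[OF vmin_pos, of \<i> "abs (tb B)" H0] by auto
 note N = nb(1)[OF B]
 have "FB B \<subseteq> {g : G. dH (act (nb B) \<i>) (act g x0) <= R}" proof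
  fix g assume g: "g : FB B"
  then have gG: "g : G" by (simp add: FB_def)
  have "dH (cd B (act g x0)) \<i> <= R" using g H0(2)[OF B gG] by (intro R) (auto simp: FB_def)
  moreover have "dH (cd B (act g x0)) \<i> = dH (act g x0) (act (nb B) \<i>)"
   using N gG dH_act_left[of "hinv (nb B)" "act g x0" \<i>] by (simp add: cd_def)
  ultimately show "g : {g : G. dH (act (nb B) \<i>) (act g x0) <= R}" using gG by (simp add: dH_commute)
 qed
 then show ?thesis using finite_orbit[of "act (nb B) \<i>" x0 R] N by (auto intro: finite_subset)
qed

text \<open>These elements relate the orbit points closest to two nearby points of one horoball; \<open>l\<close> bounds the number
 of turns around the cusp.\<close>

definition SL :: "nat => (real^2^2) set" where
 "SL l = {hinv f ** pw B j ** f' | B f f' j. B : C \<and> f : FB B \<and> f' : FB B \<and> abs j <= int l}"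

lemma SL_card: "\<exists>K. \<forall>l. finite (SL l) \<and> card (SL l) <= K * (l + 1)"
proof -
 define N where "N = (\<Sum>B\<in>C. card (FB B) * card (FB B))"
 have eq: "SL l = (\<Union>B\<in>C. (%(f, f', j). hinv f ** pw B j ** f') ` (FB B \<times> FB B \<times> {- int l..int l}))" for l
  by (force simp: SL_def)
 have fin: "finite (SL l)" for l unfolding eq using finite_C finite_FB by auto
 have "card (SL l) <= (\<Sum>B\<in>C. card ((%(f, f', j). hinv f ** pw B j ** f') ` (FB B \<times> FB B \<times> {- int l..int l})))" for l
  unfolding eq by (rule card_UN_le[OF finite_C])
 also have "... l <= (\<Sum>B\<in>C. card (FB B) * card (FB B) * (2 * l + 1))" for l proof (rule sum_mono)
  fix B assume B: "B : C"
  have "card ((%(f, f', j). hinv f ** pw B j ** f') ` (FB B \<times> FB B \<times> {- int l..int l})) <= card (FB B \<times> FB B \<times> {- int l..int l})"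
   using finite_FB[OF B] by (intro card_image_le) auto
  also have "... = card (FB B) * card (FB B) * (2 * l + 1)" proof -
   have "card {- int l..int l} = 2 * l + 1" unfolding card_atLeastAtMost_int by linarith
   then show ?thesis by (simp only: card_cartesian_product mult.assoc)
  qed
  finally show "card ((%(f, f', j). hinv f ** pw B j ** f') ` (FB B \<times> FB B \<times> {- int l..int l})) <= card (FB B) * card (FB B) * (2 * l + 1)" .
 qed
 also have "(\<Sum>B\<in>C. card (FB B) * card (FB B) * (2 * l + 1)) <= (2 * N) * (l + 1)" for l
  unfolding N_def sum_distrib_right[symmetric] by simp
 finally show ?thesis using fin by blast
qed

text \<open>Powers of \<open>pb B\<close> bring both elements into \<open>FB B\<close>. The
  exponents differ by the horizontal distance measured in translation lengths, plus at most 2 for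
  the two reductions.\<close>

lemma cusp_letter: assumes B: "B : C" and g: "g : G" "g' : G" and v: "vmin <= ht B g x0" "vmin <= ht B g' x0"
  and l: "abs (Re (cd B (act g x0)) - Re (cd B (act g' x0))) + 2 * abs (tb B) <= real l * abs (tb B)" shows "hinv g ** g' : SL l"
proof -
 have red: "\<exists>j f. f : FB B \<and> f = pw B j ** h \<and> abs (Re (cd B (act h x0)) + of_int j * tb B) <= abs (tb B)"
  if h: "h : G" "vmin <= ht B h x0" for h proof -
  obtain j :: int where j: "abs (Re (cd B (act h x0)) + of_int j * tb B) <= abs (tb B)" using int_shift[OF pb_tb(2)[OF B]] by blast
  have "cd B (act (pw B j ** h) x0) = cd B (act h x0) + of_real (of_int j * tb B)" using h pw_G[OF B] B by (simp add: act_mult cd_pw)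
  then have "pw B j ** h : FB B" using j h pw_G[OF B] by (simp add: FB_def)
  then show ?thesis using j by blast
 qed
 obtain j f where f: "f : FB B" "f = pw B j ** g" "abs (Re (cd B (act g x0)) + of_int j * tb B) <= abs (tb B)" using red[OF g(1) v(1)] by blast
 obtain j' f' where f': "f' : FB B" "f' = pw B j' ** g'" "abs (Re (cd B (act g' x0)) + of_int j' * tb B) <= abs (tb B)"
  using red[OF g(2) v(2)] by blast
 have P: "pw B i : SL2" for i using pw_G[OF B] by simp
 have "g = hinv (pw B j) ** f" "g' = hinv (pw B j') ** f'" using f(2) f'(2) P by simp_all
 then have "hinv g ** g' = hinv f ** pw B j ** (pw B (- j') ** f')" using f(1) P by (simp add: hinv_mult pw_minus[OF B] FB_def)
 also have "... = hinv f ** pw B (j - j') ** f'" using pw_add[OF B, of j "- j'"] by (simp add: matrix_mul_assoc)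
 finally have e: "hinv g ** g' = hinv f ** pw B (j - j') ** f'" .
 have "abs (of_int (j - j')) * abs (tb B) = abs (of_int j * tb B - of_int j' * tb B)" by (simp add: left_diff_distrib flip: abs_mult)
 also have "... <= real l * abs (tb B)" using f(3) f'(3) l by linarith
 finally have "abs (of_int (j - j')) <= real l" using pb_tb(2)[OF B] by simp
 then have "abs (j - j') <= int l" by linarith
 then show ?thesis using e f(1) f'(1) B by (auto simp: SL_def)
qed

lemma same_cusp:
 "\<exists>K>0. \<forall>B\<in>C. \<forall>k\<in>G. \<forall>z z' g g' l. 0 < Im z --> 0 < Im z' --> closest z g --> closest z' g' -->
   2 * H0 <= ht B k z --> 2 * H0 <= ht B k z' -->
   K * (abs (Re (cd B (act k z)) - Re (cd B (act k z'))) + ht B k z + ht B k z') <= real l -->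
   hinv g ** g' : SL l"
proof -
 \<comment> \<open>The sum of the inverse translation lengths serves all cusps at once; the 2 pays
   for the two reductions in \<open>cusp_letter\<close>.\<close>
 define K where "K = C1 * (\<Sum>B\<in>C. 1 / abs (tb B)) + 2"
 have S: "1 / abs (tb B) <= (\<Sum>B\<in>C. 1 / abs (tb B))" if "B : C" for B using that finite_C by (intro member_le_sum) auto
 have "0 <= (\<Sum>B\<in>C. 1 / abs (tb B))" by (intro sum_nonneg) simp
 then have K: "0 < K" using C1_ge by (simp add: K_def add_nonneg_pos)
 show ?thesis proof (intro exI[of _ K] conjI K ballI allI impI)
  fix B k z z' g g' and l :: nat
  assume B: "B : C" and k: "k : G" and z: "0 < Im z" "0 < Im z'" and g: "closest z g" "closest z' g'"
   and h: "2 * H0 <= ht B k z" "2 * H0 <= ht B k z'" and l: "K * (abs (Re (cd B (act k z)) - Re (cd B (act k z'))) + ht B k z + ht B k z') <= real l"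
  let ?p = "cd B (act k z)" and ?p' = "cd B (act k z')"
  let ?s = "abs (Re ?p - Re ?p') + Im ?p + Im ?p'"
  have t: "0 < abs (tb B)" using pb_tb(2)[OF B] by simp
  note n = near_cusp[OF B k z(1) h(1) g(1)] near_cusp[OF B k z(2) h(2) g(2)]
  have s1: "1 <= ?s" using h H0(1) by linarith
  have "abs (Re (cd B (act (k ** g) x0)) - Re (cd B (act (k ** g') x0))) <= abs (Re ?p - Re ?p') + C1 * Im ?p + C1 * Im ?p'" using n by linarith
  also have "... <= C1 * ?s" using C1_ge mult_right_mono[of 1 C1 "abs (Re ?p - Re ?p')"] by (simp add: algebra_simps)
  also have "... <= (C1 * (\<Sum>B\<in>C. 1 / abs (tb B)) * ?s) * abs (tb B)" proof -
   have "1 <= (\<Sum>B\<in>C. 1 / abs (tb B)) * abs (tb B)" using S[OF B] t by (simp add: field_simps)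
   then have "C1 * ?s * 1 <= C1 * ?s * ((\<Sum>B\<in>C. 1 / abs (tb B)) * abs (tb B))" using C1_ge s1 by (intro mult_left_mono) auto
   then show ?thesis by (simp add: mult_ac)
  qed
  finally have "abs (Re (cd B (act (k ** g) x0)) - Re (cd B (act (k ** g') x0))) + 2 * abs (tb B)
    <= (C1 * (\<Sum>B\<in>C. 1 / abs (tb B)) * ?s) * abs (tb B) + (2 * ?s) * abs (tb B)" using s1 t by (intro add_mono mult_right_mono) auto
  also have "... = K * ?s * abs (tb B)" by (simp add: K_def algebra_simps)
  also have "... <= real l * abs (tb B)" using l by (intro mult_right_mono) auto
  finally have "hinv (k ** g) ** (k ** g') : SL l" using B k closestD[OF g(1)] closestD[OF g(2)] n by (intro cusp_letter) auto
  moreover have "hinv (k ** g) ** (k ** g') = hinv g ** g'" using k closestD[OF g(1)] by (simp add: hinv_mult matrix_mul_assoc[symmetric])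
  ultimately show "hinv g ** g' : SL l" by simp
 qed
qed

lemma lenG_pw: "B : C ==> lenG (pw B j) <= nat (abs j) * lenG (pb B)"
proof -
 assume B: "B : C"
 have pbG: "pb B : G" using stab_G[OF pb_tb(1)[OF B]] .
 have p: "lenG (pw B (int n)) <= n * lenG (pb B)" for n proof (induction n)
  case (Suc n)
  have "pw B (int (Suc n)) = pb B ** pw B (int n)" using pw_add[OF B, of 1 "int n"] by (simp add: pw_1[OF B])
  then show ?case using A.len_mult[OF pbG pw_G[OF B], of "int n"] Suc by simp
 qed simp
 show ?thesis proof (cases "0 <= j")
  case True then show ?thesis using p[of "nat j"] by simp
 next
  case False
  then have "pw B j = hinv (pw B (int (nat (- j))))" by (simp add: pw_minus[OF B, symmetric])
  then show ?thesis using p[of "nat (- j)"] False A.len_inv[OF pw_G[OF B], of "int (nat (- j))"] by simp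
 qed
qed

text \<open>Turning \<open>j\<close> times around a cusp costs at most about \<open>abs j\<close>
  letters of \<open>A\<close> but a single relative letter. This asymmetry separates the two
  lengths.\<close>

lemma SL_len: "\<exists>K. \<forall>l. \<forall>s\<in>SL l. lenG s <= K * (l + 1) \<and> lenR s <= K"
proof -
 define M where "M = (\<Sum>B\<in>C. \<Sum>f\<in>FB B. lenG f)"
 define P where "P = (\<Sum>B\<in>C. lenG (pb B))"
 have M: "lenG f <= M" if "B : C" "f : FB B" for B f proof -
  have "lenG f <= (\<Sum>f\<in>FB B. lenG f)" using that finite_FB by (intro member_le_sum) auto
  also have "... <= M" unfolding M_def using that finite_C by (intro member_le_sum) auto
  finally show ?thesis .
 qed
 have P: "lenG (pb B) <= P" if "B : C" for B unfolding P_def using that finite_C by (intro member_le_sum) auto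
 show ?thesis proof (intro exI[of _ "2 * M + P + 1"] allI ballI)
  fix l s assume "s : SL l"
  then obtain B f f' j where s: "s = hinv f ** pw B j ** f'" "B : C" "f : FB B" "f' : FB B" "abs j <= int l" by (auto simp: SL_def)
  have G: "f : G" "f' : G" "pw B j : G" using s pw_G by (auto simp: FB_def)
  have "lenG s <= lenG f + lenG (pw B j) + lenG f'" using A.len_mult[of "hinv f ** pw B j" f'] A.len_mult[of "hinv f" "pw B j"] G s by simp
  also have "lenG (pw B j) <= nat (abs j) * lenG (pb B)" by (rule lenG_pw) fact
  also have "... <= l * P" using P[OF s(2)] s(5) by (intro mult_mono) auto
  finally have 1: "lenG s <= 2 * M + l * P" using M[OF s(2,3)] M[OF s(2,4)] by simp
  have "lenR s <= lenR f + lenR (pw B j) + lenR f'" using R.len_mult[of "hinv f ** pw B j" f'] R.len_mult[of "hinv f" "pw B j"] G s by simp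
  also have "lenR (pw B j) <= 1" using lenR_stab[OF s(2) pw_stab[OF s(2)]] .
  finally have 2: "lenR s <= 2 * M + 1" using M[OF s(2,3)] M[OF s(2,4)] lenR_le_lenG[OF G(1)] lenR_le_lenG[OF G(2)] by simp
  show "lenG s <= (2 * M + P + 1) * (l + 1) \<and> lenR s <= 2 * M + P + 1" using 1 2 by (simp add: algebra_simps)
 qed
qed

lemma deep_point: assumes z: "0 < Im z" and d: "R0 + ln Y < dorb z" and Y: "1 <= Y" shows "\<exists>B\<in>C. \<exists>k\<in>G. Y <= ht B k z"
proof -
 have "R0 < dorb z" using d ln_ge_zero[OF Y] by linarith
 then obtain B k where b: "B : C" "k : G" "1 < ht B k z" using R0(3)[OF z] by blast
 have "ln Y <= ln (ht B k z)" using R0(2)[OF b(1,2) z] b(3) d by linarith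
 then show ?thesis using b Y by auto
qed

lemma close_heights: assumes B: "B : C" "k : G" and z: "0 < Im z" "0 < Im z'" "dH z z' <= c" shows "ht B k z' <= exp c * ht B k z"
  "ht B k z <= exp c * ht B k z'"
  "abs (Re (cd B (act k z)) - Re (cd B (act k z'))) <= 2 * exp c * cosh c * ht B k z"
proof -
 let ?p = "cd B (act k z)" and ?q = "cd B (act k z')"
 have p: "0 < Im ?p" "0 < Im ?q" using B z by auto
 have d: "dH ?p ?q <= c" using B z by simp
 have c0: "0 <= c" using d dH_nonneg[OF p] by linarith
 have "Im ?q <= Im ?p * exp (dH ?p ?q)" using p by (intro Im_le_exp)
 also have "... <= Im ?p * exp c" using d p by simp
 finally show q: "Im ?q <= exp c * Im ?p" by (simp add: mult.commute)
 have "Im ?p <= Im ?q * exp (dH ?q ?p)" using p by (intro Im_le_exp)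
 also have "... <= Im ?q * exp c" using d p by (simp add: dH_commute)
 finally show "Im ?p <= exp c * Im ?q" by (simp add: mult.commute)
 have "(Re ?p - Re ?q)^2 <= (cmod (?p - ?q))^2" by (simp add: cmod_power2)
 also have "... <= 2 * Im ?p * Im ?q * cosh (dH ?p ?q)" using p by (intro cmod_sq_le_dist)
 also have "... <= 2 * Im ?p * (exp c * Im ?p) * cosh c" using p q d c0 cosh_real_nonneg_le_iff[of "dH ?p ?q" c] by (intro mult_mono) auto
 also have "... <= (2 * exp c * cosh c * Im ?p)^2" proof -
  have "1 * 1 <= exp c * cosh c" using c0 by (intro mult_mono) (auto simp: cosh_real_ge_1)
  then have "1 <= 2 * (exp c * cosh c)" by simp
  then have "1 * (2 * (exp c * cosh c) * (Im ?p)^2) <= 2 * (exp c * cosh c) * (2 * (exp c * cosh c) * (Im ?p)^2)" by (intro mult_right_mono) auto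
  then show ?thesis by (simp add: power2_eq_square)
 qed
 finally have "(Re ?p - Re ?q)^2 <= (2 * exp c * cosh c * Im ?p)^2" .
 then show "abs (Re ?p - Re ?q) <= 2 * exp c * cosh c * Im ?p" using abs_le_square_iff[of "Re ?p - Re ?q" "2 * exp c * cosh c * Im ?p"] p by simp
qed

text \<open>Near the orbit only finitely many elements occur. In a cusp the horizontal distance of
  two points at bounded distance is at most a multiple of their height, hence of
  \<open>exp (dorb z)\<close>, and so is the number of turns.\<close>

lemma local_length:
 "\<exists>K>0. \<forall>z z' g g'. 0 < Im z --> 0 < Im z' --> dH z z' <= c --> closest z g --> closest z' g' -->
   lG (hinv g ** g') <= K * exp (dorb z) \<and> lR (hinv g ** g') <= K"
proof -
 \<comment> \<open>A height changes by at most the factor \<open>exp c\<close> over a distance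
   \<open>c\<close>; this margin keeps the second point above \<open>2 * H0\<close> too.\<close>
 define Y where "Y = 2 * H0 * exp (abs c)"
 have Y: "1 <= Y" using mult_mono[of 1 "2 * H0" 1 "exp (abs c)"] H0(1) by (simp add: Y_def)
 define Rb where "Rb = R0 + ln Y"
 obtain K1 where K1: "0 < K1" "!!B k z z' g g' l. B : C ==> k : G ==> 0 < Im z ==> 0 < Im z' ==> closest z g ==> closest z' g' ==>
   2 * H0 <= ht B k z ==> 2 * H0 <= ht B k z' ==>
   K1 * (abs (Re (cd B (act k z)) - Re (cd B (act k z'))) + ht B k z + ht B k z') <= real l ==>
   hinv g ** g' : SL l" using same_cusp by blast
 obtain K2 where K2: "!!l s. s : SL l ==> lenG s <= K2 * (l + 1) \<and> lenR s <= K2" using SL_len by blast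
 let ?F = "{s : G. dH x0 (act s x0) <= 2 * Rb + 2 * c}"
 have finF: "finite ?F" by (intro finite_orbit) auto
 define M where "M = (\<Sum>s\<in>?F. lG s)"
 define E where "E = 2 * exp (abs c) * cosh c + 1 + exp (abs c)"
 have E: "0 < E" by (simp add: E_def add_pos_pos)
 define K where "K = M + real K2 * (K1 * E * H0 + 2) + 1"
 have M0: "0 <= M" by (simp add: M_def sum_nonneg)
 have KK: "0 <= real K2 * (K1 * E * H0 + 2)" using K1 E H0 by (intro mult_nonneg_nonneg add_nonneg_nonneg) auto
 have K: "0 < K" using M0 KK by (simp add: K_def)
 show ?thesis proof (intro exI[of _ K] conjI K allI impI)
  fix z z' g g'
  assume z: "0 < Im z" "0 < Im z'" "dH z z' <= c" and g: "closest z g" "closest z' g'"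
  note gG = closestD(1)[OF g(1)] closestD(1)[OF g(2)]
  have c0: "0 <= c" using z dH_nonneg[OF z(1,2)] by linarith
  have e1: "1 <= exp (dorb z)" using dorb_nonneg[OF z(1)] by simp
  have "lG (hinv g ** g') <= K * exp (dorb z) \<and> lR (hinv g ** g') <= K" proof (cases "Rb < dorb z")
   case False
   have "dorb z' <= dorb z + c" using dorb_lipschitz[OF z(2,1)] z(3) by (simp add: dH_commute)
   have "dH x0 (act (hinv g ** g') x0) = dH (act g x0) (act g' x0)" using gG by (simp add: act_mult dH_act_left)
   also have "... <= dH (act g x0) z + dH z (act g' x0)" using gG z by (intro dH_triangle) auto
   also have "... <= dH (act g x0) z + (dH z z' + dH z' (act g' x0))" using gG z dH_triangle[of z z' "act g' x0"] by simp
   also have "... = dorb z + dH z z' + dorb z'" using closestD(2)[OF g(1)] closestD(2)[OF g(2)] by (simp add: dH_commute)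
   also have "... <= 2 * Rb + 2 * c" using False z(3) \<open>dorb z' <= dorb z + c\<close> by linarith
   finally have "hinv g ** g' : ?F" using gG by simp
   then have "lG (hinv g ** g') <= M" unfolding M_def using finF by (intro member_le_sum) auto
   also have "M <= K" using KK by (simp add: K_def)
   finally have l: "lG (hinv g ** g') <= K" .
   have "K * 1 <= K * exp (dorb z)" using K e1 by (intro mult_left_mono) auto
   then show ?thesis using l lenR_le_lenG[of "hinv g ** g'"] gG by simp
  next
   case True
   then obtain B k where b: "B : C" "k : G" "Y <= ht B k z" using deep_point[OF z(1) _ Y] by (auto simp: Rb_def)
   let ?p = "cd B (act k z)" and ?q = "cd B (act k z')"
   note ch = close_heights[OF b(1,2) z]
   have hY: "2 * H0 * exp c <= Im ?p" using b(3) c0 by (simp add: Y_def)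
   also note ch(2)
   finally have hq: "2 * H0 <= Im ?q" by simp
   have "2 * H0 * 1 <= 2 * H0 * exp c" using c0 H0(1) by (intro mult_left_mono) auto
   then have hp: "2 * H0 <= Im ?p" using hY by linarith
   define l where "l = nat \<lceil>K1 * (abs (Re ?p - Re ?q) + Im ?p + Im ?q)\<rceil>"
   have s: "hinv g ** g' : SL l" using K1(2)[OF b(1,2) z(1,2) g hp hq, of l] by (simp add: l_def) linarith
   have "abs (Re ?p - Re ?q) + Im ?p + Im ?q <= E * Im ?p" using ch c0 by (simp add: E_def algebra_simps)
   also have "... <= E * (H0 * exp (dorb z))" using dorb_ge_height[OF b(1,2) z(1)] E by (intro mult_left_mono) auto
   finally have "K1 * (abs (Re ?p - Re ?q) + Im ?p + Im ?q) <= K1 * (E * (H0 * exp (dorb z)))" using K1(1) by (intro mult_left_mono) auto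
   moreover have "0 <= K1 * (abs (Re ?p - Re ?q) + Im ?p + Im ?q)" using K1(1) b z by (intro mult_nonneg_nonneg add_nonneg_nonneg) (auto simp: less_imp_le)
   ultimately have "real l <= K1 * E * H0 * exp (dorb z) + 1" unfolding l_def by simp linarith
   moreover have "(K1 * E * H0 + 2) * exp (dorb z) = K1 * E * H0 * exp (dorb z) + 2 * exp (dorb z)" by (simp add: distrib_right)
   ultimately have "real (l + 1) <= (K1 * E * H0 + 2) * exp (dorb z)" using e1 unfolding of_nat_add of_nat_1 by linarith
   then have "real K2 * real (l + 1) <= real K2 * ((K1 * E * H0 + 2) * exp (dorb z))" by (intro mult_left_mono) auto
   moreover have "lG (hinv g ** g') <= real K2 * real (l + 1)" using K2[OF s] by (metis of_nat_le_iff of_nat_mult)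
   moreover have "real K2 * (K1 * E * H0 + 2) * exp (dorb z) <= K * exp (dorb z)" using M0 by (intro mult_right_mono) (auto simp: K_def)
   ultimately have 1: "lG (hinv g ** g') <= K * exp (dorb z)" unfolding mult.assoc by linarith
   have "real K2 * 1 <= real K2 * (K1 * E * H0 + 2)" using K1 E H0 by (intro mult_left_mono) auto
   then have "real K2 <= K" using M0 by (simp add: K_def)
   then show ?thesis using 1 K2[OF s] by (smt (verit) of_nat_le_iff)
  qed
  then show "lG (hinv g ** g') <= K * exp (dorb z)" "lR (hinv g ** g') <= K" by auto
 qed
qed

text \<open>The relative bound of \<open>SL_len\<close> does not depend on the number of turns, so
  that number may be chosen as large as \<open>same_cusp\<close> demands.\<close>

lemma same_cusp_rel:
 "\<exists>K. \<forall>B\<in>C. \<forall>k\<in>G. \<forall>z z' g g'. 0 < Im z --> 0 < Im z' --> closest z g --> closest z' g' -->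
   2 * H0 <= ht B k z --> 2 * H0 <= ht B k z' --> lenR (hinv g ** g') <= K"
proof -
 obtain K1 where K1: "!!B k z z' g g' l. B : C ==> k : G ==> 0 < Im z ==> 0 < Im z' ==> closest z g ==> closest z' g' ==>
   2 * H0 <= ht B k z ==> 2 * H0 <= ht B k z' ==>
   K1 * (abs (Re (cd B (act k z)) - Re (cd B (act k z'))) + ht B k z + ht B k z') <= real l ==>
   hinv g ** g' : SL l" using same_cusp by blast
 obtain K2 where K2: "!!l s. s : SL l ==> lenG s <= K2 * (l + 1) \<and> lenR s <= K2" using SL_len by blast
 show ?thesis proof (intro exI[of _ K2] ballI allI impI)
  fix B k z z' g g'
  assume a: "B : C" "k : G" "0 < Im z" "0 < Im z'" "closest z g" "closest z' g'"
   "2 * H0 <= ht B k z" "2 * H0 <= ht B k z'"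
  show "lenR (hinv g ** g') <= K2" using K2[OF K1[OF a real_nat_ceiling_ge]] by blast
 qed
qed

end

subsection \<open>Projection to a geodesic\<close>

text \<open>A matrix \<open>M\<close> stands for the oriented geodesic that it carries to the
  imaginary axis: \<open>ap M\<close> is its unit speed parametrization, \<open>pr M\<close> the
  time of the nearest point and \<open>rho M\<close> the distance to it.\<close>

definition ap :: "real^2^2 => real => complex" where "ap M t = act (hinv M) (iax t)"

definition pr :: "real^2^2 => complex => real" where "pr M z = ln (cmod (act M z))"

definition rho :: "real^2^2 => complex => real" where "rho M z = abs (fr (act M z))"

lemma ap_upper [simp]: "M : SL2 ==> 0 < Im (ap M t)" by (simp add: ap_def)

lemma act_ap [simp]: "M : SL2 ==> act M (ap M t) = iax t" by (simp add: ap_def)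

lemma ap_eqI: "M : SL2 ==> 0 < Im z ==> act M z = iax t ==> ap M t = z" by (metis act_inv(1) ap_def)

lemma ap_dist [simp]: "M : SL2 ==> dH (ap M s) (ap M t) = abs (s - t)" by (simp add: ap_def)

lemma pr_ap [simp]: "M : SL2 ==> pr M (ap M t) = t" by (simp add: pr_def)

lemma rho_nonneg [simp]: "0 <= rho M z" by (simp add: rho_def)

lemma pr_lipschitz: "M : SL2 ==> 0 < Im z ==> 0 < Im w ==> abs (pr M z - pr M w) <= dH z w"
 using ln_cmod_lipschitz[of "act M z" "act M w"] by (simp add: pr_def)

lemma dist_fermi: assumes "M : SL2" "0 < Im z" "0 < Im w" shows "cosh (rho M z) * cosh (rho M w) * (cosh (pr M z - pr M w) - 1) <= cosh (dH z w) - 1"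
 using fermi_gap[of "act M z" "act M w"] assms by (simp add: pr_def rho_def)

lemma dist_foot: "M : SL2 ==> 0 < Im z ==> dH z (ap M (pr M z)) = rho M z"
proof -
 assume a: "M : SL2" "0 < Im z"
 have n: "act M z ~= 0" using Im_act_pos[OF a] by auto
 have "cosh (dH (act M z) (iax (pr M z))) = cosh (rho M z)" using a by (subst cosh_fermi) (simp_all add: pr_def rho_def)
 then have "dH (act M z) (iax (pr M z)) = rho M z" using a by simp
 then show ?thesis using dH_act[of M z "ap M (pr M z)"] a by simp
qed

lemma dist_ap_le: "M : SL2 ==> 0 < Im z ==> dH z (ap M t) <= rho M z + abs (pr M z - t)"
 using dH_triangle[of z "ap M (pr M z)" "ap M t"] dist_foot[of M z] by simp

text \<open>In a right-angled triangle the hyperbolic cosines multiply, so the length of the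
  hypotenuse is the sum of the legs up to a constant; here 2 works because
  \<open>4 <= exp 2\<close>.\<close>

lemma dist_ap_ge: assumes "M : SL2" "0 < Im z" shows "rho M z + abs (pr M z - t) - 2 <= dH z (ap M t)"
proof -
 have n: "act M z ~= 0" using Im_act_pos[OF assms] by auto
 have "exp (rho M z) / 2 * (exp (abs (pr M z - t)) / 2) <= cosh (rho M z) * cosh (abs (pr M z - t))" by (intro mult_mono cosh_ge_exp_half) auto
 also have "... = cosh (dH (act M z) (iax t))" using assms by (subst cosh_fermi) (simp_all add: pr_def rho_def)
 also have "dH (act M z) (iax t) = dH z (ap M t)" using dH_act[of M z "ap M t"] assms by simp
 also have "cosh (dH z (ap M t)) <= exp (dH z (ap M t))" using assms by (intro cosh_le_exp) simp
 finally have "exp (rho M z + abs (pr M z - t)) <= 4 * exp (dH z (ap M t))" by (simp add: exp_add)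
 also have "... <= exp 2 * exp (dH z (ap M t))" proof -
  have "(4::real) <= exp 2" using mult_mono[of 2 "exp 1" 2 "exp (1::real)"] exp_ge_add_one_self[of "1::real"] by (simp flip: exp_add)
  then show ?thesis by (intro mult_right_mono) auto
 qed
 also have "... = exp (2 + dH z (ap M t))" by (simp add: exp_add)
 finally show ?thesis by simp
qed

lemma rho_lipschitz: assumes "M : SL2" "0 < Im z" "0 < Im w" shows "rho M z <= rho M w + dH z w"
proof -
 have "1 * cosh (fr (act M z) - fr (act M w)) <= cosh (dH (act M z) (act M w))" proof -
  have "0 <= cosh (fr (act M z)) * cosh (fr (act M w)) * (cosh (ln (cmod (act M z)) - ln (cmod (act M w))) - 1)" by (simp add: cosh_real_ge_1)
  then show ?thesis using assms by (subst cosh_fermi) (auto simp: cosh_diff algebra_simps)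
 qed
 then have "cosh (abs (fr (act M z) - fr (act M w))) <= cosh (dH z w)" using assms by simp
 then have "abs (fr (act M z) - fr (act M w)) <= dH z w" using assms by (simp add: cosh_real_nonneg_le_iff del: cosh_real_abs)
 then show ?thesis by (simp add: rho_def)
qed

lemma cosh_ge_square: "1 + x^2 / 2 <= cosh (x::real)"
proof -
 have ge: "t <= sinh t" if "0 <= t" for t :: real proof -
  have "sinh 0 - 0 <= sinh t - t" using that by (intro DERIV_nonneg_imp_nondecreasing[of 0 t "%t. sinh t - t"])
    (auto intro!: derivative_eq_intros simp: cosh_real_ge_1)
  then show ?thesis by simp
 qed
 have "(sinh (x/2))^2 \<ge> (x/2)^2" proof -
  have "abs (x/2) <= sinh (abs (x/2))" by (rule ge) simp
  also have "... = abs (sinh (x/2))" by (simp add: abs_if)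
  finally show ?thesis by (rule abs_le_square_iff[THEN iffD1])
 qed
 moreover have "cosh x = 1 + 2 * (sinh (x/2))^2" using cosh_double[of "x/2"] by (simp add: cosh_square_eq)
 ultimately show ?thesis by (simp add: power_divide)
qed

context cusped
begin

definition hgt :: "real^2^2 => real => real" where "hgt M t = exp (dorb (ap M t))"

text \<open>At depth \<open>r\<close> in a cusp a unit of arc length costs about \<open>exp r\<close> generators, so the increments of \<open>F\<close> measure
 the word length along the geodesic.\<close>

definition antider :: "real^2^2 => (real => real) => bool" where
 "antider M F \<longleftrightarrow> (\<forall>t. (F has_real_derivative hgt M t) (at t))"

lemma hgt_ge_1: "M : SL2 ==> 1 <= hgt M t" by (simp add: hgt_def dorb_nonneg)

lemma hgt_le: assumes "M : SL2" shows "hgt M s <= exp (abs (s - t)) * hgt M t"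
proof -
 have "dorb (ap M s) <= dorb (ap M t) + abs (s - t)" using dorb_lipschitz[of "ap M s" "ap M t"] assms by simp
 then have "hgt M s <= exp (abs (s - t) + dorb (ap M t))" by (simp add: hgt_def)
 then show ?thesis by (simp add: hgt_def exp_add)
qed

lemma antider_exists: assumes M: "M : SL2" shows "\<exists>F. antider M F"
proof -
 have "isCont (%t. dorb (ap M t)) x" for x proof -
  have "abs (dorb (ap M t) - dorb (ap M x)) <= abs (t - x)" for t
   using dorb_lipschitz[of "ap M t" "ap M x"] dorb_lipschitz[of "ap M x" "ap M t"] M by simp
  then show ?thesis unfolding isCont_def LIM_def dist_real_def by (meson le_less_trans)
 qed
 then have "isCont (hgt M) x" for x unfolding hgt_def by (intro continuous_intros) auto
 then obtain F where "\<forall>x::real. -\<infinity> < ereal x --> ereal x < \<infinity> --> (F has_vector_derivative hgt M x) (at x)"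
  using einterval_antiderivative[of "-\<infinity>" "\<infinity>" "hgt M"] by auto
 then show ?thesis by (auto simp: antider_def has_real_derivative_iff_has_vector_derivative)
qed

lemma antider_mvt: assumes "antider M F" "a <= b" shows "\<exists>c. a <= c \<and> c <= b \<and> F b - F a = (b - a) * hgt M c"
proof (cases "a = b")
 case False
 then obtain c where "a < c" "c < b" "F b - F a = (b - a) * hgt M c" using MVT2[of a b F "hgt M"] assms by (auto simp: antider_def)
 then show ?thesis by (intro exI[of _ c]) auto
qed auto

lemma antider_mono: assumes M: "M : SL2" and P: "antider M F" "a <= b" shows "b - a <= F b - F a"
proof -
 obtain c where "F b - F a = (b - a) * hgt M c" using antider_mvt[OF P] by blast
 then show ?thesis using mult_left_mono[OF hgt_ge_1[OF M, of c], of "b - a"] P by simp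
qed

lemma antider_unit: assumes M: "M : SL2" and P: "antider M F" and t: "a <= t" "t <= b" "a + 1 <= b" shows "hgt M t <= exp 1 * (F b - F a)"
proof -
 \<comment> \<open>The unit interval from \<open>s\<close> contains \<open>t\<close> and stays
   inside the interval from \<open>a\<close> to \<open>b\<close>.\<close>
 define s where "s = max a (t - 1)"
 have s: "a <= s" "s + 1 <= b" "s <= t" "t <= s + 1" using t by (auto simp: s_def)
 obtain c where c: "s <= c" "c <= s + 1" "F (s + 1) - F s = hgt M c" using antider_mvt[OF P, of s "s + 1"] by auto
 have "hgt M t <= exp (abs (t - c)) * hgt M c" by (rule hgt_le[OF M])
 also have "... <= exp 1 * hgt M c" using c s hgt_ge_1[OF M, of c] by (intro mult_right_mono) auto
 also have "hgt M c <= F b - F a" using c(3) antider_mono[OF M P, of a s] antider_mono[OF M P, of "s + 1" b] s by simp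
 finally show ?thesis by simp
qed

lemma generator_dist: "\<exists>D>0. \<forall>s\<in>A \<union> hinv ` A. dH x0 (act s x0) <= D"
proof -
 define D where "D = (\<Sum>s\<in>A. dH x0 (act s x0)) + 1"
 have AG: "s : G" if "s : A" for s using that A_G by auto
 have a: "dH x0 (act s x0) <= D" if "s : A" for s using member_le_sum[of s A "%s. dH x0 (act s x0)"] that finite_A AG by (force simp: D_def)
 have b: "dH x0 (act (hinv s) x0) <= D" if "s : A" for s using a[OF that] dH_act_left[of s x0 x0] AG[OF that] by (simp add: dH_commute)
 have "0 <= (\<Sum>s\<in>A. dH x0 (act s x0))" using AG by (intro sum_nonneg) auto
 then show ?thesis using a b by (intro exI[of _ D]) (auto simp: D_def)
qed

text \<open>A path along the orbit that stays at distance \<open>r\<close> from a point of the geodesic moves its projection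
 slowly, by a factor \<open>exp (- r)\<close>, near that point.\<close>

lemma orbit_path_lower:
 "\<exists>K>0. \<forall>M F g g'. M : SL2 --> antider M F --> g : G --> g' : G -->
   abs (F (pr M (act g' x0)) - F (pr M (act g x0))) <= K * lG (hinv g ** g')"
proof -
 obtain D where D: "0 < D" "!!s. s : A \<union> hinv ` A ==> dH x0 (act s x0) <= D" using generator_dist by blast
 define c where "c = 8 * cosh D * exp D"
 have c1: "1 <= c" using mult_mono[of 1 "8 * cosh D" 1 "exp D"] cosh_real_ge_1[of D] D by (simp add: c_def)
 define K where "K = c * exp D"
 have K: "0 < K" using c1 by (simp add: K_def)
 have step: "abs (F (pr M (act (g ** s) x0)) - F (pr M (act g x0))) <= K"
  if M: "M : SL2" and P: "antider M F" and g: "g : G" and s: "s : A \<union> hinv ` A" for M F g s proof -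
  have sG: "s : G" using s A_G by auto
  define z where "z = act g x0"
  define w where "w = act (g ** s) x0"
  have u: "0 < Im z" "0 < Im w" using g sG by (simp_all add: z_def w_def)
  have d: "dH z w <= D" using D(2)[OF s] g sG by (simp add: z_def w_def act_mult)
  define r where "r = rho M z"
  define T where "T = abs (pr M z - pr M w)"
  have T: "T <= D" using pr_lipschitz[OF M u] d by (simp add: T_def)
  have "exp r / 2 * (exp (r - D) / 2) <= cosh (rho M z) * cosh (rho M w)" proof (rule mult_mono)
   show "exp r / 2 <= cosh (rho M z)" unfolding r_def by (rule cosh_ge_exp_half)
   have "exp (r - D) <= exp (rho M w)" using rho_lipschitz[OF M u] d by (simp add: r_def)
   then show "exp (r - D) / 2 <= cosh (rho M w)" using cosh_ge_exp_half[of "rho M w"] by linarith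
  qed auto
  moreover have "T^2 / 2 <= cosh (pr M z - pr M w) - 1" using cosh_ge_square[of "pr M z - pr M w"] by (simp add: T_def)
  ultimately have "exp r / 2 * (exp (r - D) / 2) * (T^2 / 2) <= cosh (rho M z) * cosh (rho M w) * (cosh (pr M z - pr M w) - 1)"
   by (rule mult_mono) auto
  also have "... <= cosh (dH z w) - 1" by (rule dist_fermi[OF M u])
  also have "... <= cosh D" using d u cosh_real_nonneg_le_iff[of "dH z w" D] D by simp
  finally have "(exp r)^2 * T^2 <= c" by (simp add: c_def exp_diff power2_eq_square field_simps)
  also have "... <= c^2" using c1 by (simp add: power2_eq_square)
  finally have "(exp r * T)^2 <= c^2" by (simp add: power_mult_distrib)
  then have rd: "exp r * T <= c" by (rule power2_le_imp_le) (use c1 in linarith)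
  define a where "a = min (pr M z) (pr M w)"
  define b where "b = max (pr M z) (pr M w)"
  have ab: "a <= b" "b - a = T" by (auto simp: a_def b_def T_def)
  obtain e where e: "a <= e" "e <= b" "F b - F a = (b - a) * hgt M e" using antider_mvt[OF P ab(1)] by blast
  \<comment> \<open>By \<open>rd\<close> the projection moves by at most
    \<open>c * exp (- r)\<close>, while an orbit point at distance \<open>r\<close> from its foot
    forces the depth there to be at most \<open>r\<close>. So \<open>F\<close> changes by a bounded
    amount per generator.\<close>
  have "hgt M e <= exp (abs (e - pr M z)) * hgt M (pr M z)" by (rule hgt_le[OF M])
  also have "... <= exp D * exp r" proof (rule mult_mono)
   have "abs (e - pr M z) <= T" using e(1,2) unfolding a_def b_def T_def by (smt (verit))
   then show "exp (abs (e - pr M z)) <= exp D" using T by simp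
   have "dorb (ap M (pr M z)) <= dorb z + rho M z" using dorb_lipschitz[of "ap M (pr M z)" z] u M dist_foot[OF M u(1)] by (simp add: dH_commute)
   moreover have "dorb z = 0" using g by (simp add: z_def)
   ultimately show "hgt M (pr M z) <= exp r" by (simp add: hgt_def r_def)
  qed (use hgt_ge_1[OF M, of "pr M z"] in auto)
  finally have "F b - F a <= T * (exp D * exp r)" unfolding e(3) ab(2) by (intro mult_left_mono) (auto simp: T_def)
  also have "... <= K" using mult_right_mono[OF rd, of "exp D"] by (simp add: K_def mult_ac)
  finally have "F b - F a <= K" .
  moreover have "abs (F (pr M w) - F (pr M z)) = F b - F a" using antider_mono[OF M P ab(1)] ab by (auto simp: a_def b_def)
  ultimately show ?thesis by (simp add: z_def w_def)
 qed
 have path: "abs (F (pr M (act (g ** lp w) x0)) - F (pr M (act g x0))) <= K * real (length w)"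
  if M: "M : SL2" and P: "antider M F" and g: "g : G" and w: "set w \<subseteq> A \<union> hinv ` A" for M F g w using g w
 proof (induction w arbitrary: g)
  case (Cons s w)
  have sG: "g ** s : G" using Cons.prems A_G by auto
  have "abs (F (pr M (act ((g ** s) ** lp w) x0)) - F (pr M (act (g ** s) x0))) <= K * real (length w)" using Cons sG by simp
  moreover have "abs (F (pr M (act (g ** s) x0)) - F (pr M (act g x0))) <= K" using Cons.prems by (intro step[OF M P]) auto
  ultimately show ?case by (simp add: matrix_mul_assoc algebra_simps)
 qed (use K in simp)
 show ?thesis proof (intro exI[of _ K] conjI K allI impI)
  fix M F g g' assume a: "M : SL2" "antider M F" "g : G" "g' : G"
  obtain w where w: "length w = lenG (hinv g ** g')" "set w \<subseteq> A \<union> hinv ` A" "hinv g ** g' = lp w"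
   using A.len_word[of "hinv g ** g'"] a by auto
  have "g ** lp w = g'" using a by (simp flip: w(3))
  then show "abs (F (pr M (act g' x0)) - F (pr M (act g x0))) <= K * lG (hinv g ** g')" using path[OF a(1-3) w(2)] w(1) by simp
 qed
qed

text \<open>Each short step costs at most a multiple of \<open>hgt\<close> by
  \<open>local_length\<close>, and \<open>antider_unit\<close> dominates this by the increment of
  \<open>F\<close> over the same step.\<close>

lemma geodesic_upper:
 "\<exists>K>0. \<forall>M F t t' g g'. M : SL2 --> antider M F --> t + 1 <= t' --> closest (ap M t) g --> closest (ap M t') g' -->
   lG (hinv g ** g') <= K * (F t' - F t)"
proof -
 obtain K where K: "0 < K" "!!z z' g g'. 0 < Im z ==> 0 < Im z' ==> dH z z' <= 2 ==> closest z g ==> closest z' g' ==>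
   lG (hinv g ** g') <= K * exp (dorb z)" using local_length[of 2] by blast
 have main: "lG (hinv g ** g') <= K * exp 1 * (F (t + real n * d) - F t)"
  if M: "M : SL2" and P: "antider M F" and d: "1 <= d" "d <= 2" and n: "1 <= n"
   and g: "closest (ap M t) g" "closest (ap M (t + real n * d)) g'" for M F d n t g g' proof -
  have one: "lG (hinv g ** g') <= K * exp 1 * (F (t + d) - F t)"
   if "closest (ap M t) g" "closest (ap M (t + d)) g'" for t g g' proof -
   have "lG (hinv g ** g') <= K * hgt M t" unfolding hgt_def using that M d by (intro K(2)) auto
   also have "... <= K * (exp 1 * (F (t + d) - F t))" using antider_unit[OF M P, of t t "t + d"] d K(1) by (intro mult_left_mono) auto
   finally show ?thesis by simp
  qed
  show ?thesis using n g proof (induction n arbitrary: g' rule: nat_induct_at_least)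
   case base then show ?case using one by simp
  next
   case (Suc n)
   obtain h where h: "closest (ap M (t + real n * d)) h" using closest_exists M by (meson ap_upper)
   have e: "t + real n * d + d = t + real (Suc n) * d" by (simp add: algebra_simps)
   have "lG (hinv g ** g') <= lG (hinv g ** h) + lG (hinv h ** g')"
    using A.len_quot[of g h g'] Suc.prems h closestD(1) by (metis of_nat_add of_nat_le_iff)
   also have "... <= K * exp 1 * (F (t + real n * d) - F t) + K * exp 1 * (F (t + real n * d + d) - F (t + real n * d))"
   proof (intro add_mono one Suc.IH h)
    show "closest (ap M t) g" "closest (ap M (t + real n * d + d)) g'" using Suc.prems by (simp_all only: e)
   qed
   also have "... = K * exp 1 * (F (t + real (Suc n) * d) - F t)" unfolding e by (simp add: algebra_simps)
   finally show ?case .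
  qed
 qed
 show ?thesis proof (intro exI[of _ "K * exp 1"] conjI allI impI)
  fix M F t t' g g'
  assume a: "M : SL2" "antider M F" "t + 1 <= t'" "closest (ap M t) g" "closest (ap M t') g'"
  define n where "n = nat \<lfloor>t' - t\<rfloor>"
  have n: "1 <= n" "real n <= t' - t" "t' - t <= real n + 1" using a(3) unfolding n_def by linarith+
  \<comment> \<open>Equal steps of length between 1 and 2: at least 1 for
    \<open>antider_unit\<close>, at most 2 for \<open>local_length\<close>.\<close>
  define d where "d = (t' - t) / real n"
  have "1 <= d" "d <= 2" "t + real n * d = t'" using n by (auto simp: d_def field_simps)
  then show "lG (hinv g ** g') <= K * exp 1 * (F t' - F t)" using main[OF a(1,2) _ _ n(1) a(4), of d g'] a(5) by simp
 qed (use K in simp)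
qed

lemma rel_upper:
 "\<exists>K>0. \<forall>M t t' g g'. M : SL2 --> t <= t' --> closest (ap M t) g --> closest (ap M t') g' -->
   lR (hinv g ** g') <= K * (t' - t + 1)"
proof -
 obtain K where K: "0 < K" "!!z z' g g'. 0 < Im z ==> 0 < Im z' ==> dH z z' <= 1 ==> closest z g ==> closest z' g' ==>
   lR (hinv g ** g') <= K" using local_length[of 1] by blast
 have main: "lR (hinv g ** g') <= K * real (Suc n)"
  if M: "M : SL2" and n: "t <= t'" "t' <= t + real (Suc n)" and g: "closest (ap M t) g" "closest (ap M t') g'" for M n t t' g g' using n g
 proof (induction n arbitrary: t' g')
  case 0 then show ?case using M by (simp add: K(2)[of "ap M t" "ap M t'"])
 next
  case (Suc n)
  define s where "s = max t (t' - 1)"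
  obtain h where h: "closest (ap M s) h" using closest_exists M by (meson ap_upper)
  have "lR (hinv g ** g') <= lR (hinv g ** h) + lR (hinv h ** g')"
   using R.len_quot[of g h g'] Suc.prems h closestD(1) by (metis of_nat_add of_nat_le_iff)
  also have "... <= K * real (Suc n) + K" using Suc h M by (intro add_mono Suc.IH[of s] K(2)[of "ap M s" "ap M t'"]) (auto simp: s_def)
  finally show ?case by (simp add: algebra_simps)
 qed
 show ?thesis proof (intro exI[of _ "2 * K"] conjI allI impI)
  fix M t t' g g'
  assume a: "M : SL2" "t <= t'" "closest (ap M t) g" "closest (ap M t') g'"
  define n where "n = nat \<lfloor>t' - t\<rfloor>"
  have n: "t' <= t + real (Suc n)" "real n <= t' - t" using a(2) unfolding n_def by linarith+
  have "lR (hinv g ** g') <= K * real (Suc n)" by (rule main[OF a(1,2) n(1) a(3,4)])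
  also have "... <= K * (2 * (t' - t + 1))" using n K(1) by (intro mult_left_mono) auto
  finally show "lR (hinv g ** g') <= 2 * K * (t' - t + 1)" by (simp add: algebra_simps)
 qed (use K in simp)
qed

text \<open>A point almost between two orbit points is near the segment joining them. The part of
  the segment before it costs no more than the integral of \<open>hgt\<close> over the whole, which
  by \<open>orbit_path_lower\<close> is at most a multiple of the word length between the
  ends.\<close>

lemma between_length:
 "\<exists>K>0. \<forall>k g p h. k : G --> g : G --> 0 < Im p --> closest p h -->
   dH (act k x0) p + dH p (act g x0) <= dH (act k x0) (act g x0) + c -->
   lG (hinv k ** h) <= K * (lG (hinv k ** g) + 1)"
proof -
 define c' where "c' = abs c + 4"
 obtain K1 where K1: "0 < K1" "!!M F g g'. M : SL2 ==> antider M F ==> g : G ==> g' : G ==>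
   abs (F (pr M (act g' x0)) - F (pr M (act g x0))) <= K1 * lG (hinv g ** g')" using orbit_path_lower by blast
 obtain K2 where K2: "0 < K2" "!!M F t t' g g'. M : SL2 ==> antider M F ==> t + 1 <= t' ==> closest (ap M t) g ==>
   closest (ap M t') g' ==> lG (hinv g ** g') <= K2 * (F t' - F t)" using geodesic_upper by blast
 obtain K3 where K3: "0 < K3" "!!z z' g g'. 0 < Im z ==> 0 < Im z' ==> dH z z' <= 2 * c' + 1 ==> closest z g ==> closest z' g' ==>
   lG (hinv g ** g') <= K3 * exp (dorb z)" using local_length[of "2 * c' + 1"] by blast
 define K where "K = K3 * (exp 1 * K1 + exp 1 + 1) + K2 * K1"
 have K: "0 < K" using K1(1) K2(1) K3(1) by (simp add: K_def add_pos_pos)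
 show ?thesis proof (intro exI[of _ K] conjI K allI impI)
  fix k g p h
  assume k: "k : G" and g: "g : G" and p: "0 < Im p" "closest p h" and b: "dH (act k x0) p + dH p (act g x0) <= dH (act k x0) (act g x0) + c"
  define T where "T = dH (act k x0) (act g x0)"
  have T0: "0 <= T" using k g by (simp add: T_def)
  obtain M where M: "M : SL2" "act M (act k x0) = \<i>" "act M (act g x0) = iax T" using to_iax[of "act k x0" "act g x0"] k g by (auto simp: T_def)
  have ak: "ap M 0 = act k x0" using M k by (intro ap_eqI) (auto simp: iax_zero)
  have ag: "ap M T = act g x0" using M g by (intro ap_eqI) auto
  obtain F where P: "antider M F" using antider_exists M by blast
  define N where "N = lG (hinv k ** g)"
  have "abs (F (pr M (act g x0)) - F (pr M (act k x0))) <= K1 * N" unfolding N_def by (rule K1(2)[OF M(1) P k g])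
  then have PT: "F T - F 0 <= K1 * N" using M(1) unfolding ak[symmetric] ag[symmetric] by simp
  define t where "t = pr M p"
  have "rho M p + abs (t - 0) - 2 <= dH p (ap M 0)" "rho M p + abs (t - T) - 2 <= dH p (ap M T)" unfolding t_def by (rule dist_ap_ge[OF M(1) p(1)])+
  then have bb: "2 * rho M p + abs t + abs (t - T) <= T + c + 4" using b unfolding ak ag T_def[symmetric] by (simp add: dH_commute)
  define s where "s = max 0 (min t T)"
  have s: "0 <= s" "s <= T" using T0 by (auto simp: s_def)
  have "abs (t - s) <= c'" "rho M p <= c'" using bb T0 rho_nonneg[of M p] unfolding s_def c'_def by (smt (verit))+
  then have pd: "dH p (ap M s) <= 2 * c'" using dist_ap_le[OF M(1) p(1), of s] by (simp add: t_def)
  obtain h' where h': "closest (ap M s) h'" using closest_exists M by (meson ap_upper)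
  have ck: "closest (ap M 0) k" "closest (ap M T) g" unfolding ak ag using closest_orbit k g by auto
  have c1: "1 <= 2 * c' + 1" by (simp add: c'_def)
  \<comment> \<open>The depth at the foot is the price of the last move from the segment to
    \<open>p\<close>. It is dominated by the integral, or by \<open>exp 1\<close> if the segment is
    shorter than 1, since it starts on the orbit.\<close>
  have "hgt M s <= exp 1 * (K1 * N) + exp 1" proof (cases "1 <= T")
   case True
   then have "hgt M s <= exp 1 * (F T - F 0)" using s by (intro antider_unit[OF M(1) P]) auto
   also have "... <= exp 1 * (K1 * N)" using PT by (intro mult_left_mono) auto
   finally show ?thesis by (simp add: add_increasing2)
  next
   case False
   have "dorb (ap M s) <= dorb (ap M 0) + s" using dorb_lipschitz[of "ap M s" "ap M 0"] M s by simp
   then have "hgt M s <= exp 1" using False s k by (simp add: hgt_def ak)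
   moreover have "0 <= exp 1 * (K1 * N)" using K1(1) by (simp add: N_def)
   ultimately show ?thesis by linarith
  qed
  moreover have "lG (hinv h' ** h) <= K3 * hgt M s" unfolding hgt_def using M pd p h' by (intro K3(2)) (auto simp: dH_commute)
  ultimately have l1: "lG (hinv h' ** h) <= K3 * (exp 1 * (K1 * N) + exp 1)" using K3(1) by (meson mult_left_mono less_imp_le order_trans)
  have l2: "lG (hinv k ** h') <= K2 * (K1 * N) + K3" proof (cases "1 <= s")
   case True
   have "lG (hinv k ** h') <= K2 * (F s - F 0)" using True by (intro K2(2)[OF M(1) P _ ck(1) h']) simp
   also have "... <= K2 * (K1 * N)" using antider_mono[OF M(1) P s(2)] s PT K2(1) by (intro mult_left_mono) auto
   finally show ?thesis using K3(1) by simp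
  next
   case False
   have "lG (hinv k ** h') <= K3 * exp (dorb (ap M 0))" using M False s c1 by (intro K3(2)[OF _ _ _ ck(1) h']) auto
   moreover have "0 <= K2 * (K1 * N)" using K1(1) K2(1) by (simp add: N_def)
   ultimately show ?thesis using k by (simp add: ak)
  qed
  have "lG (hinv k ** h) <= lG (hinv k ** h') + lG (hinv h' ** h)" using A.len_quot[of k h' h] k h' p closestD(1) by (metis of_nat_add of_nat_le_iff)
  also have "... <= K2 * (K1 * N) + K3 + K3 * (exp 1 * (K1 * N) + exp 1)" using l1 l2 by linarith
  also have "... <= K * (N + 1)" proof -
   have "0 <= K2 * K1 + K3 * exp 1 * K1 + K3 * exp 1 * N + K3 * N" using K1(1) K2(1) K3(1) by (simp add: N_def)
   then show ?thesis by (simp add: K_def algebra_simps)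
  qed
  finally show "lG (hinv k ** h) <= K * (lG (hinv k ** g) + 1)" by (simp add: N_def)
 qed
qed

end

section \<open>A lower bound for the relative length\<close>

lemma nat_interval_card: assumes "0 <= c"
 shows "finite {i::nat. abs (real i - a) <= c} \<and> card {i::nat. abs (real i - a) <= c} <= nat \<lfloor>2 * c\<rfloor> + 1"
proof (cases "{i::nat. abs (real i - a) <= c} = {}")
 case True
 show ?thesis unfolding True by simp
next
 case False
 let ?S = "{i::nat. abs (real i - a) <= c}"
 define m where "m = (LEAST i. i : ?S)"
 have m: "m : ?S" using False unfolding m_def by (metis (mono_tags, lifting) LeastI_ex ex_in_conv)
 have sub: "?S \<subseteq> {m..m + nat \<lfloor>2 * c\<rfloor>}" proof
  fix i assume i: "i : ?S"
  have "m <= i" using i unfolding m_def by (rule Least_le)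
  moreover have "real i - real m <= 2 * c" using i m by auto
  then have "int i - int m <= \<lfloor>2 * c\<rfloor>" by (simp add: le_floor_iff)
  ultimately show "i : {m..m + nat \<lfloor>2 * c\<rfloor>}" by auto
 qed
 then show ?thesis using card_mono[OF _ sub] finite_subset[OF sub] by simp
qed

context cusped
begin

text \<open>The geodesic between the two ends of a parabolic jump rises high into the horoball. A
  point of bounded height must therefore be near one end: it is horizontally at least half the jump
  away from the other end, and that distance already uses up the length of the segment up to a
  constant.\<close>

lemma parabolic_deep:
 "\<exists>c\<ge>1. \<forall>M u B s i. M : SL2 --> u : G --> B : C --> s : set_stabilizer G B -->
   min (pr M (act u x0)) (pr M (act (u ** s) x0)) <= i --> i <= max (pr M (act u x0)) (pr M (act (u ** s) x0)) -->
   dorb (ap M i) <= R --> abs (i - pr M (act u x0)) <= c \<or> abs (i - pr M (act (u ** s) x0)) <= c"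
proof -
 define cB where "cB = (%B. ln (640 * (H0 * exp R) / Im (cd B x0)))"
 define c where "c = (\<Sum>B\<in>C. abs (cB B)) + 1"
 have c: "cB B <= c" if "B : C" for B using member_le_sum[OF that, of "%B. abs (cB B)"] finite_C by (simp add: c_def)
 have c1: "1 <= c" by (simp add: c_def)
 show ?thesis proof (intro exI[of _ c] conjI c1 allI impI)
  fix M u B s i
  assume M: "M : SL2" and u: "u : G" and B: "B : C" and s: "s : set_stabilizer G B"
  define z where "z = act u x0"
  define w where "w = act (u ** s) x0"
  define p where "p = ap M i"
  assume i: "min (pr M (act u x0)) (pr M (act (u ** s) x0)) <= i" "i <= max (pr M (act u x0)) (pr M (act (u ** s) x0))" and d: "dorb (ap M i) <= R"
  define a where "a = pr M z"
  define b where "b = pr M w"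
  have sG: "s : G" using s stab_G by blast
  have up: "0 < Im z" "0 < Im w" "0 < Im p" using u sG M by (simp_all add: z_def w_def p_def)
  have ab: "abs (i - a) + abs (i - b) = abs (a - b)" using i unfolding a_def b_def z_def w_def by (smt (verit))
  have "abs (i - a) <= c \<or> abs (i - b) <= c" proof (cases "abs (a - b) < 1")
   case True then show ?thesis using ab c1 by linarith
  next
   case False
   define T where "T = abs (a - b)"
   have T: "1 <= T" using False by (simp add: T_def)
   have "exp T / 8 <= cosh (a - b) - 1" proof -
    have "exp 1 <= exp T" using T by simp
    moreover have "5 / 2 <= exp (1::real)" using exp_lower_Taylor_quadratic[of "1::real"] by simp
    moreover have "8/3 <= exp (1::real)" proof -
     have "(\<Sum>n<4. 1 ^ n /\<^sub>R fact n) <= exp (1::real)" unfolding exp_def by (intro sum_le_suminf summable_exp_generic) auto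
     then show ?thesis by (simp add: eval_nat_numeral)
    qed
    moreover have "exp T / 2 <= cosh (a - b)" using cosh_ge_exp_half[of T] by (simp add: T_def)
    ultimately show ?thesis by linarith
   qed
   then have "exp (rho M z) / 2 * (exp (rho M w) / 2) * (exp T / 8)
     <= cosh (rho M z) * cosh (rho M w) * (cosh (a - b) - 1)" by (intro mult_mono cosh_ge_exp_half) auto
   also have "... <= cosh (dH z w) - 1" using dist_fermi[OF M up(1,2)] by (simp add: a_def b_def)
   finally have e1: "exp (rho M z + rho M w + T) <= 32 * cosh (dH z w)" by (simp add: exp_add)
   have dzp: "dH z p <= rho M z + abs (i - a)" "dH w p <= rho M w + abs (i - b)"
    using dist_ap_le[OF M up(1), of i] dist_ap_le[OF M up(2), of i] by (simp_all add: p_def a_def b_def)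
   have "exp (dH z p + dH w p) <= exp (rho M z + rho M w + T)" using dzp ab by (simp add: T_def)
   then have e2: "exp (dH z p) * exp (dH w p) <= 32 * cosh (dH z w)" using e1 by (simp add: exp_add)
   obtain t where t: "!!v. 0 < Im v ==> cd B (act s v) = cd B v + of_real t" using stab_translation[OF B s] by blast
   define j where "j = cd B x0"
   define P where "P = cd B (act (hinv u) p)"
   have im: "0 < Im j" "0 < Im P" using B u up by (simp_all add: j_def P_def)
   have cz: "dH z p = dH j P" "dH w p = dH (j + of_real t) P" "dH z w = dH j (j + of_real t)" proof -
    show "dH z p = dH j P" using B u up by (simp add: z_def j_def P_def dH_act_left)
    have e: "cd B (act s x0) = j + of_real t" using t[of x0] by (simp add: j_def)
    show "dH w p = dH (j + of_real t) P" unfolding e[symmetric] using B u sG up by (simp add: w_def P_def dH_act_left act_mult)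
    show "dH z w = dH j (j + of_real t)" unfolding e[symmetric] using B u sG by (simp add: z_def w_def j_def act_mult)
   qed
   define y0 where "y0 = Im j"
   define y where "y = Im P"
   have y: "0 < y0" "0 < y" using im by (simp_all add: y0_def y_def)
   have czw: "cosh (dH z w) = 1 + t^2 / (2 * y0^2)" unfolding cz(3) using im by (subst cosh_hyp_dist) (simp_all add: y0_def power2_eq_square)
   have "5/4 <= cosh (dH z w)" proof -
    have "1 <= dH z w" using pr_lipschitz[OF M up(1,2)] T by (simp add: T_def a_def b_def)
    then have "cosh 1 <= cosh (dH z w)" by (subst cosh_real_nonneg_le_iff) auto
    then show ?thesis using cosh_1_ge by linarith
   qed
   then have ty: "y0^2 <= 2 * t^2" unfolding czw using y by simp
   have e3: "exp (dH z p) * exp (dH w p) <= 80 * t^2 / y0^2" proof -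
    have "32 <= 64 * t^2 / y0^2" using ty y by (simp add: field_simps)
    moreover have "32 * cosh (dH z w) = 32 + 16 * t^2 / y0^2" unfolding czw by simp
    ultimately show ?thesis using e2 by simp
   qed
   have lower: "(Re q - Re P)^2 / (2 * y * y0) <= exp (dH q P)" if "Im q = y0" for q proof -
    have q: "0 < Im q" using that y by simp
    have "(Re q - Re P)^2 / (2 * y * y0) <= (cmod (q - P))^2 / (2 * Im q * Im P)"
     unfolding that y_def[symmetric] using y by (simp add: cmod_power2 divide_right_mono mult_ac)
    also have "... <= cosh (dH q P)" using q im by (simp add: cosh_hyp_dist)
    also have "... <= exp (dH q P)" using q im by (intro cosh_le_exp) simp
    finally show ?thesis .
   qed
   have fin: "r <= cB B" if r: "exp r * (t^2 / (8 * y * y0)) <= 80 * t^2 / y0^2" for r proof -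
    have t0: "0 < t^2" using ty y by (smt (verit) zero_less_power zero_le_power2)
    have "exp r <= 80 * t^2 / y0^2 / (t^2 / (8 * y * y0))" using r t0 y by (subst pos_le_divide_eq) auto
    also have "... = 640 * y / y0" proof -
     have "t ~= 0" using t0 by auto
     then show ?thesis by (simp add: power2_eq_square)
    qed
    also have "... <= 640 * (H0 * exp R) / y0" proof -
     have "y <= H0 * exp (dorb p)" unfolding y_def P_def using B u up by (intro dorb_ge_height) auto
     also have "... <= H0 * exp R" using d H0(1) by (simp add: p_def)
     finally show ?thesis using y by (simp add: divide_right_mono)
    qed
    finally have "exp r <= 640 * (H0 * exp R) / Im (cd B x0)" by (simp add: y0_def j_def)
    then have "ln (exp r) <= cB B" unfolding cB_def by (subst ln_le_cancel_iff) (use B H0(1) in auto)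
    then show ?thesis by simp
   qed
   have four: "t^2 / (8 * y * y0) <= x^2 / (2 * y * y0)" if "abs t / 2 <= abs x" for x proof -
    have "(abs t / 2)^2 <= abs x^2" using that by (intro power_mono) auto
    then have "t^2 / 4 / (2 * y * y0) <= x^2 / (2 * y * y0)" using y by (intro divide_right_mono) (auto simp: power_divide)
    then show ?thesis by simp
   qed
   \<comment> \<open>The ends have the same height and are \<open>t\<close> apart horizontally, so
     \<open>P\<close> is at least \<open>abs t / 2\<close> away from one of them.\<close>
   consider "abs t / 2 <= abs (Re j - Re P)" | "abs t / 2 <= abs (Re (j + of_real t) - Re P)" proof -
    have "abs t / 2 <= abs (Re j - Re P) \<or> abs t / 2 <= abs (Re (j + of_real t) - Re P)" unfolding plus_complex.sel Re_complex_of_real by linarith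
    then show ?thesis using that by blast
   qed
   then show ?thesis proof cases
    case 1
    have "t^2 / (8 * y * y0) <= exp (dH z p)" using four[OF 1] lower[of j] by (simp add: y0_def cz)
    then have "exp (dH w p) * (t^2 / (8 * y * y0)) <= exp (dH w p) * exp (dH z p)" by (intro mult_left_mono) auto
    then have "dH w p <= cB B" using e3 by (intro fin) (simp add: mult.commute)
    moreover have "abs (i - b) <= dH w p" using pr_lipschitz[OF M up(2,3)] M by (simp add: p_def b_def)
    ultimately show ?thesis using c[OF B] by linarith
   next
    case 2
    have "t^2 / (8 * y * y0) <= exp (dH w p)" using four[OF 2] lower[of "j + of_real t"] by (simp add: y0_def cz)
    then have "exp (dH z p) * (t^2 / (8 * y * y0)) <= exp (dH z p) * exp (dH w p)" by (intro mult_left_mono) auto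
    then have "dH z p <= cB B" using e3 by (intro fin) simp
    moreover have "abs (i - a) <= dH z p" using pr_lipschitz[OF M up(1,3)] M by (simp add: p_def a_def)
    ultimately show ?thesis using c[OF B] by linarith
   qed
  qed
  then show "abs (i - pr M (act u x0)) <= c \<or> abs (i - pr M (act (u ** s) x0)) <= c" by (simp add: a_def b_def z_def w_def)
 qed
qed

definition thicks :: "real => real^2^2 => real => real => nat set" where
 "thicks R M a b = {i::nat. min a b <= real i \<and> real i <= max a b \<and> dorb (ap M (real i)) <= R}"

text \<open>Each relative letter accounts for boundedly many integer times at which the geodesic is
  near the orbit: a letter of \<open>A\<close> moves the projection little, a parabolic letter is
  covered by \<open>parabolic_deep\<close>. So the number of these times bounds the relative length
  from below.\<close>

lemma thicks_count:
 "\<exists>K. \<forall>M u g. M : SL2 --> u : G --> g : G -->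
   finite (thicks R M (pr M (act u x0)) (pr M (act (u ** g) x0))) \<and>
   card (thicks R M (pr M (act u x0)) (pr M (act (u ** g) x0))) <= K * lenR g + K"
proof -
 obtain D where D: "0 < D" "!!s. s : A \<union> hinv ` A ==> dH x0 (act s x0) <= D" using generator_dist by blast
 obtain c where c: "1 <= c" "!!M u B s i. M : SL2 ==> u : G ==> B : C ==> s : set_stabilizer G B ==>
   min (pr M (act u x0)) (pr M (act (u ** s) x0)) <= i ==> i <= max (pr M (act u x0)) (pr M (act (u ** s) x0)) ==>
   dorb (ap M i) <= R ==> abs (i - pr M (act u x0)) <= c \<or> abs (i - pr M (act (u ** s) x0)) <= c" using parabolic_deep[of R] by blast
 define e where "e = max c D"
 define K where "K = 2 * (nat \<lfloor>2 * e\<rfloor> + 1)"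
 have e0: "0 <= e" using D by (simp add: e_def)
 have step: "finite (thicks R M (pr M (act u x0)) (pr M (act (u ** s) x0))) \<and>
   card (thicks R M (pr M (act u x0)) (pr M (act (u ** s) x0))) <= K"
  if M: "M : SL2" and u: "u : G" and s: "s : rel_generators G A C \<union> hinv ` rel_generators G A C" for M u s proof -
  let ?a = "pr M (act u x0)" and ?b = "pr M (act (u ** s) x0)"
  let ?I = "%x. {i::nat. abs (real i - x) <= e}"
  have sG: "s : G" using s rel_G by auto
  have "thicks R M ?a ?b \<subseteq> ?I ?a \<union> ?I ?b" proof
   fix i assume i: "i : thicks R M ?a ?b"
   consider "s : A \<union> hinv ` A" | B where "B : C" "s : set_stabilizer G B" using s stab_inv by (auto simp: rel_generators_def)
   then show "i : ?I ?a \<union> ?I ?b" proof cases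
    case 1
    have "abs (?a - ?b) <= dH (act u x0) (act (u ** s) x0)" using M u sG by (intro pr_lipschitz) auto
    also have "... <= D" using D(2)[OF 1] u sG by (simp add: act_mult)
    finally have "abs (real i - ?a) <= D" using i unfolding thicks_def by (smt (verit) mem_Collect_eq)
    then show ?thesis by (auto simp: e_def)
   next
    case 2
    then show ?thesis using c(2)[OF M u 2, of "real i"] i by (auto simp: thicks_def e_def)
   qed
  qed
  moreover have "finite (?I ?a \<union> ?I ?b)" "card (?I ?a \<union> ?I ?b) <= K"
   using nat_interval_card[OF e0, of ?a] nat_interval_card[OF e0, of ?b] card_Un_le[of "?I ?a" "?I ?b"] by (simp_all add: K_def)
  ultimately show ?thesis by (meson card_mono finite_subset order_trans)
 qed
 have path: "finite (thicks R M (pr M (act u x0)) (pr M (act (u ** lp w) x0))) \<and>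
   card (thicks R M (pr M (act u x0)) (pr M (act (u ** lp w) x0))) <= K * length w + K"
  if M: "M : SL2" and u: "u : G" and w: "set w \<subseteq> rel_generators G A C \<union> hinv ` rel_generators G A C" for M u w using u w
 proof (induction w arbitrary: u)
  case Nil
  have "thicks R M (pr M (act u x0)) (pr M (act u x0)) \<subseteq> {i::nat. abs (real i - pr M (act u x0)) <= e}" using e0 by (auto simp: thicks_def)
  then have "card (thicks R M (pr M (act u x0)) (pr M (act u x0))) <= card {i::nat. abs (real i - pr M (act u x0)) <= e} \<and>
    finite (thicks R M (pr M (act u x0)) (pr M (act u x0)))" using nat_interval_card[OF e0] by (meson card_mono finite_subset)
  then show ?case using nat_interval_card[OF e0, of "pr M (act u x0)"] by (simp add: K_def)
 next
  case (Cons s w)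
  have sG: "u ** s : G" using Cons.prems rel_G by auto
  let ?a = "pr M (act u x0)" and ?b = "pr M (act (u ** s) x0)" and ?c = "pr M (act ((u ** s) ** lp w) x0)"
  have st: "finite (thicks R M ?a ?b) \<and> card (thicks R M ?a ?b) <= K" using Cons.prems by (intro step M) auto
  have ih: "finite (thicks R M ?b ?c) \<and> card (thicks R M ?b ?c) <= K * length w + K" using Cons sG by simp
  have sub: "thicks R M ?a ?c \<subseteq> thicks R M ?a ?b \<union> thicks R M ?b ?c" by (auto simp: thicks_def)
  have "card (thicks R M ?a ?c) <= card (thicks R M ?a ?b \<union> thicks R M ?b ?c)" using st ih by (intro card_mono sub) auto
  then have "card (thicks R M ?a ?c) <= K * length (s # w) + K" using st ih card_Un_le[of "thicks R M ?a ?b" "thicks R M ?b ?c"] by simp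
  moreover have "finite (thicks R M ?a ?c)" using sub st ih by (meson finite_UnI finite_subset)
  ultimately show ?case by (simp add: matrix_mul_assoc)
 qed
 show ?thesis proof (intro exI[of _ K] allI impI)
  fix M u g assume a: "M : SL2" "u : G" "g : G"
  obtain w where w: "length w = lenR g" "set w \<subseteq> rel_generators G A C \<union> hinv ` rel_generators G A C" "g = lp w"
   using R.len_word[OF a(3)] by blast
  show "finite (thicks R M (pr M (act u x0)) (pr M (act (u ** g) x0))) \<and>
   card (thicks R M (pr M (act u x0)) (pr M (act (u ** g) x0))) <= K * lenR g + K" using path[OF a(1,2) w(2)] unfolding w(3)[symmetric] w(1) .
 qed
qed

end

section \<open>Counting elements by word length and relative length\<close>

context cusped
begin

text \<open>Beyond this depth the height exceeds \<open>2 * H0 * exp 2\<close>; the factor leaves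
  room for a time step at either end of an excursion.\<close>

definition Rt :: real where "Rt = R0 + ln (2 * H0 * exp 2)"

definition FO :: "(real^2^2) set" where "FO = {s : G. dH x0 (act s x0) <= 2 * Rt + 2}"

lemma finite_FO: "finite FO" unfolding FO_def by (rule finite_orbit) auto

lemma Rt_ge: "1 <= Rt"
proof -
 have "exp 1 <= 2 * H0 * exp (2::real)" proof -
  have "1 * exp 2 <= 2 * H0 * exp (2::real)" using H0(1) by (intro mult_right_mono) auto
  moreover have "exp 1 <= exp (2::real)" by simp
  ultimately show ?thesis by linarith
 qed
 then have "ln (exp 1) <= ln (2 * H0 * exp 2)" using H0(1) by (subst ln_le_cancel_iff) auto
 then show ?thesis using R0(1) by (simp add: Rt_def)
qed

lemma one_FO: "mat 1 : FO" using Rt_ge by (simp add: FO_def)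

lemma close_FO: assumes "0 < Im z" "0 < Im w" "closest z g" "closest w h" "dorb z <= Rt" "dorb w <= Rt" "dH z w <= 2" shows "hinv g ** h : FO"
proof -
 note g = closestD[OF assms(3)] and h = closestD[OF assms(4)]
 have "dH x0 (act (hinv g ** h) x0) = dH (act g x0) (act h x0)" using g h by (simp add: act_mult dH_act_left)
 also have "... <= dH (act g x0) z + dH z (act h x0)" using g h assms by (intro dH_triangle) auto
 also have "... <= dH (act g x0) z + (dH z w + dH w (act h x0))" using h assms dH_triangle[of z w "act h x0"] by simp
 also have "... <= 2 * Rt + 2" using g h assms by (simp add: dH_commute[of "act g x0"])
 finally show ?thesis using g h by (simp add: FO_def)
qed

text \<open>Between consecutive integer times near the orbit the geodesic stays in one horoball, so
  the whole excursion is one letter of \<open>SL l\<close>. Horizontal travel and height are sums of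
  increments of \<open>F\<close>, which bounds the number of turns.\<close>

lemma excursion_letter:
 "\<exists>K>0. \<forall>M F i i' g g' l. M : SL2 --> antider M F --> (i::nat) < i' --> dorb (ap M i) <= Rt --> dorb (ap M i') <= Rt -->
   (\<forall>j. i < j --> j < i' --> Rt < dorb (ap M (real j))) --> closest (ap M i) g --> closest (ap M i') g' -->
   K * (F i' - F i) <= real l --> hinv g ** g' : SL l \<union> FO"
proof -
 obtain K1 where K1: "0 < K1" "!!B k z z' g g' l. B : C ==> k : G ==> 0 < Im z ==> 0 < Im z' ==> closest z g ==> closest z' g' ==>
   2 * H0 <= ht B k z ==> 2 * H0 <= ht B k z' ==>
   K1 * (abs (Re (cd B (act k z)) - Re (cd B (act k z'))) + ht B k z + ht B k z') <= real l ==>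
   hinv g ** g' : SL l" using same_cusp by blast
 define E where "E = 2 * exp 1 * cosh 1 * H0 * exp (1::real)"
 define K where "K = K1 * (E + 2 * exp 1 * H0 * exp 1)"
 have E: "0 < E" using H0(1) by (simp add: E_def)
 have K: "0 < K" using K1(1) E H0(1) by (simp add: K_def add_pos_pos)
 show ?thesis proof (intro exI[of _ K] conjI K allI impI)
  fix M F g g' and i i' l :: nat
  assume M: "M : SL2" and P: "antider M F" and ii: "i < i'" and th: "dorb (ap M i) <= Rt" "dorb (ap M i') <= Rt"
   and mid: "\<forall>j. i < j --> j < i' --> Rt < dorb (ap M (real j))" and g: "closest (ap M i) g" "closest (ap M i') g'"
   and l: "K * (F i' - F i) <= real l"
  show "hinv g ** g' : SL l \<union> FO" proof (cases "i' = i + 1")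
   case True
   then show ?thesis using M th by (intro UnI2 close_FO[OF _ _ g]) auto
  next
   case False
   then have i2: "i + 2 <= i'" using ii by linarith
   define Y where "Y = 2 * H0 * exp 2"
   have Y: "exp 1 * (2 * H0) <= Y" "1 <= 2 * H0" using H0(1) by (simp_all add: Y_def)
   have Y1: "exp 1 < Y" proof -
    have "exp 1 * 2 <= exp 1 * (2 * H0)" using H0(1) by simp
    then show ?thesis using Y(1) exp_gt_zero[of "1::real"] by linarith
   qed
   have Y2: "1 <= Y" using Y1 one_le_exp_iff[of "1::real"] by linarith
   have deep: "\<exists>B\<in>C. \<exists>k\<in>G. Y <= ht B k (ap M (real j))" if "i < j" "j < i'" for j
    using mid that M Y2 by (intro deep_point) (auto simp: Rt_def Y_def)
   obtain B k where B: "B : C" "k : G" "Y <= ht B k (ap M (real (i + 1)))" using deep[of "i+1"] i2 by auto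
   define p where "p = (%j::nat. cd B (act k (ap M (real j))))"
   have dj: "dH (ap M (real j)) (ap M (real (Suc j))) <= 1" for j using M by simp
   have ch: "Im (p (Suc j)) <= exp 1 * Im (p j)" "Im (p j) <= exp 1 * Im (p (Suc j))"
    "abs (Re (p j) - Re (p (Suc j))) <= 2 * exp 1 * cosh 1 * Im (p j)" for j using close_heights[OF B(1,2) _ _ dj[of j]] M by (simp_all add: p_def)
   \<comment> \<open>Over a unit of time the height drops by at most the factor
     \<open>exp 1 < Y\<close>, so the next point is still inside the first horoball; all horoballs
     containing a point assign it the same height.\<close>
   have hj: "Y <= Im (p (i + 1 + n))" if "i + 1 + n < i'" for n using that proof (induction n)
    case 0 then show ?case using B by (simp add: p_def)
   next
    case (Suc n)
    obtain B' k' where B': "B' : C" "k' : G" "Y <= ht B' k' (ap M (real (i + 1 + Suc n)))" using deep[of "i + 1 + Suc n"] Suc.prems by auto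
    have "Y <= Im (p (i + 1 + n))" using Suc by simp
    also have "... <= exp 1 * Im (p (i + 1 + Suc n))" using ch(2)[of "i + 1 + n"] by simp
    finally have "exp 1 < exp 1 * Im (p (i + 1 + Suc n))" using Y1 by linarith
    then have "1 < Im (p (i + 1 + Suc n))" by simp
    moreover have "1 < ht B' k' (ap M (real (i + 1 + Suc n)))" using B'(3) Y1 one_le_exp_iff[of "1::real"] by linarith
    ultimately have "ht B' k' (ap M (real (i + 1 + Suc n))) = Im (p (i + 1 + Suc n))"
     unfolding p_def using horoball_height[OF B(1) B'(1) B(2) B'(2) ap_upper[OF M]] by blast
    then show ?case using B' by simp
   qed
   have hi: "2 * H0 <= Im (p i)" proof -
    have "Y <= exp 1 * Im (p i)" using ch(1)[of i] hj[of 0] i2 by simp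
    then have "exp 1 * (2 * H0) <= exp 1 * Im (p i)" using Y by linarith
    then show ?thesis by simp
   qed
   define m where "m = i' - 1"
   have m: "Suc m = i'" "i + 1 <= m" using i2 by (auto simp: m_def)
   have hi': "2 * H0 <= Im (p i')" proof -
    have "Y <= Im (p m)" using hj[of "m - (i + 1)"] m by simp
    also have "... <= exp 1 * Im (p i')" using ch(2)[of m] m by simp
    finally have "exp 1 * (2 * H0) <= exp 1 * Im (p i')" using Y by linarith
    then show ?thesis by simp
   qed
   have imp: "Im (p j) <= H0 * exp 1 * (F (real (Suc j)) - F (real j))" for j proof -
    have "Im (p j) <= H0 * hgt M (real j)" unfolding p_def hgt_def using B M by (intro dorb_ge_height) auto
    also have "hgt M (real j) <= exp 1 * (F (real (Suc j)) - F (real j))" using antider_unit[OF M P, of "real j" "real j" "real (Suc j)"] by simp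
    finally show ?thesis using H0(1) by simp
   qed
   have re: "abs (Re (p i) - Re (p (i + n))) <= E * (F (real (i + n)) - F (real i))" for n proof (induction n)
    case (Suc n)
    have "abs (Re (p (i + n)) - Re (p (i + Suc n))) <= 2 * exp 1 * cosh 1 * Im (p (i + n))" using ch(3)[of "i + n"] by simp
    also have "... <= 2 * exp 1 * cosh 1 * (H0 * exp 1 * (F (real (Suc (i + n))) - F (real (i + n))))" by (intro mult_left_mono imp) auto
    finally show ?case using Suc by (simp add: E_def algebra_simps)
   qed simp
   define T where "T = F i' - F i"
   have s1: "abs (Re (p i) - Re (p i')) <= E * T" using re[of "i' - i"] ii by (simp add: T_def)
   have mono: "F (real j) <= F (real j')" if "j <= j'" for j j' :: nat using antider_mono[OF M P, of "real j" "real j'"] that by simp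
   have s2: "Im (p i) <= exp 1 * H0 * exp 1 * T" proof -
    have "0 <= H0 * exp 1 * (F (real (Suc i)) - F (real i))" using H0(1) mono[of i "Suc i"] by simp
    then have "Im (p i) <= exp 1 * (H0 * exp 1 * (F (real (Suc i)) - F (real i)))"
     using imp[of i] mult_right_mono[of 1 "exp 1" "H0 * exp 1 * (F (real (Suc i)) - F (real i))"] by simp
    also have "... <= exp 1 * (H0 * exp 1 * T)" unfolding T_def using H0(1) mono[of "Suc i" i'] ii by (intro mult_left_mono) auto
    finally show ?thesis by simp
   qed
   have s3: "Im (p i') <= exp 1 * H0 * exp 1 * T" proof -
    have "Im (p i') <= exp 1 * Im (p m)" using ch(1)[of m] m by simp
    also have "... <= exp 1 * (H0 * exp 1 * (F (real (Suc m)) - F (real m)))" by (intro mult_left_mono imp) auto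
    also have "... <= exp 1 * (H0 * exp 1 * T)" unfolding T_def m(1) using H0(1) mono[of i m] m by (intro mult_left_mono) auto
    finally show ?thesis by simp
   qed
   have "K1 * (abs (Re (p i) - Re (p i')) + Im (p i) + Im (p i')) <= K1 * (E * T + exp 1 * H0 * exp 1 * T + exp 1 * H0 * exp 1 * T)"
    using s1 s2 s3 K1(1) by (intro mult_left_mono add_mono) auto
   also have "... = K * T" by (simp add: K_def algebra_simps)
   also have "... <= real l" using l by (simp add: T_def)
   finally have "hinv g ** g' : SL l" using K1(2)[OF B(1,2) _ _ g] hi hi' M by (simp add: p_def)
   then show ?thesis by simp
  qed
 qed
qed

text \<open>Products of \<open>q\<close> letters of total weight at most \<open>n\<close>, where a
  letter of \<open>SL l\<close> has weight \<open>l\<close> and a letter of \<open>FO\<close> may be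
  given weight 0.\<close>

primrec PP :: "nat => nat => (real^2^2) set" where
 "PP 0 n = {mat 1}"
| "PP (Suc q) n = (\<Union>l\<in>{..n}. \<Union>h\<in>PP q (n - l). (%s. h ** s) ` (SL l \<union> FO))"

lemma PP_mono: "n <= n' ==> PP q n \<subseteq> PP q n'"
proof (induction q arbitrary: n n')
 case (Suc q)
 have "PP q (n - l) \<subseteq> PP q (n' - l)" for l using Suc by (intro Suc.IH) auto
 then show ?case using Suc.prems by fastforce
qed simp

lemma PP_Suc: assumes "h : PP q n" "s : SL l \<union> FO" shows "h ** s : PP (Suc q) (n + l)"
proof -
 have "h : PP q (n + l - l)" using assms by simp
 then show ?thesis unfolding PP.simps using assms(2) by (intro UN_I[of l] UN_I[of h] imageI) auto
qed

lemma PP_pad: "q <= q' ==> PP q n \<subseteq> PP q' n"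
proof (induction q' rule: dec_induct)
 case (step m)
 have "PP m n \<subseteq> PP (Suc m) n" proof
  fix h assume "h : PP m n"
  then show "h : PP (Suc m) n" using PP_Suc[of h m n "mat 1" 0] one_FO by simp
 qed
 then show ?case using step by blast
qed simp

text \<open>Give weight \<open>n\<close> the factor \<open>v ^ n\<close>. The letters then have
  total weight at most \<open>K\<close> times the sum of \<open>(l + 1) * v ^ l\<close>, which is
  \<open>K / (1 - v)^2\<close>, and products multiply. Near \<open>v = 1\<close> the dependence on
  \<open>n\<close> becomes arbitrarily weak.\<close>

lemma PP_card:
 "\<exists>K. \<forall>v q n. 0 < v --> v < 1 --> finite (PP q n) \<and> real (card (PP q n)) <= (real K / (1 - v)^2) ^ q * (1 / v) ^ n"
proof -
 obtain K0 where K0: "!!l. finite (SL l) \<and> card (SL l) <= K0 * (l + 1)" using SL_card by blast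
 define K where "K = K0 + card FO"
 have Sl: "finite (SL l \<union> FO)" "card (SL l \<union> FO) <= K * Suc l" for l proof -
  show "finite (SL l \<union> FO)" using K0 finite_FO by simp
  have "card (SL l \<union> FO) <= K0 * (l + 1) + card FO" using K0[of l] card_Un_le[of "SL l" FO] by linarith
  then show "card (SL l \<union> FO) <= K * Suc l" by (simp add: K_def algebra_simps)
 qed
 show ?thesis proof (intro exI[of _ K] allI impI)
  fix v :: real and q n assume th: "0 < v" "v < 1"
  define Z where "Z = real K / (1 - v)^2"
  have ser: "(\<Sum>l\<in>{..n}. real K * (real (Suc l) * v ^ l)) <= Z" for n proof -
   have s: "(%l. real (Suc l) * v ^ l) sums (1 / (1 - v)^2)" using geometric_deriv_sums[of v] th by simp
   have "(\<Sum>l\<in>{..n}. real (Suc l) * v ^ l) <= (\<Sum>l. real (Suc l) * v ^ l)" using th by (intro sum_le_suminf sums_summable[OF s]) auto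
   also have "... = 1 / (1 - v)^2" using sums_unique[OF s] by simp
   finally have "real K * (\<Sum>l\<in>{..n}. real (Suc l) * v ^ l) <= real K * (1 / (1 - v)^2)" by (intro mult_left_mono) auto
   then show ?thesis by (simp add: Z_def sum_distrib_left)
  qed
  show "finite (PP q n) \<and> real (card (PP q n)) <= (real K / (1 - v)^2) ^ q * (1 / v) ^ n" unfolding Z_def[symmetric]
  proof (induction q arbitrary: n)
   case 0 then show ?case using th by simp
  next
   case (Suc q)
   have fin: "finite (PP (Suc q) n)" using Suc Sl by auto
   have "card (PP (Suc q) n) <= (\<Sum>l\<in>{..n}. card (\<Union>h\<in>PP q (n - l). (%s. h ** s) ` (SL l \<union> FO)))"
    unfolding PP.simps by (rule card_UN_le) simp
   also have "... <= (\<Sum>l\<in>{..n}. card (PP q (n - l)) * (K * Suc l))" proof (rule sum_mono)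
    fix l
    have "card (\<Union>h\<in>PP q (n - l). (%s. h ** s) ` (SL l \<union> FO)) <= (\<Sum>h\<in>PP q (n - l). card ((%s. h ** s) ` (SL l \<union> FO)))"
     using Suc by (intro card_UN_le) simp
    also have "... <= (\<Sum>h\<in>PP q (n - l). K * Suc l)" by (intro sum_mono order_trans[OF card_image_le[OF Sl(1)] Sl(2)])
    finally show "card (\<Union>h\<in>PP q (n - l). (%s. h ** s) ` (SL l \<union> FO)) <= card (PP q (n - l)) * (K * Suc l)" by simp
   qed
   finally have "real (card (PP (Suc q) n)) <= (\<Sum>l\<in>{..n}. real (card (PP q (n - l))) * (real K * real (Suc l)))"
    by (simp only: of_nat_mult[symmetric] of_nat_sum[symmetric] of_nat_le_iff)
   also have "... <= (\<Sum>l\<in>{..n}. (Z ^ q * (1 / v) ^ (n - l)) * (real K * real (Suc l)))" using Suc by (intro sum_mono mult_right_mono) auto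
   also have "... = (\<Sum>l\<in>{..n}. Z ^ q * (1 / v) ^ n * (real K * (real (Suc l) * v ^ l)))" proof (rule sum.cong[OF refl])
    fix l assume "l : {..n}"
    then have "(1 / v) ^ (n - l) = (1 / v) ^ n * v ^ l" using th by (simp add: power_diff power_divide)
    then show "(Z ^ q * (1 / v) ^ (n - l)) * (real K * real (Suc l)) = Z ^ q * (1 / v) ^ n * (real K * (real (Suc l) * v ^ l))"
     by (simp only: mult_ac)
   qed
   also have "... = Z ^ q * (1 / v) ^ n * (\<Sum>l\<in>{..n}. real K * (real (Suc l) * v ^ l))" by (simp only: sum_distrib_left)
   also have "... <= Z ^ q * (1 / v) ^ n * Z" using th by (intro mult_left_mono ser) (auto simp: Z_def)
   finally show ?case using fin by (simp add: mult_ac)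
  qed
 qed
qed

text \<open>Cut the geodesic from \<open>x0\<close> to \<open>act g x0\<close> at the integer times
  near the orbit. \<open>thicks_count\<close> bounds the number of pieces by the relative length;
  the weights add up to a multiple of the integral of \<open>hgt\<close>, hence of the word
  length.\<close>

lemma element_PP:
 "\<exists>K. \<forall>g\<in>G. g : PP (K * lenR g + K) (K * lenG g + K)"
proof -
 obtain K1 where K1: "0 < K1" "!!M F i i' g g' l. M : SL2 ==> antider M F ==> (i::nat) < i' ==> dorb (ap M i) <= Rt ==>
   dorb (ap M i') <= Rt ==> (\<forall>j. i < j --> j < i' --> Rt < dorb (ap M (real j))) ==> closest (ap M i) g ==> closest (ap M i') g' ==>
   K1 * (F i' - F i) <= real l ==> hinv g ** g' : SL l \<union> FO" using excursion_letter by blast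
 obtain K2 where K2: "0 < K2" "!!M F g g'. M : SL2 ==> antider M F ==> g : G ==> g' : G ==>
   abs (F (pr M (act g' x0)) - F (pr M (act g x0))) <= K2 * lG (hinv g ** g')" using orbit_path_lower by blast
 obtain K3 where K3: "!!M u g. M : SL2 ==> u : G ==> g : G ==>
   finite (thicks Rt M (pr M (act u x0)) (pr M (act (u ** g) x0))) \<and>
   card (thicks Rt M (pr M (act u x0)) (pr M (act (u ** g) x0))) <= K3 * lenR g + K3" using thicks_count by blast
 define K where "K = K3 + 1 + nat \<lceil>(K1 + 1) * K2\<rceil>"
 show ?thesis proof (intro exI[of _ K] ballI)
  fix g assume g: "g : G"
  define T where "T = dH x0 (act g x0)"
  have T0: "0 <= T" using g by (simp add: T_def)
  obtain M where M: "M : SL2" "act M x0 = \<i>" "act M (act g x0) = iax T" using to_iax[of x0 "act g x0"] g by (auto simp: T_def)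
  have a0: "ap M 0 = x0" using M by (intro ap_eqI) (auto simp: iax_zero)
  have aT: "ap M T = act g x0" using M g by (intro ap_eqI) auto
  have p0: "pr M x0 = 0" using pr_ap[OF M(1), of 0] by (simp add: a0)
  have pT: "pr M (act g x0) = T" using pr_ap[OF M(1), of T] by (simp add: aT)
  obtain F where P: "antider M F" using antider_exists M by blast
  have PT: "F T - F 0 <= K2 * lG g" using K2(2)[OF M(1) P, of "mat 1" g] g by (simp add: p0 pT)
  let ?t = "%i::nat. dorb (ap M (real i)) <= Rt"
  let ?S = "%i. {j. j <= i \<and> ?t j}"
  have t0: "?t 0" using Rt_ge by (simp add: a0)
  \<comment> \<open>The factor \<open>K1 + 1\<close> in place of \<open>K1\<close> pays for rounding
    \<open>l\<close> up, because \<open>F\<close> grows by at least 1 on every piece.\<close>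
  have main: "h : PP (card (?S i)) N" if "?t i" "closest (ap M (real i)) h" "(K1 + 1) * (F i - F 0) <= real N" for i h N using that
  proof (induction i arbitrary: h N rule: less_induct)
   case (less i)
   show ?case proof (cases "i = 0")
    case True
    have "hinv (mat 1) ** h : FO" using less.prems True closest_orbit[of "mat 1"] by (intro close_FO[of x0 x0]) (auto simp: a0)
    then have "mat 1 ** h : PP (Suc 0) (N + 0)" by (intro PP_Suc[of _ 0]) auto
    moreover have "?S i = {0}" using True t0 by auto
    ultimately show ?thesis by simp
   next
    case False
    define j where "j = Max {j. j < i \<and> ?t j}"
    have ne: "finite {j. j < i \<and> ?t j}" "{j. j < i \<and> ?t j} ~= {}" using False t0 by auto
    have j: "j < i" "?t j" using Max_in[OF ne] by (auto simp: j_def)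
    have mid: "\<forall>k. j < k --> k < i --> Rt < dorb (ap M (real k))" proof (intro allI impI)
     fix k assume k: "j < k" "k < i"
     show "Rt < dorb (ap M (real k))" proof (rule ccontr)
      assume "\<not> ?thesis"
      then have "k <= j" unfolding j_def using k by (intro Max_ge ne) auto
      then show False using k by simp
     qed
    qed
    obtain h' where h': "closest (ap M (real j)) h'" using closest_exists M by (meson ap_upper)
    define l where "l = nat \<lceil>K1 * (F i - F j)\<rceil>"
    have d1: "1 <= F (real i) - F (real j)" using antider_mono[OF M(1) P, of "real j" "real i"] j by simp
    have "0 <= K1 * (F i - F j)" using d1 K1(1) by simp
    then have l: "K1 * (F i - F j) <= real l" "real l <= K1 * (F i - F j) + 1" unfolding l_def by linarith+
    have s: "hinv h' ** h : SL l \<union> FO" using K1(2)[OF M(1) P j(1,2) less.prems(1) mid h' less.prems(2) l(1)] .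
    have lN: "real l + (K1 + 1) * (F j - F 0) <= real N" proof -
     have "(K1 + 1) * (F i - F 0) = (K1 + 1) * (F j - F 0) + K1 * (F i - F j) + (F i - F j)" by (simp add: algebra_simps)
     then show ?thesis using l less.prems(3) d1 by linarith
    qed
    have "0 <= (K1 + 1) * (F (real j) - F 0)" using antider_mono[OF M(1) P, of 0 "real j"] K1(1) by simp
    then have lN': "l <= N" using lN by linarith
    have "h' : PP (card (?S j)) (N - l)" using lN by (intro less.IH j h') simp
    then have "h' ** (hinv h' ** h) : PP (Suc (card (?S j))) (N - l + l)" using s by (rule PP_Suc)
    moreover have "h' ** (hinv h' ** h) = h" using closestD[OF h'] by simp
    moreover have "?S i = insert i (?S j)" proof (rule Set.set_eqI)
     fix k show "k : ?S i \<longleftrightarrow> k : insert i (?S j)"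
      using mid[rule_format, of k] j less.prems(1) by (cases "k <= j"; cases "k < i") auto
    qed
    moreover have "i \<notin> ?S j" using j by simp
    ultimately show ?thesis using lN' by simp
   qed
  qed
  define n where "n = nat \<lfloor>T\<rfloor>"
  have n: "real n <= T" "T <= real n + 1" using T0 unfolding n_def by linarith+
  have tn: "?t n" proof -
   have "dorb (ap M (real n)) <= dorb (ap M T) + abs (real n - T)" using dorb_lipschitz[of "ap M (real n)" "ap M T"] M by simp
   then show ?thesis using n Rt_ge g by (simp add: aT)
  qed
  obtain h where h: "closest (ap M (real n)) h" using closest_exists M by (meson ap_upper)
  define N where "N = nat \<lceil>(K1 + 1) * (F T - F 0)\<rceil>"
  have "F (real n) <= F T" using antider_mono[OF M(1) P n(1)] n by linarith
  then have "(K1 + 1) * (F (real n) - F 0) <= (K1 + 1) * (F T - F 0)" using K1(1) by (intro mult_left_mono) auto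
  then have "(K1 + 1) * (F (real n) - F 0) <= real N" unfolding N_def by linarith
  then have hP: "h : PP (card (?S n)) N" using main[OF tn h] by blast
  have "dH (ap M (real n)) (ap M T) <= 2" using M n by simp
  then have "hinv h ** g : FO" using M tn Rt_ge closest_orbit[OF g] g by (intro close_FO[OF _ _ h, of "ap M T"]) (auto simp: aT)
  then have "h ** (hinv h ** g) : PP (Suc (card (?S n))) (N + 0)" using hP by (intro PP_Suc) auto
  then have gP: "g : PP (Suc (card (?S n))) N" using closestD[OF h] by simp
  have "?S n = thicks Rt M 0 T" proof -
   have "j <= n \<longleftrightarrow> real j <= T" for j :: nat unfolding n_def using T0 by (simp add: le_nat_iff le_floor_iff)
   then show ?thesis using T0 by (auto simp: thicks_def)
  qed
  then have "card (?S n) <= K3 * lenR g + K3" using K3[OF M(1), of "mat 1" g] g by (simp add: p0 pT)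
  then have q: "Suc (card (?S n)) <= K * lenR g + K" by (simp add: K_def algebra_simps)
  have "N <= K * lenG g + K" proof -
   have "(K1 + 1) * (F T - F 0) <= (K1 + 1) * (K2 * lG g)" using PT K1(1) by (intro mult_left_mono) auto
   also have "... = ((K1 + 1) * K2) * lG g" by simp
   also have "... <= real K * lG g" unfolding K_def by (intro mult_right_mono) linarith+
   finally have "(K1 + 1) * (F T - F 0) <= real (K * lenG g)" by simp
   then have "N <= K * lenG g" unfolding N_def by (simp add: ceiling_le_iff)
   then show ?thesis by simp
  qed
  then show "g : PP (K * lenR g + K) (K * lenG g + K)" using gP q PP_mono PP_pad by blast
 qed
qed

text \<open>\<open>K\<close> is chosen before \<open>v\<close>. Hence the exponential rate in
  \<open>n\<close> can be made as small as desired at the price of a larger \<open>Z\<close>, and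
  the factor with \<open>Z\<close> is harmless if \<open>m\<close> is a small fraction of
  \<open>n\<close>.\<close>

lemma growth_bound:
 "\<exists>K::nat. \<forall>v. 0 < v --> v < 1 --> (\<exists>Z\<ge>1. \<forall>m n. finite {g : G. lenR g <= m \<and> lenG g <= n} \<and>
   real (card {g : G. lenR g <= m \<and> lenG g <= n}) <= Z ^ (K * m + K) * (1 / v) ^ (K * n + K))"
proof -
 obtain K where K: "!!g. g : G ==> g : PP (K * lenR g + K) (K * lenG g + K)" using element_PP by blast
 obtain K' where K': "!!v q n. 0 < v ==> v < 1 ==> finite (PP q n) \<and> real (card (PP q n)) <= (real K' / (1 - v)^2) ^ q * (1 / v) ^ n"
  using PP_card by blast
 show ?thesis proof (intro exI[of _ K] allI impI)
  fix v :: real assume th: "0 < v" "v < 1"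
  define Z where "Z = max 1 (real K' / (1 - v)^2)"
  show "\<exists>Z\<ge>1. \<forall>m n. finite {g : G. lenR g <= m \<and> lenG g <= n} \<and>
   real (card {g : G. lenR g <= m \<and> lenG g <= n}) <= Z ^ (K * m + K) * (1 / v) ^ (K * n + K)" proof (intro exI[of _ Z] conjI allI)
   show "1 <= Z" by (simp add: Z_def)
   fix m n
   let ?S = "{g : G. lenR g <= m \<and> lenG g <= n}"
   have sub: "?S \<subseteq> PP (K * m + K) (K * n + K)" proof
    fix g assume g: "g : ?S"
    then have "K * lenR g + K <= K * m + K" "K * lenG g + K <= K * n + K" by auto
    then show "g : PP (K * m + K) (K * n + K)" using K[of g] g PP_mono PP_pad by blast
   qed
   note P = K'[OF th, of "K * m + K" "K * n + K"]
   show "finite ?S" using P finite_subset[OF sub] by simp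
   have "real (card ?S) <= real (card (PP (K * m + K) (K * n + K)))" using P card_mono[OF _ sub] by simp
   also have "... <= (real K' / (1 - v)^2) ^ (K * m + K) * (1 / v) ^ (K * n + K)" using P by simp
   also have "... <= Z ^ (K * m + K) * (1 / v) ^ (K * n + K)" using th by (intro mult_right_mono power_mono) (auto simp: Z_def)
   finally show "real (card ?S) <= Z ^ (K * m + K) * (1 / v) ^ (K * n + K)" .
  qed
 qed
qed

end

subsection \<open>The subadditive ergodic theorem for the shift\<close>

definition shiftn :: "nat => (nat => 'a) => nat => 'a" where "shiftn n v i = v (i + n)"

lemma shift_0 [simp]: "shiftn 0 v = v" by (auto simp: shiftn_def)

lemma shift_shift [simp]: "shiftn m (shiftn n v) = shiftn (m + n) v" by (rule ext) (simp add: shiftn_def add.assoc)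

lemma shift_comb_seq: "shiftn n (comb_seq n v v') = v'" by (rule ext) (simp add: shiftn_def comb_seq_add)

lemma sum_lessThan_split:
 fixes g :: "nat => 'b::comm_monoid_add" shows "(\<Sum>k<m + n. g k) = (\<Sum>k<m. g k) + (\<Sum>k<n. g (m + k))"
 by (induction n) (simp_all add: add.assoc)

lemma tendsto_ratioI:
 fixes y :: "nat => real"
 assumes "!!r. r < l ==> \<forall>\<^sub>F n in sequentially. r * real n < y n" "!!r. l < r ==> \<forall>\<^sub>F n in sequentially. y n < r * real n"
 shows "(%n. y n / real n) \<longlonglongrightarrow> l"
proof (rule order_tendstoI)
 fix r assume "r < l"
 then show "\<forall>\<^sub>F n in sequentially. r < y n / real n"
  using eventually_conj[OF assms(1)[of r] eventually_gt_at_top[of "0::nat"]] by (auto elim!: eventually_mono simp: field_simps)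
next
 fix r assume "l < r"
 then show "\<forall>\<^sub>F n in sequentially. y n / real n < r"
  using eventually_conj[OF assms(2)[of r] eventually_gt_at_top[of "0::nat"]] by (auto elim!: eventually_mono simp: field_simps)
qed

context sequence_space
begin

lemma shift_measurable [measurable]: "shiftn n : S \<rightarrow>\<^sub>M S" unfolding shiftn_def[abs_def]
 by (intro measurable_PiM_single') (auto simp: space_PiM)

lemma shift_space [simp]: "v : space S ==> shiftn n v : space S" by (auto simp: space_PiM shiftn_def)

lemma distr_shift: "distr S S (shiftn n) = S"
proof -
 have "distr S S (%v. \<lambda>i\<in>UNIV. v (i + n)) = S" using distr_PiM_reindex[of UNIV "%_. M" "%i. i + n" UNIV] prob_space by simp
 moreover have "(%v. \<lambda>i\<in>UNIV. v (i + n)) = (shiftn n :: (nat => 'a) => _)" by (intro ext) (simp add: shiftn_def)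
 ultimately show ?thesis by simp
qed

lemma AE_shift: "AE v in S. Q v ==> AE v in S. Q (shiftn n v)" by (rule AE_distrD[OF shift_measurable]) (simp only: distr_shift)

lemma integrable_shift: fixes f :: "(nat => 'a) => real" shows "integrable S f ==> integrable S (%v. f (shiftn n v))"
 using integrable_distr[OF shift_measurable[of n], of f] by (simp add: distr_shift)

lemma integral_shift: fixes f :: "(nat => 'a) => real" assumes "f : borel_measurable S"
 shows "(\<integral>v. f (shiftn n v) \<partial>S) = (\<integral>v. f v \<partial>S)"
 using integral_distr[OF shift_measurable[of n] assms] by (simp add: distr_shift)

text \<open>An invariant event does not change when finitely many coordinates are put in front of a
  sequence. So it is independent of every cylinder, conditioning on it does not change the measure,
  and it has full measure unless it is null.\<close>

lemma zero_one: assumes E: "E : sets S" and inv: "!!n. AE v in S. shiftn n v : E \<longleftrightarrow> v : E"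
 shows "measure S E = 0 \<or> measure S E = 1"
proof (cases "emeasure S E = 0")
 case True then show ?thesis by (simp add: measure_def)
next
 case False
 have fin: "emeasure S E ~= \<infinity>" by simp
 have cs: "(%(v, v'). comb_seq n v v') : S \<Otimes>\<^sub>M S \<rightarrow>\<^sub>M S" for n by (rule measurable_comb_seq)
 have "uniform_measure S E = S" proof (rule PiM_eq)
  fix J F assume J: "finite J" "J \<subseteq> (UNIV::nat set)" "!!j. j : J ==> F j : sets M"
  let ?X = "prod_emb UNIV (%_. M) J (\<Pi>\<^sub>E j\<in>J. F j)"
  obtain n where n: "!!j. j : J ==> j < n" using J(1) finite_nat_bounded[of J] by auto
  have X: "?X : sets S" using J by (intro sets_PiM_I) auto
  have "emeasure S (E \<inter> ?X) = emeasure (distr (S \<Otimes>\<^sub>M S) S (%(v, v'). comb_seq n v v')) (E \<inter> ?X)"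
   by (simp only: PiM_comb_seq)
  also have "... = emeasure (S \<Otimes>\<^sub>M S) ((%(v, v'). comb_seq n v v') -` (E \<inter> ?X) \<inter> space (S \<Otimes>\<^sub>M S))"
   using E X by (subst emeasure_distr[OF cs]) auto
  also have "... = emeasure (S \<Otimes>\<^sub>M S) (?X \<times> E)" proof (rule emeasure_eq_AE)
   have "AE v in distr (S \<Otimes>\<^sub>M S) S (%(v, v'). comb_seq n v v'). shiftn n v : E \<longleftrightarrow> v : E"
    using inv[of n] by (simp only: PiM_comb_seq)
   from AE_distrD[OF cs this]
   have ae: "AE x in S \<Otimes>\<^sub>M S. snd x : E \<longleftrightarrow> comb_seq n (fst x) (snd x) : E"
    by (simp add: case_prod_beta shift_comb_seq)
   show "AE x in S \<Otimes>\<^sub>M S. x : (%(v, v'). comb_seq n v v') -` (E \<inter> ?X) \<inter> space (S \<Otimes>\<^sub>M S) \<longleftrightarrow> x : ?X \<times> E"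
    using ae AE_space proof (eventually_elim)
    case (elim x)
    have sE: "E \<subseteq> space S" using E sets.sets_into_space by blast
    have "comb_seq n v v' : ?X \<longleftrightarrow> v : ?X" if "v : space S" "v' : space S" for v v' :: "nat => 'a" proof -
     have "comb_seq n v v' j = v j" if "j : J" for j using n[OF that] by (simp add: comb_seq_less)
     moreover have "comb_seq n v v' : space S" using measurable_space[OF cs, of "(v, v')"] that by (simp add: space_pair_measure)
     ultimately show ?thesis using that by (auto simp: prod_emb_def space_PiM PiE_iff)
    qed
    moreover have "?X \<subseteq> space S" using X sets.sets_into_space by blast
    ultimately show ?case using elim by (cases x) (auto simp: space_pair_measure)
   qed
   show "(%(v, v'). comb_seq n v v') -` (E \<inter> ?X) \<inter> space (S \<Otimes>\<^sub>M S) : sets (S \<Otimes>\<^sub>M S)"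
    using E X by (intro measurable_sets[OF cs]) auto
  qed (use E X in auto)
  also have "... = emeasure S ?X * emeasure S E" using E X by (intro P.emeasure_pair_measure_Times) auto
  finally have "emeasure S (E \<inter> ?X) = emeasure S ?X * emeasure S E" .
  then have "emeasure (uniform_measure S E) ?X = emeasure S ?X * emeasure S E / emeasure S E" using E X by simp
  also have "... = emeasure S ?X" using False by (simp add: ennreal_mult_divide_eq)
  also have "... = (\<Prod>j\<in>J. emeasure M (F j))" using J by (intro emeasure_PiM_emb) auto
  finally show "emeasure (uniform_measure S E) ?X = (\<Prod>j\<in>J. emeasure M (F j))" .
 qed simp
 then have "emeasure S E = emeasure (uniform_measure S E) E" by simp
 also have "... = 1" using E False by (simp add: P.emeasure_eq_measure)
 finally show ?thesis by (simp add: measure_def)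
qed

text \<open>The covering argument of Katznelson and Weiss: the time axis is cut greedily into blocks on which
 the process is small, up to a few bad times.\<close>

lemma greedy_bound:
 fixes Y :: "nat => (nat => 'a) => real" assumes Y0: "!!v. v : space S ==> Y 0 v <= 0"
  and sub: "!!m n v. v : space S ==> Y (m + n) v <= Y m v + Y n (shiftn m v)"
  and tau: "!!v. v : space S ==> 1 <= t v \<and> t v <= M' \<and> Y (t v) v <= q * real (t v) + b v"
  and b: "!!v. v : space S ==> 0 <= b v" and e: "!!v. v : space S ==> Y 1 v <= q + e v \<and> 0 <= e v" and w: "v : space S"
 shows "Y n v <= q * real n + (\<Sum>k<n. b (shiftn k v)) + (\<Sum>k\<in>{n - M'..<n}. e (shiftn k v))" using w
proof (induction n arbitrary: v rule: less_induct)
 case (less n)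
 have wk: "shiftn k v : space S" for k using less.prems by simp
 show ?case proof (cases "n <= M'")
  \<comment> \<open>At the end a whole block may no longer fit; the last \<open>M'\<close> times are
    then passed one at a time, each at the extra cost \<open>e\<close>.\<close>
  case True
  have "Y n v <= q * real n + (\<Sum>k<n. e (shiftn k v))" for n proof (induction n)
   case (Suc n)
   have "Y (Suc n) v <= Y n v + Y 1 (shiftn n v)" using sub[OF less.prems, of n 1] by simp
   also have "... <= (q * real n + (\<Sum>k<n. e (shiftn k v))) + (q + e (shiftn n v))" using Suc e[OF wk[of n]] by linarith
   finally show ?case by (simp add: algebra_simps)
  qed (use Y0[OF less.prems] in simp)
  moreover have "0 <= (\<Sum>k<n. b (shiftn k v))" using b wk by (intro sum_nonneg) auto
  moreover have "{n - M'..<n} = {..<n}" using True by auto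
  ultimately show ?thesis by (smt (verit))
 next
  case False
  let ?t = "t v"
  note ta = tau[OF less.prems]
  have nt: "?t < n" "n - ?t < n" using ta False by auto
  have "Y n v <= Y ?t v + Y (n - ?t) (shiftn ?t v)" using sub[OF less.prems, of ?t "n - ?t"] nt by simp
  also have "Y (n - ?t) (shiftn ?t v) <= q * real (n - ?t) + (\<Sum>k<n - ?t. b (shiftn k (shiftn ?t v))) + (\<Sum>k\<in>{n - ?t - M'..<n - ?t}. e (shiftn k (shiftn ?t v)))"
   using nt wk by (intro less.IH) auto
  also have "(\<Sum>k<n - ?t. b (shiftn k (shiftn ?t v))) <= (\<Sum>k<n. b (shiftn k v)) - b v" proof -
   have "(\<Sum>k<n. b (shiftn k v)) = (\<Sum>k<?t. b (shiftn k v)) + (\<Sum>k<n - ?t. b (shiftn (?t + k) v))"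
    using sum_lessThan_split[of "%k. b (shiftn k v)" ?t "n - ?t"] nt by simp
   moreover have "b (shiftn 0 v) <= (\<Sum>k<?t. b (shiftn k v))" using ta b wk by (intro member_le_sum) auto
   ultimately show ?thesis by (simp add: add.commute)
  qed
  also have "(\<Sum>k\<in>{n - ?t - M'..<n - ?t}. e (shiftn k (shiftn ?t v))) <= (\<Sum>k\<in>{n - M'..<n}. e (shiftn k v))" proof -
   have "(\<Sum>k\<in>{n - ?t - M'..<n - ?t}. e (shiftn k (shiftn ?t v))) = (\<Sum>k\<in>(%k. k + ?t) ` {n - ?t - M'..<n - ?t}. e (shiftn k v))"
    by (subst sum.reindex) auto
   also have "... <= (\<Sum>k\<in>{n - M'..<n}. e (shiftn k v))" using e wk by (intro sum_mono2) auto
   finally show ?thesis .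
  qed
  also have "Y ?t v <= q * real ?t + b v" using ta by simp
  finally show ?thesis using nt by (simp add: algebra_simps)
 qed
qed

text \<open>Almost every point has a block on which the process is below slope \<open>q\<close>.
  Bounding the block length by \<open>N\<close> leaves a bad set on which \<open>e\<close> has a
  small integral; integrating \<open>greedy_bound\<close> by invariance then bounds the mean at a
  large time.\<close>

lemma subadditive_expectation:
 fixes Y :: "nat => (nat => 'a) => real" assumes int: "!!n. integrable S (Y n)" and Y0: "!!v. v : space S ==> Y 0 v <= 0"
  and sub: "!!m n v. v : space S ==> Y (m + n) v <= Y m v + Y n (shiftn m v)"
  and small: "AE v in S. \<exists>n\<ge>1. Y n v <= q * real n" and eps: "0 < H"
 shows "\<exists>n\<ge>1. integral\<^sup>L S (Y n) <= (q + H) * real n"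
proof -
 have [measurable]: "Y n : borel_measurable S" for n using int by auto
 define e where "e = (%v. abs (Y 1 v) + abs q)"
 have e_int: "integrable S e" unfolding e_def using int by auto
 have [measurable]: "e : borel_measurable S" using e_int by auto
 define bad where "bad = (%N. {v : space S. \<forall>n\<in>{1..N}. q * real n < Y n v})"
 have bad_m [measurable]: "bad N : sets S" for N unfolding bad_def by measurable
 have "(%N. \<integral>v. e v * indicator (bad N) v \<partial>S) \<longlonglongrightarrow> (\<integral>v. 0 \<partial>S)"
 proof (rule integral_dominated_convergence[where w=e])
  show "AE v in S. (%N. e v * indicator (bad N) v) \<longlonglongrightarrow> 0" using small proof eventually_elim
   case (elim v)
   then obtain n where n: "1 <= n" "Y n v <= q * real n" by blast
   have "\<forall>\<^sub>F N in sequentially. e v * indicator (bad N) v = 0" using eventually_ge_at_top[of n] proof eventually_elim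
    case (elim N)
    then have "v \<notin> bad N" using n by (auto simp: bad_def not_less)
    then show ?case by simp
   qed
   then show ?case by (rule tendsto_eventually)
  qed
 qed (use e_int in "auto simp: e_def indicator_def")
 then have "\<forall>\<^sub>F N in sequentially. (\<integral>v. e v * indicator (bad N) v \<partial>S) < H / 2"
  using eps by (auto dest!: order_tendstoD(2)[of _ _ _ "H / 2"])
 then obtain N where N: "(\<integral>v. e v * indicator (bad N) v \<partial>S) < H / 2" by (meson eventually_sequentially order_refl)
 define M' where "M' = max N 1"
 \<comment> \<open>On the bad set the block is a single step, whose cost is at most \<open>q\<close>
   plus \<open>e v\<close>.\<close>
 define t where "t = (%v. if v : bad N then 1 else (LEAST n. 1 <= n \<and> n <= N \<and> Y n v <= q * real n))"
 define b where "b = (%v. e v * indicator (bad N) v)"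
 have tau: "1 <= t v \<and> t v <= M' \<and> Y (t v) v <= q * real (t v) + b v" if w: "v : space S" for v proof (cases "v : bad N")
  case True
  then show ?thesis by (auto simp: t_def M'_def b_def e_def)
 next
  case False
  then have "\<exists>n. 1 <= n \<and> n <= N \<and> Y n v <= q * real n" using w by (auto simp: bad_def)
  from LeastI_ex[OF this] show ?thesis using False by (auto simp: t_def M'_def b_def)
 qed
 have b_int: "integrable S b" unfolding b_def by (rule Bochner_Integration.integrable_bound[OF e_int]) (auto simp: indicator_def)
 have main: "integral\<^sup>L S (Y n) <= q * real n + real n * (H / 2) + real M' * integral\<^sup>L S e" for n proof -
  have "integral\<^sup>L S (Y n) <= (\<integral>v. q * real n + (\<Sum>k<n. b (shiftn k v)) + (\<Sum>k\<in>{n - M'..<n}. e (shiftn k v)) \<partial>S)"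
  proof (rule integral_mono)
   fix v assume w: "v : space S"
   show "Y n v <= q * real n + (\<Sum>k<n. b (shiftn k v)) + (\<Sum>k\<in>{n - M'..<n}. e (shiftn k v))"
    by (rule greedy_bound[where t=t, OF Y0 sub tau _ _ w]) (auto simp: b_def e_def)
  qed (use int b_int e_int in "auto intro!: Bochner_Integration.integrable_add Bochner_Integration.integrable_sum integrable_shift")
  also have "... = q * real n + (\<Sum>k<n. integral\<^sup>L S b) + (\<Sum>k\<in>{n - M'..<n}. integral\<^sup>L S e)" using b_int e_int
   by (simp add: integrable_shift integral_shift P.prob_space)
  also have "... <= q * real n + real n * (H / 2) + real M' * integral\<^sup>L S e" proof -
   have "0 <= integral\<^sup>L S e" by (simp add: e_def)
   moreover have "integral\<^sup>L S b <= H / 2" using N by (simp add: b_def)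
   ultimately have "real n * integral\<^sup>L S b <= real n * (H / 2)" "real (card {n - M'..<n}) * integral\<^sup>L S e <= real M' * integral\<^sup>L S e"
    by (intro mult_left_mono mult_right_mono; simp)+
   then show ?thesis by simp
  qed
  finally show ?thesis .
 qed
 obtain n :: nat where n: "1 <= n" "real M' * integral\<^sup>L S e <= real n * (H / 2)" proof -
  obtain n :: nat where "real M' * integral\<^sup>L S e / (H / 2) <= real n" using real_arch_simple by blast
  then have "real M' * integral\<^sup>L S e <= real (max n 1) * (H / 2)"
   using eps mult_right_mono[of "real n" "real (max n 1)" "H / 2"] by (simp only: pos_divide_le_eq) linarith
  then show ?thesis using that[of "max n 1"] by simp
 qed
 then show ?thesis using main[of n] by (intro exI[of _ n]) (auto simp: algebra_simps)
qed

text \<open>That the lower limit of \<open>Y n v / n\<close> is below \<open>q\<close> does not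
  depend on the first increment, by the hypothesis \<open>Z\<close>. Hence it has probability 0 or
  1. Rational thresholds make the event measurable.\<close>

lemma dichotomy:
 fixes Y :: "nat => (nat => 'a) => real" assumes [measurable]: "!!n. Y n : borel_measurable S"
  and Z: "AE v in S. \<exists>z. \<forall>n. abs (Y (Suc n) v - Y n (shiftn 1 v)) <= z"
 shows "(AE v in S. \<exists>n\<ge>1. Y n v <= q * real n) \<or> (AE v in S. \<forall>r<q. \<forall>\<^sub>F n in sequentially. r * real n < Y n v)"
proof -
 define P where "P = (%v. \<exists>r\<in>\<rat>. r < q \<and> (\<forall>N. \<exists>n\<ge>N. Y n v <= r * real n))"
 define E where "E = {v : space S. P v}"
 have E: "E : sets S" unfolding E_def P_def using countable_rat by measurable
 \<comment> \<open>The two values of the pair \<open>a\<close>, \<open>b\<close> treat a shift by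
   one time in either direction. The bounded discrepancy is absorbed by passing from
   \<open>r\<close> to a slightly larger rational \<open>s\<close>.\<close>
 have half: "P v'" if P: "P v" and d: "!!n. Y (n + a) v' <= Y (n + b) v + z" and ab: "a = 0 \<and> b = 1 \<or> a = 1 \<and> b = 0" for v v' a b z
 proof -
  obtain r where r: "r < q" "!!N. \<exists>n\<ge>N. Y n v <= r * real n" using P by (auto simp: P_def)
  obtain s where s: "s : \<rat>" "r < s" "s < q" using Rats_dense_in_real[OF r(1)] by auto
  have "\<exists>n\<ge>N. Y n v' <= s * real n" for N proof -
   obtain N' :: nat where N': "(abs z + abs r + abs s) / (s - r) <= real N'" using real_arch_simple by blast
   obtain n where n: "n \<ge> N + N' + 1" "Y n v <= r * real n" using r(2) by blast
   define m where "m = n - b"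
   have m: "m + b = n" using n ab by (auto simp: m_def)
   have "abs z + abs r + abs s <= (s - r) * real N'" using N' s by (simp add: pos_divide_le_eq mult.commute)
   also have "... <= (s - r) * real m" using s n ab m by (intro mult_left_mono) auto
   finally have "r * real m + abs r + abs z + abs s <= s * real m" by (simp add: left_diff_distrib)
   moreover have "Y (m + a) v' <= r * real (m + b) + z" using d[of m] n m by simp
   moreover have "r * real (m + b) <= r * real m + abs r" using ab by (auto simp: algebra_simps)
   moreover have "s * real m - abs s <= s * real (m + a)" using ab by (auto simp: algebra_simps)
   ultimately have "Y (m + a) v' <= s * real (m + a)" by linarith
   moreover have "N <= m + a" using n m ab by auto
   ultimately show ?thesis by blast
  qed
  then show ?thesis using s by (auto simp: P_def)
 qed
 have inv1: "AE v in S. shiftn 1 v : E \<longleftrightarrow> v : E" using Z AE_space proof eventually_elim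
  case (elim v)
  then obtain z where z: "!!n. abs (Y (Suc n) v - Y n (shiftn 1 v)) <= z" by blast
  have "P v" if "P (shiftn 1 v)" using half[OF that, of 1 v 0 z] z by (simp add: abs_le_iff) (smt (verit))
  moreover have "P (shiftn 1 v)" if "P v" using half[OF that, of 0 "shiftn 1 v" 1 z] z by (simp add: abs_le_iff) (smt (verit))
  ultimately show ?case using elim by (auto simp: E_def)
 qed
 have inv: "AE v in S. shiftn n v : E \<longleftrightarrow> v : E" for n proof (induction n)
  case (Suc n)
  have "AE v in S. shiftn 1 (shiftn n v) : E \<longleftrightarrow> shiftn n v : E" by (rule AE_shift[OF inv1])
  then show ?case using Suc by eventually_elim simp
 qed simp
 from zero_one[OF E inv] show ?thesis proof
  assume "measure S E = 1"
  then have "AE v in S. v : E" using E by (simp add: P.AE_in_set_eq_1)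
  then have "AE v in S. \<exists>n\<ge>1. Y n v <= q * real n" proof eventually_elim
   case (elim v)
   then obtain r n where "r < q" "1 <= n" "Y n v <= r * real n" unfolding E_def P_def by blast
   then show ?case by (intro exI[of _ n]) (auto intro: order_trans)
  qed
  then show ?thesis ..
 next
  assume "measure S E = 0"
  then have "AE v in S. v \<notin> E" using E by (intro AE_not_in null_setsI) (auto simp: P.emeasure_eq_measure)
  then have "AE v in S. \<forall>r<q. \<forall>\<^sub>F n in sequentially. r * real n < Y n v" using AE_space proof eventually_elim
   case (elim v)
   show ?case proof (intro allI impI)
    fix r assume "r < q"
    then obtain s where s: "s : \<rat>" "r < s" "s < q" using Rats_dense_in_real by auto
    then have "\<not> (\<forall>N. \<exists>n\<ge>N. Y n v <= s * real n)" using elim by (auto simp: E_def P_def)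
    then obtain N where "!!n. N <= n ==> s * real n < Y n v" by (meson not_le)
    then have "r * real n < Y n v" if "N <= n" for n using s that mult_right_mono[of r s "real n"] by (smt (verit) of_nat_0_le_iff)
    then show "\<forall>\<^sub>F n in sequentially. r * real n < Y n v" by (auto simp: eventually_sequentially)
   qed
  qed
  then show ?thesis ..
 qed
qed

lemma liminf_bound:
 fixes Y :: "nat => (nat => 'a) => real" assumes int: "!!n. integrable S (Y n)" and Y0: "!!v. v : space S ==> Y 0 v <= 0"
  and sub: "!!m n v. v : space S ==> Y (m + n) v <= Y m v + Y n (shiftn m v)"
  and Z: "AE v in S. \<exists>z. \<forall>n. abs (Y (Suc n) v - Y n (shiftn 1 v)) <= z"
  and l: "!!n. 1 <= n ==> l * real n <= integral\<^sup>L S (Y n)"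
 shows "AE v in S. \<forall>r<l. \<forall>\<^sub>F n in sequentially. r * real n < Y n v"
proof -
 have each: "AE v in S. \<forall>r<q. \<forall>\<^sub>F n in sequentially. r * real n < Y n v" if "q < l" for q proof -
  have False if s: "AE v in S. \<exists>n\<ge>1. Y n v <= q * real n" proof -
   obtain n where n: "1 <= n" "integral\<^sup>L S (Y n) <= (q + (l - q) / 2) * real n"
    using subadditive_expectation[OF int Y0 sub s, of "(l - q) / 2"] \<open>q < l\<close> by auto
   have "(q + (l - q) / 2) * real n < l * real n" using \<open>q < l\<close> n by (intro mult_strict_right_mono) (auto simp: field_simps)
   then show False using l[OF n(1)] n by linarith
  qed
  then show ?thesis using dichotomy[OF borel_measurable_integrable[OF int] Z, of q] by blast
 qed
 have "AE v in S. \<forall>k::nat. \<forall>r<l - 1 / real (Suc k). \<forall>\<^sub>F n in sequentially. r * real n < Y n v"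
  unfolding AE_all_countable by (intro allI each) simp
 then show ?thesis proof eventually_elim
  case (elim v)
  show ?case proof (intro allI impI)
   fix r assume "r < l"
   then obtain k where "1 / real (Suc k) < l - r" using nat_approx_posE[of "l - r"] by auto
   then have "r < l - 1 / real (Suc k)" by linarith
   then show "\<forall>\<^sub>F n in sequentially. r * real n < Y n v" using elim by blast
  qed
 qed
qed

text \<open>For an additive process the lower bound of \<open>liminf_bound\<close> applies to
  \<open>f\<close> and to \<open>- f\<close>.\<close>

theorem birkhoff:
 fixes f :: "(nat => 'a) => real" assumes f: "integrable S f"
 shows "AE v in S. (%n. (\<Sum>k<n. f (shiftn k v)) / real n) \<longlonglongrightarrow> integral\<^sup>L S f"
proof -
 have bnd: "AE v in S. \<forall>r<integral\<^sup>L S g. \<forall>\<^sub>F n in sequentially. r * real n < (\<Sum>k<n. g (shiftn k v))"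
  if g: "integrable S g" for g :: "(nat => 'a) => real" proof (rule liminf_bound)
  have [measurable]: "g : borel_measurable S" using g by auto
  show "AE v in S. \<exists>z. \<forall>n. abs ((\<Sum>k<Suc n. g (shiftn k v)) - (\<Sum>k<n. g (shiftn k (shiftn 1 v)))) <= z"
  proof (rule AE_I2, rule exI, rule allI)
   fix v n
   show "abs ((\<Sum>k<Suc n. g (shiftn k v)) - (\<Sum>k<n. g (shiftn k (shiftn 1 v)))) <= abs (g v)"
    using sum_lessThan_split[of "%k. g (shiftn k v)" 1 n] by simp
  qed
  show "integrable S (%v. \<Sum>k<n. g (shiftn k v))" for n using g by (intro Bochner_Integration.integrable_sum integrable_shift)
  show "(\<Sum>k<m + n. g (shiftn k v)) <= (\<Sum>k<m. g (shiftn k v)) + (\<Sum>k<n. g (shiftn k (shiftn m v)))" for m n v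
   by (simp add: sum_lessThan_split add.commute)
  show "integral\<^sup>L S g * real n <= (\<integral>v. (\<Sum>k<n. g (shiftn k v)) \<partial>S)" for n
   using g by (simp add: integrable_shift integral_shift)
 qed simp
 have "integrable S (%v. - f v)" using f by simp
 from bnd[OF f] bnd[OF this] show ?thesis proof eventually_elim
  case (elim v)
  show ?case proof (rule tendsto_ratioI)
   fix r assume "integral\<^sup>L S f < r"
   then have "- r < integral\<^sup>L S (%v. - f v)" by simp
   then have "\<forall>\<^sub>F n in sequentially. - r * real n < (\<Sum>k<n. - f (shiftn k v))" using elim(2) by blast
   then show "\<forall>\<^sub>F n in sequentially. (\<Sum>k<n. f (shiftn k v)) < r * real n" by eventually_elim (simp add: sum_negf)
  qed (use elim in blast)
 qed
qed

text \<open>The limit is the infimum of the mean slopes. \<open>liminf_bound\<close> gives the lower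
  half; the upper half compares with blocks of a fixed length \<open>m\<close> and Birkhoff's
  theorem for \<open>Y m\<close>.\<close>

theorem kingman:
 fixes Y :: "nat => (nat => 'a) => real" assumes meas [measurable]: "!!n. Y n : borel_measurable S" and int1: "integrable S (Y 1)"
  and pos: "!!n v. v : space S ==> 0 <= Y n v" and Y0: "!!v. v : space S ==> Y 0 v = 0"
  and sub: "!!m n v. v : space S ==> Y (m + n) v <= Y m v + Y n (shiftn m v)"
  and Z: "AE v in S. \<exists>z. \<forall>n. abs (Y (Suc n) v - Y n (shiftn 1 v)) <= z"
 shows "\<exists>l\<ge>0. AE v in S. (%n. Y n v / real n) \<longlonglongrightarrow> l"
proof -
 have dom: "Y n v <= (\<Sum>k<n. Y 1 (shiftn k v))" if "v : space S" for n v proof (induction n)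
  case (Suc n) then show ?case using sub[OF that, of n 1] by simp
 qed (use Y0[OF that] in simp)
 have int: "integrable S (Y n)" for n proof (rule Bochner_Integration.integrable_bound)
  show "integrable S (%v. \<Sum>k<n. Y 1 (shiftn k v))" using int1 by (intro Bochner_Integration.integrable_sum integrable_shift)
  show "AE v in S. norm (Y n v) <= norm (\<Sum>k<n. Y 1 (shiftn k v))" using pos dom by (intro AE_I2) (auto simp: sum_nonneg)
 qed simp
 define a where "a = (%n. integral\<^sup>L S (Y n) / real n)"
 have a0: "0 <= a n" for n unfolding a_def using pos by (intro divide_nonneg_nonneg integral_nonneg_AE) auto
 define l where "l = (INF n\<in>{1..}. a n)"
 have bdd: "bdd_below (a ` {1..})" using a0 by (intro bdd_belowI[of _ 0]) auto
 have l0: "0 <= l" unfolding l_def using a0 by (intro cINF_greatest) auto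
 have "l * real n <= integral\<^sup>L S (Y n)" if "1 <= n" for n using cINF_lower[OF bdd, of n] that by (simp add: l_def a_def field_simps)
 then have low: "AE v in S. \<forall>r<l. \<forall>\<^sub>F n in sequentially. r * real n < Y n v"
  using Y0 by (intro liminf_bound[OF int _ sub Z]) auto
 \<comment> \<open>The \<open>m\<close> possible phases of the blocks are treated together:
   \<open>Am\<close> grows by at most \<open>Y m (shiftn n v)\<close> per step, so it is bounded by
   a Birkhoff sum. \<open>YA\<close> returns from the phases to a single time at the cost of
   \<open>m\<close> increments of \<open>Dd\<close>, which is sublinear.\<close>
 have up1: "AE v in S. \<forall>r>a m. \<forall>\<^sub>F n in sequentially. Y n v < r * real n" if m: "1 <= m" for m
  using birkhoff[OF int[of m]] birkhoff[OF int1] AE_space proof eventually_elim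
  case (elim v)
  define Am where "Am = (%n. \<Sum>i<m. Y (n + i) v)"
  define B where "B = (%n. \<Sum>k<n. Y m (shiftn k v))"
  define Dd where "Dd = (%n. \<Sum>k<n. Y 1 (shiftn k v))"
  have AB: "Am n <= Am 0 + B n" for n proof (induction n)
   case (Suc n)
   have "Am (Suc n) + Y n v = Am n + Y (n + m) v" unfolding Am_def using sum.lessThan_Suc_shift[of "%i. Y (n + i) v" m] by simp
   moreover have "Y (n + m) v <= Y n v + Y m (shiftn n v)" using sub elim by blast
   ultimately show ?case using Suc by (simp add: B_def)
  qed (simp add: B_def)
  have YA: "real m * Y (n + m) v <= Am n + real m * (Dd (n + m) - Dd n)" for n proof -
   have "Y (n + m) v <= Y (n + i) v + (Dd (n + m) - Dd n)" if i: "i < m" for i proof -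
    have Dn: "Dd n <= Dd (n + i)" unfolding Dd_def using pos elim by (intro sum_mono2) auto
    have "Y (n + m) v <= Y (n + i) v + Y (m - i) (shiftn (n + i) v)" using sub[of v "n + i" "m - i"] elim i by simp
    also have "Y (m - i) (shiftn (n + i) v) <= (\<Sum>k<m - i. Y 1 (shiftn k (shiftn (n + i) v)))" using elim by (intro dom) simp
    also have "... = Dd (n + m) - Dd (n + i)"
     unfolding Dd_def using sum_lessThan_split[of "%k. Y 1 (shiftn k v)" "n + i" "m - i"] i by (simp add: add.commute)
    finally show ?thesis using Dn by linarith
   qed
   then have "(\<Sum>i<m. Y (n + m) v) <= (\<Sum>i<m. Y (n + i) v + (Dd (n + m) - Dd n))" by (intro sum_mono) auto
   then show ?thesis by (simp add: Am_def sum.distrib)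
  qed
  have lim: "(%n. B n / real n) \<longlonglongrightarrow> integral\<^sup>L S (Y m)" using elim by (simp add: B_def)
  have limD: "(%n. Dd n / real n) \<longlonglongrightarrow> integral\<^sup>L S (Y 1)" using elim by (simp add: Dd_def)
  have nn: "(%n. real n / real (n + m)) \<longlonglongrightarrow> 1" by real_asymp
  have limD2: "(%n. Dd (n + m) / real (n + m) - Dd n / real n * (real n / real (n + m))) \<longlonglongrightarrow> integral\<^sup>L S (Y 1) - integral\<^sup>L S (Y 1) * 1"
   by (intro tendsto_intros LIMSEQ_ignore_initial_segment[OF limD] limD nn)
  have lim0: "(%n. Am 0 / real (n + m)) \<longlonglongrightarrow> 0" by real_asymp
  have "(%n. Am 0 / real (n + m) + B n / real n * (real n / real (n + m)) + real m * (Dd (n + m) / real (n + m) - Dd n / real n * (real n / real (n + m))))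
    \<longlonglongrightarrow> 0 + integral\<^sup>L S (Y m) * 1 + real m * (integral\<^sup>L S (Y 1) - integral\<^sup>L S (Y 1) * 1)"
   by (intro tendsto_intros lim0 lim nn limD2)
  then have L: "(%n. Am 0 / real (n + m) + B n / real n * (real n / real (n + m)) + real m * (Dd (n + m) / real (n + m) - Dd n / real n * (real n / real (n + m))))
    \<longlonglongrightarrow> real m * a m" using m by (simp add: a_def)
  show ?case proof (intro allI impI)
   fix r assume "a m < r"
   then have "real m * a m < real m * r" using m by simp
   from order_tendstoD(2)[OF L this] have "\<forall>\<^sub>F n in sequentially. Y (n + m) v < r * real (n + m)" using eventually_gt_at_top[of 0]
   proof eventually_elim
    case (elim n)
    have "real m * Y (n + m) v <= Am 0 + B n + real m * (Dd (n + m) - Dd n)" using AB[of n] YA[of n] by linarith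
    also have "... = (Am 0 / real (n + m) + B n / real n * (real n / real (n + m)) + real m * (Dd (n + m) / real (n + m) - Dd n / real n * (real n / real (n + m)))) * real (n + m)"
    proof -
     have gf: "c + b + k * (D - d) = (c / x + b / u * (u / x) + k * (D / x - d / u * (u / x))) * x"
      if "x ~= 0" "u ~= 0" for c b k D d x u :: real using that by (simp add: field_simps)
     show ?thesis by (rule gf) (use elim in simp_all)
    qed
    also have "... < real m * r * real (n + m)" using elim by (intro mult_strict_right_mono) auto
    finally show ?case using m by simp
   qed
   then show "\<forall>\<^sub>F n in sequentially. Y n v < r * real n" by (rule iffD1[OF eventually_sequentially_seg])
  qed
 qed
 have "AE v in S. \<forall>m\<in>{1..}. \<forall>r>a m. \<forall>\<^sub>F n in sequentially. Y n v < r * real n"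
  using up1 by (subst AE_ball_countable) auto
 with low have "AE v in S. (%n. Y n v / real n) \<longlonglongrightarrow> l" proof eventually_elim
  case (elim v)
  show ?case proof (rule tendsto_ratioI)
   fix r assume "l < r"
   then obtain m where "m : {1..}" "a m < r" using cINF_less_iff[of "{1..}" a r] bdd unfolding l_def by auto
   then show "\<forall>\<^sub>F n in sequentially. Y n v < r * real n" using elim by blast
  qed (use elim in blast)
 qed
 then show ?thesis using l0 by blast
qed

end

subsection \<open>Transience and positive drift\<close>

context cusped
begin

text \<open>Otherwise the whole group fixes the base point of \<open>B\<close>. Heights bounded on
  the orbit then force every element to preserve height, \<open>B\<close> is the only cusp, and
  points far below the orbit would be near neither the orbit nor a horoball.\<close>

lemma moved_cusp: "\<exists>B\<in>C. \<exists>g\<in>G. (hinv (nb B) ** g ** nb B)$2$1 ~= 0"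
proof (rule ccontr)
 assume no: "\<not> ?thesis"
 obtain B where B: "B : C" using C_nonempty by blast
 define cj where "cj = (%g. hinv (nb B) ** g ** nb B)"
 note N = nb(1)[OF B]
 have cj: "cj g : SL2" "cj g$2$1 = 0" "cj g$1$1 * cj g$2$2 = 1" if "g : G" for g proof -
  show "cj g : SL2" "cj g$2$1 = 0" using no that N B by (auto simp: cj_def)
  then show "cj g$1$1 * cj g$2$2 = 1" by (simp add: SL2_iff)
 qed
 have ht: "ht B g z = (cj g$1$1)^2 * Im (cd B z)" if g: "g : G" and z: "0 < Im z" for g z proof -
  have "cd B (act g z) = act (cj g) (cd B z)" using g z N by (simp add: cd_def cj_def act_mult)
  then have "ht B g z = Im (cd B z) / (cj g$2$2)^2" using cj[OF g] B z by (simp add: Im_act den_def)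
  moreover have "cj g$2$2 = inverse (cj g$1$1)" using cj(3)[OF g] by (metis inverse_unique)
  ultimately show ?thesis by (simp add: field_simps)
 qed
 define y0 where "y0 = Im (cd B x0)"
 have y0: "0 < y0" using B by (simp add: y0_def)
 have le1: "(cj g$1$1)^2 <= 1" if g: "g : G" for g proof (rule ccontr)
  assume n: "\<not> (cj g$1$1)^2 <= 1"
  have pw: "\<exists>h\<in>G. ht B h x0 = ((cj g$1$1)^2) ^ n * y0" for n proof (induction n)
   case 0 show ?case by (rule bexI[of _ "mat 1"]) (simp_all add: y0_def)
  next
   case (Suc n)
   then obtain h where h: "h : G" "ht B h x0 = ((cj g$1$1)^2) ^ n * y0" by blast
   have "ht B (g ** h) x0 = (cj g$1$1)^2 * (((cj g$1$1)^2) ^ n * y0)" using ht[OF g, of "act h x0"] h g by (simp add: act_mult)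
   then show ?case using h g by (intro bexI[of _ "g ** h"]) auto
  qed
  obtain n where "H0 / y0 < ((cj g$1$1)^2) ^ n" using real_arch_pow n by (meson not_le)
  then have "H0 < ((cj g$1$1)^2) ^ n * y0" using y0 by (simp add: pos_divide_less_eq)
  then show False using pw[of n] H0(2)[OF B] by force
 qed
 have ht1: "ht B g z = Im (cd B z)" if g: "g : G" and z: "0 < Im z" for g z proof (rule antisym)
  have "ht B g z <= Im (cd B z)" if "g : G" "0 < Im z" for g z
   unfolding ht[OF that] using le1[OF that(1)] cd_upper[OF B that(2)] by (intro mult_left_le_one_le) auto
  from this[of g z] this[of "hinv g" "act g z"] g z
  show "ht B g z <= Im (cd B z)" "Im (cd B z) <= ht B g z" by auto
 qed
 have stB: "g : set_stabilizer G B" if g: "g : G" for g proof -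
  have "act g ` B \<subseteq> B" if "g : G" for g proof
   fix w assume "w : act g ` B"
   then obtain z where z: "z : B" "w = act g z" by blast
   then have u: "0 < Im z" using horoball_upper[OF B] by auto
   then show "w : B" using z mem_horoball[OF B] ht1[OF that u] that by simp
  qed
  from this[OF g] this[of "hinv g"] g have s: "act g ` B \<subseteq> B" "act (hinv g) ` B \<subseteq> B" by auto
  have "z : act g ` B" if z: "z : B" for z proof -
   have "0 < Im z" using horoball_upper[OF B] z by auto
   then show ?thesis using s(2) z g by (intro image_eqI[of _ _ "act (hinv g) z"]) auto
  qed
  then show ?thesis using g s(1) by (auto simp: set_stabilizer_def)
 qed
 \<comment> \<open>A parabolic element stabilizing \<open>B'\<close> also stabilizes
   \<open>B\<close>. Its displacement computed in both coordinates shows that the two heights are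
   proportional, so a high point lies in both horoballs.\<close>
 have one: "B' = B" if B': "B' : C" for B' proof -
  obtain p where p: "p : set_stabilizer G B'" "parabolic p" using cusps B' by (auto simp: cusp_horoballs_def)
  then have nt: "p \<notin> triv" by (auto simp: parabolic_def triv_def)
  obtain t' where t': "t' ~= 0" "!!z. 0 < Im z ==> displ z p = (t' / Im (cd B' z))^2" using stab_translation[OF B' p(1)] nt by auto
  obtain t where t: "t ~= 0" "!!z. 0 < Im z ==> displ z p = (t / Im (cd B z))^2" using stab_translation[OF B stB[OF stab_G[OF p(1)]]] nt by auto
  define Y where "Y = max 2 (2 * abs t' / abs t)"
  define z where "z = act (nb B') (Complex 0 Y)"
  have Y: "2 <= Y" "2 * abs t' <= Y * abs t" using t(1) by (auto simp: Y_def max_def field_simps)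
  have z: "0 < Im z" "cd B' z = Complex 0 Y" using Y nb(1)[OF B'] by (simp_all add: z_def cd_def)
  have "(t / Im (cd B z))^2 = (t' / Y)^2" using t(2)[OF z(1)] t'(2)[OF z(1)] z(2) by simp
  then have "abs t / Im (cd B z) = abs t' / Y" using Y cd_upper[OF B z(1)] by (simp add: power2_eq_iff abs_divide flip: abs_eq_iff)
  then have "abs t' * Im (cd B z) = abs t * Y" using Y cd_upper[OF B z(1)] by (simp add: field_simps)
  then have "abs t' * 2 <= abs t' * Im (cd B z)" using Y by (simp add: mult.commute)
  then have "z : B" using mem_horoball[OF B z(1)] t'(1) by simp
  moreover have "z : B'" using mem_horoball[OF B' z(1)] z Y by simp
  ultimately have "act (mat 1) ` B \<inter> B' ~= {}" by auto
  then show ?thesis using cusps B B' G_one unfolding cusp_horoballs_def by metis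
 qed
 \<comment> \<open>Every orbit point has height \<open>y0\<close>, and the logarithmic distance from
   height \<open>y\<close> to \<open>y0\<close> exceeds \<open>R0\<close>; with height at most 1/2
   the point is in no horoball either.\<close>
 define y where "y = min (1/2) (y0 * exp (- R0) / 2)"
 define z where "z = act (nb B) (Complex 0 y)"
 have y: "0 < y" "y <= 1/2" "y <= y0 * exp (- R0) / 2" using y0 by (auto simp: y_def)
 have z: "0 < Im z" "cd B z = Complex 0 y" using y N by (simp_all add: z_def cd_def)
 have "dorb z <= R0" proof (rule ccontr)
  assume "\<not> dorb z <= R0"
  then obtain k B' where k: "k : G" "B' : C" "1 < ht B' k z" using R0(3)[OF z(1)] by force
  then show False using one[OF k(2)] ht1[OF k(1) z(1)] z y by auto
 qed
 moreover obtain h where h: "closest z h" using closest_exists[OF z(1)] by blast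
 ultimately have d: "dH z (act h x0) <= R0" using closestD(2)[OF h] by simp
 have hG: "h : G" using closestD(1)[OF h] .
 have "ht B h x0 <= Im (cd B z) * exp (dH (cd B z) (cd B (act h x0)))" by (intro Im_le_exp cd_upper[OF B]) (use z hG in auto)
 then have "y0 <= y * exp (dH z (act h x0))" using ht1[OF hG x0] z(2) cd_dist[OF B z(1), of "act h x0"] hG by (simp add: y0_def)
 also have "... <= y * exp R0" using y d by simp
 also have "... <= y0 * exp (- R0) / 2 * exp R0" using y by simp
 finally show False using y0 by (simp add: exp_minus)
qed

end

text \<open>A ping-pong estimate: the map sends infinity to the real number
  \<open>A$1$1 / A$2$1\<close>, so points with large real part land at bounded real part.\<close>

lemma act_Re_bound: assumes A: "A : SL2" "A$2$1 ~= 0" shows "\<exists>T. \<forall>z. 0 < Im z --> T < abs (Re z) --> abs (Re (act A z)) <= T"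
proof -
 let ?c = "A$2$1" and ?d = "A$2$2" and ?a = "A$1$1"
 define T where "T = abs (?a / ?c) + 1 / abs (?c) + (abs (?d) + 1) / abs (?c)"
 have "abs (Re (act A z)) <= T" if z: "0 < Im z" "T < abs (Re z)" for z proof -
  have e: "of_real (?a) * of_real ?d - of_real (A$1$2) * of_real ?c = (1::complex)"
   using arg_cong[OF A(1)[unfolded SL2_iff], of complex_of_real] by simp
  have "act A z = of_real (?a / ?c) - 1 / (of_real ?c * den A z)"
   using den_nonzero[OF A(1) z(1)] A(2) e by (simp add: act_eq field_simps) (simp add: den_def algebra_simps)
  then have "abs (Re (act A z)) <= abs (?a / ?c) + abs (Re (1 / (of_real ?c * den A z)))" by (simp only: minus_complex.simps Re_complex_of_real abs_triangle_ineq4)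
  also have "abs (Re (1 / (of_real ?c * den A z))) <= cmod (1 / (of_real ?c * den A z))" by (rule abs_Re_le_cmod)
  also have "... = 1 / (abs (?c) * cmod (den A z))" by (simp add: norm_divide norm_mult)
  also have "... <= 1 / abs (?c)" proof -
   have "(abs (?d) + 1) / abs (?c) <= T" by (simp add: T_def)
   then have "(abs (?d) + 1) / abs (?c) <= abs (Re z)" using z by linarith
   then have "abs (?d) + 1 <= abs (?c * Re z)" using A(2) by (simp add: abs_mult pos_divide_le_eq mult.commute)
   then have "1 <= abs (Re (den A z))" by (simp add: den_def)
   then have "1 <= cmod (den A z)" using abs_Re_le_cmod[of "den A z"] by linarith
   then show ?thesis using A(2) by (intro divide_left_mono) (auto intro!: mult_pos_pos)
  qed
  also have "abs (?a / ?c) + 1 / abs (?c) <= T" by (simp add: T_def)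
  finally show ?thesis by simp
 qed
 then show ?thesis by blast
qed

text \<open>The set \<open>X\<close> and its images under \<open>f\<close> and its inverse are
  disjoint. If \<open>p\<close> were nearly invariant each would carry almost the mass of
  \<open>X\<close>, and three disjoint sets cannot each hold almost half of the total.\<close>

lemma wandering_displacement:
 fixes p :: "'a => real" assumes bij: "bij f" and int: "integrable (count_space UNIV) (%x. (p x)^2)"
  and X: "!!x. x : X ==> f x \<notin> X" "!!x. x : X ==> f (f x) \<notin> X"
  and half: "(\<integral>x. (p x)^2 \<partial>count_space UNIV) <= 2 * (\<integral>x. (p x)^2 * indicator X x \<partial>count_space UNIV)"
 shows "(\<integral>x. (p x)^2 \<partial>count_space UNIV) <= 24 * (\<integral>x. (p x - p (f x))^2 \<partial>count_space UNIV)"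
proof -
 let ?I = "integral\<^sup>L (count_space UNIV)"
 define g where "g = inv_into UNIV f"
 have g: "bij g" "!!x. f (g x) = x" "!!x. g (f x) = x" using bij by (auto simp: g_def bij_imp_bij_inv surj_f_inv_f bij_is_surj bij_is_inj)
 have ch: "?I (%x. h (s x)) = ?I h" "integrable (count_space UNIV) (%x. h (s x)) = integrable (count_space UNIV) h"
  if "bij s" for s and h :: "'a => real" using integral_bij_count_space[OF that, of h] integrable_bij_count_space[OF that, of h] by auto
 have sub: "integrable (count_space UNIV) (%x. h x * indicator Y x)" if "integrable (count_space UNIV) h" for h :: "'a => real" and Y
  using integrable_real_mult_indicator[of Y "count_space UNIV" h] that by simp
 have i2: "integrable (count_space UNIV) (%x. (p (s x))^2)" if "bij s" for s using ch(2)[OF that, of "%x. (p x)^2"] int by simp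
 have iD: "integrable (count_space UNIV) (%x. (p x - p (s x))^2)" if "bij s" for s proof (rule Bochner_Integration.integrable_bound)
  show "integrable (count_space UNIV) (%x. 2 * (p x)^2 + 2 * (p (s x))^2)" using i2[OF that] int by simp
  have "(a - b)^2 <= 2 * a^2 + 2 * b^2" for a b :: real using sum_squares_ge_zero[of "a + b" 0] by (simp add: power2_eq_square algebra_simps)
  then show "AE x in count_space UNIV. norm ((p x - p (s x))^2) <= norm (2 * (p x)^2 + 2 * (p (s x))^2)" by simp
 qed simp
 define D where "D = ?I (%x. (p x - p (f x))^2)"
 define m where "m = ?I (%x. (p x)^2 * indicator X x)"
 have Dg: "?I (%x. (p x - p (g x))^2) = D" using ch(1)[OF bij, of "%x. (p x - p (g x))^2"] g by (simp add: D_def power2_commute)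
 have step: "m <= 3/2 * ?I (%x. (p x)^2 * indicator X (t x)) + 3 * ?I (%x. (p x - p (s x))^2)"
  if s: "bij s" "!!x. t (s x) = x" for s t proof -
  have e: "?I (%x. (p x)^2 * indicator X (t x)) = ?I (%x. (p (s x))^2 * indicator X x)"
   using ch(1)[OF s(1), of "%x. (p x)^2 * indicator X (t x)"] s(2) by simp
  have "m <= ?I (%x. 3/2 * ((p (s x))^2 * indicator X x) + 3 * (p x - p (s x))^2)" unfolding m_def proof (rule integral_mono)
   fix x
   \<comment> \<open>With these constants the three masses add up to at least
     \<open>7/3 * m - 4 * D\<close>. As \<open>m\<close> is at least half of the total, the total is
     at most \<open>24 * D\<close>.\<close>
   have q: "a^2 <= 3/2 * b^2 + 3 * (a - b)^2" for a b :: real using zero_le_power2[of "2 * a - 3 * b"] by (simp add: power2_eq_square algebra_simps)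
   show "(p x)^2 * indicator X x <= 3/2 * ((p (s x))^2 * indicator X x) + 3 * (p x - p (s x))^2"
    using q[of "p x" "p (s x)"] by (auto simp: indicator_def)
  qed (use sub[OF int] sub[OF i2[OF s(1)]] iD[OF s(1)] in "auto intro!: Bochner_Integration.integrable_add")
  also have "... = 3/2 * ?I (%x. (p x)^2 * indicator X (t x)) + 3 * ?I (%x. (p x - p (s x))^2)"
   unfolding e using sub[OF i2[OF s(1)]] iD[OF s(1)] by (subst Bochner_Integration.integral_add) auto
  finally show ?thesis .
 qed
 have "?I (%x. (p x)^2 * indicator X x) + ?I (%x. (p x)^2 * indicator X (f x)) + ?I (%x. (p x)^2 * indicator X (g x))
   = ?I (%x. (p x)^2 * indicator X x + (p x)^2 * indicator (f -` X) x + (p x)^2 * indicator (g -` X) x)"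
  using sub[OF int, of X] sub[OF int, of "f -` X"] sub[OF int, of "g -` X"] by (simp add: indicator_vimage)
 also have "... <= ?I (%x. (p x)^2)" proof (rule integral_mono)
  fix x
  show "(p x)^2 * indicator X x + (p x)^2 * indicator (f -` X) x + (p x)^2 * indicator (g -` X) x <= (p x)^2"
   using X[of x] X[of "g x"] g by (auto simp: indicator_def)
 qed (use sub[OF int] int in auto)
 finally show ?thesis using step[OF bij g(3)] step[OF g(1) g(2)] half unfolding Dg D_def[symmetric] m_def[symmetric] by linarith
qed

section \<open>Convolution powers and exponential decay of return probabilities\<close>

definition cv :: "(real^2^2) pmf => (real^2^2) pmf => (real^2^2) pmf" where
 "cv q p = bind_pmf q (%s. map_pmf ((**) s) p)"

text \<open>The collision probability: Kesten's estimate is a contraction of the squared norm \<open>coin p p\<close>.\<close>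

definition coin :: "'a pmf => 'a pmf => real" where
 "coin p q = (\<integral>x. pmf p x * pmf q x \<partial>count_space UNIV)"

lemma coin_sym: "coin p q = coin q p" by (simp add: coin_def mult.commute)

lemma coin_eq: "(\<integral>x. pmf q x \<partial>measure_pmf p) = coin p q" unfolding coin_def measure_pmf_eq_density by (subst integral_density) auto

lemma coin_integrable: "integrable (count_space UNIV) (%x. pmf p x * pmf q x)"
proof (rule Bochner_Integration.integrable_bound)
 show "integrable (count_space UNIV) (pmf p)" by (rule integrable_pmf)
 show "AE x in count_space UNIV. norm (pmf p x * pmf q x) <= norm (pmf p x)" by (simp add: pmf_le_1 mult_left_le)
qed simp

lemma coin_bind: "coin (bind_pmf q F) p = (\<integral>s. coin (F s) p \<partial>measure_pmf q)"
proof -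
 have "coin (bind_pmf q F) p = (\<integral>x. pmf p x \<partial>measure_pmf (bind_pmf q F))" by (simp add: coin_eq)
 also have "... = (\<integral>s. (\<integral>x. pmf p x \<partial>measure_pmf (F s)) \<partial>measure_pmf q)" unfolding measure_pmf_bind
  by (rule integral_bind[where K="count_space UNIV" and B=1 and B'=1]) (auto simp: pmf_le_1 intro!: measure_pmf_in_subprob_algebra)
 finally show ?thesis by (simp add: coin_eq)
qed

lemma coin_bounds: "0 <= coin p q" "coin p q <= 1"
proof -
 show "0 <= coin p q" unfolding coin_def by (intro integral_nonneg_AE) simp
 show "coin p q <= 1" unfolding coin_eq[symmetric]
  by (intro measure_pmf.integral_le_const measure_pmf.integrable_const_bound[of _ 1]) (auto simp: pmf_le_1)
qed

lemma coin_diff: "(\<integral>x. (pmf p x - pmf q x)^2 \<partial>count_space UNIV) = coin p p + coin q q - 2 * coin p q"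
proof -
 have "(\<integral>x. (pmf p x - pmf q x)^2 \<partial>count_space UNIV) =
   (\<integral>x. pmf p x * pmf p x + pmf q x * pmf q x - 2 * (pmf p x * pmf q x) \<partial>count_space UNIV)"
  by (intro Bochner_Integration.integral_cong) (auto simp: power2_eq_square algebra_simps)
 then show ?thesis by (simp add: coin_def coin_integrable)
qed

lemma pmf_translate: "s : SL2 ==> pmf (map_pmf ((**) s) p) x = pmf p (hinv s ** x)"
 using pmf_map_inj'[of "(**) s" p "hinv s ** x"] by (metis hinv_cancel injI)

lemma bij_translate: "s : SL2 ==> bij ((**) s)" by (rule bij_betw_byWitness[of _ "(**) (hinv s)"]) auto

lemma coin_translate: assumes "s : SL2" shows "coin (map_pmf ((**) s) p) (map_pmf ((**) s) p) = coin p p"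
 using integral_bij_count_space[OF bij_translate[OF SL2_inv[OF assms]], of "%x. pmf p x * pmf p x"] by (simp add: coin_def pmf_translate assms)

text \<open>The left side averages the inner products of all pairs of translates of
  \<open>p\<close>. Translations preserve \<open>coin p p\<close>, so every pair gives at most that;
  the pair of the identity and \<open>a\<close> supplies the gain.\<close>

lemma coin_cv: assumes q: "set_pmf q \<subseteq> SL2"
 shows "coin (cv q p) (cv q p) <= coin p p - pmf q (mat 1) * pmf q a * (coin p p - coin p (map_pmf ((**) a) p))"
proof -
 let ?F = "%s. map_pmf ((**) s) p"
 have F1: "?F (mat 1) = p" by (simp add: map_pmf_idI)
 have le: "coin (?F s) (?F t) <= coin p p" if "s : SL2" "t : SL2" for s t proof -
  have "0 <= (\<integral>x. (pmf (?F s) x - pmf (?F t) x)^2 \<partial>count_space UNIV)" by (intro integral_nonneg_AE) simp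
  then show ?thesis unfolding coin_diff using that by (simp add: coin_translate)
 qed
 define T where "T = coin p p - coin p (?F a)"
 have int: "integrable (measure_pmf q) f" if "!!x. abs (f x) <= B" for f :: "real^2^2 => real" and B
  by (rule measure_pmf.integrable_const_bound[of _ B]) (auto simp: that)
 have I1: "integrable (measure_pmf q) (%t. coin (?F t) (?F s))" for s by (rule int[of _ 1]) (use coin_bounds[of "?F _" "?F s"] in auto)
 have I2: "integrable (measure_pmf q) (%t. c - k * indicator {x} t)" for c k :: real and x
  by (rule int[of _ "abs c + abs k"]) (auto simp: indicator_def)
 have E2: "(\<integral>t. c - k * indicator {x} t \<partial>measure_pmf q) = c - k * pmf q x" for c k :: real and x
  by (subst Bochner_Integration.integral_diff) (auto simp: measure_pmf_single intro!: int[of _ 1])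
 have "coin (cv q p) (cv q p) = (\<integral>s. (\<integral>t. coin (?F t) (?F s) \<partial>measure_pmf q) \<partial>measure_pmf q)"
  unfolding cv_def coin_bind by (subst coin_sym) (simp only: coin_bind)
 also have "... <= (\<integral>s. coin p p - T * pmf q (mat 1) * indicator {a} s \<partial>measure_pmf q)" proof (rule integral_mono_AE)
  show "AE s in measure_pmf q. (\<integral>t. coin (?F t) (?F s) \<partial>measure_pmf q) <= coin p p - T * pmf q (mat 1) * indicator {a} s"
  proof (rule AE_pmfI)
   fix s assume s: "s : set_pmf q"
   have "(\<integral>t. coin (?F t) (?F s) \<partial>measure_pmf q) <= (\<integral>t. coin p p - (T * indicator {a} s) * indicator {mat 1} t \<partial>measure_pmf q)"
   proof (rule integral_mono_AE[OF I1 I2])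
    show "AE t in measure_pmf q. coin (?F t) (?F s) <= coin p p - T * indicator {a} s * indicator {mat 1} t"
     using le s q by (intro AE_pmfI) (auto simp: indicator_def T_def F1 intro: le[of "mat 1", unfolded F1])
   qed
   then show "(\<integral>t. coin (?F t) (?F s) \<partial>measure_pmf q) <= coin p p - T * pmf q (mat 1) * indicator {a} s"
    unfolding E2 by (simp add: mult_ac)
  qed
  show "integrable (measure_pmf q) (%s. \<integral>t. coin (?F t) (?F s) \<partial>measure_pmf q)" proof (rule int[of _ 1])
   fix s
   have "0 <= (\<integral>t. coin (?F t) (?F s) \<partial>measure_pmf q)" using coin_bounds(1) by (intro integral_nonneg_AE AE_pmfI)
   moreover have "(\<integral>t. coin (?F t) (?F s) \<partial>measure_pmf q) <= 1"
    using coin_bounds(2) by (intro measure_pmf.integral_le_const I1 AE_pmfI)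
   ultimately show "abs (\<integral>t. coin (?F t) (?F s) \<partial>measure_pmf q) <= 1" by simp
  qed
 qed (rule I2)
 also have "... = coin p p - T * pmf q (mat 1) * pmf q a" by (rule E2)
 finally show ?thesis by (simp add: T_def mult_ac)
qed

lemma lp_walk: "walk (m + n) v = walk m v ** walk n (shiftn m v)"
proof -
 have "map v [0..<m + n] = map v [0..<m] @ map (shiftn m v) [0..<n]" by (rule nth_equalityI) (auto simp: nth_append shiftn_def)
 then show ?thesis by (simp add: walk_def lp_append)
qed

lemma walk_0 [simp]: "walk 0 v = mat 1" by (simp add: walk_def)

lemma walk_1 [simp]: "walk (Suc 0) v = v 0" by (simp add: walk_def)

lemma walk_Suc: "walk (Suc n) v = v 0 ** walk n (shiftn 1 v)" using lp_walk[of 1 n v] by simp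

primrec mun :: "(real^2^2) pmf => nat => (real^2^2) pmf" where
 "mun \<mu> 0 = return_pmf (mat 1)" | "mun \<mu> (Suc n) = cv \<mu> (mun \<mu> n)"

lemma mun_add: "mun \<mu> (m + n) = cv (mun \<mu> m) (mun \<mu> n)"
proof (induction m)
 case (Suc m)
 have "cv (cv p q) r = cv p (cv q r)" for p q r by (simp add: cv_def bind_assoc_pmf bind_map_pmf map_bind_pmf pmf.map_comp matrix_mul_assoc o_def)
 then show ?case using Suc by simp
qed (simp add: cv_def bind_return_pmf map_pmf_idI)

locale walked = cusped +
 fixes \<mu> :: "(real^2^2) pmf" assumes supp: "set_pmf \<mu> \<subseteq> G" and semi: "semigroup_generated SL2R (set_pmf \<mu>) = G"
  and moment: "integrable (measure_pmf \<mu>) (%g. lG g)"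
begin

lemma mun_mult: "g : set_pmf (mun \<mu> m) ==> h : set_pmf (mun \<mu> n) ==> g ** h : set_pmf (mun \<mu> (m + n))" by (auto simp: mun_add cv_def)

lemma mun_G: "set_pmf (mun \<mu> n) \<subseteq> G" using supp by (induction n) (auto simp: cv_def subset_iff intro!: G_mult)

lemma mun_reach: assumes "g : G" shows "\<exists>n\<ge>1. g : set_pmf (mun \<mu> n)"
proof -
 have w: "lp w : set_pmf (mun \<mu> (length w))" if "set w \<subseteq> set_pmf \<mu>" for w using that by (induction w) (auto simp: cv_def)
 obtain w where "w ~= []" "set w \<subseteq> set_pmf \<mu>" "g = lp w" using assms semi by (auto simp: semigroup_generated_def)
 then show ?thesis using w[of w] by (intro exI[of _ "length w"]) (auto simp: Suc_le_eq)
qed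

lemma mun_pow: assumes B: "B : C" and g: "g : G" and s: "g ** pw B i ** hinv g : set_pmf (mun \<mu> n)"
 shows "g ** pw B (int m * i) ** hinv g : set_pmf (mun \<mu> (m * n))"
proof (induction m)
 case 0 show ?case using g by simp
next
 case (Suc m)
 have "g ** pw B i ** hinv g ** (g ** pw B (int m * i) ** hinv g) = g ** pw B (i + int m * i) ** hinv g"
  using g by (simp add: pw_add[OF B] flip: matrix_mul_assoc)
 then show ?case using mun_mult[OF s Suc] by (simp add: algebra_simps)
qed

text \<open>By \<open>act_Re_bound\<close> every element has bounded real part in the cusp
  coordinate either directly or after \<open>hinv g\<close>. A large power of the parabolic element,
  respectively its conjugate by \<open>g\<close>, pushes that set off itself twice. One of the two
  sets carries half of the squared norm of \<open>p\<close>, and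
  \<open>wandering_displacement\<close> applies to it.\<close>

lemma decay_step:
 "\<exists>k v. 1 <= k \<and> 0 < v \<and> v < 1 \<and> (\<forall>p. set_pmf p \<subseteq> G --> coin (cv (mun \<mu> k) p) (cv (mun \<mu> k) p) <= (1 - v) * coin p p)"
proof -
 obtain B g where B: "B : C" and g: "g : G" "(hinv (nb B) ** g ** nb B)$2$1 ~= 0" using moved_cusp by blast
 define r where "r = hinv (nb B) ** hinv g ** nb B"
 have r: "r : SL2" "r$2$1 ~= 0" proof -
  show S: "r : SL2" using nb(1)[OF B] g by (simp add: r_def)
  have "hinv r = hinv (nb B) ** g ** nb B" using nb(1)[OF B] g by (simp add: r_def hinv_mult matrix_mul_assoc)
  then show "r$2$1 ~= 0" using g(2) arg_cong[OF hinv_eq[OF S], of "%A. A$2$1"] by auto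
 qed
 obtain T where T: "!!z. 0 < Im z ==> T < abs (Re z) ==> abs (Re (act r z)) <= T" using act_Re_bound[OF r] by blast
 define co where "co = (%h. Re (cd B (act h x0)))"
 define X where "X = {h : G. abs (co h) <= T}"
 define X' where "X' = {h : G. abs (co (hinv g ** h)) <= T}"
 have cov: "G \<subseteq> X \<union> X'" proof
  fix h assume h: "h : G"
  have "co (hinv g ** h) = Re (act r (cd B (act h x0)))" using h g nb(1)[OF B] by (simp add: co_def r_def cd_def act_mult)
  then show "h : X \<union> X'" using T[of "cd B (act h x0)"] h B by (force simp: X_def X'_def co_def)
 qed
 have sh: "co (pw B i ** h) = co h + of_int i * tb B" if "h : G" for h i using that pw_G[OF B, of i] by (simp add: co_def act_mult cd_pw[OF B])
 obtain N :: nat where N: "2 * abs T / abs (tb B) < real N" using reals_Archimedean2 by blast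
 have tb: "tb B ~= 0" using pb_tb(2)[OF B] .
 obtain n1 na nb' where n: "1 <= n1" "mat 1 : set_pmf (mun \<mu> n1)" "1 <= na" "pw B (int N + 1) : set_pmf (mun \<mu> na)"
   "1 <= nb'" "g ** pw B (int N + 1) ** hinv g : set_pmf (mun \<mu> nb')"
  using mun_reach[OF G_one] mun_reach[OF pw_G[OF B, of "int N + 1"]] mun_reach[of "g ** pw B (int N + 1) ** hinv g"] pw_G[OF B] g by force
 \<comment> \<open>The product of the three reaching times: suitable powers of the identity, the
   parabolic element and its conjugate then lie in the support of the same convolution power, by
   \<open>mun_pow\<close>.\<close>
 define k where "k = n1 * na * nb'"
 define q where "q = mun \<mu> k"
 define i where "i = int (n1 * nb') * (int N + 1)"
 define i' where "i' = int (n1 * na) * (int N + 1)"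
 have big: "2 * abs T < abs (of_int (int m * (int N + 1)) * tb B)" if "1 <= m" for m :: nat proof -
  have "2 * abs T < real N * abs (tb B)" using N tb by (simp add: pos_divide_less_eq)
  also have "... <= (real m * (real N + 1)) * abs (tb B)" proof (rule mult_right_mono)
   have "1 * (real N + 1) <= real m * (real N + 1)" using that by (intro mult_right_mono) auto
   then show "real N <= real m * (real N + 1)" by (simp only: mult_1)
  qed simp
  finally show ?thesis by simp
 qed
 have bi: "2 * abs T < abs (of_int i * tb B)" "2 * abs T < abs (of_int i' * tb B)"
  using big[of "n1 * nb'"] big[of "n1 * na"] n by (auto simp: i_def i'_def)
 have one: "mat 1 : set_pmf q" using mun_pow[OF B G_one, of 0 n1 "na * nb'"] n by (simp add: q_def k_def mult_ac)
 have a: "pw B i : set_pmf q" using mun_pow[OF B G_one, of "int N + 1" na "n1 * nb'"] n by (simp add: q_def k_def i_def mult_ac)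
 have b: "g ** pw B i' ** hinv g : set_pmf q" (is "?b : _") using mun_pow[OF B g(1), of "int N + 1" nb' "n1 * na"] n by (simp add: q_def k_def i'_def)
 define v where "v = pmf q (mat 1) * min (pmf q (pw B i)) (pmf q ?b) / 48"
 have v: "0 < v" "v < 1" proof -
  show "0 < v" using one a b by (simp add: v_def pmf_positive)
  have "pmf q (mat 1) * min (pmf q (pw B i)) (pmf q ?b) <= 1 * 1" by (intro mult_mono) (auto simp: pmf_le_1 min.coboundedI1)
  then show "v < 1" by (simp add: v_def)
 qed
 have "coin (cv q p) (cv q p) <= (1 - v) * coin p p" if p: "set_pmf p \<subseteq> G" for p proof -
  have c0: "0 <= coin p p" by (rule coin_bounds)
  have int: "integrable (count_space UNIV) (%x. (pmf p x)^2)" using coin_integrable[of p p] by (simp add: power2_eq_square)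
  have cc: "coin p p = (\<integral>x. (pmf p x)^2 \<partial>count_space UNIV)" by (simp add: coin_def power2_eq_square)
  have fin: ?thesis
   if s: "s : G" "s : set_pmf q" "pmf q (pw B i) = pmf q s \<or> pmf q ?b = pmf q s"
    and Y: "!!x. x : Y ==> hinv s ** x \<notin> Y" "!!x. x : Y ==> hinv s ** (hinv s ** x) \<notin> Y"
    and h: "coin p p <= 2 * (\<integral>x. (pmf p x)^2 * indicator Y x \<partial>count_space UNIV)" for s Y proof -
   have "coin p p <= 24 * (\<integral>x. (pmf p x - pmf p (hinv s ** x))^2 \<partial>count_space UNIV)"
    using wandering_displacement[OF bij_translate[of "hinv s"] int Y] s(1) h by (simp add: cc)
   also have "... = 24 * (2 * coin p p - 2 * coin p (map_pmf ((**) s) p))"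
    using coin_diff[of p "map_pmf ((**) s) p"] s(1) by (simp add: pmf_translate coin_translate)
   finally have d: "coin p p / 48 <= coin p p - coin p (map_pmf ((**) s) p)" by simp
   have m: "min (pmf q (pw B i)) (pmf q ?b) <= pmf q s" using s(3) by auto
   have "v * coin p p = pmf q (mat 1) * min (pmf q (pw B i)) (pmf q ?b) * (coin p p / 48)" by (simp add: v_def)
   also have "... <= pmf q (mat 1) * pmf q s * (coin p p - coin p (map_pmf ((**) s) p))" using d c0 m by (intro mult_mono mult_nonneg_nonneg) auto
   also have "... <= coin p p - coin (cv q p) (cv q p)" using coin_cv[of q p s] mun_G[of k] by (force simp: q_def)
   finally show ?thesis by (simp add: algebra_simps)
  qed
  have "coin p p <= (\<integral>x. (pmf p x)^2 * indicator X x + (pmf p x)^2 * indicator X' x \<partial>count_space UNIV)" unfolding cc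
  proof (rule integral_mono)
   fix x
   have "x \<notin> G ==> pmf p x = 0" using p by (auto simp: set_pmf_iff)
   then show "(pmf p x)^2 <= (pmf p x)^2 * indicator X x + (pmf p x)^2 * indicator X' x" using cov by (cases "x : G") auto
  qed (use int integrable_real_mult_indicator[OF _ int] in "auto simp: mult.commute")
  also have "... = (\<integral>x. (pmf p x)^2 * indicator X x \<partial>count_space UNIV) + (\<integral>x. (pmf p x)^2 * indicator X' x \<partial>count_space UNIV)"
   using integrable_real_mult_indicator[OF _ int] by (intro Bochner_Integration.integral_add) auto
  finally consider "coin p p <= 2 * (\<integral>x. (pmf p x)^2 * indicator X x \<partial>count_space UNIV)"
   | "coin p p <= 2 * (\<integral>x. (pmf p x)^2 * indicator X' x \<partial>count_space UNIV)" by linarith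
  then show ?thesis proof cases
   case 1
   show ?thesis proof (rule fin[OF pw_G[OF B] a _ _ _ 1])
    have e: "hinv (pw B i) = pw B (- i)" by (simp add: pw_minus[OF B])
    show "hinv (pw B i) ** x \<notin> X" "hinv (pw B i) ** (hinv (pw B i) ** x) \<notin> X" if "x : X" for x
     unfolding e using that bi(1) pw_G[OF B] by (auto simp: X_def sh)
   qed simp
  next
   case 2
   have bG: "?b : G" using g pw_G[OF B] by simp
   show ?thesis proof (rule fin[OF bG b _ _ _ 2])
    have e: "hinv ?b = g ** pw B (- i') ** hinv g" using g pw_G[OF B] by (simp add: pw_minus[OF B] hinv_mult matrix_mul_assoc)
    have e2: "hinv g ** (hinv ?b ** x) = pw B (- i') ** (hinv g ** x)" if "x : G" for x unfolding e using g by (simp add: flip: matrix_mul_assoc)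
    have X': "x : X' \<longleftrightarrow> x : G \<and> abs (co (hinv g ** x)) <= T" for x by (simp add: X'_def)
    show "hinv ?b ** x \<notin> X'" "hinv ?b ** (hinv ?b ** x) \<notin> X'" if "x : X'" for x
     using that bi(2) g bG pw_G[OF B] unfolding X' by (auto simp: e2 sh)
   qed simp
  qed
 qed
 moreover have "1 <= k" using n by (simp add: k_def)
 ultimately show ?thesis using v unfolding q_def by blast
qed

text \<open>A single squared probability is at most the collision probability, which
  \<open>decay_step\<close> contracts by a fixed factor every \<open>k\<close> steps.\<close>

lemma return_decay: "\<exists>k r. 1 <= k \<and> 0 < r \<and> r < 1 \<and> (\<forall>j g. pmf (mun \<mu> (j * k)) g <= r ^ j)"
proof -
 obtain k d where k: "1 <= k" "0 < d" "d < 1"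
  "!!p. set_pmf p \<subseteq> G ==> coin (cv (mun \<mu> k) p) (cv (mun \<mu> k) p) <= (1 - d) * coin p p" using decay_step by blast
 have c: "coin (mun \<mu> (j * k)) (mun \<mu> (j * k)) <= (1 - d) ^ j" for j proof (induction j)
  case 0 show ?case by (simp add: coin_bounds)
 next
  case (Suc j)
  have "coin (mun \<mu> (Suc j * k)) (mun \<mu> (Suc j * k)) <= (1 - d) * coin (mun \<mu> (j * k)) (mun \<mu> (j * k))"
   using k(4)[OF mun_G] by (simp add: mun_add)
  also have "... <= (1 - d) * (1 - d) ^ j" using Suc k by (intro mult_left_mono) auto
  finally show ?case by simp
 qed
 have "pmf (mun \<mu> (j * k)) g <= sqrt (1 - d) ^ j" for j g proof -
  let ?p = "mun \<mu> (j * k)"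
  have "(pmf ?p g)^2 = (\<integral>x. (pmf ?p g)^2 * indicator {g} x \<partial>count_space UNIV)" by simp
  also have "... <= coin ?p ?p" unfolding coin_def
   by (intro integral_mono coin_integrable integrable_mult_right integrable_real_indicator) (auto simp: power2_eq_square split: split_indicator)
  also have "... <= (1 - d) ^ j" by (rule c)
  finally have "pmf ?p g <= sqrt ((1 - d) ^ j)" by (rule real_le_rsqrt)
  then show ?thesis by (simp add: real_sqrt_power)
 qed
 then show ?thesis using k by (intro exI[of _ k] exI[of _ "sqrt (1 - d)"]) auto
qed

end

section \<open>The random walk as a stationary subadditive process\<close>

lemma borel_measurable_matrix_mult [measurable]:
 fixes f g :: "'a => real^2^2" assumes "f : borel_measurable M" "g : borel_measurable M" shows "(%x. f x ** g x) : borel_measurable M"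
proof (rule borel_measurable_continuous_Pair[OF assms])
 show "continuous_on UNIV (%x. fst x ** snd x :: real^2^2)" unfolding matrix_matrix_mult_def by (intro continuous_intros)
qed

sublocale walked \<subseteq> W: sequence_space "measure_pmf \<mu>"
proof -
 have "product_prob_space (%_::nat. measure_pmf \<mu>)" by (rule product_prob_spaceI) (rule measure_pmf.prob_space_axioms)
 then show "sequence_space (measure_pmf \<mu>)" by (simp add: sequence_space_def)
qed

context walked
begin

abbreviation "\<Omega> \<equiv> PiM UNIV (%_::nat. measure_pmf \<mu>)"

lemma \<Omega>_eq: "increments \<mu> = \<Omega>" by (simp add: increments_def)

lemma space_\<Omega> [simp]: "space \<Omega> = UNIV" by (simp add: space_PiM)

lemma coord_measurable: "(%v. f (v i)) : \<Omega> \<rightarrow>\<^sub>M N" if "range f \<subseteq> space N"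
 by (rule measurable_compose[OF measurable_component_singleton[of i]]) (use that in auto)

lemma walk_measurable [measurable]: "walk n : borel_measurable \<Omega>"
proof (induction n)
 case (Suc n)
 have "walk (Suc n) = (%v. walk n v ** v n)" by (rule ext) (use lp_walk[of n 1] in "simp add: shiftn_def")
 moreover have "(%v. v n) : borel_measurable \<Omega>" using coord_measurable[of id borel n] by simp
 ultimately show ?case using Suc by simp
qed (simp add: walk_def[abs_def])

definition good :: "(nat => real^2^2) => bool" where "good v \<longleftrightarrow> (\<forall>i. v i : G)"

lemma good_measurable [measurable]: "Measurable.pred \<Omega> good"
 unfolding good_def by (intro pred_intros_countable coord_measurable[of "%x. x : G"]) simp

lemma AE_good: "AE v in \<Omega>. good v" unfolding good_def AE_all_countable using supp by (auto intro!: W.AE_component AE_pmfI)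

lemma good_shift [simp]: "good v ==> good (shiftn n v)" by (simp add: good_def shiftn_def)

lemma good_walk [simp]: "good v ==> walk n v : G" using A.lp_G[of "map v [0..<n]"] by (auto simp: walk_def good_def)

text \<open>The value 0 off the almost sure event \<open>good\<close> makes the process subadditive
  everywhere. It also makes it measurable for arbitrary \<open>f\<close>, since only the countably
  many values of the walk in \<open>G\<close> matter.\<close>

definition proc :: "(real^2^2 => real) => nat => (nat => real^2^2) => real" where
 "proc f n v = (if good v then f (walk n v) else 0)"

lemma proc_measurable [measurable]: "proc f n : borel_measurable \<Omega>"
proof -
 have "(%g. if g : G then f g else 0) : borel_measurable borel" by (rule measurable_discrete_difference[OF _ countable_G, of "%_. 0"]) auto
 then have "(%v. if good v then (if walk n v : G then f (walk n v) else 0) else 0) : borel_measurable \<Omega>" by measurable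
 moreover have "(%v. if good v then (if walk n v : G then f (walk n v) else 0) else 0) = proc f n" by (auto simp: proc_def)
 ultimately show ?thesis by simp
qed

lemma proc_sets: "Y : sets borel ==> {v. proc f n v : Y} : sets \<Omega>"
 using measurable_sets[OF proc_measurable[of f n], of Y] by (simp only: vimage_def Collect_mem_eq space_\<Omega> Int_UNIV_right)

lemma proc_1_integrable: "integrable (measure_pmf \<mu>) f ==> integrable \<Omega> (proc f 1)"
proof -
 assume "integrable (measure_pmf \<mu>) f"
 then have "integrable (distr \<Omega> (measure_pmf \<mu>) (%v. v 0)) f" by (subst W.PiM_component) auto
 then have "integrable \<Omega> (%v. f (v 0))" by (rule integrable_distr[rotated]) simp
 then show ?thesis by (rule integrable_cong_AE_imp) (use AE_good in "auto elim!: eventually_mono simp: proc_def")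
qed

text \<open>The hypothesis \<open>Z\<close> of Kingman's theorem holds because deleting the first
  increment \<open>s\<close> changes \<open>f\<close> by at most \<open>f s\<close>, by
  subadditivity and symmetry.\<close>

lemma proc_drift: assumes f1: "f (mat 1) = 0" and nn: "!!g. g : G ==> 0 <= f g" and sub: "!!g h. g : G ==> h : G ==> f (g ** h) <= f g + f h"
  and inv: "!!g. g : G ==> f (hinv g) = f g" and int: "integrable (measure_pmf \<mu>) f"
 shows "\<exists>l\<ge>0. AE v in \<Omega>. (%n. f (walk n v) / real n) \<longlonglongrightarrow> l"
proof -
 have "\<exists>l\<ge>0. AE v in \<Omega>. (%n. proc f n v / real n) \<longlonglongrightarrow> l" proof (rule W.kingman)
  show "proc f (m + n) v <= proc f m v + proc f n (shiftn m v)" for m n v by (cases "good v") (auto simp: proc_def lp_walk sub nn)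
  show "AE v in \<Omega>. \<exists>z. \<forall>n. abs (proc f (Suc n) v - proc f n (shiftn 1 v)) <= z" using AE_good proof eventually_elim
   case (elim v)
   have "abs (proc f (Suc n) v - proc f n (shiftn 1 v)) <= f (v 0)" for n proof -
    define h where "h = walk n (shiftn (Suc 0) v)"
    have g: "v 0 : G" "h : G" using elim by (simp_all add: good_def h_def shiftn_def)
    have "f h <= f (v 0) + f (v 0 ** h)" using sub[of "hinv (v 0)" "v 0 ** h"] g inv by simp
    then show ?thesis using sub[OF g] elim by (simp add: proc_def walk_Suc flip: h_def)
   qed
   then show ?case by blast
  qed
  show "0 <= proc f n v" "proc f 0 v = 0" for n v by (auto simp: proc_def nn f1)
 qed (rule proc_measurable, rule proc_1_integrable[OF int])
 then obtain l where l: "l \<ge> 0" "AE v in \<Omega>. (%n. proc f n v / real n) \<longlonglongrightarrow> l" by blast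
 from l(2) AE_good have "AE v in \<Omega>. (%n. f (walk n v) / real n) \<longlonglongrightarrow> l" by eventually_elim (simp add: proc_def)
 then show ?thesis using l(1) by blast
qed

lemma walk_law: "emeasure \<Omega> {v. walk n v = g} = ennreal (pmf (mun \<mu> n) g)"
proof (induction n arbitrary: g)
 case 0
 show ?case using W.P.emeasure_space_1 by auto
next
 case (Suc n)
 have cs: "(%(s, v). case_nat s v) : measure_pmf \<mu> \<Otimes>\<^sub>M \<Omega> \<rightarrow>\<^sub>M \<Omega>" by measurable
 have sh: "shiftn (Suc 0) (case_nat s v) = v" for s :: "real^2^2" and v by (rule ext) (simp add: shiftn_def)
 have m: "{v. walk n v = g} : sets \<Omega>" for n g using measurable_sets[OF walk_measurable[of n], of "{g}"] by (simp add: vimage_def)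
 have "emeasure \<Omega> {v. walk (Suc n) v = g} = emeasure (distr (measure_pmf \<mu> \<Otimes>\<^sub>M \<Omega>) \<Omega> (%(s, v). case_nat s v)) {v. walk (Suc n) v = g}"
  by (simp only: W.PiM_iter)
 also have "... = emeasure (measure_pmf \<mu> \<Otimes>\<^sub>M \<Omega>) {x. fst x ** walk n (snd x) = g}"
  by (subst emeasure_distr[OF cs m]) (auto simp: space_pair_measure walk_Suc sh intro!: arg_cong2[of _ _ _ _ emeasure])
 also have "... = (\<integral>\<^sup>+s. emeasure \<Omega> (Pair s -` {x. fst x ** walk n (snd x) = g}) \<partial>measure_pmf \<mu>)"
 proof (rule W.P.emeasure_pair_measure_alt)
  have "(%x. fst x ** walk n (snd x)) : borel_measurable (measure_pmf \<mu> \<Otimes>\<^sub>M \<Omega>)"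
   by (intro borel_measurable_matrix_mult measurable_compose[OF measurable_fst] measurable_compose[OF measurable_snd walk_measurable]) simp
  from measurable_sets[OF this, of "{g}"] show "{x. fst x ** walk n (snd x) = g} : sets (measure_pmf \<mu> \<Otimes>\<^sub>M \<Omega>)"
   by (simp add: space_pair_measure vimage_def)
 qed
 also have "... = (\<integral>\<^sup>+s. ennreal (pmf (map_pmf ((**) s) (mun \<mu> n)) g) \<partial>measure_pmf \<mu>)"
 proof (rule nn_integral_cong_AE, rule AE_pmfI)
  fix s assume "s : set_pmf \<mu>"
  then have s: "s : SL2" using supp by auto
  have "Pair s -` {x. fst x ** walk n (snd x) = g} = {v. walk n v = hinv s ** g}" using s by auto
  then show "emeasure \<Omega> (Pair s -` {x. fst x ** walk n (snd x) = g}) = ennreal (pmf (map_pmf ((**) s) (mun \<mu> n)) g)"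
   using Suc s by (simp add: pmf_translate)
 qed
 also have "... = ennreal (pmf (mun \<mu> (Suc n)) g)" by (simp add: cv_def ennreal_pmf_bind)
 finally show ?case .
qed

lemma orbit_dist_le: "\<exists>D>0. \<forall>g\<in>G. dH x0 (act g x0) <= D * lG g"
proof -
 obtain D where D: "0 < D" "!!s. s : A \<union> hinv ` A ==> dH x0 (act s x0) <= D" using generator_dist by blast
 have w: "dH x0 (act (lp w) x0) <= D * real (length w)" if "set w \<subseteq> A \<union> hinv ` A" for w using that proof (induction w)
  case (Cons s w)
  have g: "s : G" "lp w : G" using A.letters_G[OF Cons.prems] A.lp_G[of w] by auto
  have "dH x0 (act (s ** lp w) x0) <= dH x0 (act s x0) + dH (act s x0) (act s (act (lp w) x0))"
   using dH_triangle[of x0 "act s x0" "act s (act (lp w) x0)"] g by (simp add: act_mult)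
  then show ?case using Cons D(2)[of s] g by (simp add: algebra_simps)
 qed simp
 have "dH x0 (act g x0) <= D * lG g" if "g : G" for g proof -
  obtain v where "length v = lenG g" "set v \<subseteq> A \<union> hinv ` A" "g = lp v" using A.len_word[OF \<open>g : G\<close>] by blast
  then show ?thesis using w[of v] by simp
 qed
 then show ?thesis using D by blast
qed

lemma lenR_le_dist: "\<exists>K>0. \<forall>g\<in>G. lR g <= K * (dH x0 (act g x0) + 1)"
proof -
 obtain K where K: "K > 0" "!!M t t' g g'. M : SL2 ==> t <= t' ==> closest (ap M t) g ==> closest (ap M t') g' ==>
   lR (hinv g ** g') <= K * (t' - t + 1)" using rel_upper by blast
 have "lR g <= K * (dH x0 (act g x0) + 1)" if g: "g : G" for g proof -
  obtain M where M: "M : SL2" "act M x0 = \<i>" "act M (act g x0) = iax (dH x0 (act g x0))" using to_iax[of x0 "act g x0"] g by auto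
  have "ap M 0 = x0" "ap M (dH x0 (act g x0)) = act g x0" using M g by (simp_all add: ap_def iax_zero flip: M(2,3))
  then show ?thesis using K(2)[OF M(1), of 0 "dH x0 (act g x0)" "mat 1" g] closest_orbit[OF g] closest_orbit[OF G_one] g by simp
 qed
 then show ?thesis using K by blast
qed

text \<open>With zero drift the walk at time \<open>j * k\<close> would be, with probability not
  tending to 0, among the elements of relative length at most \<open>e * j\<close> and word length
  at most \<open>L * j\<close>. There are too few of them for return probabilities as small as
  \<open>H ^ j\<close>.\<close>

lemma lenR_drift_pos: assumes "AE v in \<Omega>. (%n. lR (walk n v) / real n) \<longlonglongrightarrow> l" shows "l ~= 0"
proof
 assume l: "l = 0"
 obtain k H where k: "1 <= k" "0 < H" "H < 1" "!!j g. pmf (mun \<mu> (j * k)) g <= H ^ j" using return_decay by blast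
 obtain K :: nat where K: "!!u. 0 < u ==> u < 1 ==> \<exists>Z\<ge>1. \<forall>m n. finite {g : G. lenR g <= m \<and> lenG g <= n} \<and>
   real (card {g : G. lenR g <= m \<and> lenG g <= n}) <= Z ^ (K * m + K) * (1 / u) ^ (K * n + K)" using growth_bound by blast
 define E where "E = (\<integral>v. proc lenG 1 v \<partial>\<Omega>)"
 have E0: "0 <= E" unfolding E_def by (intro integral_nonneg_AE) (auto simp: proc_def)
 \<comment> \<open>By Markov's inequality the word length at time \<open>j * k\<close> reaches
   \<open>L * j\<close> with probability at most 1/4.\<close>
 obtain L :: nat where L: "4 * real k * E + 1 <= real L" using real_arch_simple by blast
 define r where "r = - ln H"
 have r: "0 < r" "H = exp (- r)" using k by (simp_all add: r_def)
 \<comment> \<open>The return probability decays at rate \<open>r\<close> in \<open>j\<close>.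
   \<open>q\<close> and, below, \<open>e\<close> are chosen so that in the bound of
   \<open>growth_bound\<close> the word length and the relative length use up at most
   \<open>r / 4\<close> each.\<close>
 define q where "q = r / (4 * (real K * real L + 1))"
 have q: "0 < q" "q * (real K * real L) <= r / 4" proof -
  have p: "0 < real K * real L + 1" by (simp add: add_nonneg_pos)
  then show "0 < q" using r by (simp add: q_def)
  have "q * (real K * real L + 1) = r / 4" using p by (simp add: q_def field_simps)
  then show "q * (real K * real L) <= r / 4" using \<open>0 < q\<close> by (simp add: distrib_left)
 qed
 obtain Z where Z: "1 <= Z" "!!m n. finite {g : G. lenR g <= m \<and> lenG g <= n}"
   "!!m n. real (card {g : G. lenR g <= m \<and> lenG g <= n}) <= Z ^ (K * m + K) * (1 / exp (- q)) ^ (K * n + K)" using K[of "exp (- q)"] q by auto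
 define z where "z = ln Z"
 have z: "0 <= z" "Z = exp z" using Z by (simp_all add: z_def)
 define e where "e = r / (4 * (z * real K + 1))"
 have e: "0 < e" "z * real K * e <= r / 4" proof -
  have p: "0 < z * real K + 1" using z by (simp add: add_nonneg_pos)
  then show "0 < e" using r by (simp add: e_def)
  have "e * (z * real K + 1) = r / 4" using p by (simp add: e_def field_simps)
  then show "z * real K * e <= r / 4" using \<open>0 < e\<close> by (simp add: distrib_left mult.commute)
 qed
 define c where "c = z * real K + q * real K"
 obtain J :: nat where J: "(c + 3) / (r / 2) <= real J" using real_arch_simple by blast
 define Q where "Q = (%j. {v. e * real j < proc lenR (j * k) v})"
 have Qm [measurable]: "Q j : sets \<Omega>" for j unfolding Q_def using proc_sets[of "{e * real j<..}"] by simp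
 have big: "1/2 <= measure \<Omega> (Q j)" if j: "J <= j" "1 <= j" for j proof -
  define m where "m = nat \<lfloor>e * real j\<rfloor>"
  define F where "F = {g : G. lenR g <= m \<and> lenG g <= L * j}"
  have m: "real m <= e * real j" using e by (simp add: m_def)
  have wm: "{v. walk (j * k) v = g} : sets \<Omega>" for g using measurable_sets[OF walk_measurable[of "j * k"], of "{g}"] by (simp add: vimage_def)
  have e1: "measure \<Omega> {v. walk (j * k) v : F} <= 1/4" proof -
   have fin: "finite F" using Z(2) by (simp add: F_def)
   have "measure \<Omega> {v. walk (j * k) v : F} = measure \<Omega> (\<Union>g\<in>F. {v. walk (j * k) v = g})"
    by (intro arg_cong2[of _ _ _ _ measure]) auto
   also have "... <= (\<Sum>g\<in>F. measure \<Omega> {v. walk (j * k) v = g})" using wm fin by (intro measure_UNION_le) auto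
   also have "... <= (\<Sum>g\<in>F. H ^ j)" using k(4) by (intro sum_mono) (simp add: measure_def walk_law)
   also have "... = real (card F) * exp (- r * real j)" by (simp add: r(2) flip: exp_of_nat_mult)
   also have "... <= (Z ^ (K * m + K) * (1 / exp (- q)) ^ (K * (L * j) + K)) * exp (- r * real j)"
    unfolding F_def using Z(3) by (intro mult_right_mono) auto
   also have "... = exp (z * real (K * m + K) + q * real (K * (L * j) + K) - r * real j)"
    unfolding z(2) by (simp add: exp_minus inverse_eq_divide exp_diff exp_add mult.commute flip: exp_of_nat_mult)
   also have "... <= exp (- 3)" proof -
    have "z * real K * real m <= z * real K * (e * real j)" using m z by (intro mult_left_mono) auto
    also have "... = z * real K * e * real j" by simp
    also have "... <= r / 4 * real j" using e by (intro mult_right_mono) auto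
    finally have a: "z * real K * real m <= r / 4 * real j" .
    have b: "q * (real K * real L) * real j <= r / 4 * real j" using q by (intro mult_right_mono) auto
    have "(c + 3) / (r / 2) <= real j" using J j by linarith
    then have "c + 3 <= r / 2 * real j" using r by (simp add: pos_divide_le_eq mult.commute)
    moreover have "z * real (K * m + K) + q * real (K * (L * j) + K) = z * real K * real m + q * (real K * real L) * real j + c"
     by (simp add: c_def algebra_simps)
    ultimately show ?thesis using a b by simp
   qed
   also have "... <= 1/4" using exp_ge_add_one_self[of 3] by (simp add: exp_minus field_simps)
   finally show ?thesis .
  qed
  have e2: "measure \<Omega> {v. real (L * j) <= proc lenG (j * k) v} <= 1/4" proof -
   have dom: "proc lenG n v <= (\<Sum>i<n. proc lenG 1 (shiftn i v))" for n v proof (induction n)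
    case (Suc n)
    have "proc lenG (Suc n) v <= proc lenG n v + proc lenG 1 (shiftn n v)" proof (cases "good v")
     case True
     then have "walk n v : G" "walk 1 (shiftn n v) : G" by (simp_all only: good_walk good_shift)
     then show ?thesis using True lp_walk[of n 1 v] A.len_mult[of "walk n v" "walk 1 (shiftn n v)"]
      by (simp only: proc_def good_shift Suc_eq_plus1 if_True flip: of_nat_add) (simp only: of_nat_le_iff)
    qed (auto simp: proc_def)
    then show ?case using Suc by simp
   qed (simp add: proc_def)
   have "0 < 4 * real k * E + 1" using E0 by (intro add_nonneg_pos mult_nonneg_nonneg) auto
   then have Lj: "0 < real (L * j)" using L j by simp
   note i1 = proc_1_integrable[OF moment]
   have i2: "integrable \<Omega> (%v. \<Sum>i<j * k. proc lenG 1 (shiftn i v))"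
    using i1 by (intro Bochner_Integration.integrable_sum W.integrable_shift)
   have "measure \<Omega> {v : space \<Omega>. real (L * j) <= (\<Sum>i<j * k. proc lenG 1 (shiftn i v))} <= (\<integral>v. (\<Sum>i<j * k. proc lenG 1 (shiftn i v)) \<partial>\<Omega>) / real (L * j)"
    by (intro integral_Markov_inequality_measure[where A="{}"] i2 AE_I2 sum_nonneg Lj) (auto simp: proc_def)
   also have "... = real (j * k) * E / real (L * j)" using i1 by (simp add: W.integrable_shift W.integral_shift E_def)
   also have "... <= 1/4" proof -
    have "real j * (real k * E) <= real j * (real L / 4)" using L by (intro mult_left_mono) auto
    then show ?thesis using Lj by (simp only: pos_divide_le_eq) (simp add: mult_ac)
   qed
   finally have s: "measure \<Omega> {v : space \<Omega>. real (L * j) <= (\<Sum>i<j * k. proc lenG 1 (shiftn i v))} <= 1/4" .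
   have "measure \<Omega> {v. real (L * j) <= proc lenG (j * k) v} <= measure \<Omega> {v : space \<Omega>. real (L * j) <= (\<Sum>i<j * k. proc lenG 1 (shiftn i v))}"
   proof (rule W.P.finite_measure_mono)
    have [measurable]: "(%v. \<Sum>i<j * k. proc lenG 1 (shiftn i v)) : borel_measurable \<Omega>" by auto
    show "{v : space \<Omega>. real (L * j) <= (\<Sum>i<j * k. proc lenG 1 (shiftn i v))} : sets \<Omega>" by measurable
   qed (use order_trans[OF _ dom] in auto)
   then show ?thesis using s by linarith
  qed
  have "{v. walk (j * k) v : F} = (\<Union>g\<in>F. {v. walk (j * k) v = g})" by auto
  then have W1: "{v. walk (j * k) v : F} : sets \<Omega>" using Z(2) wm by (auto simp: F_def)
  have W2: "{v. real (L * j) <= proc lenG (j * k) v} : sets \<Omega>" using proc_sets[of "{real (L * j)..}" lenG "j * k"] by simp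
  have "1 = measure \<Omega> {v. good v}" using AE_good W.P.prob_Collect_eq_1[of good] good_measurable by (simp add: pred_def)
  also have "... <= measure \<Omega> (Q j \<union> ({v. walk (j * k) v : F} \<union> {v. real (L * j) <= proc lenG (j * k) v}))"
  proof (rule W.P.finite_measure_mono)
   show "{v. good v} \<subseteq> Q j \<union> ({v. walk (j * k) v : F} \<union> {v. real (L * j) <= proc lenG (j * k) v})"
    by (auto simp: Q_def F_def proc_def m_def le_nat_floor simp flip: of_nat_mult)
  qed (use Qm W1 W2 in auto)
  also have "... <= measure \<Omega> (Q j) + (measure \<Omega> {v. walk (j * k) v : F} + measure \<Omega> {v. real (L * j) <= proc lenG (j * k) v})"
   by (intro order_trans[OF measure_Un_le] add_left_mono measure_Un_le sets.Un Qm W1 W2 order_refl)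
  finally show ?thesis using e1 e2 by linarith
 qed
 have "(%j. \<integral>v. indicator (Q j) v \<partial>\<Omega>) \<longlonglongrightarrow> (\<integral>v. 0 \<partial>\<Omega> :: real)"
 proof (rule integral_dominated_convergence[where w="%_. 1"])
  show "AE v in \<Omega>. (%j. indicator (Q j) v :: real) \<longlonglongrightarrow> 0" using assms AE_good proof eventually_elim
   case (elim v)
   have "filterlim (%j. j * k) sequentially sequentially" using k(1) by (intro mult_nat_right_at_top) auto
   from filterlim_compose[OF elim(1) this]
   have lim: "(%j. lR (walk (j * k) v) / real (j * k)) \<longlonglongrightarrow> 0" by (simp add: l)
   have "\<forall>\<^sub>F j in sequentially. lR (walk (j * k) v) / real (j * k) < e / real k" using order_tendstoD(2)[OF lim] e k by simp
   then have "\<forall>\<^sub>F j in sequentially. indicator (Q j) v = (0::real)" using eventually_gt_at_top[of 0] proof eventually_elim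
    case (elim j)
    then have "lR (walk (j * k) v) < e * real j" using k by (simp add: field_simps)
    then show ?case by (simp add: Q_def proc_def)
   qed
   then show ?case by (rule tendsto_eventually)
  qed
 qed (auto simp: indicator_def)
 then have "(%j. measure \<Omega> (Q j)) \<longlonglongrightarrow> 0" by simp
 from LIMSEQ_le_const[OF this, of "1/2"] have "1/2 <= (0::real)" using big by (meson le_trans max.cobounded1 max.cobounded2)
 then show False by simp
qed

end

subsection \<open>The boundary in the disc model\<close>

lemma cayley_eq: "cayley z = (z - \<i>) / (z + \<i>)" by (simp add: cayley_def moebius_def)

lemma plus_i_nonzero: "0 < Im z ==> z + \<i> ~= 0" by (auto simp: complex_eq_iff)

lemma cayley_i [simp]: "cayley \<i> = 0" by (simp add: cayley_eq)

lemma cmod_plus_i: "0 < Im z ==> (cmod (z + \<i>))^2 = 2 * Im z * (cosh (dH \<i> z) + 1)"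
 using cosh_dist_alt[of \<i> z] by (simp add: cmod_power2 field_simps) (simp add: power2_eq_square algebra_simps)

lemma cayley_dist: assumes z: "0 < Im z" and w: "0 < Im w"
 shows "(cmod (cayley z - cayley w))^2 = 2 * (cosh (dH z w) - 1) / ((cosh (dH \<i> z) + 1) * (cosh (dH \<i> w) + 1))"
proof -
 have "cayley z - cayley w = 2 * \<i> * (z - w) / ((z + \<i>) * (w + \<i>))"
  using plus_i_nonzero[OF z] plus_i_nonzero[OF w] by (simp add: cayley_eq field_simps)
 then have "(cmod (cayley z - cayley w))^2 = 4 * (cmod (z - w))^2 / ((cmod (z + \<i>))^2 * (cmod (w + \<i>))^2)"
  by (simp add: norm_mult norm_divide power_mult_distrib power_divide)
 also have "(cmod (z - w))^2 = 2 * Im z * Im w * (cosh (dH z w) - 1)" using z w by (simp add: cosh_hyp_dist)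
 also have "4 * (2 * Im z * Im w * (cosh (dH z w) - 1)) / ((cmod (z + \<i>))^2 * (cmod (w + \<i>))^2) =
   (4 * Im z * Im w * (2 * (cosh (dH z w) - 1))) / (4 * Im z * Im w * ((cosh (dH \<i> z) + 1) * (cosh (dH \<i> w) + 1)))" proof -
  have "4 * (2 * p * q * k) / (2 * p * u * (2 * q * v)) = 4 * p * q * (2 * k) / (4 * p * q * (u * v))" for p q k u v :: real by simp
  then show ?thesis unfolding cmod_plus_i[OF z] cmod_plus_i[OF w] .
 qed
 also have "... = 2 * (cosh (dH z w) - 1) / ((cosh (dH \<i> z) + 1) * (cosh (dH \<i> w) + 1))" using z w by (subst mult_divide_mult_cancel_left) auto
 finally show ?thesis .
qed

text \<open>The exponent is minus the Gromov product of the two points with respect to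
  \<open>\<i>\<close>: Euclidean distance in the disc is controlled by that product.\<close>

lemma cayley_close: assumes z: "0 < Im z" and w: "0 < Im w" shows "cmod (cayley z - cayley w) <= 3 * exp ((dH z w - dH \<i> z - dH \<i> w) / 2)"
proof -
 have "(cmod (cayley z - cayley w))^2 <= 2 * exp (dH z w) / (exp (dH \<i> z) / 2 * (exp (dH \<i> w) / 2))" unfolding cayley_dist[OF z w]
 proof (intro frac_le mult_mono)
  show "cosh (dH z w) - 1 <= exp (dH z w)" using cosh_le_exp[of "dH z w"] z w by simp
  show "exp (dH \<i> z) / 2 <= cosh (dH \<i> z) + 1" "exp (dH \<i> w) / 2 <= cosh (dH \<i> w) + 1"
   using cosh_ge_exp_half[of "dH \<i> z"] cosh_ge_exp_half[of "dH \<i> w"] by linarith+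
  show "0 <= cosh (dH \<i> z) + 1" by simp
 qed (auto simp: cosh_real_ge_1)
 also have "... = 8 * (exp ((dH z w - dH \<i> z - dH \<i> w) / 2))^2" proof -
  have "(exp (y / 2))^2 = exp y" for y :: real by (simp add: power2_eq_square flip: exp_add)
  then show ?thesis by (simp add: exp_diff)
 qed
 also have "... <= (3 * exp ((dH z w - dH \<i> z - dH \<i> w) / 2))^2" by simp
 finally show ?thesis by (rule power2_le_imp_le) simp
qed

definition cden :: "real^2^2 => complex => complex" where
 "cden A h = Complex (A$1$2 - A$2$1) (A$1$1 + A$2$2) + Complex (- A$1$2 - A$2$1) (A$1$1 - A$2$2) * h"

text \<open>The Moebius action conjugated by the Cayley transform, in a form that also makes sense on the boundary circle.\<close>

definition dact :: "real^2^2 => complex => complex" where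
 "dact A h = (Complex (A$1$2 + A$2$1) (A$1$1 - A$2$2) + Complex (A$2$1 - A$1$2) (A$1$1 + A$2$2) * h) / cden A h"

lemma cden_nonzero: assumes A: "A : SL2" and e: "cmod h <= 1" shows "cden A h ~= 0"
proof
 let ?q = "Complex (A$1$2 - A$2$1) (A$1$1 + A$2$2)" and ?r = "Complex (- A$1$2 - A$2$1) (A$1$1 - A$2$2)"
 assume "cden A h = 0"
 then have "?q = - ?r * h" by (simp add: cden_def eq_neg_iff_add_eq_0)
 then have "cmod ?q <= cmod ?r" using e by (simp only: norm_mult norm_minus_cancel) (simp add: mult_left_le)
 then have le: "(cmod ?q)^2 <= (cmod ?r)^2" by (intro power_mono) auto
 have "(cmod ?q)^2 - (cmod ?r)^2 = 4 * (A$1$1 * A$2$2 - A$1$2 * A$2$1)" by (simp only: cmod_power2) (simp add: power2_eq_square algebra_simps)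
 then show False using le A by (simp only: SL2_iff)
qed

lemma cayley_act: assumes A: "A : SL2" and z: "0 < Im z" shows "cayley (act A z) = dact A (cayley z)"
proof -
 have n: "z + \<i> ~= 0" "den A z ~= 0" using plus_i_nonzero[OF z] den_nonzero[OF A z] by auto
 let ?a = "complex_of_real (A$1$1)" and ?b = "complex_of_real (A$1$2)" and ?c = "complex_of_real (A$2$1)" and ?d = "complex_of_real (A$2$2)"
 let ?N = "?a * z + ?b - \<i> * (?c * z + ?d)" and ?D = "?a * z + ?b + \<i> * (?c * z + ?d)"
 have c1: "cden A (cayley z) * (z + \<i>) = 2 * \<i> * ?D"
  using n(1) by (simp add: cden_def cayley_eq distrib_right) (simp add: complex_eq_iff algebra_simps)
 have c2: "(Complex (A$1$2 + A$2$1) (A$1$1 - A$2$2) + Complex (A$2$1 - A$1$2) (A$1$1 + A$2$2) * cayley z) * (z + \<i>) = 2 * \<i> * ?N"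
  using n(1) by (simp add: cayley_eq distrib_right) (simp add: complex_eq_iff algebra_simps)
 have "dact A (cayley z) = ?N / ?D" proof -
  have "P / Q = N / D" if "Q * k = 2 * \<i> * D" "P * k = 2 * \<i> * N" "k ~= 0" for P Q N D k :: complex proof -
   have "P / Q = (P * k) / (Q * k)" using that(3) by simp
   also have "... = N / D" unfolding that by (subst mult_divide_mult_cancel_left) auto
   finally show ?thesis .
  qed
  from this[OF c1 c2 n(1)] show ?thesis unfolding dact_def .
 qed
 also have "... = cayley (act A z)" proof -
  have "(u - \<i> * v) / (u + \<i> * v) = (u / v - \<i>) / (u / v + \<i>)" if "v ~= 0" for u v :: complex proof -
   have "u / v - \<i> = (u - \<i> * v) / v" "u / v + \<i> = (u + \<i> * v) / v" using that by (simp_all add: field_simps)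
   then show ?thesis using that by simp
  qed
  from this[OF n(2)] show ?thesis by (simp add: cayley_eq act_eq) (simp add: den_def)
 qed
 finally show ?thesis by simp
qed

lemma cmod_cayley: "0 < Im z ==> cmod (cayley z) < 1"
proof -
 assume z: "0 < Im z"
 have "(cmod (z - \<i>))^2 < (cmod (z + \<i>))^2" using z by (simp only: cmod_power2) (simp add: power2_eq_square algebra_simps)
 then have "cmod (z - \<i>) < cmod (z + \<i>)" by (rule power2_less_imp_less) simp
 then show ?thesis using plus_i_nonzero[OF z] by (simp add: cayley_eq norm_divide)
qed

lemma tendsto_dact: assumes "A : SL2" "(f \<longlongrightarrow> q) F" "cmod q <= 1" shows "((%x. dact A (f x)) \<longlongrightarrow> dact A q) F"
 unfolding dact_def by (rule tendsto_divide[OF _ _ cden_nonzero[OF assms(1,3)]]) (unfold cden_def, (intro tendsto_intros assms(2))+)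

lemma cayley_lim_bound: assumes "((%x. cayley (f x)) \<longlongrightarrow> q) F" "F ~= bot" "!!x. 0 < Im (f x)" shows "cmod q <= 1"
 by (rule Lim_norm_ubound[OF assms(2,1)]) (simp add: cmod_cayley assms(3) less_imp_le)

lemma cayley_iax_eq: "cayley (iax t) = of_real ((exp t - 1) / (exp t + 1))"
proof -
 have "cayley (iax t) = (\<i> * (of_real (exp t) - 1)) / (\<i> * (of_real (exp t) + 1))" by (simp add: cayley_eq iax_def Complex_eq algebra_simps)
 also have "... = (of_real (exp t) - 1) / (of_real (exp t) + 1)" by (subst mult_divide_mult_cancel_left) auto
 finally show ?thesis by simp
qed

lemma exp_steps_converge:
 fixes h :: "nat => complex" assumes a: "0 < a" and st: "!!n. N <= n ==> cmod (h (Suc n) - h n) <= 3 * exp (- a * real n)"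
 shows "\<exists>C>0. \<exists>L. h \<longlonglongrightarrow> L \<and> (\<forall>n\<ge>N. cmod (h n - L) <= C * exp (- a * real n))"
proof -
 define C where "C = 3 / (1 - exp (- a))"
 have C: "0 < C" "C * (1 - exp (- a)) = 3" proof -
  have "exp (- a) < 1" using a by simp
  then show "0 < C" "C * (1 - exp (- a)) = 3" unfolding C_def by simp_all (simp add: field_simps)
 qed
 have tel: "cmod (h (n + k) - h n) <= C * (exp (- a * real n) - exp (- a * real (n + k)))" if n: "N <= n" for n k proof (induction k)
  case (Suc k)
  have "cmod (h (n + Suc k) - h n) <= cmod (h (Suc (n + k)) - h (n + k)) + cmod (h (n + k) - h n)"
   using norm_triangle_ineq[of "h (Suc (n + k)) - h (n + k)" "h (n + k) - h n"] by simp
  also have "... <= C * (1 - exp (- a)) * exp (- a * real (n + k)) + C * (exp (- a * real n) - exp (- a * real (n + k)))"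
   using Suc st[of "n + k"] n C(2) by (intro add_mono) auto
  also have "... = C * (exp (- a * real n) - exp (- a) * exp (- a * real (n + k)))" by (simp add: algebra_simps)
  also have "exp (- a) * exp (- a * real (n + k)) = exp (- a * real (n + Suc k))" by (simp add: algebra_simps flip: exp_add)
  finally show ?case .
 qed simp
 have bd: "cmod (h (n + k) - h n) <= C * exp (- a * real n)" if n: "N <= n" for n k
  using tel[OF n, of k] C(1) by (smt (verit) exp_gt_zero mult_left_mono)
 have z: "(%n. C * exp (- a * real n)) \<longlonglongrightarrow> 0" using a by real_asymp
 have "Cauchy h" proof (rule CauchyI')
  fix e :: real assume "0 < e"
  then have "\<forall>\<^sub>F n in sequentially. C * exp (- a * real n) < e" using order_tendstoD(2)[OF z] by blast
  then obtain n0 where n0: "!!n. n0 <= n ==> C * exp (- a * real n) < e" by (auto simp: eventually_sequentially)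
  show "\<exists>M. \<forall>m\<ge>M. \<forall>n>m. dist (h m) (h n) < e" proof (intro exI[of _ "max N n0"] allI impI)
   fix m n assume "max N n0 <= m" "m < n"
   then show "dist (h m) (h n) < e" using bd[of m "n - m"] n0[of m] by (simp add: dist_norm norm_minus_commute)
  qed
 qed
 then obtain L where L: "h \<longlonglongrightarrow> L" using Cauchy_convergent by (auto simp: convergent_def)
 have "cmod (h n - L) <= C * exp (- a * real n)" if n: "N <= n" for n proof (rule Lim_bounded)
  show "(%k. cmod (h n - h (k + n))) \<longlonglongrightarrow> cmod (h n - L)" by (intro tendsto_intros LIMSEQ_ignore_initial_segment[OF L])
  show "\<forall>k\<ge>0. cmod (h n - h (k + n)) <= C * exp (- a * real n)" using bd[OF n] by (simp add: norm_minus_commute add.commute)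
 qed
 then show ?thesis using C(1) L by blast
qed

section \<open>Convergence to the boundary and tracking of geodesics\<close>

context cusped
begin

text \<open>Linear escape with sublinear steps makes the Gromov products of consecutive points grow
  linearly, so their images in the disc form a Cauchy sequence with exponential rate. If the limit
  is 1, the rate bounds the projection to the imaginary axis from below.\<close>

lemma boundary_rate: assumes M: "M : SL2" "act M x0 = \<i>" and w: "!!n. w n : G"
  and l: "0 < l" "(%n. dH x0 (act (w n) x0) / real n) \<longlonglongrightarrow> l"
  and s: "(%n. dH (act (w n) x0) (act (w (Suc n)) x0) / real n) \<longlonglongrightarrow> 0" shows "convergent (%n. cayley (act M (act (w n) x0)))"
  and "(%n. cayley (act M (act (w n) x0))) \<longlonglongrightarrow> 1 ==> (%n. pr M (act (w n) x0) / real n) \<longlonglongrightarrow> l"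
proof -
 define z where "z = (%n. act M (act (w n) x0))"
 have u: "0 < Im (z n)" for n using w M by (simp add: z_def)
 have dz: "dH \<i> (z n) = dH x0 (act (w n) x0)" for n using w M(1) by (simp add: z_def flip: M(2))
 have dd: "dH (z n) (z m) = dH (act (w n) x0) (act (w m) x0)" for n m using w M(1) by (simp add: z_def)
 have main: "\<exists>N. \<exists>C>0. \<exists>L. (%n. cayley (z n)) \<longlonglongrightarrow> L \<and> (\<forall>n\<ge>N. cmod (cayley (z n) - L) <= C * exp (- (l - 2 * H) * real n))"
  if e: "0 < H" "H < l / 4" for H proof -
  have "\<forall>\<^sub>F n in sequentially. l - H < dH x0 (act (w n) x0) / real n \<and> dH (act (w n) x0) (act (w (Suc n)) x0) / real n < H \<and> 0 < n"
   using order_tendstoD(1)[OF l(2), of "l - H"] order_tendstoD(2)[OF s, of H] e by (intro eventually_conj eventually_gt_at_top) auto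
  then obtain N where N: "!!n. N <= n ==> l - H < dH x0 (act (w n) x0) / real n \<and> dH (act (w n) x0) (act (w (Suc n)) x0) / real n < H \<and> 0 < n"
   by (auto simp: eventually_sequentially)
  have N1: "(l - H) * real n <= dH \<i> (z n)" "dH (z n) (z (Suc n)) <= H * real n" if "N <= n" for n
   using N[OF that] by (auto simp: dz dd field_simps)
  have "cmod (cayley (z (Suc n)) - cayley (z n)) <= 3 * exp (- (l - 2 * H) * real n)" if n: "N <= n" for n proof -
   have "(l - H) * real n <= (l - H) * real (Suc n)" using e by (intro mult_left_mono) auto
   then have "(l - H) * real n <= dH \<i> (z (Suc n))" using N1(1)[of "Suc n"] n by linarith
   moreover have "0 <= H * real n" using e by simp
   moreover have "(dH (z n) (z (Suc n)) - dH \<i> (z n) - dH \<i> (z (Suc n))) / 2 <= (H * real n - (l - H) * real n - (l - H) * real n) / 2"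
    using N1[OF n] calculation by (intro divide_right_mono diff_mono) auto
   moreover have "(H * real n - (l - H) * real n - (l - H) * real n) / 2 = - (l - 2 * H) * real n - H * real n / 2" by (simp add: field_simps)
   ultimately have "(dH (z n) (z (Suc n)) - dH \<i> (z n) - dH \<i> (z (Suc n))) / 2 <= - (l - 2 * H) * real n" by linarith
   then show ?thesis using cayley_close[OF u[of n] u[of "Suc n"]] by (simp only: norm_minus_commute) (smt (verit) exp_le_cancel_iff)
  qed
  then show ?thesis using exp_steps_converge[of "l - 2 * H" N "%n. cayley (z n)"] e l by fastforce
 qed
 show "convergent (%n. cayley (act M (act (w n) x0)))" using main[of "l / 5"] l unfolding convergent_def z_def by auto
 assume one: "(%n. cayley (act M (act (w n) x0))) \<longlonglongrightarrow> 1"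
 show "(%n. pr M (act (w n) x0) / real n) \<longlonglongrightarrow> l" proof (rule tendsto_ratioI)
  fix r assume "l < r"
  have "pr M (act (w n) x0) <= dH x0 (act (w n) x0)" for n using pr_lipschitz[OF M(1), of "act (w n) x0" x0] w M by (simp add: pr_def dH_commute)
  then show "\<forall>\<^sub>F n in sequentially. pr M (act (w n) x0) < r * real n"
   using eventually_conj[OF order_tendstoD(2)[OF l(2) \<open>l < r\<close>] eventually_gt_at_top[of 0]]
   by (elim eventually_mono) (metis le_less_trans of_nat_0_less_iff pos_divide_less_eq)
 next
  fix r assume r: "r < l"
  define H where "H = min (l / 5) ((l - r) / 4)"
  have e: "0 < H" "H < l / 4" "r <= l - 4 * H" using r l by (auto simp: H_def min_def field_simps)
  obtain N C L where N: "0 < C" "(%n. cayley (z n)) \<longlonglongrightarrow> L" "!!n. N <= n ==> cmod (cayley (z n) - L) <= C * exp (- (l - 2 * H) * real n)"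
   using main[OF e(1,2)] by blast
  have L: "L = 1" using LIMSEQ_unique[OF N(2)] one by (simp add: z_def)
  have "\<forall>\<^sub>F n in sequentially. 2 <= 2 / C * exp (H * real n)" using N(1) e(1) by real_asymp
  then show "\<forall>\<^sub>F n in sequentially. r * real n < pr M (act (w n) x0)" using eventually_ge_at_top[of N] eventually_gt_at_top[of 0]
  proof eventually_elim
   case (elim n)
   \<comment> \<open>The boundary point 1 is infinity in the half-plane, so fast convergence to it
     means that \<open>cmod (z n)\<close>, whose logarithm is the projection, is large.\<close>
   have "cmod (cayley (z n) - 1) = 2 / cmod (z n + \<i>)" proof -
    have "cayley (z n) - 1 = - 2 * \<i> / (z n + \<i>)" using plus_i_nonzero[OF u[of n]] by (simp add: cayley_eq field_simps)
    then show ?thesis by (simp add: norm_divide)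
   qed
   then have "2 / cmod (z n + \<i>) <= C * exp (- (l - 2 * H) * real n)" using N(3)[of n] elim L by simp
   then have "2 <= C * exp (- (l - 2 * H) * real n) * cmod (z n + \<i>)" using plus_i_nonzero[OF u[of n]] by (simp add: pos_divide_le_eq)
   then have "2 * exp ((l - 2 * H) * real n) <= C * exp (- (l - 2 * H) * real n) * cmod (z n + \<i>) * exp ((l - 2 * H) * real n)"
    by (intro mult_right_mono) auto
   also have "... = C * cmod (z n + \<i>) * (exp (- (l - 2 * H) * real n) * exp ((l - 2 * H) * real n))" by (simp only: mult_ac)
   also have "exp (- (l - 2 * H) * real n) * exp ((l - 2 * H) * real n) = 1" unfolding exp_add[symmetric] by (simp add: algebra_simps)
   finally have "2 / C * exp ((l - 2 * H) * real n) <= cmod (z n + \<i>)" using N(1) by (simp add: field_simps)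
   moreover have "exp ((l - 2 * H) * real n) = exp (H * real n) * exp ((l - 3 * H) * real n)" by (simp add: algebra_simps flip: exp_add)
   ultimately have "2 / C * exp (H * real n) * exp ((l - 3 * H) * real n) <= cmod (z n) + 1" using norm_triangle_ineq[of "z n" \<i>] by simp
   moreover have "2 * exp ((l - 3 * H) * real n) <= 2 / C * exp (H * real n) * exp ((l - 3 * H) * real n)" using elim by (intro mult_right_mono) auto
   moreover have "1 <= exp ((l - 3 * H) * real n)" using e by simp
   ultimately have "exp ((l - 3 * H) * real n) <= cmod (z n)" by linarith
   moreover have "0 < cmod (z n)" using u[of n] by auto
   ultimately have "(l - 3 * H) * real n <= ln (cmod (z n))" by (simp add: ln_ge_iff)
   then have "(l - 3 * H) * real n <= pr M (act (w n) x0)" by (simp add: pr_def z_def)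
   moreover have "r * real n < (l - 3 * H) * real n" using e elim by simp
   ultimately show ?case by linarith
  qed
 qed
qed

text \<open>Points that project at least 1 before and 1 after time \<open>t\<close> are joined by a
  geodesic passing near \<open>ap M t\<close>: by \<open>dist_fermi\<close> their distance is both
  distances to the axis plus the travel along it, up to 3, because
  \<open>16 <= exp 3\<close>.\<close>

lemma between_projections: assumes M: "M : SL2" and z: "0 < Im z" "0 < Im w" and t: "pr M z <= t - 1" "t + 1 <= pr M w"
 shows "dH z (ap M t) + dH (ap M t) w <= dH z w + 3"
proof -
 define T where "T = pr M w - pr M z"
 have D: "2 <= T" using t by (simp add: T_def)
 have "exp 1 * exp 1 <= exp T" using D by (simp flip: exp_add)
 moreover have "2 * 2 <= exp 1 * exp (1::real)" using exp_ge_add_one_self[of "1::real"] by (intro mult_mono) auto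
 ultimately have "exp T / 4 <= cosh T - 1" using cosh_ge_exp_half[of T] by linarith
 then have "exp (rho M z) / 2 * (exp (rho M w) / 2) * (exp T / 4) <= cosh (rho M z) * cosh (rho M w) * (cosh T - 1)"
  by (intro mult_mono cosh_ge_exp_half) auto
 also have "cosh T = cosh (pr M z - pr M w)" by (metis T_def cosh_minus minus_diff_eq)
 also have "cosh (rho M z) * cosh (rho M w) * (cosh (pr M z - pr M w) - 1) <= cosh (dH z w) - 1" by (rule dist_fermi[OF M z])
 also have "... <= exp (dH z w)" using cosh_le_exp[of "dH z w"] z by simp
 finally have "exp (rho M z + rho M w + T) <= 16 * exp (dH z w)" by (simp add: exp_add)
 also have "... <= exp 3 * exp (dH z w)" proof (rule mult_right_mono)
  have "(27/10)^3 <= exp (1::real) ^ 3" using e_approx_32 by (intro power_mono) (auto simp: abs_if split: if_splits)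
  also have "exp (1::real) ^ 3 = exp 3" by (simp flip: exp_of_nat_mult)
  finally show "16 <= exp (3::real)" by (simp add: power3_eq_cube)
 qed simp
 also have "... = exp (3 + dH z w)" by (simp add: exp_add)
 finally have "rho M z + rho M w + T <= 3 + dH z w" by simp
 then show ?thesis using dist_ap_le[OF M z(1), of t] dist_ap_le[OF M z(2), of t] t by (simp add: T_def dH_commute)
qed

lemma tendsto_at_scaled:
 fixes y :: "nat => real" assumes "(%n. y n / real n) \<longlonglongrightarrow> L" "0 < b"
 shows "((%t. y (nat \<lfloor>b * t\<rfloor>) / t) \<longlongrightarrow> L * b) at_top"
proof -
 have f: "filterlim (%t. nat \<lfloor>b * t\<rfloor>) sequentially at_top" using assms(2) by real_asymp
 have g: "((%t. real (nat \<lfloor>b * t\<rfloor>) / t) \<longlongrightarrow> b) at_top" using assms(2) by real_asymp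
 have "((%t. y (nat \<lfloor>b * t\<rfloor>) / real (nat \<lfloor>b * t\<rfloor>) * (real (nat \<lfloor>b * t\<rfloor>) / t)) \<longlongrightarrow> L * b) at_top"
  by (intro tendsto_mult filterlim_compose[OF assms(1) f] g)
 moreover have "\<forall>\<^sub>F t in at_top. y (nat \<lfloor>b * t\<rfloor>) / real (nat \<lfloor>b * t\<rfloor>) * (real (nat \<lfloor>b * t\<rfloor>) / t) = y (nat \<lfloor>b * t\<rfloor>) / t"
  using eventually_compose_filterlim[OF eventually_gt_at_top[of 0] f] proof eventually_elim
  case (elim t)
  have "x / k * (k / t) = x / t" if "k ~= 0" for x k t :: real using that by simp
  then show ?case by (metis elim less_irrefl of_nat_eq_0_iff)
 qed
 ultimately show ?thesis by (rule Lim_transform_eventually)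
qed

text \<open>For \<open>n\<close> slightly below and \<open>m\<close> slightly above
  \<open>t / l\<close>, the point \<open>ap M t\<close> is almost between the walk at these two
  times. \<open>between_length\<close> bounds the error by the length travelled in between, hence by
  \<open>S m - S n\<close>, which is a small multiple of \<open>t\<close>.\<close>

lemma ray_ratio: assumes M: "M : SL2" and w: "!!n. w n : G" and l: "0 < l" "(%n. pr M (act (w n) x0) / real n) \<longlonglongrightarrow> l"
  and a: "(%n. lG (w n) / real n) \<longlonglongrightarrow> a" and b: "(%n. lR (w n) / real n) \<longlonglongrightarrow> b" "b ~= 0"
  and S: "!!n m. n <= m ==> lG (hinv (w n) ** w m) <= S m - S n" "(%n. S n / real n) \<longlonglongrightarrow> E"
  and h: "!!t. 0 <= t ==> closest (ap M t) (h t)" shows "((%t. lG (h t) / lR (h t)) \<longlongrightarrow> a / b) at_top"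
proof -
 obtain K where K: "0 < K" "!!k g p h. k : G ==> g : G ==> 0 < Im p ==> closest p h ==>
   dH (act k x0) p + dH p (act g x0) <= dH (act k x0) (act g x0) + 3 ==>
   lG (hinv k ** h) <= K * (lG (hinv k ** g) + 1)" using between_length[of 3] by blast
 have err: "\<forall>\<^sub>F t in at_top. lG (hinv (w (nat \<lfloor>(1 - H) / l * t\<rfloor>)) ** h t) / t < (2 * K * E / l + 1) * H"
  if e: "0 < H" "H < 1" for H proof -
  define n where "n = (%t. nat \<lfloor>(1 - H) / l * t\<rfloor>)"
  define m where "m = (%t. nat \<lfloor>(1 + H) / l * t\<rfloor>)"
  have k: "0 < (1 - H) / l" "0 < (1 + H) / l" using e l by auto
  have p: "((%t. pr M (act (w (n t)) x0) / t) \<longlongrightarrow> 1 - H) at_top" "((%t. pr M (act (w (m t)) x0) / t) \<longlongrightarrow> 1 + H) at_top"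
   using tendsto_at_scaled[OF l(2) k(1)] tendsto_at_scaled[OF l(2) k(2)] l by (simp_all add: n_def m_def)
  have q: "\<forall>\<^sub>F t in at_top. pr M (act (w (n t)) x0) / t < 1 - H / 2 \<and> 1 + H / 2 < pr M (act (w (m t)) x0) / t"
   using order_tendstoD(2)[OF p(1), of "1 - H / 2"] order_tendstoD(1)[OF p(2), of "1 + H / 2"] e by (intro eventually_conj) auto
  have "((%t. K * (S (m t) / t - S (n t) / t + 1 / t)) \<longlongrightarrow> K * (E * ((1 + H) / l) - E * ((1 - H) / l) + 0)) at_top"
   unfolding m_def n_def by (intro tendsto_intros tendsto_at_scaled[OF S(2)] k) real_asymp
  also have "K * (E * ((1 + H) / l) - E * ((1 - H) / l) + 0) = 2 * K * E / l * H" using l by (simp add: field_simps)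
  finally have "\<forall>\<^sub>F t in at_top. K * (S (m t) / t - S (n t) / t + 1 / t) < (2 * K * E / l + 1) * H"
   by (rule order_tendstoD) (use e in "simp add: algebra_simps")
  then show ?thesis using q eventually_ge_at_top[of "2 / H"] proof eventually_elim
   case (elim t)
   have t: "0 < t" "1 <= H / 2 * t" using elim e by (auto simp: field_simps intro: less_le_trans[of _ "2 / H"])
   have "pr M (act (w (n t)) x0) < (1 - H / 2) * t" "(1 + H / 2) * t < pr M (act (w (m t)) x0)" using elim t by (simp_all add: field_simps)
   then have "pr M (act (w (n t)) x0) <= t - 1" "t + 1 <= pr M (act (w (m t)) x0)" using t by (simp_all add: algebra_simps)
   then have "dH (act (w (n t)) x0) (ap M t) + dH (ap M t) (act (w (m t)) x0) <= dH (act (w (n t)) x0) (act (w (m t)) x0) + 3"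
    using M w by (intro between_projections) auto
   then have "lG (hinv (w (n t)) ** h t) <= K * (lG (hinv (w (n t)) ** w (m t)) + 1)" using K(2)[OF w w _ h] M t by simp
   also have "... <= K * (S (m t) - S (n t) + 1)" proof -
    have "(1 - H) / l * t <= (1 + H) / l * t" using t e l by (intro mult_right_mono divide_right_mono) auto
    then have "n t <= m t" unfolding n_def m_def by (intro nat_mono floor_mono)
    then show ?thesis using S(1)[of "n t" "m t"] K(1) by simp
   qed
   finally have "lG (hinv (w (n t)) ** h t) / t <= K * (S (m t) - S (n t) + 1) / t" using t by (simp add: divide_right_mono)
   also have "... = K * (S (m t) / t - S (n t) / t + 1 / t)" by (simp add: divide_inverse algebra_simps)
   finally show ?case using elim unfolding n_def by linarith
  qed
 qed
 have lim: "((%t. real (f (h t)) / t) \<longlongrightarrow> q / l) at_top"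
  if q: "(%n. real (f (w n)) / real n) \<longlonglongrightarrow> q" and f: "!!g k. g : G ==> k : G ==> abs (real (f g) - real (f k)) <= lG (hinv g ** k)" for f q
 proof (rule tendstoI)
  fix e0 :: real assume e0: "0 < e0"
  \<comment> \<open>Three errors, each a multiple of \<open>H\<close>: the comparison of
    \<open>h t\<close> with the walk, the convergence of \<open>f (w n) / t\<close>, and the
    shortfall of \<open>n\<close> by the factor \<open>1 - H\<close>.\<close>
  define Q where "Q = abs (2 * K * E / l) + 2 + abs (q / l)"
  have Q: "2 <= Q" by (simp add: Q_def)
  define H where "H = min (1/2) (e0 / Q)"
  have e: "0 < H" "H < 1" "Q * H <= e0" proof -
   show "0 < H" "H < 1" using e0 Q by (auto simp: H_def)
   have "Q * H <= Q * (e0 / Q)" using Q by (intro mult_left_mono) (auto simp: H_def)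
   then show "Q * H <= e0" using Q by simp
  qed
  define n where "n = (%t. nat \<lfloor>(1 - H) / l * t\<rfloor>)"
  have lm: "((%t. real (f (w (n t))) / t) \<longlongrightarrow> q * ((1 - H) / l)) at_top"
   unfolding n_def using e l by (intro tendsto_at_scaled[OF q]) auto
  have "\<forall>\<^sub>F t in at_top. dist (real (f (w (n t))) / t) (q * ((1 - H) / l)) < H" using tendstoD[OF lm e(1)] .
  then show "\<forall>\<^sub>F t in at_top. dist (real (f (h t)) / t) (q / l) < e0"
   using err[OF e(1,2), folded n_def, unfolded n_def[THEN fun_cong, symmetric]] eventually_gt_at_top[of 0] proof eventually_elim
   case (elim t)
   have "abs (real (f (w (n t))) - real (f (h t))) <= lG (hinv (w (n t)) ** h t)" using f[OF w, of "h t" "n t"] closestD(1)[OF h[of t]] elim by simp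
   then have "abs (real (f (w (n t))) - real (f (h t))) / t <= lG (hinv (w (n t)) ** h t) / t" using elim by (simp add: divide_right_mono)
   then have "abs (real (f (w (n t))) / t - real (f (h t)) / t) < (2 * K * E / l + 1) * H" using elim by (simp flip: diff_divide_distrib)
   moreover have "q * ((1 - H) / l) = q / l - q / l * H" using l by (simp add: field_simps)
   moreover have "abs (q / l * H) = abs (q / l) * H" using e(1) by (simp add: abs_mult)
   moreover have "(2 * K * E / l + 1) * H <= (abs (2 * K * E / l) + 1) * H" using e(1) by (intro mult_right_mono add_right_mono abs_ge_self) auto
   moreover have "(abs (2 * K * E / l) + 1) * H + H + abs (q / l) * H = Q * H" by (simp add: Q_def algebra_simps)
   moreover have "abs (y - c') < e'" if "abs (x - y) < b" "c = c' - d" "abs d = d'" "b <= b'" "b' + H + d' = r" "abs (x - c) < H" "r <= e'"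
    for x y b c c' d d' b' r e' :: real using that by linarith
   ultimately show ?case using elim(1) e(3) unfolding dist_real_def by blast
  qed
 qed
 have rev: "abs (real (A.len g) - real (A.len k)) <= lG (hinv g ** k)" "abs (real (R.len g) - real (R.len k)) <= lG (hinv g ** k)"
  if "g : G" "k : G" for g k proof -
  have "A.len k <= A.len g + A.len (hinv g ** k)" "A.len g <= A.len k + A.len (hinv k ** g)" "R.len k <= R.len g + R.len (hinv g ** k)" "R.len g <= R.len k + R.len (hinv k ** g)"
   using that A.len_mult[of g "hinv g ** k"] A.len_mult[of k "hinv k ** g"] R.len_mult[of g "hinv g ** k"] R.len_mult[of k "hinv k ** g"] by simp_all
  moreover have "R.len (hinv g ** k) <= A.len (hinv g ** k)" using that by (intro lenR_le_lenG) simp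
  ultimately show "abs (real (A.len g) - real (A.len k)) <= lG (hinv g ** k)" "abs (real (R.len g) - real (R.len k)) <= lG (hinv g ** k)"
   using A.len_quot_sym[OF that] R.len_quot_sym[OF that] by linarith+
 qed
 have "((%t. (lG (h t) / t) / (lR (h t) / t)) \<longlongrightarrow> (a / l) / (b / l)) at_top"
  using b(2) l(1) by (intro tendsto_divide lim[OF a rev(1)] lim[OF b(1) rev(2)]) auto
 moreover have "\<forall>\<^sub>F t::real in at_top. (lG (h t) / t) / (lR (h t) / t) = lG (h t) / lR (h t)"
  using eventually_gt_at_top[of 0] by eventually_elim simp
 ultimately show ?thesis using l(1) Lim_transform_eventually by fastforce
qed

end

section \<open>Rays as functions of their endpoints\<close>

context cusped
begin

text \<open>In the disc, the geodesic from the origin to the boundary point \<open>q\<close> is \<open>t \<mapsto> tanh (t/2) q\<close>.\<close>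

lemma ray_in_disc: assumes M: "M : SL2" "act M x0 = \<i>" and g: "geodesic_ray x0 r" "ray_endpoint r q" and t: "0 <= t"
 shows "cayley (act M (r t)) = of_real (tanh (t / 2)) * dact M q" and "cmod (dact M q) = 1"
proof -
 define h where "h = (%t. cayley (act M (r t)))"
 have up: "0 < Im (r t)" if "0 <= t" for t using g(1) that by (auto simp: geodesic_ray_def)
 have d0: "dH \<i> (act M (r t)) = t" if "0 <= t" for t using g(1) that up[OF that] M(1) unfolding M(2)[symmetric] by (auto simp: geodesic_ray_def)
 have dd: "dH (act M (r s)) (act M (r t)) = abs (s - t)" if "0 <= s" "0 <= t" for s t using g(1) that M(1) by (auto simp: geodesic_ray_def)
 have sq: "(cmod (h s - h t))^2 = 2 * (cosh (s - t) - 1) / ((cosh s + 1) * (cosh t + 1))" if "0 <= s" "0 <= t" for s t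
  unfolding h_def using that up M by (subst cayley_dist) (auto simp: d0 dd simp del: dH_act)
 have eq0: "h 0 = 0" using g(1) M by (simp add: h_def geodesic_ray_def)
 have tan: "cosh t + 1 = 2 * (cosh (t / 2))^2" "cosh t - 1 = 2 * (sinh (t / 2))^2" for t :: real
  using cosh_double[of "t / 2"] by (simp_all add: cosh_square_eq)
 have e: "cmod (h s - h t) = tanh (s / 2) - tanh (t / 2)" if st: "0 <= t" "t <= s" for s t proof -
  have "(cmod (h s - h t))^2 = (sinh ((s - t) / 2) / (cosh (s / 2) * cosh (t / 2)))^2" proof -
   have "2 * (2 * a^2) / (2 * b^2 * (2 * c^2)) = (a / (b * c))^2" for a b c :: real by (simp add: power_divide power_mult_distrib)
   then show ?thesis using sq[of s t] st unfolding tan by simp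
  qed
  also have "sinh ((s - t) / 2) / (cosh (s / 2) * cosh (t / 2)) = tanh (s / 2) - tanh (t / 2)" proof -
   have "sinh (x - y) / (cosh x * cosh y) = tanh x - tanh y" for x y :: real by (simp add: sinh_diff tanh_def diff_divide_distrib)
   from this[of "s / 2" "t / 2"] show ?thesis by (simp only: diff_divide_distrib)
  qed
  finally show ?thesis using st by simp
 qed
 have n: "cmod (h s) = tanh (s / 2)" if "0 <= s" for s using e[of 0 s] that eq0 by simp
 \<comment> \<open>By \<open>e\<close> Euclidean distances along the image of the ray are additive
   from the origin. Equality in the triangle inequality puts all points on one radius, whose
   direction is read off in the limit.\<close>
 have par: "tanh (t / 2) *\<^sub>R h s = tanh (s / 2) *\<^sub>R h t" if st: "0 <= t" "t <= s" for s t proof -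
  have "norm (h t + (h s - h t)) = norm (h t) + norm (h s - h t)" using n e st by simp
  then have "norm (h t) *\<^sub>R (h s - h t) = norm (h s - h t) *\<^sub>R h t" by (simp only: norm_triangle_eq)
  then show ?thesis using n e st by (simp add: scaleR_diff_left scaleR_diff_right)
 qed
 have lim: "(h \<longlongrightarrow> dact M q) at_top" proof -
  have l: "((%t. cayley (r (max t 0))) \<longlongrightarrow> q) at_top" proof (rule Lim_transform_eventually)
   show "((%t. cayley (r t)) \<longlongrightarrow> q) at_top" using g(2) by (simp add: ray_endpoint_def)
   show "\<forall>\<^sub>F t in at_top. cayley (r t) = cayley (r (max t 0))" using eventually_ge_at_top[of 0] by eventually_elim simp
  qed
  have "cmod q <= 1" by (rule cayley_lim_bound[OF l]) (auto simp: up)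
  from tendsto_dact[OF M(1) l this] show ?thesis proof (rule Lim_transform_eventually)
   show "\<forall>\<^sub>F t in at_top. dact M (cayley (r (max t 0))) = h t"
    using eventually_ge_at_top[of 0] by eventually_elim (simp add: h_def cayley_act M up)
  qed
 qed
 have th: "((%s::real. tanh (s / 2)) \<longlongrightarrow> 1) at_top" by (rule filterlim_compose[OF tanh_real_at_top]) real_asymp
 have "tanh (t / 2) *\<^sub>R dact M q = 1 *\<^sub>R h t" proof (rule tendsto_unique)
  show "((%s. tanh (t / 2) *\<^sub>R h s) \<longlongrightarrow> tanh (t / 2) *\<^sub>R dact M q) at_top" by (intro tendsto_intros lim)
  have "((%s. tanh (s / 2) *\<^sub>R h t) \<longlongrightarrow> 1 *\<^sub>R h t) at_top" by (intro tendsto_intros th)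
  then show "((%s. tanh (t / 2) *\<^sub>R h s) \<longlongrightarrow> 1 *\<^sub>R h t) at_top" proof (rule Lim_transform_eventually)
   show "\<forall>\<^sub>F s in at_top. tanh (s / 2) *\<^sub>R h t = tanh (t / 2) *\<^sub>R h s"
    using eventually_ge_at_top[of t] by eventually_elim (simp add: par t)
  qed
 qed simp
 then show "cayley (act M (r t)) = of_real (tanh (t / 2)) * dact M q" by (simp add: h_def scaleR_conv_of_real)
 have "((%s. cmod (h s)) \<longlongrightarrow> cmod (dact M q)) at_top" by (intro tendsto_intros lim)
 moreover have "((%s. cmod (h s)) \<longlongrightarrow> 1) at_top"
  using th by (rule Lim_transform_eventually) (rule eventually_mono[OF eventually_ge_at_top[of "0::real"]], simp add: n)
 ultimately show "cmod (dact M q) = 1" by (rule tendsto_unique[rotated]) simp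
qed

lemma endpoint_bound: assumes g: "geodesic_ray x0 r" "ray_endpoint r q" shows "cmod q <= 1"
proof (rule cayley_lim_bound)
 show "((%t. cayley (r (max t 0))) \<longlongrightarrow> q) at_top" proof (rule Lim_transform_eventually)
  show "((%t. cayley (r t)) \<longlongrightarrow> q) at_top" using g(2) by (simp add: ray_endpoint_def)
  show "\<forall>\<^sub>F t in at_top. cayley (r t) = cayley (r (max t 0))" using eventually_ge_at_top[of 0] by eventually_elim simp
 qed
qed (use g(1) in "auto simp: geodesic_ray_def")

definition uncay :: "complex => complex" where "uncay h = \<i> * (1 + h) / (1 - h)"

lemma uncay_cayley: "0 < Im z ==> uncay (cayley z) = z"
proof -
 assume "0 < Im z"
 then have n: "z + \<i> ~= 0" by (rule plus_i_nonzero)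
 have "1 + cayley z = 2 * z / (z + \<i>)" "1 - cayley z = 2 * \<i> / (z + \<i>)" using n by (simp_all add: cayley_eq field_simps)
 then show ?thesis using n by (simp add: uncay_def)
qed

lemma cayley_uncay: "cmod h < 1 ==> cayley (uncay h) = h"
proof -
 assume "cmod h < 1"
 then have n: "1 - h ~= 0" by auto
 then have "uncay h - \<i> = \<i> * 2 * h / (1 - h)" "uncay h + \<i> = \<i> * 2 / (1 - h)" by (simp_all add: uncay_def field_simps)
 then show ?thesis using n by (simp add: cayley_eq)
qed

lemma uncay_upper: assumes "cmod h < 1" shows "0 < Im (uncay h)"
proof -
 have n: "1 - h ~= 0" using assms by auto
 have "uncay h = \<i> * (1 + h) * cnj (1 - h) / of_real ((cmod (1 - h))^2)" unfolding uncay_def by (subst complex_div_cnj) simp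
 then have "Im (uncay h) = (1 - (cmod h)^2) / (cmod (1 - h))^2" by (simp add: cmod_power2) (simp add: power2_eq_square algebra_simps)
 moreover have "(cmod h)^2 < 1" using assms by (simp add: abs_square_less_1)
 ultimately show ?thesis using n by simp
qed

lemma uncay_continuous: "(!!x. x : S ==> cmod (f x) < 1) ==> continuous_on S f ==> continuous_on S (%x. uncay (f x))"
proof -
 assume "!!x. x : S ==> cmod (f x) < 1" "continuous_on S f"
 moreover from this have "1 - f x ~= 0" if "x : S" for x using that by force
 ultimately show ?thesis unfolding uncay_def by (intro continuous_intros) auto
qed

text \<open>The ray with endpoint \<open>q\<close> by an explicit formula in \<open>q\<close> and
  \<open>t\<close>. Joint continuity in both is what the measurability argument requires.\<close>

definition disc_ray :: "real^2^2 => complex => real => complex" where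
 "disc_ray M q t = act (hinv M) (uncay (of_real (tanh (t / 2)) * dact M q))"

lemma disc_ray_eq: assumes "M : SL2" "act M x0 = \<i>" "geodesic_ray x0 r" "ray_endpoint r q" "0 <= t" shows "disc_ray M q t = r t"
proof -
 have "0 < Im (r t)" using assms by (auto simp: geodesic_ray_def)
 then show ?thesis using assms(1) by (simp add: disc_ray_def uncay_cayley flip: ray_in_disc(1)[OF assms])
qed

lemma disc_ray_ap: assumes M: "M : SL2" "act M x0 = \<i>" and z: "cmod (dact M q) = 1"
 shows "\<exists>R\<in>SL2. act (R ** M) x0 = \<i> \<and> dact R (dact M q) = 1 \<and> (\<forall>t. ap (R ** M) t = disc_ray M q t)"
proof -
 define f where "f = Arg (dact M q)"
 have ph: "dact M q = cis f" proof -
  have "dact M q ~= 0" using z by auto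
  then show ?thesis using cis_Arg[of "dact M q"] z by (simp add: f_def sgn_eq)
 qed
 define R where "R = rot (- f / 2)"
 have R: "dact R h = cis (- f) * h" for h proof -
  have n: "cis (f / 2) ~= 0" by simp
  have "dact R h = (2 * \<i> * cis (- f / 2) * h) / (2 * \<i> * cis (f / 2))" proof -
   have "2 * \<i> * cis (- f / 2) = Complex (2 * sin (f / 2)) (2 * cos (f / 2))" "2 * \<i> * cis (f / 2) = Complex (- (2 * sin (f / 2))) (2 * cos (f / 2))"
    by (simp_all add: complex_eq_iff)
   then show ?thesis by (simp only:) (simp add: dact_def cden_def R_def rot_def flip: zero_complex.code)
  qed
  also have "... = cis (- f / 2) / cis (f / 2) * h" by simp
  finally show ?thesis by (simp add: cis_divide)
 qed
 have "ap (R ** M) t = disc_ray M q t" for t proof (rule ap_eqI)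
  have lt: "cmod (of_real (tanh (t / 2)) * dact M q) < 1" using z tanh_real_bounds[of "t / 2"] by (auto simp: norm_mult)
  note u = uncay_upper[OF lt]
  show "0 < Im (disc_ray M q t)" using u M by (simp add: disc_ray_def)
  have "act (R ** M) (disc_ray M q t) = act R (uncay (of_real (tanh (t / 2)) * dact M q))" using u M by (simp add: disc_ray_def act_mult R_def)
  then have "cayley (act (R ** M) (disc_ray M q t)) = cis (- f) * (of_real (tanh (t / 2)) * cis f)"
   using cayley_act[of R, OF _ u] cayley_uncay[OF lt] by (simp add: R) (simp add: R_def ph)
  also have "... = of_real (tanh (t / 2))" by (simp add: cis_mult)
  also have "tanh (t / 2) = (exp t - 1) / (exp t + 1)" proof -
   have "exp t = exp (t / 2) * exp (t / 2)" by (simp flip: exp_add)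
   moreover have "(e - inverse e) / (e + inverse e) = (e * e - 1) / (e * e + 1)" if "0 < e" for e :: real proof -
    have "e - inverse e = (e * e - 1) / e" "e + inverse e = (e * e + 1) / e" using that by (simp_all add: field_simps)
    then show ?thesis using that by simp
   qed
   ultimately show ?thesis by (simp add: tanh_altdef exp_minus)
  qed
  also have "of_real ... = cayley (iax t)" by (simp add: cayley_iax_eq)
  finally have "uncay (cayley (act (R ** M) (disc_ray M q t))) = uncay (cayley (iax t))" by (simp only:)
  moreover have "0 < Im (act (R ** M) (disc_ray M q t))" using u M by (simp add: disc_ray_def R_def)
  moreover have "0 < Im (iax t)" by simp
  ultimately show "act (R ** M) (disc_ray M q t) = iax t" by (simp only: uncay_cayley)
 qed (use M in "simp add: R_def")
 moreover have "act (R ** M) x0 = \<i>" using M by (simp add: R_def act_mult)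
 moreover have "dact R (dact M q) = 1" by (simp add: R ph cis_mult)
 moreover have "R : SL2" by (simp add: R_def)
 ultimately show ?thesis by blast
qed

text \<open>Clearing denominators in the hyperbolic cosines turns closeness into weak inequalities
  between continuous functions of \<open>z\<close>, so it is a closed condition.\<close>

lemma closest_poly: assumes "0 < Im z"
 shows "closest z g \<longleftrightarrow> g : G \<and> (\<forall>k\<in>G. (cmod (z - act g x0))^2 * Im (act k x0) <= (cmod (z - act k x0))^2 * Im (act g x0))"
proof -
 have "dH (act g x0) z <= dH (act k x0) z \<longleftrightarrow>
   (cmod (z - act g x0))^2 * Im (act k x0) <= (cmod (z - act k x0))^2 * Im (act g x0)" if "g : G" "k : G" for g k proof -
  have p: "0 < Im (act g x0)" "0 < Im (act k x0)" using that by simp_all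
  have "dH (act g x0) z <= dH (act k x0) z \<longleftrightarrow> cosh (dH (act g x0) z) <= cosh (dH (act k x0) z)"
   using p assms by (simp add: cosh_real_nonneg_le_iff)
  also have "... \<longleftrightarrow> (cmod (z - act g x0))^2 / (2 * Im (act g x0) * Im z) <= (cmod (z - act k x0))^2 / (2 * Im (act k x0) * Im z)"
   using p assms by (simp add: cosh_hyp_dist norm_minus_commute)
  also have "... \<longleftrightarrow> (cmod (z - act g x0))^2 * Im (act k x0) <= (cmod (z - act k x0))^2 * Im (act g x0)"
   using p assms by (simp add: field_simps)
  finally show ?thesis .
 qed
 then show ?thesis using assms by (auto simp: closest_iff closest_orbit_element_def)
qed

text \<open>The set is the projection, along a compact time interval, of a compact set of pairs of
  endpoint and time.\<close>

lemma closest_times_closed: assumes M: "M : SL2"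
 shows "closed {q. cmod q <= 1 \<and> cmod (dact M q) = 1 \<and> (\<exists>t\<in>{0..} \<inter> {a..b}. closest (disc_ray M q t) g)}"
proof (cases "g : G")
 case g: True
 define K where "K = {x : cball (0::complex) 1 \<times> {max 0 a..b}. cmod (dact M (fst x)) = 1}"
 define p where "p = (%x. uncay (of_real (tanh (snd x / 2)) * dact M (fst x)))"
 have cd: "continuous_on (cball 0 1 \<times> {max 0 a..b}) (%x. dact M (fst x))"
  unfolding dact_def cden_def[abs_def] by (intro continuous_intros) (use cden_nonzero[OF M] in "auto simp: cden_def")
 have cK: "compact K" proof -
  have "closed K" unfolding K_def by (intro continuous_closed_preimage_constant continuous_on_norm cd closed_Times) auto
  moreover have "K \<subseteq> cball 0 1 \<times> {max 0 a..b}" by (auto simp: K_def)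
  moreover have "compact (cball (0::complex) 1 \<times> {max 0 a..b})" by (intro compact_Times) auto
  ultimately show ?thesis using compact_Int_closed[of "cball (0::complex) 1 \<times> {max 0 a..b}" K] by (simp add: inf.absorb2)
 qed
 have lt: "cmod (of_real (tanh (snd x / 2)) * dact M (fst x)) < 1" if "x : K" for x
  using that tanh_real_bounds[of "snd x / 2"] by (auto simp: K_def norm_mult)
 have cp: "continuous_on K p" unfolding p_def proof (rule uncay_continuous[OF lt])
  show "continuous_on K (%x. of_real (tanh (snd x / 2)) * dact M (fst x))" by (intro continuous_intros continuous_on_subset[OF cd]) (auto simp: K_def)
 qed
 have up: "0 < Im (p x)" if "x : K" for x unfolding p_def by (rule uncay_upper[OF lt[OF that]])
 have nz: "den (hinv M) (p x) ~= 0" if "x : K" for x by (rule den_nonzero) (use M up[OF that] in auto)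
 have cq: "continuous_on K (%x. act (hinv M) (p x))" unfolding act_eq den_def by (intro continuous_intros cp) (use nz in "auto simp: den_def")
 have "{x : K. closest (act (hinv M) (p x)) g} = K \<inter> (\<Inter>k\<in>G. {x : K. (cmod (act (hinv M) (p x) - act g x0))^2 * Im (act k x0) <= (cmod (act (hinv M) (p x) - act k x0))^2 * Im (act g x0)})"
  using closest_poly[of "act (hinv M) (p _)"] M up g by auto
 moreover have "compact ..."
  using cK by (intro compact_Int_closed closed_INT ballI continuous_on_closed_Collect_le continuous_intros cq compact_imp_closed) auto
 ultimately have "compact {x : K. closest (act (hinv M) (p x)) g}" by simp
 then have "compact (fst ` {x : K. closest (act (hinv M) (p x)) g})" by (rule compact_continuous_image[rotated]) (intro continuous_intros)
 moreover have "fst ` {x : K. closest (act (hinv M) (p x)) g} =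
   {q. cmod q <= 1 \<and> cmod (dact M q) = 1 \<and> (\<exists>t\<in>{0..} \<inter> {a..b}. closest (disc_ray M q t) g)}"
  by (force simp: K_def p_def disc_ray_def)
 ultimately show ?thesis using compact_imp_closed by fastforce
next
 case False
 then show ?thesis by (simp add: closest_def)
qed

end

section \<open>The ratio along almost every ray for the harmonic measure\<close>

context walked
begin

text \<open>To pass from the walk to its hitting measure, the exceptional endpoints must lie in a
  Borel set. The set \<open>bad\<close> is one, and its preimage under the limit map is null by
  \<open>ray_ratio\<close>.\<close>

theorem harmonic_ratio:
 "\<exists>c>0. almost_all_rays x0 (harmonic_measure \<mu> x0) (%r. has_rho G A C x0 r (ereal c))"
proof -
 obtain D where D: "D > 0" "!!g. g : G ==> dH x0 (act g x0) <= D * lG g" using orbit_dist_le by blast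
 have intR: "integrable (measure_pmf \<mu>) (%g. lR g)"
  by (rule Bochner_Integration.integrable_bound[OF moment]) (use supp lenR_le_lenG in "auto intro!: AE_pmfI")
 have intH: "integrable (measure_pmf \<mu>) (%g. dH x0 (act g x0))"
  by (rule Bochner_Integration.integrable_bound[OF integrable_mult_right[OF moment, of D]]) (use supp D in "auto intro!: AE_pmfI simp: subset_iff")
 obtain a where a: "AE v in \<Omega>. (%n. lG (walk n v) / real n) \<longlonglongrightarrow> a"
  using proc_drift[of "%g. lG g"] moment A.len_mult by (auto simp flip: of_nat_add)
 obtain b where b: "0 <= b" "AE v in \<Omega>. (%n. lR (walk n v) / real n) \<longlonglongrightarrow> b"
  using proc_drift[of "%g. lR g"] intR R.len_mult by (auto simp flip: of_nat_add)
 have b0: "b ~= 0" by (rule lenR_drift_pos[OF b(2)])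
 obtain l where l: "0 <= l" "AE v in \<Omega>. (%n. dH x0 (act (walk n v) x0) / real n) \<longlonglongrightarrow> l" proof -
  have "dH x0 (act (g ** h) x0) <= dH x0 (act g x0) + dH x0 (act h x0)" if "g : G" "h : G" for g h
   using dH_triangle[of x0 "act g x0" "act g (act h x0)"] that by (simp add: act_mult)
  moreover have "dH x0 (act (hinv g) x0) = dH x0 (act g x0)" if "g : G" for g using dH_act_left[of g x0 x0] that by (simp add: dH_commute)
  ultimately show ?thesis using proc_drift[of "%g. dH x0 (act g x0)"] intH that by auto
 qed
 obtain K where K: "0 < K" "!!g. g : G ==> lR g <= K * (dH x0 (act g x0) + 1)" using lenR_le_dist by blast
 \<comment> \<open>These inequalities pass the positivity of the relative drift on to the word drift
   and the escape rate.\<close>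
 have comp: "b <= a \<and> b <= K * l" proof -
  have "AE v in \<Omega>. b <= a \<and> b <= K * l" using AE_good a b(2) l(2) proof eventually_elim
   case (elim v)
   have "(%n. K * (dH x0 (act (walk n v) x0) / real n + 1 / real n)) \<longlonglongrightarrow> K * (l + 0)"
    by (intro tendsto_intros elim lim_1_over_n)
   moreover have "lR (walk n v) / real n <= K * (dH x0 (act (walk n v) x0) / real n + 1 / real n)" for n
    using divide_right_mono[OF K(2)[OF good_walk[OF elim(1)]], of "real n"] by (simp add: add_divide_distrib distrib_left)
   ultimately have "b <= K * (l + 0)" by (intro LIMSEQ_le[OF elim(3)]) auto
   moreover have "b <= a" using good_walk[OF elim(1)] lenR_le_lenG by (intro LIMSEQ_le[OF elim(3) elim(2)]) (auto intro!: divide_right_mono)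
   ultimately show ?case by simp
  qed
  then show ?thesis by simp
 qed
 have ab: "0 < a" "0 < b" "0 < l" using b b0 comp l(1) by (auto simp: less_le)
 obtain M where M: "M : SL2" "act M x0 = \<i>" using to_i[OF x0] by blast
 define c where "c = a / b"
 define f where "f = (%v. lim (%n. cayley (act (walk n v) x0)))"
 have fm: "f : borel_measurable \<Omega>" proof -
  have nth: "(%A::real^2^2. A$i$j) : borel_measurable borel" for i j by (intro borel_measurable_continuous_onI continuous_intros)
  have "(%v. cayley (act (walk n v) x0)) : borel_measurable \<Omega>" for n unfolding cayley_eq act_eq den_def
   by (intro borel_measurable_divide borel_measurable_diff borel_measurable_add borel_measurable_times borel_measurable_const
    measurable_compose[OF measurable_compose[OF walk_measurable nth] borel_measurable_of_real])
  then show ?thesis unfolding f_def by (rule borel_measurable_lim_metric)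
 qed
 define far where "far = (%j. {g : G. 1 / real (Suc j) <= abs (lG g / lR g - c)})"
 define Z where "Z = (%g N n. {q. cmod q <= 1 \<and> cmod (dact M q) = 1 \<and> (\<exists>t\<in>{0..} \<inter> {real N..real n}. closest (disc_ray M q t) g)})"
 \<comment> \<open>An endpoint is bad if, for some precision \<open>1 / (j + 1)\<close>, arbitrarily
   late points of its ray have a closest element whose ratio is off by at least that much. Every set
   \<open>Z\<close> is closed and all indices are countable.\<close>
 define bad where "bad = (\<Union>j. \<Inter>N. \<Union>n. \<Union>g\<in>far j. Z g N n)"
 have badm: "bad : sets borel" proof -
  have "countable (far j)" for j by (rule countable_subset[OF _ countable_G]) (auto simp: far_def)
  moreover have "Z g N n : sets borel" for g N n unfolding Z_def by (intro borel_closed closest_times_closed M)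
  ultimately show ?thesis unfolding bad_def by (intro sets.countable_UN'' sets.countable_INT'' countableI_type) auto
 qed
 have rho: "has_rho G A C x0 r (ereal c)" if g: "geodesic_ray x0 r" "ray_endpoint r q" and xi: "q \<notin> bad" for r q unfolding has_rho_def
 proof (intro allI impI)
  fix h assume h: "\<forall>t\<ge>0. closest_orbit_element G x0 (r t) (h t)"
  have up: "0 < Im (r t)" if "0 <= t" for t using g(1) that by (auto simp: geodesic_ray_def)
  have "((%t. lG (h t) / lR (h t)) \<longlongrightarrow> c) at_top" proof (rule tendstoI)
   fix e :: real assume "0 < e"
   obtain j where j: "1 / real (Suc j) < e" using \<open>0 < e\<close> by (rule nat_approx_posE)
   have "q \<notin> (\<Inter>N. \<Union>n. \<Union>g\<in>far j. Z g N n)" using xi unfolding bad_def by blast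
   then obtain N where N: "!!n g. g : far j ==> q \<notin> Z g N n" by blast
   show "\<forall>\<^sub>F t in at_top. dist (lG (h t) / lR (h t)) c < e" using eventually_ge_at_top[of "real N"] proof eventually_elim
    case (elim t)
    then have t: "0 <= t" by linarith
    have cl: "closest (r t) (h t)" using h t up[OF t] by (simp add: closest_iff)
    have "q : Z (h t) N (nat \<lceil>t\<rceil>)" unfolding Z_def mem_Collect_eq proof (intro conjI bexI[of _ t])
     show "closest (disc_ray M q t) (h t)" using cl disc_ray_eq[OF M g t] by (simp only:)
show "t : {0..} \<inter> {real N..real (nat \<lceil>t\<rceil>)}" using elim by auto
    qed (rule endpoint_bound[OF g], rule ray_in_disc(2)[OF M g t])
    then have "h t \<notin> far j" using N by blast
    then show ?case using j closestD(1)[OF cl] by (auto simp: far_def dist_real_def)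
   qed
  qed
  then show "((%t. ereal (real (word_dist SL2R A (mat 1) (h t)) / real (word_dist SL2R (rel_generators G A C) (mat 1) (h t)))) \<longlongrightarrow> ereal c) at_top"
   by (simp add: A.len_def R.len_def)
 qed
 define S where "S = (%n v. \<Sum>k<n. proc lenG 1 (shiftn k v))"
 define E where "E = (\<integral>v. proc lenG 1 v \<partial>\<Omega>)"
 have birk: "AE v in \<Omega>. (%n. S n v / real n) \<longlonglongrightarrow> E"
  unfolding S_def E_def by (rule W.birkhoff[OF proc_1_integrable[OF moment]])
 have ae: "AE v in \<Omega>. f v \<notin> bad" using AE_good a b(2) l(2) birk proof eventually_elim
  case (elim v)
  let ?w = "%n. walk n v"
  have w: "?w n : G" for n by (rule good_walk[OF elim(1)])
  have one: "proc lenG 1 (shiftn n v) = lG (v n)" for n using elim(1) by (simp add: proc_def) (simp add: shiftn_def)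
  have st: "lG (hinv (?w n) ** ?w m) <= S m v - S n v" if "n <= m" for n m using that proof (induction m rule: dec_induct)
   case (step m)
   have "hinv (?w n) ** ?w (Suc m) = hinv (?w n) ** ?w m ** v m" using lp_walk[of m 1 v] by (simp add: shiftn_def matrix_mul_assoc)
   moreover have "v m : G" using elim(1) by (simp add: good_def)
   ultimately have "lenG (hinv (?w n) ** ?w (Suc m)) <= lenG (hinv (?w n) ** ?w m) + lenG (v m)"
    using A.len_mult[of "hinv (?w n) ** ?w m" "v m"] w by simp
   then show ?case using step one[of m] by (simp add: S_def)
  qed (use w in simp)
  have sr: "(%n. dH (act (?w n) x0) (act (?w (Suc n)) x0) / real n) \<longlonglongrightarrow> 0" proof (rule tendsto_sandwich[of "%_. 0"])
   have "(%n. D * (S (Suc n) v / real (Suc n) * (real (Suc n) / real n) - S n v / real n)) \<longlonglongrightarrow> D * (E * 1 - E)"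
    by (intro tendsto_intros LIMSEQ_Suc[OF elim(5)] elim(5)) real_asymp
   then show "(%n. D * (S (Suc n) v / real (Suc n) * (real (Suc n) / real n) - S n v / real n)) \<longlonglongrightarrow> 0" by simp
   show "\<forall>\<^sub>F n in sequentially. dH (act (?w n) x0) (act (?w (Suc n)) x0) / real n <= D * (S (Suc n) v / real (Suc n) * (real (Suc n) / real n) - S n v / real n)"
   proof (rule eventuallyI)
    fix n
    have "dH (act (?w n) x0) (act (?w (Suc n)) x0) = dH x0 (act (hinv (?w n) ** ?w (Suc n)) x0)"
     using dH_act_left[of "?w n" x0 "act (?w (Suc n)) x0"] w by (simp add: act_mult)
    also have "... <= D * lG (hinv (?w n) ** ?w (Suc n))" using w by (intro D(2)) simp
    also have "... <= D * (S (Suc n) v - S n v)" using st[of n "Suc n"] D(1) by (intro mult_left_mono) auto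
    finally have "dH (act (?w n) x0) (act (?w (Suc n)) x0) / real n <= D * (S (Suc n) v - S n v) / real n" by (simp add: divide_right_mono)
    then show "dH (act (?w n) x0) (act (?w (Suc n)) x0) / real n <= D * (S (Suc n) v / real (Suc n) * (real (Suc n) / real n) - S n v / real n)"
     by (simp add: diff_divide_distrib right_diff_distrib)
   qed
  qed (use w in auto)
  have conv: "(%n. cayley (act (?w n) x0)) \<longlonglongrightarrow> f v" proof -
   have "convergent (%n. cayley (act M (act (?w n) x0)))" by (rule boundary_rate(1)[OF M w ab(3) elim(4) sr])
   then obtain L where L: "(%n. cayley (act M (act (?w n) x0))) \<longlonglongrightarrow> L" by (auto simp: convergent_def)
   have "cmod L <= 1" by (rule cayley_lim_bound[OF L]) (use w M in auto)
   from tendsto_dact[OF SL2_inv[OF M(1)] L this]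
   have "(%n. cayley (act (?w n) x0)) \<longlonglongrightarrow> dact (hinv M) L" using w M by (simp flip: cayley_act)
   then show ?thesis unfolding f_def by (simp add: limI)
  qed
  have le1: "cmod (f v) <= 1" by (rule cayley_lim_bound[OF conv]) (use w in auto)
  show "f v \<notin> bad" proof
   assume "f v : bad"
   then obtain j where "f v : (\<Inter>N. \<Union>n. \<Union>g\<in>far j. Z g N n)" unfolding bad_def by (rule UN_E)
   then have j: "\<exists>n. \<exists>g\<in>far j. f v : Z g N n" for N by blast
   then have z: "cmod (dact M (f v)) = 1" by (auto simp: Z_def)
   obtain R where R: "R : SL2" "act (R ** M) x0 = \<i>" "dact R (dact M (f v)) = 1" "!!t. ap (R ** M) t = disc_ray M (f v) t"
    using disc_ray_ap[OF M z] by blast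
   have RM: "R ** M : SL2" using R M by simp
   \<comment> \<open>The least favourable selection: a closest element with a wrong ratio whenever
     there is one. Convergence along this selection contradicts badness.\<close>
   define h where "h = (%t. if \<exists>g\<in>far j. closest (ap (R ** M) t) g then SOME g. g : far j \<and> closest (ap (R ** M) t) g else SOME g. closest (ap (R ** M) t) g)"
   have h: "closest (ap (R ** M) t) (h t) \<and> ((\<exists>g\<in>far j. closest (ap (R ** M) t) g) --> h t : far j)" for t
   proof (cases "\<exists>g\<in>far j. closest (ap (R ** M) t) g")
    case True
    then have "\<exists>g. g : far j \<and> closest (ap (R ** M) t) g" by blast
    from someI_ex[OF this] show ?thesis using True by (simp add: h_def)
   next
    case False
    have "\<exists>g. closest (ap (R ** M) t) g" using RM by (intro closest_exists) simp
    from someI_ex[OF this] show ?thesis using False by (simp add: h_def)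
   qed
   have "(%n. dact R (dact M (cayley (act (?w n) x0)))) \<longlonglongrightarrow> dact R (dact M (f v))"
    by (intro tendsto_dact conv le1 R M) (simp add: z)
   then have "(%n. cayley (act (R ** M) (act (?w n) x0))) \<longlonglongrightarrow> 1" using w M R by (simp add: act_mult cayley_act)
   then have p: "(%n. pr (R ** M) (act (?w n) x0) / real n) \<longlonglongrightarrow> l" by (rule boundary_rate(2)[OF RM R(2) w ab(3) elim(4) sr])
   have lim: "((%t. lG (h t) / lR (h t)) \<longlongrightarrow> c) at_top"
    unfolding c_def using h by (intro ray_ratio[OF RM w ab(3) p elim(2,3) b0 st elim(5)]) auto
   have "\<forall>\<^sub>F t in at_top. dist (lG (h t) / lR (h t)) c < 1 / real (Suc j)" using tendstoD[OF lim] by simp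
   then obtain T where T: "!!t. T <= t ==> dist (lG (h t) / lR (h t)) c < 1 / real (Suc j)" by (auto simp: eventually_at_top_linorder)
   obtain N :: nat where N: "T <= real N" using real_arch_simple by blast
   obtain n g where ng: "g : far j" "f v : Z g N n" using j by blast
   then obtain t where t: "real N <= t" "closest (ap (R ** M) t) g" by (auto simp: Z_def R(4))
   then have "h t : far j" using h[of t] ng by blast
   then show False using T[of t] t N by (auto simp: far_def dist_real_def)
  qed
 qed
 show ?thesis proof (intro exI[of _ c] conjI)
  show "0 < c" using ab by (simp add: c_def)
  have "AE q in distr \<Omega> borel f. q \<notin> bad" using ae badm by (subst AE_distr_iff[OF fm]) auto
  then show "almost_all_rays x0 (harmonic_measure \<mu> x0) (%r. has_rho G A C x0 r (ereal c))"
   unfolding almost_all_rays_def harmonic_measure_def \<Omega>_eq f_def[symmetric] by eventually_elim (use rho in blast)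
 qed
qed

end

subsection \<open>Cusp excursions of almost every geodesic\<close>

text \<open>The pair \<open>(n, j)\<close> stands for the dyadic interval of length \<open>2\<^sup>-\<^sup>n\<close> starting at \<open>j / 2\<^sup>n\<close>. \<open>Ed f m n j\<close> is
 the average of \<open>f\<close> over its descendants \<open>m\<close> levels below, and \<open>Fd l h N n j\<close> is the expectation
 of \<open>exp (- l S)\<close>, where \<open>S\<close> is the sum of \<open>h\<close> along the first \<open>N\<close> levels of a random descending path.\<close>

primrec Ed :: "(nat => int => real) => nat => nat => int => real" where
 "Ed f 0 n j = f n j"
| "Ed f (Suc m) n j = (Ed f m (Suc n) (2 * j) + Ed f m (Suc n) (2 * j + 1)) / 2"

primrec Fd :: "real => (nat => int => real) => nat => nat => int => real" where
 "Fd l h 0 n j = 1"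
| "Fd l h (Suc N) n j = exp (- l * h n j) * ((Fd l h N (Suc n) (2 * j) + Fd l h N (Suc n) (2 * j + 1)) / 2)"

definition Ud :: "(nat => int => real) => nat => nat => int => real" where "Ud h N n j = (\<Sum>m<N. Ed h m n j)"

lemma Ed_mono: "(!!n j. f n j <= g n j) ==> Ed f m n j <= Ed g m n j" by (induction m arbitrary: n j) (auto intro!: add_mono)

lemma Ed_linear: "Ed (%n j. a * f n j + g n j) m n j = a * Ed f m n j + Ed g m n j" by (induction m arbitrary: n j) (auto simp: field_simps)

lemma Ed_const: "Ed (%_ _. a) m n j = a" by (induction m arbitrary: n j) auto

lemma Ed_nonneg: "(!!n j. 0 <= f n j) ==> 0 <= Ed f m n j" using Ed_mono[of "%_ _. 0" f m n j] by (simp add: Ed_const)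

lemma Ed_sum: "Ed (%n j. \<Sum>i<(k::nat). f i n j) m n j = (\<Sum>i<k. Ed (f i) m n j)"
proof (induction k)
 case (Suc k)
 then show ?case using Ed_linear[of 1 "%n j. \<Sum>i<k. f i n j" "f k" m n j] by simp
qed (simp add: Ed_const)

lemma Ed_tower: "Ed f (m + i) n j = Ed (%n j. Ed f i n j) m n j" by (induction m arbitrary: n j) auto

lemma Ed_descendant: assumes f: "!!n j. 0 <= f n j" and r: "0 <= r" "r < 2 ^ i" shows "f (n + i) (j * 2 ^ i + r) <= 2 ^ i * Ed f i n j" using r
proof (induction i arbitrary: n j r)
 case (Suc i)
 note nn = Ed_nonneg[of f, OF f]
 show ?case proof (cases "r < 2 ^ i")
  case True
  then show ?thesis using Suc.IH[of r "Suc n" "2 * j"] Suc.prems nn[of i "Suc n" "2 * j + 1"]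
   by (simp add: algebra_simps) (smt (verit) zero_le_power mult_nonneg_nonneg)
 next
  case False
  then show ?thesis using Suc.IH[of "r - 2 ^ i" "Suc n" "2 * j + 1"] Suc.prems nn[of i "Suc n" "2 * j"]
   by (simp add: algebra_simps) (smt (verit) zero_le_power mult_nonneg_nonneg)
 qed
next
 case 0
 then have "r = 0" by simp
 then show ?case by simp
qed

lemma Fd_bounds: assumes "0 <= l" "!!n j. 0 <= h n j" shows "0 <= Fd l h N n j \<and> Fd l h N n j <= 1"
proof (induction N arbitrary: n j)
 case (Suc N)
 have "exp (- l * h n j) * ((Fd l h N (Suc n) (2 * j) + Fd l h N (Suc n) (2 * j + 1)) / 2) <= 1 * 1"
  using Suc[of "Suc n" "2 * j"] Suc[of "Suc n" "2 * j + 1"] assms by (intro mult_mono) auto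
 then show ?case using Suc by simp
qed simp

lemma Fd_add: assumes l: "0 <= l" "!!n j. 0 <= h n j" and b: "!!j. Fd l h N (n + k) j <= b" shows "Fd l h (k + N) n j <= Fd l h k n j * b" using b
proof (induction k arbitrary: n j)
 case (Suc k)
 have "Fd l h (k + N) (Suc n) j <= Fd l h k (Suc n) j * b" for j using Suc by simp
 from add_mono[OF this[of "2 * j"] this[of "2 * j + 1"]]
 have "(Fd l h (k + N) (Suc n) (2 * j) + Fd l h (k + N) (Suc n) (2 * j + 1)) / 2 <= (Fd l h k (Suc n) (2 * j) + Fd l h k (Suc n) (2 * j + 1)) / 2 * b"
  by (simp add: algebra_simps)
 from mult_left_mono[OF this, of "exp (- l * h n j)"] show ?case by simp
qed simp

text \<open>First order expansion of the Laplace transform: while \<open>l * S\<close> stays at most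
  1/3, the expectation of \<open>exp (- l * S)\<close> is at most 1 minus half of \<open>l\<close>
  times the mean of \<open>S\<close>.\<close>

lemma Fd_Ud: assumes l: "0 <= l" and h: "!!n j. 0 <= h n j" "!!n j. h n j <= b" and K: "l * (real K * b) <= 1 / 3" and N: "N <= K"
 shows "Fd l h N n j <= 1 - l / 2 * Ud h N n j" using N
proof (induction N arbitrary: n j)
 case (Suc N)
 define u where "u = (Ud h N (Suc n) (2 * j) + Ud h N (Suc n) (2 * j + 1)) / 2"
 have U: "Ud h (Suc N) n j = h n j + u"
  by (simp only: Ud_def sum.lessThan_Suc_shift u_def) (simp add: sum_divide_distrib add_divide_distrib sum.distrib)
 have b0: "0 <= b" using h(1)[of n j] h(2)[of n j] by linarith
 have ub: "0 <= Ud h N m i \<and> Ud h N m i <= real N * b" for m i proof -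
  have "Ed h p m i <= b" for p using Ed_mono[of h "%_ _. b" p m i] h(2) by (simp add: Ed_const)
  then have "(\<Sum>p<N. Ed h p m i) <= (\<Sum>p<N. b)" by (rule sum_mono)
  then show ?thesis by (auto simp: Ud_def intro!: sum_nonneg Ed_nonneg h)
 qed
 have Nb: "l * (real (Suc N) * b) <= 1 / 3" using Suc.prems l b0 by (intro order_trans[OF _ K] mult_left_mono mult_right_mono) auto
 have u: "0 <= u" "u <= real N * b" using ub[of "Suc n" "2 * j"] ub[of "Suc n" "2 * j + 1"] by (auto simp: u_def)
 have lu: "0 <= l * u" "l * u <= 1 / 3" proof -
  have "l * u <= l * (real (Suc N) * b)" using u b0 l by (intro mult_left_mono) (auto simp: algebra_simps)
  then show "0 <= l * u" "l * u <= 1 / 3" using Nb u l by auto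
 qed
 define x where "x = l * h n j"
 have x: "0 <= x" "x <= 1 / 3" proof -
  have "l * h n j <= l * (real (Suc N) * b)" using h(2)[of n j] b0 l by (intro mult_left_mono) (auto simp: algebra_simps intro: add_increasing2)
  then show "0 <= x" "x <= 1 / 3" using Nb h l by (auto simp: x_def)
 qed
 \<comment> \<open>The coefficient 3/4 instead of the 1/2 wanted in the end leaves
   \<open>x / 4\<close>, which absorbs the cross term \<open>3/8 * x * (l * u)\<close>.\<close>
 have e: "exp (- x) <= 1 - 3 / 4 * x" proof -
  have "0 <= x * (1 - 3 * x)" using x by simp
  then have "1 <= (1 - 3 / 4 * x) * (1 + x)" by (simp add: algebra_simps)
  also have "... <= (1 - 3 / 4 * x) * exp x" using x by (intro mult_left_mono) auto
  finally show ?thesis by (simp add: exp_minus inverse_eq_divide pos_divide_le_eq)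
 qed
 let ?F = "(Fd l h N (Suc n) (2 * j) + Fd l h N (Suc n) (2 * j + 1)) / 2"
 have "l / 2 * u = (l / 2 * Ud h N (Suc n) (2 * j) + l / 2 * Ud h N (Suc n) (2 * j + 1)) / 2" by (simp add: u_def field_simps)
 moreover have "(A + B) / 2 <= 1 - w" if "w = (p + q) / 2" "A <= 1 - p" "B <= 1 - q" for A B w p q :: real using that by simp
 ultimately have F: "?F <= 1 - l / 2 * u" using Suc.IH[OF Suc_leD[OF Suc.prems], of "Suc n" "2 * j"] Suc.IH[OF Suc_leD[OF Suc.prems], of "Suc n" "2 * j + 1"] by blast
 have "exp (- x) * ?F <= (1 - 3 / 4 * x) * (1 - l / 2 * u)" using e x F Fd_bounds[where h=h, OF l h(1)] by (intro mult_mono) auto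
 also have "... = 1 - x / 2 - l / 2 * u - x * (1 / 4 - 3 / 8 * (l * u))" by (simp add: field_simps)
 also have "... <= 1 - x / 2 - l / 2 * u" using x lu by simp
 also have "... = 1 - l / 2 * Ud h (Suc N) n j" by (simp add: U x_def field_simps)
 finally show ?case by (simp add: x_def)
qed (simp add: Ud_def)

text \<open>The mean over \<open>K\<close> levels is bounded below from every starting vertex, so
  each block of \<open>K\<close> levels contributes one more factor
  \<open>exp (- l * a * K)\<close>.\<close>

lemma Fd_decay: assumes l: "0 <= l" and h: "!!n j. 0 <= h n j" "!!n j. h n j <= b" and K: "1 <= K" "l * (real K * b) <= 1 / 3"
  and a: "0 <= a" "!!n j. 2 * a * real K <= Ud h K n j" shows "Fd l h N n j <= exp (- l * a * (real N - real K))"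
proof (induction N arbitrary: n j rule: less_induct)
 case (less N)
 show ?case proof (cases "N < K")
  case True
  then have "0 <= l * a * (real K - real N)" using l a by simp
  then have "1 <= exp (l * a * (real K - real N))" by simp
  also have "l * a * (real K - real N) = - l * a * (real N - real K)" by (simp add: algebra_simps)
  finally show ?thesis using Fd_bounds[where h=h, OF l h(1), of N n j] by linarith
 next
  case False
  define N' where "N' = N - K"
  have N: "N = K + N'" "N' < N" using False K by (auto simp: N'_def)
  have "l / 2 * (2 * a * real K) <= l / 2 * Ud h K n j" using a(2) l by (intro mult_left_mono) auto
  then have "Fd l h K n j <= 1 + (- l * a * real K)" using Fd_Ud[where h=h, OF l h K(2) order_refl, where n=n and j=j] by simp
  also have "... <= exp (- l * a * real K)" by (rule exp_ge_add_one_self)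
  finally have k: "Fd l h K n j <= exp (- l * a * real K)" .
  have "Fd l h N n j <= Fd l h K n j * exp (- l * a * (real N' - real K))" unfolding N(1) using less[OF N(2)] by (intro Fd_add l h) auto
  also have "... <= exp (- l * a * real K) * exp (- l * a * (real N' - real K))" using k by (intro mult_right_mono) auto
  also have "... = exp (- l * a * (real N - real K))" by (simp add: N(1) algebra_simps flip: exp_add)
  finally show ?thesis .
 qed
qed

text \<open>The dyadic intervals containing a uniformly distributed point form a random descending
  path, so the tree recursion computes an integral over the interval.\<close>

lemma Fd_integral:
 "(\<integral>\<^sup>+x. ennreal (exp (- l * (\<Sum>m<N. h (n + m) \<lfloor>2 ^ (n + m) * x\<rfloor>))) * indicator {real_of_int j / 2 ^ n..<(real_of_int j + 1) / 2 ^ n} x \<partial>lborel)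
  = ennreal (Fd l h N n j / 2 ^ n)"
proof (induction N arbitrary: n j)
 case 0
 have "(of_int j + 1) / 2 ^ n - of_int j / 2 ^ n = (1 / 2 ^ n :: real)" by (simp add: add_divide_distrib)
 then show ?case by (simp add: divide_right_mono)
next
 case (Suc N)
 let ?I = "%n j. {of_int j / 2 ^ n..<(of_int j + 1) / 2 ^ n} :: real set"
 define g where "g = (%x::real. ennreal (exp (- l * (\<Sum>m<N. h (Suc n + m) \<lfloor>2 ^ (Suc n + m) * x\<rfloor>))))"
 have gm [measurable]: "g : borel_measurable lborel" unfolding g_def by measurable
 have I: "x : ?I n j \<longleftrightarrow> of_int j <= 2 ^ n * x \<and> 2 ^ n * x < of_int j + 1" for n j x
  by (simp add: pos_divide_le_eq pos_less_divide_eq mult.commute)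
 have "ennreal (exp (- l * (\<Sum>m<Suc N. h (n + m) \<lfloor>2 ^ (n + m) * x\<rfloor>))) * indicator (?I n j) x
   = ennreal (exp (- l * h n j)) * (g x * indicator (?I (Suc n) (2 * j)) x + g x * indicator (?I (Suc n) (2 * j + 1)) x)" for x
 proof (cases "x : ?I n j")
  case True
  then have "\<lfloor>2 ^ n * x\<rfloor> = j" unfolding I by (intro floor_unique) auto
  then have e: "ennreal (exp (- l * (\<Sum>m<Suc N. h (n + m) \<lfloor>2 ^ (n + m) * x\<rfloor>))) = ennreal (exp (- l * h n j)) * g x"
   by (simp only: sum.lessThan_Suc_shift g_def) (simp add: algebra_simps flip: ennreal_mult exp_add)
  have "(x : ?I (Suc n) (2 * j)) ~= (x : ?I (Suc n) (2 * j + 1))" using True unfolding I by auto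
  then show ?thesis using True e by auto
 next
  case False
  then have "x \<notin> ?I (Suc n) (2 * j)" "x \<notin> ?I (Suc n) (2 * j + 1)" unfolding I by auto
  then show ?thesis using False by simp
 qed
 then have "(\<integral>\<^sup>+x. ennreal (exp (- l * (\<Sum>m<Suc N. h (n + m) \<lfloor>2 ^ (n + m) * x\<rfloor>))) * indicator (?I n j) x \<partial>lborel) =
   ennreal (exp (- l * h n j)) * ((\<integral>\<^sup>+x. g x * indicator (?I (Suc n) (2 * j)) x \<partial>lborel) + (\<integral>\<^sup>+x. g x * indicator (?I (Suc n) (2 * j + 1)) x \<partial>lborel))"
  by (simp only:) (subst nn_integral_cmult, (measurable; simp), subst nn_integral_add, auto)
 also have "... = ennreal (exp (- l * h n j)) * (ennreal (Fd l h N (Suc n) (2 * j) / 2 ^ Suc n) + ennreal (Fd l h N (Suc n) (2 * j + 1) / 2 ^ Suc n))"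
  by (simp only: g_def Suc)
 also have "... = ennreal (Fd l h (Suc N) n j / 2 ^ n)" proof -
  have nn: "0 <= Fd l h N n j" for N n j by (induction N arbitrary: n j) (simp_all add: add_nonneg_nonneg)
  show ?thesis by (simp add: nn field_simps flip: ennreal_plus ennreal_mult)
 qed
 finally show ?case .
qed

text \<open>An exponential Markov inequality turns \<open>Fd_decay\<close> into summable
  probabilities on each unit interval; Borel-Cantelli finishes, and countably many intervals cover
  the line.\<close>

lemma path_sums_grow: assumes h: "!!n j. 0 <= h n j" "!!n j. h n j <= b" and K: "1 <= K" and a: "0 < a" "!!n j. 2 * a * real K <= Ud h K n j"
 shows "AE x::real in lborel. \<forall>\<^sub>F N in sequentially. a / 2 * real N <= (\<Sum>m<N. h m \<lfloor>2 ^ m * x\<rfloor>)"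
proof -
 \<comment> \<open>Small enough that the sum over a block of \<open>K\<close> levels, each at most
   \<open>b\<close>, stays in the range where \<open>Fd_Ud\<close> linearizes.\<close>
 define l where "l = 1 / (3 * (real K * b + 1))"
 have b0: "0 <= b" using h(1)[of 0 0] h(2)[of 0 0] by linarith
 have l: "0 < l" "l * (real K * b) <= 1 / 3" proof -
  have p: "0 < real K * b + 1" using b0 by (simp add: add_nonneg_pos)
  then show "0 < l" by (simp add: l_def)
  have "l * (real K * b + 1) = 1 / 3" using p by (simp add: l_def)
  then show "l * (real K * b) <= 1 / 3" using \<open>0 < l\<close> by (simp add: distrib_left)
 qed
 define s where "s = (%N (x::real). \<Sum>m<N. h m \<lfloor>2 ^ m * x\<rfloor>)"
 have [measurable]: "s N : borel_measurable borel" for N unfolding s_def by measurable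
 have each: "AE x in lborel. \<forall>\<^sub>F N in sequentially. x : space lborel - {x : {of_int j..<of_int j + 1}. s N x < a / 2 * real N}" for j :: int
 proof (rule borel_cantelli_AE1)
  let ?A = "%N. {x : {of_int j..<of_int j + 1::real}. s N x < a / 2 * real N}"
  show A: "?A N : sets lborel" for N by measurable
  have m: "emeasure lborel (?A N) <= ennreal (exp (l * a * real K) * exp (- (l * a / 2)) ^ N)" for N proof -
   have "emeasure lborel (?A N) = (\<integral>\<^sup>+x. indicator (?A N) x \<partial>lborel)" by simp
   also have "... <= (\<integral>\<^sup>+x. ennreal (exp (l * a / 2 * real N)) * (ennreal (exp (- l * (\<Sum>m<N. h (0 + m) \<lfloor>2 ^ (0 + m) * x\<rfloor>))) * indicator {real_of_int j / 2 ^ 0..<(real_of_int j + 1) / 2 ^ 0} x) \<partial>lborel)"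
   proof (rule nn_integral_mono)
    fix x :: real
    have "1 <= exp (l * a / 2 * real N) * exp (- l * s N x)" if "s N x < a / 2 * real N" proof -
     have "l * s N x <= l * (a / 2 * real N)" using l that by (intro mult_left_mono) auto
     then show ?thesis by (simp flip: exp_add)
    qed
    then show "indicator (?A N) x <= ennreal (exp (l * a / 2 * real N)) * (ennreal (exp (- l * (\<Sum>m<N. h (0 + m) \<lfloor>2 ^ (0 + m) * x\<rfloor>))) * indicator {real_of_int j / 2 ^ 0..<(real_of_int j + 1) / 2 ^ 0} x)"
     by (auto simp: indicator_def s_def simp flip: ennreal_mult)
   qed
   also have "... = ennreal (exp (l * a / 2 * real N)) * ennreal (Fd l h N 0 j / 2 ^ 0)"
    unfolding Fd_integral[symmetric] by (rule nn_integral_cmult) measurable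
   also have "... <= ennreal (exp (l * a / 2 * real N)) * ennreal (exp (- l * a * (real N - real K)))"
    using Fd_decay[where h=h, OF _ h K l(2) _ a(2), of N 0 j] l a by (intro mult_left_mono ennreal_leI) auto
   also have "... = ennreal (exp (l * a * real K) * exp (- (l * a / 2)) ^ N)" by (simp add: algebra_simps flip: ennreal_mult exp_add exp_of_nat_mult)
   finally show ?thesis .
  qed
  show "emeasure lborel (?A N) < \<infinity>" for N using le_less_trans[OF m[of N] ennreal_less_top] by (simp only: infinity_ennreal_def)
  show "summable (%N. measure lborel (?A N))" proof (rule summable_comparison_test')
   show "summable (%N. exp (l * a * real K) * exp (- (l * a / 2)) ^ N)" using l a by (intro summable_mult summable_geometric) simp
   show "norm (measure lborel (?A N)) <= exp (l * a * real K) * exp (- (l * a / 2)) ^ N" if "0 <= N" for N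
    using m[of N] by (simp add: measure_def enn2real_leI)
  qed
 qed
 have "AE x in lborel. \<forall>j::int. \<forall>\<^sub>F N in sequentially. x : space lborel - {x : {of_int j..<of_int j + 1}. s N x < a / 2 * real N}"
  unfolding AE_all_countable using each by blast
 then show ?thesis proof eventually_elim
  case (elim x)
  have "x : {of_int \<lfloor>x\<rfloor>..<of_int \<lfloor>x\<rfloor> + 1}" by simp
  then show ?case using spec[OF elim, of "\<lfloor>x\<rfloor>"] by (auto simp: s_def not_less)
 qed
qed

section \<open>Cusps below dyadic points\<close>

lemma horizontal_close: assumes "0 < y" "abs (x - x') <= y" shows "dH (Complex x y) (Complex x' y) <= 1"
proof -
 have "(x - x')^2 <= y^2" using assms by (intro abs_le_square_iff[THEN iffD1]) auto
 then have "(x - x')^2 / (2 * y * y) <= 1^2 / 2" using assms by (simp add: power2_eq_square)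
 moreover have "(cmod (Complex x y - Complex x' y))^2 = (x - x')^2" by (simp add: cmod_power2)
 ultimately have "1 + (cmod (Complex x y - Complex x' y))^2 / (2 * y * y) <= cosh 1" using cosh_ge_square[of 1] by (simp only:)
 then show ?thesis using assms by (subst dH_le_iff) auto
qed

context cusped
begin

lemma near_horoball:
 "\<exists>R\<ge>0. \<forall>z. 0 < Im z --> (\<exists>B\<in>C. \<exists>g\<in>G. \<exists>w. 0 < Im w \<and> dH z w <= R \<and> 1 < ht B g w)"
proof -
 obtain B where B: "B : C" using C_nonempty by blast
 define b where "b = act (nb B) (Complex 0 2)"
 have b: "0 < Im b" "cd B b = Complex 0 2" using nb(1)[OF B] by (simp_all add: b_def cd_def)
 have "\<exists>B\<in>C. \<exists>g\<in>G. \<exists>w. 0 < Im w \<and> dH z w <= R0 + dH x0 b \<and> 1 < ht B g w" if z: "0 < Im z" for z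
 proof (cases "R0 < dorb z")
  case True
  then show ?thesis using R0(1) R0(3)[OF z] z b by (metis dH_same dH_nonneg x0 add_nonneg_nonneg)
 next
  case False
  obtain g where g: "closest z g" using closest_exists[OF z] by blast
  have "dH z (act g b) <= dH z (act g x0) + dH (act g x0) (act g b)" using z b closestD(1)[OF g] by (intro dH_triangle) auto
  then have "dH z (act g b) <= R0 + dH x0 b" using False closestD[OF g] b by simp
  then show ?thesis using B b closestD(1)[OF g] by (intro bexI[of _ B] bexI[of _ "hinv g"] exI[of _ "act g b"]) auto
 qed
 then show ?thesis using R0(1) b by (intro exI[of _ "R0 + dH x0 b"]) auto
qed

text \<open>Below a point near the orbit there is a cusp of definite size: a horoball that comes close to a
 low point but does not swallow the given one must be based nearby.\<close>

lemma cusp_below: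
 "\<exists>c>0. \<forall>N\<in>SL2. exp (dorb (act N \<i>)) <= a --> (\<exists>x. 0 < x \<and> x < 1 \<and> (\<forall>y>0. c / y <= exp (dorb (act N (Complex x y)))))"
proof (cases "1 <= a")
 case False
 have "\<not> exp (dorb (act N \<i>)) <= a" if "N : SL2" for N proof -
  have "1 <= exp (dorb (act N \<i>))" using dorb_nonneg[of "act N \<i>"] that by simp
  then show ?thesis using False by linarith
 qed
 then show ?thesis by (intro exI[of _ 1]) auto
next
 case a: True
 obtain R where R: "R \<ge> 0" "!!z. 0 < Im z ==> \<exists>B\<in>C. \<exists>g\<in>G. \<exists>w. 0 < Im w \<and> dH z w <= R \<and> 1 < ht B g w"
  using near_horoball by blast
 \<comment> \<open>So low that every point within distance \<open>R\<close> of height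
   \<open>y0\<close> has height at most \<open>1 / (64 * (H0 * a))\<close>.\<close>
 define y0 where "y0 = exp (- R) / (64 * (H0 * a))"
 have Ha: "1 <= H0 * a" using mult_mono[of 1 H0 1 a] H0(1) a by simp
 have y0: "0 < y0" "y0 * exp R = 1 / (64 * (H0 * a))" proof -
  show "0 < y0" using a H0(1) by (simp add: y0_def)
  show "y0 * exp R = 1 / (64 * (H0 * a))" by (simp add: y0_def exp_minus)
 qed
 define c where "c = y0 * exp (- R) / H0"
 have c: "0 < c" using y0 H0(1) by (simp add: c_def)
 have "\<exists>x. 0 < x \<and> x < 1 \<and> (\<forall>y>0. c / y <= exp (dorb (act N (Complex x y))))" if N: "N : SL2" and th: "exp (dorb (act N \<i>)) <= a" for N
 proof -
  define w where "w = Complex (1/2) y0"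
  have w: "0 < Im w" using y0 by (simp add: w_def)
  obtain B g z' where B: "B : C" "g : G" and z': "0 < Im z'" "dH (act N w) z' <= R" "1 < ht B g z'" using R(2)[of "act N w"] N w by auto
  define v where "v = act (hinv N) z'"
  have v: "0 < Im v" "act N v = z'" "dH w v <= R" using z' N w dH_act_left[of N w z'] by (auto simp: v_def)
  define A where "A = hinv (nb B) ** g ** N"
  have A: "A : SL2" using nb(1)[OF B(1)] B N by (simp add: A_def)
  have Aeq: "ht B g (act N u) = Im u / (cmod (den A u))^2" if "0 < Im u" for u proof -
   have "cd B (act g (act N u)) = act A u" using nb(1)[OF B(1)] B N that by (simp add: A_def cd_def act_mult)
   then show ?thesis using Im_act[OF A that] by simp
  qed
  let ?c = "A$2$1" and ?d = "A$2$2"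
  define p where "p = Re v"
  have iv: "Im v <= y0 * exp R" "y0 * exp (- R) <= Im v" proof -
   have "Im v <= y0 * exp (dH w v)" using Im_le_exp[OF w v(1)] by (simp add: w_def)
   also have "... <= y0 * exp R" using v(3) y0(1) by (intro mult_left_mono) auto
   finally show "Im v <= y0 * exp R" .
   have "y0 <= Im v * exp (dH w v)" using Im_le_exp[OF v(1) w] by (simp add: w_def dH_commute)
   also have "... <= Im v * exp R" using v by simp
   finally show "y0 * exp (- R) <= Im v" by (simp add: exp_minus field_simps)
  qed
  have yR: "y0 * exp R <= 1 / 64" unfolding y0(2) using Ha by (intro divide_left_mono) auto
  have p: "1/4 < p" "p < 3/4" proof -
   have "(cmod (w - v))^2 = 2 * y0 * Im v * (cosh (dH w v) - 1)" using w v by (simp add: cosh_hyp_dist w_def)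
   also have "... <= 2 * y0 * (y0 * exp R) * exp R"
    using iv(1) v(1,3) y0(1) cosh_le_exp[of "dH w v"] w cosh_real_ge_1[of "dH w v"] exp_le_cancel_iff[of "dH w v" R] by (intro mult_mono) (auto simp del: exp_le_cancel_iff)
   also have "... = 2 * (y0 * exp R)^2" by (simp add: power2_eq_square)
   also have "... <= 2 * (1/64)^2" using yR y0(1) by (intro mult_left_mono power_mono) auto
   also have "... < (1/4)^2" by (simp add: power2_eq_square)
   finally have "cmod (w - v) < 1/4" by (rule power2_less_imp_less) simp
   then have "abs (Re (w - v)) < 1/4" using abs_Re_le_cmod[of "w - v"] by linarith
   then have "abs (1/2 - p) < 1/4" by (simp add: w_def p_def)
   then show "1/4 < p" "p < 3/4" by linarith+
  qed
  have dv: "(cmod (den A v))^2 = (?c * p + ?d)^2 + ?c^2 * (Im v)^2" by (simp add: cmod_power2 den_def p_def power_mult_distrib)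
  have big: "(?c * p + ?d)^2 + ?c^2 * (Im v)^2 < Im v" using z'(3) Aeq[OF v(1)] den_nonzero[OF A v(1)] v by (simp add: dv[symmetric])
  define X where "X = ?c^2 + ?d^2"
  \<comment> \<open>\<open>X\<close> is the inverse of the height of \<open>act N \<i>\<close> over
    the horoball found below. This height is bounded because that point is near the orbit, which
    prevents a horoball based far away or at infinity from reaching down to
    \<open>v\<close>.\<close>
  have X: "64 * Im v <= X" proof -
   have i: "Im (act N \<i>) > 0" using N by simp
   have "ht B g (act N \<i>) <= H0 * exp (dorb (act N \<i>))" using dorb_ge_height[OF B] i by simp
   also have "... <= H0 * a" using th H0(1) by simp
   finally have "1 / X <= H0 * a" using Aeq[of \<i>] by (simp add: den_def cmod_power2 X_def add.commute)
   moreover have "X ~= 0" using A by (auto simp: X_def SL2_iff)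
   then have "0 < X" unfolding X_def by (simp add: sum_power2_gt_zero_iff)
   ultimately have "1 <= H0 * a * X" by (simp add: pos_divide_le_eq)
   then have "64 * (1 / (64 * (H0 * a))) <= X" using Ha by (simp add: pos_divide_le_eq mult.commute)
   then show ?thesis using iv(1) y0(2) by linarith
  qed
  define e where "e = ?c * p + ?d"
  have e2: "e^2 < X / 64" using big X zero_le_power2[of "?c * Im v"] unfolding e_def power_mult_distrib by linarith
  have dd: "?d^2 <= 2 * e^2 + 2 * (?c^2 * p^2)" using zero_le_power2[of "e + ?c * p"] by (simp add: e_def power2_eq_square algebra_simps)
  have "p^2 <= 9 / 16" using p power_mono[of p "3/4" 2] by (simp add: power2_eq_square)
  then have "?c^2 * p^2 <= ?c^2 * (9 / 16)" by (intro mult_left_mono) auto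
  then have l: "8 * ?d^2 <= 16 * e^2 + 9 * ?c^2" "64 * e^2 < ?c^2 + ?d^2" using dd e2 by (simp_all add: X_def)
  have g: "16 * E < F" if "8 * D <= 16 * E + 9 * F" "64 * E < F + D" "0 <= F" for D E F :: real using that by linarith
  have ec: "16 * e^2 < ?c^2" by (rule g[OF l zero_le_power2])
  then have c0: "?c ~= 0" by auto
  \<comment> \<open>The pole of the denominator is the base point of the horoball. It is within 1/4
    of \<open>p\<close>, which is within 1/4 of 1/2.\<close>
  define x where "x = - ?d / ?c"
  have "p - x = e / ?c" using c0 by (simp add: x_def e_def add_divide_distrib)
  then have "(p - x)^2 = e^2 / ?c^2" by (simp only: power_divide)
  also have "... < (1/4)^2" using ec by (simp add: power2_eq_square divide_less_eq)
  finally have "abs (p - x)^2 < (1/4)^2" by (simp only: power2_abs)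
  then have "abs (p - x) < 1/4" by (rule power2_less_imp_less) simp
  then have x: "0 < x" "x < 1" using p by linarith+
  \<comment> \<open>On the vertical line above the base point the denominator is purely imaginary,
    so the height is exactly a constant over \<open>y\<close>.\<close>
  have "c / y <= exp (dorb (act N (Complex x y)))" if y: "0 < y" for y proof -
   have d: "den A (Complex x y) = Complex 0 (?c * y)" using c0 by (simp add: den_def x_def complex_eq_iff)
   have u: "0 < Im (act N (Complex x y))" using N y by simp
   have "ht B g (act N (Complex x y)) = y / (?c * y)^2" using Aeq[of "Complex x y"] y d by (simp add: cmod_power2)
   then have "y / (?c * y)^2 <= H0 * exp (dorb (act N (Complex x y)))" using dorb_ge_height[OF B u] by simp
   moreover have "y0 * exp (- R) / y <= y / (?c * y)^2" proof -
    have "?c^2 * (Im v)^2 < Im v" using big zero_le_power2[of "?c * p + ?d"] by linarith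
    then have "?c^2 * Im v * Im v < 1 * Im v" by (simp add: power2_eq_square mult.assoc)
    then have "?c^2 * Im v < 1" using v(1) by (simp only: mult_less_cancel_right_pos)
    then have "?c^2 * (y0 * exp (- R)) <= 1" using mult_left_mono[OF iv(2), of "?c^2"] by simp
    then have "y0 * exp (- R) <= 1 / ?c^2" using c0 by (simp add: pos_le_divide_eq mult.commute)
    then have "y0 * exp (- R) / y <= 1 / ?c^2 / y" using y by (intro divide_right_mono) auto
    also have "1 / ?c^2 / y = y / (?c * y)^2" by (simp add: power2_eq_square)
    finally show ?thesis .
   qed
   ultimately have "y0 * exp (- R) / y <= H0 * exp (dorb (act N (Complex x y)))" by linarith
   then show ?thesis using H0(1) y by (simp add: c_def field_simps)
  qed
  then show ?thesis using x by blast
 qed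
 then show ?thesis using c by blast
qed

definition Hd :: "nat => int => real" where "Hd n j = exp (dorb (Complex (of_int j / 2 ^ n) (1 / 2 ^ n)))"

lemma Hd_close: assumes "abs (of_int j / 2 ^ n - x) <= 1 / 2 ^ n"
 shows "exp (dorb (Complex x (1 / 2 ^ n))) <= exp 1 * Hd n j" "Hd n j <= exp 1 * exp (dorb (Complex x (1 / 2 ^ n)))"
 using dorb_lipschitz[of "Complex (of_int j / 2 ^ n) (1 / 2 ^ n)" "Complex x (1 / 2 ^ n)"] dorb_lipschitz[of "Complex x (1 / 2 ^ n)" "Complex (of_int j / 2 ^ n) (1 / 2 ^ n)"]
  horizontal_close[OF _ assms] by (auto simp: Hd_def dH_commute simp flip: exp_add)

lemma floor_dyadic: fixes x :: real shows "abs (of_int \<lfloor>2 ^ n * x\<rfloor> / 2 ^ n - x) <= 1 / 2 ^ n"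
proof -
 have "of_int \<lfloor>2 ^ n * x\<rfloor> / 2 ^ n - x = (of_int \<lfloor>2 ^ n * x\<rfloor> - 2 ^ n * x) / 2 ^ n" by (simp add: diff_divide_distrib)
 moreover have "abs (of_int \<lfloor>2 ^ n * x\<rfloor> - 2 ^ n * x) <= 1" by linarith
 ultimately show ?thesis by (simp add: divide_right_mono)
qed

text \<open>\<open>cusp_below\<close> is applied after the affine map that carries the unit scale to
  the given dyadic vertex. The first \<open>i\<close> binary digits of the base point select the
  descendant below the cusp.\<close>

lemma Hd_descend: "\<exists>c>0. \<forall>n j i. Hd n j <= a --> (\<exists>r\<ge>0. r < 2 ^ i \<and> c * 2 ^ i <= Hd (n + i) (j * 2 ^ i + r))"
proof -
 obtain c where c: "c > 0" "\<forall>N\<in>SL2. exp (dorb (act N \<i>)) <= a --> (\<exists>x. 0 < x \<and> x < 1 \<and> (\<forall>y>0. c / y <= exp (dorb (act N (Complex x y)))))"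
  using cusp_below[of a] by (elim exE conjE)
 have "\<exists>r\<ge>0. r < 2 ^ i \<and> c / exp 1 * 2 ^ i <= Hd (n + i) (j * 2 ^ i + r)" if th: "Hd n j <= a" for n j i proof -
  define s where "s = 1 / sqrt (2 ^ n)"
  have s: "s * s = 1 / 2 ^ n" "s ~= 0" by (simp_all add: s_def)
  define N where "N = mat2 s (of_int j * s) 0 (1 / s)"
  have N: "N : SL2" using s by (simp add: N_def)
  have aN: "act N (Complex x y) = Complex ((x + of_int j) / 2 ^ n) (y / 2 ^ n)" for x y proof -
   have "act N (Complex x y) = of_real (s * s) * (Complex x y + of_int j)" by (simp add: act_eq den_def N_def field_simps)
   then show ?thesis by (simp add: s(1) complex_eq_iff)
  qed
  have "act N \<i> = Complex (of_int j / 2 ^ n) (1 / 2 ^ n)" using aN[of 0 1] by (simp flip: imaginary_unit.code)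
  then obtain x where x: "0 < x" "x < 1" "!!y. 0 < y ==> c / y <= exp (dorb (act N (Complex x y)))"
   using c(2)[rule_format, OF N] th by (auto simp: Hd_def)
  define r where "r = \<lfloor>2 ^ i * x\<rfloor>"
  have r: "0 <= r" "r < 2 ^ i" using x by (auto simp: r_def floor_less_iff)
  have m: "(x + of_int j) / 2 ^ n = (2 ^ i * x + of_int (j * 2 ^ i)) / 2 ^ (n + i)" by (simp add: power_add field_simps)
  have "c / exp 1 * 2 ^ i <= exp (dorb (act N (Complex x (1 / 2 ^ i)))) / exp 1" using x(3)[of "1 / 2 ^ i"] by (simp add: field_simps)
  also have "act N (Complex x (1 / 2 ^ i)) = Complex ((x + of_int j) / 2 ^ n) (1 / 2 ^ (n + i))" by (simp add: aN power_add)
  also have "exp (dorb (Complex ((x + of_int j) / 2 ^ n) (1 / 2 ^ (n + i)))) / exp 1 <= Hd (n + i) (j * 2 ^ i + r)" proof -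
   have "abs (of_int (j * 2 ^ i + r) / 2 ^ (n + i) - (x + of_int j) / 2 ^ n) = abs (of_int r - 2 ^ i * x) / 2 ^ (n + i)"
    unfolding m by (simp flip: diff_divide_distrib)
   also have "... <= 1 / 2 ^ (n + i)" using floor_correct[of "2 ^ i * x"] unfolding r_def by (intro divide_right_mono) (linarith, simp)
   finally show ?thesis using Hd_close(1) by (simp add: pos_divide_le_eq mult.commute)
  qed
  finally show ?thesis using r by blast
 qed
 then show ?thesis using c(1) by (intro exI[of _ "c / exp 1"]) auto
qed

lemma powers_below: "0 <= (y::real) ==> (\<Sum>i<k. if 2 ^ i <= y then 2 ^ i else 0) <= 2 * y"
proof -
 assume y: "0 <= y"
 have "(\<Sum>i<k. if 2 ^ i <= y then 2 ^ i else 0) <= min (2 * y) (2 ^ k)" proof (induction k)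
  case (Suc k) then show ?case by (auto split: if_splits)
 qed (use y in auto)
 then show ?thesis by simp
qed

text \<open>A vertex near the orbit has at each level \<open>i\<close> below it a descendant of
  weight \<open>2 ^ -i\<close> with value at least \<open>c * 2 ^ i\<close>; each of
  \<open>k\<close> scales thus adds a constant to the mean. A vertex away from the orbit contributes
  at least \<open>a\<close> itself.\<close>

lemma Hd_average: assumes a: "0 < a"
 shows "\<exists>b k. 1 <= k \<and> (\<forall>n j. a / 2 * real k <= Ud (%n j. min (Hd n j) b) (2 * k) n j) \<and> 0 <= b"
proof -
 obtain c where c: "c > 0" "\<forall>n j i. Hd n j <= a --> (\<exists>r\<ge>0. r < 2 ^ i \<and> c * 2 ^ i <= Hd (n + i) (j * 2 ^ i + r))"
  using Hd_descend[of a] by (elim exE conjE)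
 obtain k0 :: nat where k0: "2 * a / c <= real k0" by (rule real_arch_simple[THEN exE])
 define k where "k = max k0 1"
 have k: "1 <= k" "a <= c / 2 * real k" proof -
  have "2 * a / c <= real k" using k0 by (simp add: k_def)
  then show "a <= c / 2 * real k" using c by (simp add: field_simps)
 qed (simp add: k_def)
 define b where "b = c * 2 ^ k + a"
 define h where "h = (%n j. min (Hd n j) b)"
 define t where "t = (%n j. if Hd n j <= a then 1 else 0 :: real)"
 \<comment> \<open>A splitting of \<open>h\<close> into dyadic sizes: by \<open>powers_below\<close>
   the sum over \<open>i\<close> is at most \<open>2 / c * h\<close>, so contributions of different
   scales may be added without counting \<open>h\<close> more than a bounded number of
   times.\<close>
 define w where "w = (%i n j. if 2 ^ i <= h n j / c then 2 ^ i else 0 :: real)"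
 have ab: "a <= b" using c(1) by (simp add: b_def)
 then have b: "0 <= b" using a by simp
 have h0: "0 <= h n j" for n j using b by (simp add: h_def Hd_def)
 have tw: "t n j <= Ed (w i) i n j" if i: "i < k" for i n j proof (cases "Hd n j <= a")
  case True
  from c(2)[rule_format, OF True, of i] obtain r where r: "0 <= r" "r < 2 ^ i" "c * 2 ^ i <= Hd (n + i) (j * 2 ^ i + r)" by (elim exE conjE)
  have "(2::real) ^ i <= 2 ^ k" using i by (intro power_increasing) auto
  then have "c * 2 ^ i <= b" using c a by (simp add: b_def add_increasing2)
  then have "w i (n + i) (j * 2 ^ i + r) = 2 ^ i" using r c(1) by (simp add: w_def h_def pos_le_divide_eq mult.commute)
  then show ?thesis using Ed_descendant[of "w i" r i n j] r True by (simp add: t_def w_def)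
 qed (auto simp: t_def w_def intro!: Ed_nonneg)
 have "a / 2 * real k <= Ud h (2 * k) n j" for n j proof -
  have "real k * Ud t k n j = (\<Sum>i<k. \<Sum>m<k. Ed t m n j)" by (simp add: Ud_def)
  also have "... <= (\<Sum>i<k. \<Sum>m<k. Ed (w i) (m + i) n j)" unfolding Ed_tower by (intro sum_mono Ed_mono tw) auto
  also have "... <= (\<Sum>i<k. \<Sum>p<2 * k. Ed (w i) p n j)" proof (intro sum_mono)
   fix i assume i: "i : {..<k}"
   have "(\<Sum>m<k. Ed (w i) (m + i) n j) = (\<Sum>p\<in>(%m. m + i) ` {..<k}. Ed (w i) p n j)" by (subst sum.reindex) auto
   also have "... <= (\<Sum>p<2 * k. Ed (w i) p n j)" using i by (intro sum_mono2 Ed_nonneg) (auto simp: w_def)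
   finally show "(\<Sum>m<k. Ed (w i) (m + i) n j) <= (\<Sum>p<2 * k. Ed (w i) p n j)" .
  qed
  also have "... = (\<Sum>p<2 * k. Ed (%n j. \<Sum>i<k. w i n j) p n j)" unfolding Ed_sum by (rule sum.swap)
  also have "... <= (\<Sum>p<2 * k. Ed (%n j. 2 / c * h n j + 0) p n j)"
   using powers_below[of "h _ _ / c" k] h0 c(1) by (intro sum_mono Ed_mono) (simp add: w_def)
  also have "... = 2 / c * Ud h (2 * k) n j" unfolding Ed_linear by (simp add: Ed_const Ud_def sum_distrib_left)
  finally have "c / 2 * real k * Ud t k n j <= Ud h (2 * k) n j" using c(1) by (simp add: field_simps)
  moreover have "a * Ud t k n j <= c / 2 * real k * Ud t k n j" using k by (intro mult_right_mono) (auto simp: Ud_def t_def intro!: sum_nonneg Ed_nonneg)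
  \<comment> \<open>The levels at which the path is away from the orbit. With the preceding bound
    for the levels near it, the two sum to \<open>a * k\<close>, so the larger gives
    \<open>a / 2 * k\<close>.\<close>
  moreover have "a * real k - a * Ud t k n j <= Ud h (2 * k) n j" proof -
   have "a * real k - a * Ud t k n j = (\<Sum>m<k. Ed (%n j. - a * t n j + a) m n j)"
    unfolding Ed_linear by (simp add: Ed_const Ud_def sum_subtractf sum_distrib_left)
   also have "... <= (\<Sum>m<k. Ed h m n j)" using a ab by (intro sum_mono Ed_mono) (auto simp: t_def h_def Hd_def)
   also have "... <= Ud h (2 * k) n j" unfolding Ud_def using h0 by (intro sum_mono2 Ed_nonneg) auto
   finally show ?thesis .
  qed
  ultimately show ?thesis by linarith
 qed
 then show ?thesis using k(1) b unfolding h_def by blast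
qed

theorem vertical_growth:
 "AE x in lborel. \<forall>a. \<forall>\<^sub>F N in sequentially. a * real N <= (\<Sum>m<N. exp (dorb (Complex x (1 / 2 ^ m))))"
proof -
 have each: "AE x in lborel. \<forall>\<^sub>F N in sequentially. real q * real N <= (\<Sum>m<N. exp (dorb (Complex x (1 / 2 ^ m))))" for q :: nat
 proof -
  define a where "a = 16 * exp 1 * real (Suc q)"
  obtain b k where bk: "1 <= k" "!!n j. a / 2 * real k <= Ud (%n j. min (Hd n j) b) (2 * k) n j" "0 <= b" using Hd_average[of a] by (auto simp: a_def)
  have "AE x::real in lborel. \<forall>\<^sub>F N in sequentially. a / 8 / 2 * real N <= (\<Sum>m<N. min (Hd m \<lfloor>2 ^ m * x\<rfloor>) b)"
  proof (rule path_sums_grow[where K="2 * k" and b=b])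
   show "2 * (a / 8) * real (2 * k) <= Ud (%n j. min (Hd n j) b) (2 * k) n j" for n j using bk(2)[of n j] by simp
  qed (use bk in "auto simp: Hd_def a_def")
  then show ?thesis proof eventually_elim
   case (elim x)
   then show ?case proof eventually_elim
    case (elim N)
    have "exp 1 * (real q * real N) <= a / 8 / 2 * real N" by (simp add: a_def algebra_simps)
    also have "... <= (\<Sum>m<N. min (Hd m \<lfloor>2 ^ m * x\<rfloor>) b)" by (rule elim)
    also have "... <= (\<Sum>m<N. exp 1 * exp (dorb (Complex x (1 / 2 ^ m))))"
     using Hd_close(2)[OF floor_dyadic] by (intro sum_mono) (meson min.coboundedI1)
    finally show ?case by (simp flip: sum_distrib_left)
   qed
  qed
 qed
 then have "AE x in lborel. \<forall>q::nat. \<forall>\<^sub>F N in sequentially. real q * real N <= (\<Sum>m<N. exp (dorb (Complex x (1 / 2 ^ m))))"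
  unfolding AE_all_countable by blast
 then show ?thesis proof eventually_elim
  case (elim x)
  show ?case proof
   fix a :: real
   obtain q :: nat where "a <= real q" using real_arch_simple by blast
   then show "\<forall>\<^sub>F N in sequentially. a * real N <= (\<Sum>m<N. exp (dorb (Complex x (1 / 2 ^ m))))"
    using spec[OF elim, of q] by (auto elim!: eventually_mono intro: order_trans[OF mult_right_mono])
  qed
 qed
qed

end

section \<open>The ratio along Lebesgue almost every ray\<close>

context cusped
begin

lemma cusp_profile:
 fixes M B k
 defines "Q \<equiv> hinv (nb B) ** k ** hinv M" assumes "M : SL2" "B : C" "k : G"
 shows "ht B k (ap M t) = exp t / ((Q$2$1 * exp t)^2 + (Q$2$2)^2)" "0 < (Q$2$1 * exp t)^2 + (Q$2$2)^2"
proof -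
 have Q: "Q : SL2" using assms nb(1) by simp
 have "cd B (act k (ap M t)) = act Q (iax t)" using assms nb(1) by (simp add: cd_def ap_def act_mult)
 moreover have d: "(cmod (den Q (iax t)))^2 = (Q$2$1 * exp t)^2 + (Q$2$2)^2" by (simp add: cmod_power2 den_def)
 ultimately show "ht B k (ap M t) = exp t / ((Q$2$1 * exp t)^2 + (Q$2$2)^2)" using Im_act[OF Q, of "iax t"] by simp
 show "0 < (Q$2$1 * exp t)^2 + (Q$2$2)^2" unfolding d[symmetric] using den_nonzero[OF Q, of "iax t"] by simp
qed

definition rho0 :: real where "rho0 = R0 + ln (2 * H0)"

lemma deep_cusp: assumes z: "0 < Im z" "rho0 < dorb z" and B: "B : C" "k : G" "1 < ht B k z" shows "2 * H0 <= ht B k z"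
proof -
 have "ln (2 * H0) < ln (ht B k z)" using R0(2)[OF B(1,2) z(1)] B(3) z(2) by (simp add: rho0_def)
 then show ?thesis using H0(1) B(3) by (simp add: ln_less_cancel_iff)
qed

lemma thin_cusp: assumes "0 < Im z" "rho0 < dorb z" shows "\<exists>B\<in>C. \<exists>k\<in>G. 1 < ht B k z"
proof -
 have "R0 <= rho0" using H0(1) by (simp add: rho0_def)
 then show ?thesis using R0(3)[OF assms(1)] assms(2) by simp
qed

text \<open>The height in one horoball cannot take the value \<open>3/2\<close> while the geodesic is far from the orbit, so it
 stays in the horoball that it has entered.\<close>

lemma same_cusp_along: assumes M: "M : SL2" and thin: "!!t. u <= t ==> t <= v ==> rho0 < dorb (ap M t)" and B: "B : C" "k : G"
  and s: "u <= s" "s <= v" "1 < ht B k (ap M s)" and t: "u <= t" "t <= v" shows "2 * H0 <= ht B k (ap M t)"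
proof (rule ccontr)
 define f where "f = (%t. ht B k (ap M t))"
 have deep: "2 * H0 <= f t" if "u <= t" "t <= v" "1 < f t" for t using deep_cusp[OF _ thin[OF that(1,2)] B] that(3) M by (simp add: f_def)
 assume "\<not> 2 * H0 <= ht B k (ap M t)"
 then have "f t <= 3/2" using deep[OF t] by (fastforce simp: f_def)
 moreover have "3/2 <= f s" using deep[OF s(1,2)] s(3) H0(1) by (simp add: f_def)
 moreover have "connected (f ` {u..v})" proof (rule connected_continuous_image)
  let ?A = "hinv (nb B) ** k ** hinv M"
  have nz: "(?A$2$1 * exp t)^2 + (?A$2$2)^2 ~= 0" for t using cusp_profile(2)[OF M B, of t] by (rule less_imp_neq[THEN not_sym])
  show "continuous_on {u..v} f" unfolding f_def cusp_profile(1)[OF M B] by (intro continuous_intros ballI nz)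
 qed simp
 ultimately have "3/2 : f ` {u..v}" using subsetD[OF connected_contains_Icc[of "f ` {u..v}" "f t" "f s"], of "3/2"] s t by auto
 then obtain r where "u <= r" "r <= v" "f r = 3/2" by force
 then show False using deep[of r] H0(1) by simp
qed

lemma antider_zero: assumes "M : SL2" shows "\<exists>F. antider M F \<and> F 0 = 0"
proof -
 obtain F where F: "antider M F" using antider_exists[OF assms] by blast
 then have "antider M (%t. F t - F 0)" unfolding antider_def by (auto intro!: derivative_eq_intros)
 then show ?thesis by (intro exI[of _ "%t. F t - F 0"]) simp
qed

text \<open>The hypothesis on \<open>x\<close> says that \<open>M\<close> sends \<open>x\<close> to
  infinity, so it carries the vertical line above \<open>x\<close> to a vertical line, which stays
  at bounded distance from the imaginary axis. Dyadic heights become times spaced by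
  \<open>ln 2\<close>, and the sums of \<open>exp (dorb z)\<close> become lower bounds for
  \<open>W\<close>.\<close>

lemma antider_superlinear: assumes M: "M : SL2" and x: "M$2$1 * x + M$2$2 = 0" and W: "antider M W"
  and grow: "!!a. \<forall>\<^sub>F N in sequentially. a * real N <= (\<Sum>m<N. exp (dorb (Complex x (1 / 2 ^ m))))" and L: "0 < L"
 shows "\<exists>T. \<forall>t\<ge>T. L * t <= W t"
proof -
 let ?a = "M$1$1" and ?c = "M$2$1"
 have c: "?c ~= 0" using M x by (auto simp: SL2_iff)
 define X where "X = ?a / ?c"
 define Y where "Y = 1 / ?c^2"
 have Y: "0 < Y" using c by (simp add: Y_def)
 have aM: "act M (Complex x y) = Complex X (Y / y)" if y: "0 < y" for y proof -
  have d: "den M (Complex x y) = Complex 0 (?c * y)" using x by (simp add: den_def complex_eq_iff)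
  have "?a * x + M$1$2 = - 1 / ?c" proof -
   have "(?a * x + M$1$2) * ?c = ?a * (M$2$1 * x) + M$1$2 * ?c" by (simp add: algebra_simps)
   also have "M$2$1 * x = - M$2$2" using x by simp
   finally show ?thesis using M c by (simp add: SL2_iff field_simps)
  qed
  then have "of_real ?a * Complex x y + of_real (M$1$2) = Complex (- 1 / ?c) (?a * y)" by (simp add: complex_eq_iff)
  also have "... = Complex X (Y / y) * Complex 0 (?c * y)" using c y by (simp add: X_def Y_def complex_eq_iff power2_eq_square)
  finally show ?thesis using c y by (simp add: act_eq d complex_eq_iff[of "Complex 0 _" 0])
 qed
 define u where "u = (%m::nat. real m * ln 2 + ln Y)"
 have e_u: "exp (u m) = Y * 2 ^ m" for m using Y by (simp add: u_def exp_add exp_of_nat_mult)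
 have hg: "exp (dorb (Complex x (1 / 2 ^ m))) <= exp (abs (X / Y)) * hgt M (u m)" for m proof -
  have i: "iax (u m) = Complex 0 (Y * 2 ^ m)" by (simp add: complex_eq_iff e_u)
  have "X^2 / (2 * (Y * 2 ^ m) * (Y * 2 ^ m)) <= X^2 / (2 * Y * Y)" using Y by (intro divide_left_mono mult_mono) auto
  also have "... = (X / Y)^2 / 2" by (simp add: power2_eq_square)
  also have "... <= cosh (abs (X / Y)) - 1" using cosh_ge_square[of "X / Y"] by (simp del: abs_divide)
  finally have "dH (Complex X (Y * 2 ^ m)) (iax (u m)) <= abs (X / Y)" using Y unfolding i by (subst dH_le_iff) (auto simp: cmod_power2)
  then have "dH (Complex x (1 / 2 ^ m)) (ap M (u m)) <= abs (X / Y)"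
   using dH_act[OF M, of "Complex x (1 / 2 ^ m)" "ap M (u m)"] M aM[of "1 / 2 ^ m"] by simp
  then have "dorb (Complex x (1 / 2 ^ m)) <= abs (X / Y) + dorb (ap M (u m))" using dorb_lipschitz[of "Complex x (1 / 2 ^ m)" "ap M (u m)"] M by simp
  then show ?thesis by (simp add: hgt_def flip: exp_add)
 qed
 define k where "k = ln 2 / (2 * exp (abs (X / Y)))"
 have k: "0 < k" by (simp add: k_def)
 have st: "k * (\<Sum>m<N. exp (dorb (Complex x (1 / 2 ^ m)))) <= W (u N) - W (u 0)" for N proof (induction N)
  case (Suc N)
  have "u N <= u (Suc N)" by (simp add: u_def)
  then obtain c where c: "u N <= c" "c <= u (Suc N)" "W (u (Suc N)) - W (u N) = (u (Suc N) - u N) * hgt M c" using antider_mvt[OF W] by blast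
  have d: "u (Suc N) - u N = ln 2" by (simp add: u_def algebra_simps)
  have "hgt M (u N) <= exp (abs (u N - c)) * hgt M c" by (rule hgt_le[OF M])
  also have "... <= exp (ln 2) * hgt M c" proof (rule mult_right_mono)
   show "exp (abs (u N - c)) <= exp (ln 2)" using c d by (simp only: exp_le_cancel_iff)
   show "0 <= hgt M c" using hgt_ge_1[OF M, of c] by linarith
  qed
  finally have "exp (dorb (Complex x (1 / 2 ^ N))) <= exp (abs (X / Y)) * (2 * hgt M c)" by (intro order_trans[OF hg] mult_left_mono) auto
  then have "k * exp (dorb (Complex x (1 / 2 ^ N))) <= k * (exp (abs (X / Y)) * (2 * hgt M c))" using k by (intro mult_left_mono) auto
  also have "... = ln 2 * hgt M c" by (simp add: k_def)
  finally show ?case using Suc c(3) d by (simp add: distrib_left)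
 qed simp
 obtain N0 where N0: "!!N. N0 <= N ==> 2 * L * ln 2 / k * real N <= (\<Sum>m<N. exp (dorb (Complex x (1 / 2 ^ m))))"
  using grow[of "2 * L * ln 2 / k"] unfolding eventually_sequentially by (elim exE) blast
 define T where "T = max ((real N0 + 1) * ln 2 + ln Y) ((2 * L * (ln Y + ln 2) - W (u 0)) / L)"
 have "L * t <= W t" if t: "T <= t" for t proof -
  define N where "N = nat \<lfloor>(t - ln Y) / ln 2\<rfloor>"
  have "(real N0 + 1) * ln 2 + ln Y <= t" using t by (simp add: T_def)
  then have r: "real N0 + 1 <= (t - ln Y) / ln 2" by (simp add: pos_le_divide_eq)
  then have N: "real N <= (t - ln Y) / ln 2" "(t - ln Y) / ln 2 - 1 <= real N" "N0 <= N" unfolding N_def by linarith+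
  have "u N <= t" using N(1) by (simp add: u_def pos_le_divide_eq)
  then have 1: "W (u N) <= W t" using antider_mono[OF M W] by (smt (verit))
  have "2 * L * (t - ln Y - ln 2) = 2 * L * ln 2 * ((t - ln Y) / ln 2 - 1)" by (simp add: field_simps)
  also have "... <= 2 * L * ln 2 * real N" using N(2) L by (intro mult_left_mono) auto
  also have "... = k * (2 * L * ln 2 / k * real N)" using k by simp
  also have "... <= k * (\<Sum>m<N. exp (dorb (Complex x (1 / 2 ^ m))))" using N0[OF N(3)] k by (intro mult_left_mono) auto
  finally have 2: "2 * L * (t - ln Y - ln 2) <= W t - W (u 0)" using st[of N] 1 by linarith
  have "(2 * L * (ln Y + ln 2) - W (u 0)) / L <= t" using t by (simp add: T_def)
  then have "2 * L * (ln Y + ln 2) - W (u 0) <= L * t" using L by (simp add: pos_divide_le_eq mult.commute)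
  then show ?thesis using 2 by (simp add: algebra_simps)
 qed
 then show ?thesis by blast
qed

text \<open>Both lengths are compared with the last time \<open>s\<close> at which the ray was near
  the orbit. The excursion in progress adds boundedly to the relative length, which is thus at most
  linear in \<open>s\<close>, while the word length is at least a multiple of \<open>W\<close> near
  \<open>s\<close>.\<close>

lemma ray_ratio_infinite: assumes M: "M : SL2" "act M x0 = \<i>" and x: "M$2$1 * x + M$2$2 = 0"
  and grow: "!!a. \<forall>\<^sub>F N in sequentially. a * real N <= (\<Sum>m<N. exp (dorb (Complex x (1 / 2 ^ m))))"
  and nc: "!!B k. B : C ==> k : G ==> (hinv (nb B) ** k)$2$1 * x + (hinv (nb B) ** k)$2$2 ~= 0" and h: "!!t. 0 <= t ==> closest (ap M t) (h t)"
 shows "filterlim (%t. lG (h t) / lR (h t)) at_top at_top"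
proof -
 obtain W where W: "antider M W" "W 0 = 0" using antider_zero[OF M(1)] by blast
 obtain K1 where K1: "K1 > 0" "!!t t' g g'. t <= t' ==> closest (ap M t) g ==> closest (ap M t') g' ==> lR (hinv g ** g') <= K1 * (t' - t + 1)"
  using rel_upper M(1) by blast
 obtain K2 where K2: "!!B k z z' g g'. B : C ==> k : G ==> 0 < Im z ==> 0 < Im z' ==> closest z g ==> closest z' g' ==>
   2 * H0 <= ht B k z ==> 2 * H0 <= ht B k z' ==> lenR (hinv g ** g') <= K2" using same_cusp_rel by blast
 obtain K3 where K3: "K3 > 0" "!!g g'. g : G ==> g' : G ==> abs (W (pr M (act g' x0)) - W (pr M (act g x0))) <= K3 * lG (hinv g ** g')"
  using orbit_path_lower M(1) W(1) by blast
 have ap0: "ap M 0 = x0" using M by (intro ap_eqI) (simp_all add: iax_zero)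
 have th0: "dorb (ap M 0) <= rho0" using R0(1) H0(1) by (simp add: ap0 rho0_def)
 have c0: "closest (ap M 0) (mat 1)" using closest_orbit[OF G_one] by (simp add: ap0)
 \<comment> \<open>A ray that stays away from the orbit stays in one horoball. By
   \<open>cusp_profile\<close> its height can remain above \<open>2 * H0\<close> only if the ray
   ends at the base point, which \<open>nc\<close> excludes.\<close>
 have unb: "\<exists>s\<ge>T. dorb (ap M s) <= rho0" for T proof (rule ccontr)
  assume "\<not> ?thesis"
  then have thin: "rho0 < dorb (ap M t)" if "T <= t" for t using that by force
  obtain B k where B: "B : C" "k : G" "1 < ht B k (ap M T)" using thin_cusp[OF _ thin[of T]] M by auto
  let ?A = "hinv (nb B) ** k ** hinv M"
  have e: "2 * (?A$2$1)^2 * exp t <= 1" if t: "T <= t" for t proof -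
   have "2 * H0 <= ht B k (ap M t)" by (rule same_cusp_along[OF M(1) _ B(1,2) _ _ B(3)]) (use thin t in auto)
   then have "2 * H0 * ((?A$2$1 * exp t)^2 + (?A$2$2)^2) <= exp t" using cusp_profile[OF M(1) B(1,2), of t] by (simp add: pos_le_divide_eq)
   moreover have "2 * ((?A$2$1 * exp t)^2) <= 2 * H0 * ((?A$2$1 * exp t)^2 + (?A$2$2)^2)" using H0(1) by (intro mult_mono) auto
   ultimately have "2 * (?A$2$1 * exp t)^2 <= exp t" by linarith
   then have "2 * (?A$2$1)^2 * exp t * exp t <= 1 * exp t" by (simp only: power2_eq_square mult_ac mult_1)
   then show ?thesis by (simp only: mult_le_cancel_right_pos exp_gt_zero)
  qed
  have "?A$2$1 = 0" proof (rule ccontr)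
   assume nz: "?A$2$1 ~= 0"
   define t where "t = max T (ln (1 / (?A$2$1)^2))"
   have "exp (ln (1 / (?A$2$1)^2)) <= exp t" unfolding t_def by (simp only: exp_le_cancel_iff max.cobounded2)
   then have "1 / (?A$2$1)^2 <= exp t" using nz by (subst (asm) exp_ln) auto
   then have "1 <= (?A$2$1)^2 * exp t" using nz by (simp add: pos_divide_le_eq mult.commute)
   then show False using e[of t] by (simp add: t_def)
  qed
  moreover have AM: "?A ** M = hinv (nb B) ** k" using M by (simp flip: matrix_mul_assoc)
  then have "(hinv (nb B) ** k)$2$1 = ?A$2$1 * M$1$1 + ?A$2$2 * M$2$1" "(hinv (nb B) ** k)$2$2 = ?A$2$1 * M$1$2 + ?A$2$2 * M$2$2"
   using mat2_mult_entries[of ?A M 2 1, unfolded AM] mat2_mult_entries[of ?A M 2 2, unfolded AM] by blast+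
  ultimately have "(hinv (nb B) ** k)$2$1 * x + (hinv (nb B) ** k)$2$2 = ?A$2$2 * (M$2$1 * x + M$2$2)" by (simp add: algebra_simps)
  then show False using nc[OF B(1,2)] x by simp
 qed
 \<comment> \<open>The supremum of the near-orbit times is replaced by a member \<open>s\<close>
   within 1 of it. If an excursion is in progress at \<open>t\<close>, it is entered at
   \<open>u\<close>, just after the supremum, and \<open>same_cusp_rel\<close> covers the
   rest.\<close>
 have last: "\<exists>s. 0 <= s \<and> s <= t \<and> dorb (ap M s) <= rho0 \<and> lR (h t) <= K1 * (s + 3) + real K2 \<and>
   (\<forall>r. 0 <= r --> r <= t --> dorb (ap M r) <= rho0 --> r <= s + 1)" if t: "0 <= t" for t proof -
  define S where "S = {s. 0 <= s \<and> s <= t \<and> dorb (ap M s) <= rho0}"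
  have S: "S ~= {}" "bdd_above S" using th0 t by (auto simp: S_def)
  then obtain s where s: "s : S" "Sup S - 1 < s" using less_cSup_iff[of S "Sup S - 1"] by auto
  have up: "r <= Sup S" if "r : S" for r using cSup_upper[OF that S(2)] .
  have St: "Sup S <= t" using S(1) by (intro cSup_least) (auto simp: S_def)
  have "lR (h t) <= K1 * (s + 3) + real K2" proof (cases "Sup S = t")
   case True
   have "lR (h t) <= K1 * (t - 0 + 1)" using K1(2)[OF t c0 h[OF t]] by simp
   also have "... <= K1 * (s + 3)" using K1(1) s(2) True by simp
   finally show ?thesis by simp
  next
   case False
   define u where "u = min (Sup S + 1) t"
   have u: "Sup S < u" "u <= t" "u <= s + 2" "0 <= u" using False St s up[of 0] th0 t by (auto simp: u_def S_def)
   have thin: "rho0 < dorb (ap M r)" if "u <= r" "r <= t" for r using up[of r] that u by (force simp: S_def)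
   obtain B k where B: "B : C" "k : G" "1 < ht B k (ap M u)" using thin_cusp[OF _ thin[of u]] M u by auto
   have hh: "2 * H0 <= ht B k (ap M r)" if "u <= r" "r <= t" for r by (rule same_cusp_along[OF M(1) thin B(1,2) _ _ B(3) that]) (use u in auto)
   obtain g where g: "closest (ap M u) g" using closest_exists[of "ap M u"] M by auto
   note gG = closestD(1)[OF g] closestD(1)[OF h[OF t]]
   have "lenR (hinv g ** h t) <= K2" using K2[OF B(1,2) _ _ g h[OF t]] hh u M by simp
   moreover have "lenR (h t) <= lenR g + lenR (hinv g ** h t)" using R.len_mult[of g "hinv g ** h t"] gG by simp
   moreover have "lR g <= K1 * (u - 0 + 1)" using K1(2)[OF u(4) c0 g] by simp
   moreover have "K1 * (u - 0 + 1) <= K1 * (s + 3)" using K1(1) u by simp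
   ultimately show ?thesis by linarith
  qed
  moreover have "r <= s + 1" if "0 <= r" "r <= t" "dorb (ap M r) <= rho0" for r using up[of r] that s by (force simp: S_def)
  ultimately show ?thesis using s(1) by (auto simp: S_def)
 qed
 \<comment> \<open>The distance of \<open>ap M t\<close> to the orbit is at most
   \<open>rho0 + (t - s)\<close>. So the closest orbit point, however deep the excursion, cannot
   project much before \<open>s\<close>, and \<open>orbit_path_lower\<close> applies.\<close>
 have low: "W (s - rho0 - 2) <= K3 * lG (h t)" if s: "0 <= s" "s <= t" "dorb (ap M s) <= rho0" for s t proof -
  have t: "0 <= t" using s by simp
  note g = closestD[OF h[OF t]]
  have "dorb (ap M t) <= rho0 + (t - s)" using dorb_lipschitz[of "ap M t" "ap M s"] M s by simp
  moreover have "rho M (act (h t) x0) + abs (pr M (act (h t) x0) - t) - 2 <= dorb (ap M t)"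
   using dist_ap_ge[OF M(1), of "act (h t) x0" t] g by (simp add: dH_commute)
  ultimately have "abs (pr M (act (h t) x0) - t) <= rho0 + (t - s) + 2" using rho_nonneg[of M "act (h t) x0"] by linarith
  then have "s - rho0 - 2 <= pr M (act (h t) x0)" by linarith
  then have "W (s - rho0 - 2) <= W (pr M (act (h t) x0))" using antider_mono[OF M(1) W(1)] by (smt (verit))
  also have "... <= K3 * lG (h t)" using K3(2)[OF G_one g(1)] M W(2) by (simp add: pr_def)
  finally show ?thesis .
 qed
 show ?thesis proof (subst filterlim_at_top_ge[where c=1], intro allI impI)
  fix Z :: real assume Z: "1 <= Z"
  define L where "L = 2 * Z * K1 * K3"
  have L: "0 < L" using Z K1 K3 by (simp add: L_def)
  obtain T where T: "!!t. T <= t ==> L * t <= W t" using antider_superlinear[OF M(1) x W(1) grow L] by blast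
  define c where "c = rho0 + 2"
  \<comment> \<open>Past this time \<open>W\<close> is superlinear at \<open>s - c\<close>, and the
    linear bound \<open>K1 * (s + 3) + K2\<close> on the relative length is at most
    \<open>2 * K1 * (s - c)\<close>.\<close>
  define S0 where "S0 = max (T + c) (max (2 * c + 3 + real K2 / K1) 0)"
  obtain s1 where s1: "S0 + 1 <= s1" "dorb (ap M s1) <= rho0" using unb by blast
  show "\<forall>\<^sub>F t in at_top. Z <= lG (h t) / lR (h t)" using eventually_ge_at_top[of s1] proof eventually_elim
   case (elim t)
   have s10: "0 <= s1" using s1(1) by (simp add: S0_def max_def split: if_splits)
   obtain s where s: "0 <= s" "s <= t" "dorb (ap M s) <= rho0" "lR (h t) <= K1 * (s + 3) + real K2"
    "\<forall>r. 0 <= r --> r <= t --> dorb (ap M r) <= rho0 --> r <= s + 1" using last[of t] s10 elim by auto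
   have s5: "s1 <= s + 1" using s(5)[rule_format, OF s10 elim s1(2)] .
   have sS: "T + c <= s" "2 * c + 3 + real K2 / K1 <= s" using s5 s1(1) by (auto simp: S0_def)
   have "L * (s - c) <= K3 * lG (h t)" using low[OF s(1-3)] T[of "s - c"] sS by (simp add: c_def diff_diff_eq)
   then have "K3 * (2 * Z * K1 * (s - c)) <= K3 * lG (h t)" by (simp add: L_def mult_ac)
   then have 1: "2 * Z * K1 * (s - c) <= lG (h t)" using K3(1) by simp
   have "K1 * (2 * c + 3 + real K2 / K1) <= K1 * s" using sS K1(1) by (intro mult_left_mono) auto
   then have b: "K1 * (s + 3) + real K2 <= 2 * K1 * (s - c)" using K1(1) by (simp add: distrib_left right_diff_distrib)
   then have "Z * lR (h t) <= Z * (2 * K1 * (s - c))" using s(4) Z by (intro mult_left_mono) auto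
   then have 2: "Z * lR (h t) <= lG (h t)" using 1 by (simp add: mult_ac)
   have "0 < K1 * (s + 3) + real K2" using K1(1) s(1) by (simp add: add_pos_nonneg)
   then have "0 < 2 * K1 * (s - c)" using b by linarith
   then have "0 < Z * (2 * K1 * (s - c))" using Z by (intro mult_pos_pos[of Z]) auto
   then have "lenG (h t) ~= 0" using 1 by (simp add: mult_ac)
   then have "h t ~= mat 1" by auto
   then have "lenR (h t) ~= 0" using R.len_zero closestD(1)[OF h[of t]] s by force
   then show ?case using 2 by (simp add: pos_le_divide_eq)
  qed
 qed
qed

lemma endpoint_real: assumes xi: "cmod q = 1" "q ~= 1" and M: "M : SL2" "dact M q = 1" shows "M$2$1 * Re (uncay q) + M$2$2 = 0"
proof -
 define u where "u = uncay q"
 have n: "1 - q ~= 0" using xi(2) by simp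
 have cd: "cden M q ~= 0" using xi by (intro cden_nonzero M) simp
 have "(of_real (M$2$1) * u + of_real (M$2$2)) * (1 - q) = of_real (M$2$1) * \<i> * (1 + q) + of_real (M$2$2) * (1 - q)"
  using n by (simp add: u_def uncay_def distrib_right)
 also have "... = 0" proof -
  have "cden M q = Complex (M$1$2 + M$2$1) (M$1$1 - M$2$2) + Complex (M$2$1 - M$1$2) (M$1$1 + M$2$2) * q" using M(2) cd by (simp add: dact_def)
  then show ?thesis by (simp add: cden_def complex_eq_iff algebra_simps)
 qed
 finally have z: "of_real (M$2$1) * u + of_real (M$2$2) = 0" using n by simp
 then have "Re (of_real (M$2$1) * u + of_real (M$2$2)) = 0" by (simp only: zero_complex.simps)
 then show ?thesis by (simp add: u_def)
qed

text \<open>The exceptional reals are those of \<open>vertical_growth\<close> together with the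
  countably many base points of horoballs. They form a null set, and the smooth map from the line to
  the angle on the circle keeps it null.\<close>

theorem lebesgue_ratio: "almost_all_rays x0 circle_lebesgue (%r. has_rho G A C x0 r \<infinity>)"
proof -
 define gd where "gd = (%x. (\<forall>a. \<forall>\<^sub>F N in sequentially. a * real N <= (\<Sum>m<N. exp (dorb (Complex x (1 / 2 ^ m))))) \<and>
  (\<forall>B\<in>C. \<forall>k\<in>G. (hinv (nb B) ** k)$2$1 * x + (hinv (nb B) ** k)$2$2 ~= 0))"
 have "AE x in lborel. \<forall>B\<in>C. \<forall>k\<in>G. (hinv (nb B) ** k)$2$1 * x + (hinv (nb B) ** k)$2$2 ~= 0" proof (subst AE_ball_countable)
  show "countable C" using cusps by (simp add: cusp_horoballs_def countable_finite)
  show "\<forall>B\<in>C. AE x in lborel. \<forall>k\<in>G. (hinv (nb B) ** k)$2$1 * x + (hinv (nb B) ** k)$2$2 ~= 0"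
  proof (intro ballI, subst AE_ball_countable[OF countable_G], intro ballI)
   fix B k assume "B : C" "k : G"
   then have "hinv (nb B) ** k : SL2" using nb(1) by simp
   then show "AE x in lborel. (hinv (nb B) ** k)$2$1 * x + (hinv (nb B) ** k)$2$2 ~= 0"
    by (intro eventually_mono[OF AE_lborel_singleton[of "- (hinv (nb B) ** k)$2$2 / (hinv (nb B) ** k)$2$1"]])
     (cases "(hinv (nb B) ** k)$2$1 = 0"; auto simp: SL2_iff field_simps add_eq_0_iff)
  qed
 qed
 with vertical_growth have "AE x in lborel. gd x" by eventually_elim (simp add: gd_def)
 then obtain N where N: "{x. \<not> gd x} \<subseteq> N" "N : null_sets lborel" by (auto elim!: AE_E simp: null_sets_def)
 define P where "P = (%q. cmod q = 1 \<and> q ~= 1 \<and> Re (uncay q) \<notin> N)"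
 \<comment> \<open>The angle of the boundary point of the disc that corresponds to the real number
   \<open>x\<close>; \<open>uncay (cis (p x))\<close> is \<open>x\<close>.\<close>
 define p where "p = (%x. pi + 2 * arctan x)"
 have "negligible (p ` N)" proof (rule negligible_differentiable_image_negligible)
  show "negligible N" using N(2) by (simp add: negligible_iff_null_sets null_sets_completionI)
  show "p differentiable_on N" unfolding p_def
   by (rule differentiable_at_imp_differentiable_on, rule real_differentiable_def[THEN iffD2]) (auto intro!: exI derivative_eq_intros)
 qed simp
 then have "AE v in lebesgue. v \<notin> p ` N" by (simp add: negligible_iff_null_sets AE_not_in)
 then have nN: "AE v in lborel. v \<notin> p ` N" by (simp add: AE_completion_iff)
 have Pc: "P (cis v)" if t: "0 < v" "v < 2 * pi" "v \<notin> p ` N" for v proof -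
  define f where "f = (v - pi) / 2"
  have ph: "- (pi / 2) < f" "f < pi / 2" "v = pi + 2 * f" using t by (auto simp: f_def field_simps)
  have cp: "0 < cos f" using ph by (intro cos_gt_zero_pi) auto
  have "p (tan f) = v" using ph by (simp add: p_def arctan_tan)
  then have "tan f \<notin> N" using t(3) by force
  moreover have c: "cis v = - (cis f * cis f)" by (simp add: ph(3) complex_eq_iff cos_add sin_add sin_double cos_double power2_eq_square)
  have 1: "1 - cis v = cis f * (2 * of_real (cos f))" "1 + cis v = cis f * (- 2 * \<i> * of_real (sin f))"
   unfolding c using sin_cos_squared_add[of f] by (simp_all add: complex_eq_iff power2_eq_square algebra_simps)
  have "uncay (cis v) = of_real (tan f)" unfolding uncay_def 1 using cp by (simp add: tan_def field_simps)
  moreover have "cis v ~= 1" using 1(1) cp by auto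
  ultimately show ?thesis by (simp add: P_def)
 qed
 have Pm: "{q. P q} : sets borel" proof -
  have [measurable]: "uncay : borel_measurable borel" unfolding uncay_def[abs_def] by measurable
  have [measurable]: "N : sets borel" using N(2) by auto
  show ?thesis unfolding P_def by measurable
 qed
 have "AE q in circle_lebesgue. P q" proof -
  have "(%v. cis v) : borel_measurable borel" by (intro borel_measurable_continuous_onI continuous_intros)
  then have cm: "cis : restrict_space lborel {0..<2 * pi} \<rightarrow>\<^sub>M borel" by (intro measurable_restrict_space1) simp
  have "AE v in lborel. v : {0..<2 * pi} --> P (cis v)" using nN AE_lborel_singleton[of "0::real"] by eventually_elim (use Pc in force)
  then show ?thesis unfolding circle_lebesgue_def by (subst AE_distr_iff[OF cm]) (simp_all add: Pm AE_restrict_space_iff)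
 qed
 then show ?thesis unfolding almost_all_rays_def proof eventually_elim
  case (elim q)
  show ?case proof (intro allI impI)
   fix r assume g: "geodesic_ray x0 r \<and> ray_endpoint r q"
   then have up: "0 < Im (r t)" if "0 <= t" for t using that by (auto simp: geodesic_ray_def)
   obtain M where M: "M : SL2" "!!t. 0 <= t ==> act M (r t) = iax t" using geodesic_ray_iax g by blast
   have M0: "act M x0 = \<i>" using M(2)[of 0] g by (simp add: geodesic_ray_def iax_zero)
   \<comment> \<open>Comparing both descriptions of the ray at one time, where the hyperbolic
     tangent is nonzero and rational, shows that \<open>M\<close> sends the endpoint to 1.\<close>
   have "cayley (iax (2 * ln 2)) = of_real (tanh (2 * ln 2 / 2)) * dact M q"
    using ray_in_disc(1)[OF M(1) M0, of r q "2 * ln 2"] g M(2)[of "2 * ln 2"] by simp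
   then have "dact M q = 1" by (simp add: cayley_iax_eq exp_double tanh_ln_real)
   then have x: "M$2$1 * Re (uncay q) + M$2$2 = 0" using elim M(1) by (intro endpoint_real) (auto simp: P_def)
   have gx: "gd (Re (uncay q))" using elim N(1) by (auto simp: P_def)
   show "has_rho G A C x0 r \<infinity>" unfolding has_rho_def proof (intro allI impI)
    fix h assume h: "\<forall>t\<ge>0. closest_orbit_element G x0 (r t) (h t)"
    have "closest (ap M t) (h t)" if t: "0 <= t" for t using h t up[OF t] ap_eqI[OF M(1) up[OF t] M(2)[OF t]] by (simp add: closest_iff)
    then have "filterlim (%t. lG (h t) / lR (h t)) at_top at_top" using gx by (intro ray_ratio_infinite[OF M(1) M0 x]) (auto simp: gd_def)
    then show "((%t. ereal (real (word_dist SL2R A (mat 1) (h t)) / real (word_dist SL2R (rel_generators G A C) (mat 1) (h t)))) \<longlongrightarrow> \<infinity>) at_top"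
     by (simp add: tendsto_PInfty_eq_at_top A.len_def R.len_def)
   qed
  qed
 qed
qed

end

theorem theorem1p1:
  fixes G A :: "(real^2^2) set" and C :: "complex set set" and x0 :: complex
    and \<mu> :: "(real^2^2) pmf"
  assumes "fuchsian G"
    and "\<not> compact_space (quotient_topology G)"
    and "finite_area_quotient G"
    and "x0 \<in> upper_half_plane"
    and "finite A" and "A \<subseteq> G" and "generate SL2R A = G"
    and "cusp_horoballs G C"
    and "set_pmf \<mu> \<subseteq> G"
    and "semigroup_generated SL2R (set_pmf \<mu>) = G"
    and "integrable (measure_pmf \<mu>) (\<lambda>g. real (word_dist SL2R A (mat 1) g))"
  shows "\<exists>c::real. c > 0 \<and>
    almost_all_rays x0 circle_lebesgue (\<lambda>\<gamma>. has_rho G A C x0 \<gamma> \<infinity>) \<and>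
    almost_all_rays x0 (harmonic_measure \<mu> x0) (\<lambda>\<gamma>. has_rho G A C x0 \<gamma> (ereal c))"
proof -
  interpret cusped G A C x0 by unfold_locales (fact assms)+
  interpret walked G A C x0 \<mu>
    by unfold_locales (use assms(9-11) in \<open>simp_all add: A.len_def[abs_def]\<close>)
  show ?thesis using harmonic_ratio lebesgue_ratio by blast
qed

end
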